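(* Let $\Lambda$ be a finite-dimensional $k$-algebra of rank $2$ with complete set of primitive orthogonal idempotents $1=e_1+e_2$ and $e_2\Lambda e_1=0$ (equivalently $\Sigma(\Lambda)\in\mathsf{Fan}^{+-}_{\rm sc}(2)$). Then there exists a finite-dimensional $k$-algebra $\Gamma$ of rank $2$ (with a complete set of primitive orthogonal idempotents) such that $\Sigma(\Gamma)=\rho(\Sigma(\Lambda))$. Moreover, if $\Lambda$ is elementary, then $\Gamma$ can be taken to be elementary.
   Context: $k$ is a field; elementary means $\Lambda/J_\Lambda$ is a product of copies of $k$. The $g$-fan $\Sigma(\Lambda)$ consists of the cones $\operatorname{cone}\{[T_1],\dots,[T_m]\}$ for basic 2-term presilting complexes $T=\bigoplus T_i$ (indecomposable $T_i$) in $K^b(\operatorname{proj}\Lambda)$ (2-term: degrees $-1,0$; presilting: $\operatorname{Hom}(T,T[\ell])=0$ for $\ell>0$; $[T]=[T^0]-[T^{-1}]$), in $\mathbb{R}^2$ via $[e_1\Lambda]\mapsto(1,0)$, $[e_2\Lambda]\mapsto(0,1)$. $\mathsf{Fan}^{+-}_{\rm sc}(2)$: (possibly infinite) nonsingular fans in $\mathbb{R}^2$ containing $\sigma_+=\operatorname{cone}\{(1,0),(0,1)\}$, $-\sigma_+$ and $\sigma_{-+}=\operatorname{cone}\{(-1,0),(0,1)\}$, each cone lying in a closed coordinate quadrant, each ray in exactly two 2-dimensional cones, all maximal cones 2-dimensional. Rotation of fans: for $\Sigma\in\mathsf{Fan}^{+-}_{\rm sc}(2)$ let $\sigma=\operatorname{cone}\{(1,0),(\ell,-1)\}$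 be its 2-dimensional cone adjacent to $\sigma_+$ along $(1,0)$ ($\ell\ge0$). Let $\Sigma'$ be the fan with rays $(\Sigma_1\setminus\{\mathbb{R}_{\ge0}(0,1)\})\cup\{\mathbb{R}_{\ge0}(-\ell,1)\}$ and 2-dimensional cones $(\Sigma_2\setminus\{\sigma_+,\sigma_{-+}\})\cup\{-\sigma,\operatorname{cone}\{(-\ell,1),(1,0)\}\}$. Then $\rho(\Sigma)$ is the image of $\Sigma'$ under the linear map of $\mathbb{R}^2$ sending $(1,0)\mapsto(0,1)$ and $(\ell,-1)\mapsto(1,0)$. *)

theory Defs
  imports Complex_Main "HOL-Algebra.Module"
begin

definition fd_algebra :: "('k::field, 'a) module \<Rightarrow> bool" where
  "fd_algebra A \<longleftrightarrow> ring A
   \<and> (\<forall>c. \<forall>x\<in>carrier A. c \<odot>\<^bsub>A\<^esub> x \<in> carrier A)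
   \<and> (\<forall>c. \<forall>x\<in>carrier A. \<forall>y\<in>carrier A. c \<odot>\<^bsub>A\<^esub> (x \<oplus>\<^bsub>A\<^esub> y) = c \<odot>\<^bsub>A\<^esub> x \<oplus>\<^bsub>A\<^esub> c \<odot>\<^bsub>A\<^esub> y)
   \<and> (\<forall>c d. \<forall>x\<in>carrier A. (c + d) \<odot>\<^bsub>A\<^esub> x = c \<odot>\<^bsub>A\<^esub> x \<oplus>\<^bsub>A\<^esub> d \<odot>\<^bsub>A\<^esub> x)
   \<and> (\<forall>c d. \<forall>x\<in>carrier A. (c * d) \<odot>\<^bsub>A\<^esub> x = c \<odot>\<^bsub>A\<^esub> (d \<odot>\<^bsub>A\<^esub> x))
   \<and> (\<forall>x\<in>carrier A. 1 \<odot>\<^bsub>A\<^esub> x = x)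
   \<and> (\<forall>c. \<forall>x\<in>carrier A. \<forall>y\<in>carrier A.
        c \<odot>\<^bsub>A\<^esub> (x \<otimes>\<^bsub>A\<^esub> y) = (c \<odot>\<^bsub>A\<^esub> x) \<otimes>\<^bsub>A\<^esub> y
      \<and> c \<odot>\<^bsub>A\<^esub> (x \<otimes>\<^bsub>A\<^esub> y) = x \<otimes>\<^bsub>A\<^esub> (c \<odot>\<^bsub>A\<^esub> y))
   \<and> (\<exists>B. finite B \<and> B \<subseteq> carrier A \<and>
        (\<forall>x\<in>carrier A. \<exists>f. x = finsum A (\<lambda>b. f b \<odot>\<^bsub>A\<^esub> b) B))"

definition idem :: "('k, 'a) module \<Rightarrow> 'a \<Rightarrow> bool" where
  "idem A e \<longleftrightarrow> e \<in> carrier A \<and> e \<otimes>\<^bsub>A\<^esub> e = e"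

definition primitive_idem :: "('k, 'a) module \<Rightarrow> 'a \<Rightarrow> bool" where
  "primitive_idem A e \<longleftrightarrow> idem A e \<and> e \<noteq> \<zero>\<^bsub>A\<^esub> \<and>
     (\<forall>f g. idem A f \<and> idem A g \<and> f \<otimes>\<^bsub>A\<^esub> g = \<zero>\<^bsub>A\<^esub> \<and> g \<otimes>\<^bsub>A\<^esub> f = \<zero>\<^bsub>A\<^esub>
        \<and> f \<oplus>\<^bsub>A\<^esub> g = e \<longrightarrow> f = \<zero>\<^bsub>A\<^esub> \<or> g = \<zero>\<^bsub>A\<^esub>)"

definition complete_poi2 :: "('k, 'a) module \<Rightarrow> 'a \<Rightarrow> 'a \<Rightarrow> bool" where
  "complete_poi2 A e1 e2 \<longleftrightarrow> primitive_idem A e1 \<and> primitive_idem A e2 \<and>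
     e1 \<otimes>\<^bsub>A\<^esub> e2 = \<zero>\<^bsub>A\<^esub> \<and> e2 \<otimes>\<^bsub>A\<^esub> e1 = \<zero>\<^bsub>A\<^esub> \<and> e1 \<oplus>\<^bsub>A\<^esub> e2 = \<one>\<^bsub>A\<^esub>"

text \<open>A projective module \<open>\<Oplus>_s e_{ps!s} A\<close> is encoded by a list of labels
 (False = e1, True = e2). A morphism from ps to qs is a matrix M with
 \<open>M t s \<in> e_{qs!t} A e_{ps!s}\<close> (Hom(e_i A, e_j A) = e_j A e_i via left multiplication),
 zero outside the index range.\<close>

definition lab :: "'a \<Rightarrow> 'a \<Rightarrow> bool \<Rightarrow> 'a" where
  "lab e1 e2 b = (if b then e2 else e1)"

definition is_mor :: "('k, 'a) module \<Rightarrow> 'a \<Rightarrow> 'a \<Rightarrow> bool list \<Rightarrow> bool list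
     \<Rightarrow> (nat \<Rightarrow> nat \<Rightarrow> 'a) \<Rightarrow> bool" where
  "is_mor A e1 e2 ps qs M \<longleftrightarrow> (\<forall>t s.
     (if t < length qs \<and> s < length ps
      then M t s \<in> carrier A \<and>
           M t s = lab e1 e2 (qs ! t) \<otimes>\<^bsub>A\<^esub> M t s \<otimes>\<^bsub>A\<^esub> lab e1 e2 (ps ! s)
      else M t s = \<zero>\<^bsub>A\<^esub>))"

definition mcomp :: "('k, 'a) module \<Rightarrow> nat \<Rightarrow> (nat \<Rightarrow> nat \<Rightarrow> 'a) \<Rightarrow> (nat \<Rightarrow> nat \<Rightarrow> 'a)
     \<Rightarrow> (nat \<Rightarrow> nat \<Rightarrow> 'a)" where
  "mcomp A n N M = (\<lambda>t s. finsum A (\<lambda>r. N t r \<otimes>\<^bsub>A\<^esub> M r s) {..<n})"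

definition madd :: "('k, 'a) module \<Rightarrow> (nat \<Rightarrow> nat \<Rightarrow> 'a) \<Rightarrow> (nat \<Rightarrow> nat \<Rightarrow> 'a)
     \<Rightarrow> (nat \<Rightarrow> nat \<Rightarrow> 'a)" where
  "madd A M N = (\<lambda>t s. M t s \<oplus>\<^bsub>A\<^esub> N t s)"

definition mzero :: "('k, 'a) module \<Rightarrow> nat \<Rightarrow> nat \<Rightarrow> 'a" where
  "mzero A = (\<lambda>t s. \<zero>\<^bsub>A\<^esub>)"

definition mid :: "('k, 'a) module \<Rightarrow> 'a \<Rightarrow> 'a \<Rightarrow> bool list \<Rightarrow> nat \<Rightarrow> nat \<Rightarrow> 'a" where
  "mid A e1 e2 ps = (\<lambda>t s. if t < length ps \<and> t = s then lab e1 e2 (ps ! t) else \<zero>\<^bsub>A\<^esub>)"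

definition mblock :: "('k, 'a) module \<Rightarrow> nat \<Rightarrow> nat \<Rightarrow> (nat \<Rightarrow> nat \<Rightarrow> 'a) \<Rightarrow> (nat \<Rightarrow> nat \<Rightarrow> 'a)
     \<Rightarrow> (nat \<Rightarrow> nat \<Rightarrow> 'a)" where
  "mblock A a b M N = (\<lambda>t s.
     if t < a then (if s < b then M t s else \<zero>\<^bsub>A\<^esub>)
     else (if s < b then \<zero>\<^bsub>A\<^esub> else N (t - a) (s - b)))"

text \<open>A 2-term complex \<open>T^{-1} \<rightarrow> T^0\<close> is a triple (T^{-1}, T^0, d).\<close>
type_synonym 'a cx = "bool list \<times> bool list \<times> (nat \<Rightarrow> nat \<Rightarrow> 'a)"

definition cm1 :: "'a cx \<Rightarrow> bool list" where "cm1 T = fst T"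
definition c0 :: "'a cx \<Rightarrow> bool list" where "c0 T = fst (snd T)"
definition cd :: "'a cx \<Rightarrow> nat \<Rightarrow> nat \<Rightarrow> 'a" where "cd T = snd (snd T)"

definition is_cx :: "('k, 'a) module \<Rightarrow> 'a \<Rightarrow> 'a \<Rightarrow> 'a cx \<Rightarrow> bool" where
  "is_cx A e1 e2 T \<longleftrightarrow> is_mor A e1 e2 (cm1 T) (c0 T) (cd T)"

definition chain_map :: "('k, 'a) module \<Rightarrow> 'a \<Rightarrow> 'a \<Rightarrow> 'a cx \<Rightarrow> 'a cx
     \<Rightarrow> (nat \<Rightarrow> nat \<Rightarrow> 'a) \<times> (nat \<Rightarrow> nat \<Rightarrow> 'a) \<Rightarrow> bool" where
  "chain_map A e1 e2 T T' f \<longleftrightarrow>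
     is_mor A e1 e2 (cm1 T) (cm1 T') (fst f) \<and> is_mor A e1 e2 (c0 T) (c0 T') (snd f) \<and>
     mcomp A (length (cm1 T')) (cd T') (fst f) = mcomp A (length (c0 T)) (snd f) (cd T)"

definition homotopic :: "('k, 'a) module \<Rightarrow> 'a \<Rightarrow> 'a \<Rightarrow> 'a cx \<Rightarrow> 'a cx
     \<Rightarrow> (nat \<Rightarrow> nat \<Rightarrow> 'a) \<times> (nat \<Rightarrow> nat \<Rightarrow> 'a)
     \<Rightarrow> (nat \<Rightarrow> nat \<Rightarrow> 'a) \<times> (nat \<Rightarrow> nat \<Rightarrow> 'a) \<Rightarrow> bool" where
  "homotopic A e1 e2 T T' f g \<longleftrightarrow> (\<exists>h. is_mor A e1 e2 (c0 T) (cm1 T') h \<and>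
     snd f = madd A (snd g) (mcomp A (length (cm1 T')) (cd T') h) \<and>
     fst f = madd A (fst g) (mcomp A (length (c0 T)) h (cd T)))"

definition chain_comp :: "('k, 'a) module \<Rightarrow> 'a cx
     \<Rightarrow> (nat \<Rightarrow> nat \<Rightarrow> 'a) \<times> (nat \<Rightarrow> nat \<Rightarrow> 'a)
     \<Rightarrow> (nat \<Rightarrow> nat \<Rightarrow> 'a) \<times> (nat \<Rightarrow> nat \<Rightarrow> 'a)
     \<Rightarrow> (nat \<Rightarrow> nat \<Rightarrow> 'a) \<times> (nat \<Rightarrow> nat \<Rightarrow> 'a)" where
  "chain_comp A Tmid g f = (mcomp A (length (cm1 Tmid)) (fst g) (fst f),
                           mcomp A (length (c0 Tmid)) (snd g) (snd f))"

definition chain_id :: "('k, 'a) module \<Rightarrow> 'a \<Rightarrow> 'a \<Rightarrow> 'a cx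
     \<Rightarrow> (nat \<Rightarrow> nat \<Rightarrow> 'a) \<times> (nat \<Rightarrow> nat \<Rightarrow> 'a)" where
  "chain_id A e1 e2 T = (mid A e1 e2 (cm1 T), mid A e1 e2 (c0 T))"

definition iso_K :: "('k, 'a) module \<Rightarrow> 'a \<Rightarrow> 'a \<Rightarrow> 'a cx \<Rightarrow> 'a cx \<Rightarrow> bool" where
  "iso_K A e1 e2 T T' \<longleftrightarrow> (\<exists>f g. chain_map A e1 e2 T T' f \<and> chain_map A e1 e2 T' T g \<and>
     homotopic A e1 e2 T T (chain_comp A T' g f) (chain_id A e1 e2 T) \<and>
     homotopic A e1 e2 T' T' (chain_comp A T f g) (chain_id A e1 e2 T'))"

definition zero_K :: "('k, 'a) module \<Rightarrow> 'a \<Rightarrow> 'a \<Rightarrow> 'a cx \<Rightarrow> bool" where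
  "zero_K A e1 e2 T \<longleftrightarrow> homotopic A e1 e2 T T (chain_id A e1 e2 T) (mzero A, mzero A)"

definition cx_sum :: "('k, 'a) module \<Rightarrow> 'a cx \<Rightarrow> 'a cx \<Rightarrow> 'a cx" where
  "cx_sum A T T' = (cm1 T @ cm1 T', c0 T @ c0 T',
     mblock A (length (c0 T)) (length (cm1 T)) (cd T) (cd T'))"

definition cx_sum_list :: "('k, 'a) module \<Rightarrow> 'a cx list \<Rightarrow> 'a cx" where
  "cx_sum_list A Ts = foldr (cx_sum A) Ts ([], [], mzero A)"

definition indecomposable_K :: "('k, 'a) module \<Rightarrow> 'a \<Rightarrow> 'a \<Rightarrow> 'a cx \<Rightarrow> bool" where
  "indecomposable_K A e1 e2 T \<longleftrightarrow> is_cx A e1 e2 T \<and> \<not> zero_K A e1 e2 T \<and>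
     \<not> (\<exists>T1 T2. is_cx A e1 e2 T1 \<and> is_cx A e1 e2 T2 \<and>
          \<not> zero_K A e1 e2 T1 \<and> \<not> zero_K A e1 e2 T2 \<and> iso_K A e1 e2 T (cx_sum A T1 T2))"

text \<open>presilting: \<open>Hom_K(T, T[l]) = 0\<close> for l > 0. For 2-term complexes only l = 1 matters;
 morphisms \<open>T \<rightarrow> T[1]\<close> are arbitrary \<open>f : T^{-1} \<rightarrow> T^0\<close> and the null-homotopic ones are
 those of the form \<open>h d + d h'\<close>.\<close>
definition presilting :: "('k, 'a) module \<Rightarrow> 'a \<Rightarrow> 'a \<Rightarrow> 'a cx \<Rightarrow> bool" where
  "presilting A e1 e2 T \<longleftrightarrow> is_cx A e1 e2 T \<and>
     (\<forall>f. is_mor A e1 e2 (cm1 T) (c0 T) f \<longrightarrow>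
        (\<exists>h h'. is_mor A e1 e2 (c0 T) (c0 T) h \<and> is_mor A e1 e2 (cm1 T) (cm1 T) h' \<and>
           f = madd A (mcomp A (length (c0 T)) h (cd T)) (mcomp A (length (cm1 T)) (cd T) h')))"

definition cnt :: "bool \<Rightarrow> bool list \<Rightarrow> real" where
  "cnt b ps = real (length (filter (\<lambda>x. x = b) ps))"

definition gvec :: "'a cx \<Rightarrow> real \<times> real" where
  "gvec T = (cnt False (c0 T) - cnt False (cm1 T), cnt True (c0 T) - cnt True (cm1 T))"

definition cone_gen :: "(real \<times> real) set \<Rightarrow> (real \<times> real) set" where
  "cone_gen S = {x. \<exists>c. (\<forall>v\<in>S. c v \<ge> 0) \<and>
      x = ((\<Sum>v\<in>S. c v * fst v), (\<Sum>v\<in>S. c v * snd v))}"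

definition gfan :: "('k, 'a) module \<Rightarrow> 'a \<Rightarrow> 'a \<Rightarrow> (real \<times> real) set set" where
  "gfan A e1 e2 = {cone_gen (gvec ` set Ts) | Ts.
      (\<forall>T\<in>set Ts. indecomposable_K A e1 e2 T) \<and>
      (\<forall>i j. i < length Ts \<and> j < length Ts \<and> i \<noteq> j \<longrightarrow> \<not> iso_K A e1 e2 (Ts ! i) (Ts ! j)) \<and>
      presilting A e1 e2 (cx_sum_list A Ts)}"

definition rays_of :: "(real \<times> real) set set \<Rightarrow> (real \<times> real) set set" where
  "rays_of \<Sigma> = {c\<in>\<Sigma>. \<exists>v. v \<noteq> (0,0) \<and> c = cone_gen {v}}"

definition cones2_of :: "(real \<times> real) set set \<Rightarrow> (real \<times> real) set set" where
  "cones2_of \<Sigma> = {c\<in>\<Sigma>. \<exists>u v. fst u * snd v - snd u * fst v \<noteq> 0 \<and> c = cone_gen {u, v}}"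

definition rot_l :: "(real \<times> real) set set \<Rightarrow> real" where
  "rot_l \<Sigma> = (THE l. l \<ge> 0 \<and> cone_gen {(1,0), (l,-1)} \<in> \<Sigma>)"

text \<open>The linear map with (1,0) \<mapsto> (0,1), (l,-1) \<mapsto> (1,0): (x,y) \<mapsto> (-y, x + l y).\<close>
definition rho :: "(real \<times> real) set set \<Rightarrow> (real \<times> real) set set" where
  "rho \<Sigma> = (let l = rot_l \<Sigma>;
      \<Sigma>' = {{(0,0)}}
          \<union> (rays_of \<Sigma> - {cone_gen {(0,1)}}) \<union> {cone_gen {(-l,1)}}
          \<union> (cones2_of \<Sigma> - {cone_gen {(1,0),(0,1)}, cone_gen {(-1,0),(0,1)}})
          \<union> {cone_gen {(-1,0),(-l,1)}, cone_gen {(-l,1),(1,0)}}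
    in (\<lambda>c. (\<lambda>(x,y). (-y, x + l * y)) ` c) ` \<Sigma>')"

text \<open>rank 2: the indecomposable projectives e1 A and e2 A are non-isomorphic\<close>
definition rank2 :: "('k, 'a) module \<Rightarrow> 'a \<Rightarrow> 'a \<Rightarrow> bool" where
  "rank2 A e1 e2 \<longleftrightarrow> \<not> (\<exists>M N. is_mor A e1 e2 [False] [True] M \<and> is_mor A e1 e2 [True] [False] N \<and>
      mcomp A 1 N M = mid A e1 e2 [False] \<and> mcomp A 1 M N = mid A e1 e2 [True])"

definition right_ideal :: "('k, 'a) module \<Rightarrow> 'a set \<Rightarrow> bool" where
  "right_ideal A I \<longleftrightarrow> I \<subseteq> carrier A \<and> \<zero>\<^bsub>A\<^esub> \<in> I \<and>
     (\<forall>x\<in>I. \<forall>y\<in>I. x \<oplus>\<^bsub>A\<^esub> y \<in> I) \<and> (\<forall>x\<in>I. \<ominus>\<^bsub>A\<^esub> x \<in> I) \<and>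
     (\<forall>x\<in>I. \<forall>y\<in>carrier A. x \<otimes>\<^bsub>A\<^esub> y \<in> I)"

definition max_right_ideal :: "('k, 'a) module \<Rightarrow> 'a set \<Rightarrow> bool" where
  "max_right_ideal A I \<longleftrightarrow> right_ideal A I \<and> I \<noteq> carrier A \<and>
     (\<forall>I'. right_ideal A I' \<and> I \<subseteq> I' \<and> I' \<noteq> carrier A \<longrightarrow> I' = I)"

definition jacobson :: "('k, 'a) module \<Rightarrow> 'a set" where
  "jacobson A = carrier A \<inter> \<Inter> {I. max_right_ideal A I}"

definition kpow :: "nat \<Rightarrow> (nat \<Rightarrow> 'k::field) set" where
  "kpow n = {f. \<forall>i\<ge>n. f i = 0}"

text \<open>elementary: A / J_A is isomorphic (as k-algebra) to k^n for some n, i.e. there is a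
 surjective k-algebra homomorphism A \<rightarrow> k^n with kernel J_A.\<close>
definition elementary :: "('k::field, 'a) module \<Rightarrow> bool" where
  "elementary A \<longleftrightarrow> (\<exists>n (\<phi> :: 'a \<Rightarrow> nat \<Rightarrow> 'k). \<phi> ` carrier A = kpow n \<and>
     \<phi> \<one>\<^bsub>A\<^esub> = (\<lambda>i. if i < n then 1 else 0) \<and>
     (\<forall>x\<in>carrier A. \<forall>y\<in>carrier A.
        \<phi> (x \<oplus>\<^bsub>A\<^esub> y) = (\<lambda>i. \<phi> x i + \<phi> y i) \<and> \<phi> (x \<otimes>\<^bsub>A\<^esub> y) = (\<lambda>i. \<phi> x i * \<phi> y i)) \<and>
     (\<forall>c. \<forall>x\<in>carrier A. \<phi> (c \<odot>\<^bsub>A\<^esub> x) = (\<lambda>i. c * \<phi> x i)) \<and>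
     {x\<in>carrier A. \<phi> x = (\<lambda>i. 0)} = jacobson A)"

end

theory Submission
  imports Defs "HOL-Library.Multiset" "HOL-Library.Nat_Bijection"
begin

text \<open>
  Projective modules are idempotent matrices and their morphisms are matrices, so that \<open>\<Lambda>\<close>, the complexes
  over it and \<open>\<Gamma>\<close> all live in one ring of finitely supported matrices.

  Let \<open>m : P\<^sub>2 \<rightarrow> P\<^sub>1\<^sup>l\<close> be the minimal left approximation of the second indecomposable projective by copies
  of the first; \<open>l\<close> is the number in the definition of the rotation. The algebra \<open>\<Gamma>\<close> consists of the chain
  endomorphisms of \<open>m \<oplus> (0 \<rightarrow> P\<^sub>1)\<close> that have no component from \<open>m\<close> to \<open>(0 \<rightarrow> P\<^sub>1)\<close>, with
  \<open>f\<^sub>1\<close> the projection to \<open>m\<close> and \<open>f\<^sub>2\<close> the projection to \<open>P\<^sub>1\<close>; minimality of \<open>m\<close> makes \<open>f\<^sub>1\<close> primitive.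
  A morphism from \<open>f\<^sub>2\<^sup>n\<close> to \<open>f\<^sub>1\<^sup>k\<close> is a map \<open>D : P\<^sub>1\<^sup>n \<rightarrow> P\<^sub>1\<^sup>k\<^sup>l\<close>, which is a split monomorphism
  if the complex is presilting without common summands. Composing \<open>m\<^sup>k : P\<^sub>2\<^sup>k \<rightarrow> P\<^sub>1\<^sup>k\<^sup>l\<close> with the
  cokernel of \<open>D\<close> gives a two-term complex over \<open>\<Lambda>\<close>. This is a bijection that preserves \<open>Hom(X, Y[1]) = 0\<close>,
  and it maps \<open>g\<close>-vectors \<open>(k, -n)\<close> to \<open>(k l - n, -k)\<close>, which is the inverse of the linear map in the rotation.
  Since \<open>e\<^sub>2\<Lambda>e\<^sub>1 = 0\<close>, the quadrant \<open>(-, +)\<close> is not subdivided, so nothing else has to be compared.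
\<close>

section \<open>Finitely supported matrices over a non-unital ring\<close>

text \<open>Chain maps suffice because Hom(P_1, P_2) = 0: a complex P_2^k -> P_1^j admits no
  homotopies, so indecomposability up to homotopy becomes a statement about pairs of idempotent
  matrices. Dropping the component from m to (0 -> P_1) makes \<Gamma> triangular again and does not
  touch Hom(f_2^n, f_1^k), which is all that the correspondence uses. One object on each side has no
  partner: (0 -> P_1) over \<Lambda> and (f_2 -> 0) over \<Gamma>. In its quadrant the first is
  compatible only with m, whose g-vector is (l, -1), the second only with f_2^l -> f_1. They account
  for the cone that becomes the positive quadrant and for the image of the negative quadrant.
  Krull-Schmidt rests on Fitting's lemma. Matrix rings of unbounded size are infinite-dimensional,
  so it is proved from finite-dimensionality of the corners x R y, which matrix rings inherit. This
  is applied to matrices over matrices: P_1^l has to be an element of the same ring as P_1 and P_2,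
  orthogonal to both, before powers of f_1 can be formed.\<close>

typedef (overloaded) 'r fmat =
  "{f :: nat \<Rightarrow> nat \<Rightarrow> 'r::zero. \<exists>N. \<forall>i j. N \<le> i \<or> N \<le> j \<longrightarrow> f i j = 0}"
  morphisms ent Fmat
  by (rule exI[of _ "\<lambda>_ _. 0"]) simp

definition bnd :: "'r::zero fmat \<Rightarrow> nat \<Rightarrow> bool" where
  "bnd X N \<longleftrightarrow> (\<forall>i j. N \<le> i \<or> N \<le> j \<longrightarrow> ent X i j = 0)"

lemma bnd_ex: "\<exists>N. bnd X N"
  using ent[of X] by (auto simp: bnd_def)

lemma bnd_mono: "bnd X N \<Longrightarrow> N \<le> M \<Longrightarrow> bnd X M"
  unfolding bnd_def by (meson le_trans)

lemma bnd2: "\<exists>N. bnd X N \<and> bnd Y N"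
  using bnd_ex[of X] bnd_ex[of Y] by (meson bnd_mono nat_le_linear)

lemma ent_Fmat: "(\<And>i j. N \<le> i \<or> N \<le> j \<Longrightarrow> f i j = 0) \<Longrightarrow> ent (Fmat f) = f"
  by (rule Fmat_inverse) auto

lemma fmat_eqI: "(\<And>i j. ent X i j = ent Y i j) \<Longrightarrow> X = Y"
  by (simp add: ent_inject[symmetric] fun_eq_iff)

lemma fmat_eq_iff: "X = Y \<longleftrightarrow> (\<forall>i j. ent X i j = ent Y i j)"
  by (metis fmat_eqI)

instantiation fmat :: (ring) ring
begin

definition zero_fmat :: "'a fmat" where "0 = Fmat (\<lambda>_ _. 0)"
definition plus_fmat :: "'a fmat \<Rightarrow> 'a fmat \<Rightarrow> 'a fmat" where
  "X + Y = Fmat (\<lambda>i j. ent X i j + ent Y i j)"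
definition minus_fmat :: "'a fmat \<Rightarrow> 'a fmat \<Rightarrow> 'a fmat" where
  "X - Y = Fmat (\<lambda>i j. ent X i j - ent Y i j)"
definition uminus_fmat :: "'a fmat \<Rightarrow> 'a fmat" where
  "- X = Fmat (\<lambda>i j. - ent X i j)"
text \<open>The support of a row is finite, so no bound has to be chosen here;
  \<open>ent_times\<close> and \<open>ent_times'\<close> trade it for any range that bounds one of
  the factors.\<close>

definition times_fmat :: "'a fmat \<Rightarrow> 'a fmat \<Rightarrow> 'a fmat" where
  "X * Y = Fmat (\<lambda>i j. \<Sum>k\<in>{k. ent X i k \<noteq> 0}. ent X i k * ent Y k j)"

lemma ent_zero [simp]: "ent (0::'a fmat) i j = 0"
  unfolding zero_fmat_def by (subst ent_Fmat) auto

lemma ent_add [simp]: "ent (X + Y :: 'a fmat) i j = ent X i j + ent Y i j"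
proof -
  obtain N where "bnd X N" "bnd Y N" using bnd2 by blast
  then show ?thesis unfolding plus_fmat_def by (subst ent_Fmat[of N]) (auto simp: bnd_def)
qed

lemma ent_diff [simp]: "ent (X - Y :: 'a fmat) i j = ent X i j - ent Y i j"
proof -
  obtain N where "bnd X N" "bnd Y N" using bnd2 by blast
  then show ?thesis unfolding minus_fmat_def by (subst ent_Fmat[of N]) (auto simp: bnd_def)
qed

lemma ent_uminus [simp]: "ent (- X :: 'a fmat) i j = - ent X i j"
proof -
  obtain N where "bnd X N" using bnd_ex by blast
  then show ?thesis unfolding uminus_fmat_def by (subst ent_Fmat[of N]) (auto simp: bnd_def)
qed

lemma ent_times_supp: "ent (X * Y :: 'a fmat) i j = (\<Sum>k\<in>{k. ent X i k \<noteq> 0}. ent X i k * ent Y k j)"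
proof -
  obtain N where N: "bnd X N" "bnd Y N" using bnd2 by blast
  have "{k. ent X i k \<noteq> 0} = {}" if "N \<le> i" for i using N that by (auto simp: bnd_def)
  then show ?thesis unfolding times_fmat_def using N by (subst ent_Fmat[of N]) (auto simp: bnd_def)
qed

lemma ent_times: "bnd X N \<Longrightarrow> ent (X * Y :: 'a fmat) i j = (\<Sum>k<N. ent X i k * ent Y k j)"
  unfolding ent_times_supp
  by (rule sum.mono_neutral_left) (auto simp: bnd_def not_less[symmetric])

lemma ent_times': "bnd Y N \<Longrightarrow> ent (X * Y :: 'a fmat) i j = (\<Sum>k<N. ent X i k * ent Y k j)"
proof -
  assume Y: "bnd Y N"
  obtain M where M: "bnd X M" "bnd Y M" using bnd2 by blast
  have "(\<Sum>k<max M N. ent X i k * ent Y k j) = (\<Sum>k<N. ent X i k * ent Y k j)"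
    by (rule sum.mono_neutral_right) (use Y in \<open>auto simp: bnd_def not_less\<close>)
  then show ?thesis using ent_times[OF bnd_mono[OF M(1), of "max M N"], of Y i j] by simp
qed

instance
proof
  fix X Y Z :: "'a fmat"
  show "X + Y + Z = X + (Y + Z)" by (rule fmat_eqI) (simp add: add.assoc)
  show "X + Y = Y + X" by (rule fmat_eqI) (simp add: add.commute)
  show "0 + X = X" by (rule fmat_eqI) simp
  show "- X + X = 0" by (rule fmat_eqI) simp
  show "X - Y = X + - Y" by (rule fmat_eqI) simp
  show "X * Y * Z = X * (Y * Z)"
  proof (rule fmat_eqI)
    fix i j
    obtain N where X: "bnd X N" and Y: "bnd Y N" using bnd2 by blast
    have XY: "bnd (X * Y) N" unfolding bnd_def
      using X Y by (auto simp: ent_times[OF X] bnd_def)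
    have "ent (X * Y * Z) i j = (\<Sum>k<N. (\<Sum>l<N. ent X i l * ent Y l k) * ent Z k j)"
      by (simp add: ent_times[OF XY] ent_times[OF X])
    also have "\<dots> = (\<Sum>l<N. \<Sum>k<N. ent X i l * ent Y l k * ent Z k j)"
      unfolding sum_distrib_right by (rule sum.swap)
    also have "\<dots> = ent (X * (Y * Z)) i j"
      by (simp add: ent_times[OF Y] ent_times[OF X] sum_distrib_left mult.assoc)
    finally show "ent (X * Y * Z) i j = ent (X * (Y * Z)) i j" .
  qed
  show "(X + Y) * Z = X * Z + Y * Z"
  proof (rule fmat_eqI)
    fix i j
    obtain N where "bnd Z N" using bnd_ex by blast
    then show "ent ((X + Y) * Z) i j = ent (X * Z + Y * Z) i j"
      by (simp add: ent_times' distrib_right sum.distrib)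
  qed
  show "X * (Y + Z) = X * Y + X * Z"
  proof (rule fmat_eqI)
    fix i j
    obtain N where "bnd X N" using bnd_ex by blast
    then show "ent (X * (Y + Z)) i j = ent (X * Y + X * Z) i j"
      by (simp add: ent_times distrib_left sum.distrib)
  qed
qed

end

lemma ent_sum: "ent (sum f A :: 'r::ring fmat) i j = (\<Sum>x\<in>A. ent (f x) i j)"
  by (induction A rule: infinite_finite_induct) auto

definition E :: "nat \<Rightarrow> nat \<Rightarrow> 'r::ring \<Rightarrow> 'r fmat" where
  "E i j x = Fmat (\<lambda>s t. if s = i \<and> t = j then x else 0)"

lemma ent_E [simp]: "ent (E i j x) s t = (if s = i \<and> t = j then x else 0)"
  unfolding E_def by (subst ent_Fmat[of "Suc (max i j)"]) auto

lemma ent_E_times [simp]: "ent (E i j x * Y) s t = (if s = i then x * ent Y j t else 0)"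
proof -
  obtain N where "bnd Y N" using bnd_ex by blast
  then have "bnd Y (N + j + 1)" by (rule bnd_mono) simp
  then show ?thesis
    by (simp add: ent_times' if_distrib[of "\<lambda>u. u * _"] sum.delta cong: if_cong)
qed

lemma ent_times_E [simp]: "ent (Y * E i j x) s t = (if t = j then ent Y s i * x else 0)"
proof -
  obtain N where "bnd Y N" using bnd_ex by blast
  then have "bnd Y (N + i + 1)" by (rule bnd_mono) simp
  then show ?thesis
    by (simp add: ent_times if_distrib[of "\<lambda>u. _ * u"] sum.delta cong: if_cong)
qed

lemma E_mult [simp]: "E i j x * E k l y = (if j = k then E i l (x * y) else 0)"
  by (rule fmat_eqI) auto

lemma E_add: "E i j (x + y) = E i j x + E i j y"
  and E_zero [simp]: "E i j 0 = 0"
  by (rule fmat_eqI; simp)+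

lemma E_inject [simp]: "E i j x = E i j y \<longleftrightarrow> x = y"
  by (metis ent_E)

lemma fmat_expand: "bnd X N \<Longrightarrow> X = (\<Sum>i<N. \<Sum>j<N. E i j (ent X i j))"
proof (rule fmat_eqI)
  fix s t assume X: "bnd X N"
  have *: "(\<Sum>j<N. if s = i \<and> t = j then ent X i j else 0) = (if s = i \<and> t < N then ent X i t else 0)" for i
    by (cases "s = i") (auto simp: sum.delta')
  show "ent X s t = ent (\<Sum>i<N. \<Sum>j<N. E i j (ent X i j)) s t"
    using X by (auto simp: ent_sum * sum.delta' bnd_def not_less if_distrib cong: if_cong)
      (cases "t < N"; auto simp: sum.delta' not_less)
qed

text \<open>For an idempotent \<open>x\<close> this is the n-fold direct sum of the object
  \<open>x\<close>; for a morphism it is the n-fold diagonal morphism, such as m^k in the form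
  \<open>dg k m\<close>.\<close>

definition dg :: "nat \<Rightarrow> 'r::ring \<Rightarrow> 'r fmat" where
  "dg n x = (\<Sum>i<n. E i i x)"

lemma ent_dg [simp]: "ent (dg n x) s t = (if s = t \<and> s < n then x else 0)"
proof -
  have "(if s = i \<and> t = i then x else 0) = (if i = s then (if s = t then x else 0) else 0)" for i
    by auto
  then show ?thesis by (simp add: dg_def ent_sum sum.delta)
qed

lemma bnd_dg: "bnd (dg n x) n" by (simp add: bnd_def)

lemma ent_dg_times [simp]: "ent (dg n x * Y) s t = (if s < n then x * ent Y s t else 0)"
  by (simp add: ent_times[OF bnd_dg] if_distrib[of "\<lambda>u. u * _"] cong: if_cong)

lemma ent_times_dg [simp]: "ent (Y * dg n x) s t = (if t < n then ent Y s t * x else 0)"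
  by (simp add: ent_times'[OF bnd_dg] if_distrib[of "\<lambda>u. _ * u"] cong: if_cong)

lemma dg_mult [simp]: "dg n x * dg n y = dg n (x * y)"
  by (rule fmat_eqI) auto

lemma dg_add: "dg n (x + y) = dg n x + dg n y"
  by (rule fmat_eqI) auto

lemma dg_zero [simp]: "dg n 0 = 0" "dg 0 x = 0"
  by (rule fmat_eqI; simp)+

lemma dg_Suc: "dg (Suc n) x = dg n x + E n n x"
  by (simp add: dg_def)

section \<open>Locally finite-dimensional algebras and the Fitting property\<close>

text \<open>Powers are shifted by one, since the rings need not have a unit: \<open>pw x n\<close> is \<open>x\<close> to the \<open>n + 1\<close>.\<close>

primrec pw :: "'r::ring \<Rightarrow> nat \<Rightarrow> 'r" where
  "pw x 0 = x" |
  "pw x (Suc n) = x * pw x n"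

lemma pw_add: "pw x m * pw x n = pw x (Suc (m + n))"
  by (induction m) (auto simp: mult.assoc)

lemma pw_comm: "pw x m * pw x n = pw x n * pw x m"
  by (simp add: pw_add add.commute)

text \<open>\<open>locally_fin\<close> puts each corner x R y inside a finite-dimensional space. It
  replaces finite dimension, which is lost for matrices of unbounded size.\<close>

locale kalg = vector_space scl for scl :: "'k::field \<Rightarrow> 'r::ring \<Rightarrow> 'r" +
  assumes scl_multL: "scl c x * y = scl c (x * y)"
    and scl_multR: "x * scl c y = scl c (x * y)"
    and locally_fin: "\<exists>B. finite B \<and> (\<forall>z. x * z * y \<in> span B)"
begin

lemma mult_span: assumes "x \<in> span A" "\<And>a. a \<in> A \<Longrightarrow> y * a \<in> span B" shows "y * x \<in> span B"
  using assms(1)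
  by (induction rule: span_induct_alt)
    (auto simp: span_zero distrib_left scl_multR intro!: span_add span_scale assms(2))

lemma span_commute: assumes "y \<in> span A" "\<And>a. a \<in> A \<Longrightarrow> x * a = a * x" shows "x * y = y * x"
  using assms(1)
  by (induction rule: span_induct_alt)
    (auto simp: distrib_left distrib_right scl_multR scl_multL assms(2))

text \<open>Otherwise every finite stretch of powers of \<open>x\<close> would be independent, while
  from the third power on all of them lie in the corner x R x.\<close>

lemma power_in_span: "\<exists>N. pw x N \<in> span (pw x ` {N<..})"
proof (rule ccontr)
  assume "\<not> ?thesis"
  then have nd: "pw x N \<notin> span (pw x ` {N<..})" for N by blast
  obtain B where B: "finite B" "\<And>z. x * z * x \<in> span B" using locally_fin[of x x] by blast
  have ind: "independent (pw x ` {m..<m+k}) \<and> card (pw x ` {m..<m+k}) = k" for m k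
  proof (induction k arbitrary: m)
    case 0 then show ?case by (simp add: independent_empty)
  next
    case (Suc k)
    have "{m..<m + Suc k} = insert m {Suc m..<Suc m + k}" by auto
    then have eq: "pw x ` {m..<m + Suc k} = insert (pw x m) (pw x ` {Suc m..<Suc m + k})" by simp
    have sub: "span (pw x ` {Suc m..<Suc m + k}) \<subseteq> span (pw x ` {m<..})"
      by (rule span_mono) auto
    then have nin: "pw x m \<notin> span (pw x ` {Suc m..<Suc m + k})" using nd by blast
    then have "pw x m \<notin> pw x ` {Suc m..<Suc m + k}" using span_base by blast
    then show ?case unfolding eq using Suc[of "Suc m"] nin by (simp add: independent_insert)
  qed
  \<comment> \<open>Index 2 is the third power, the first one from which a factor \<open>x\<close>
    can be split off at both ends with something left between.\<close>
  have "pw x ` {2..<2 + Suc (card B)} \<subseteq> span B"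
  proof
    fix y assume "y \<in> pw x ` {2..<2 + Suc (card B)}"
    then obtain j where j: "j \<ge> 2" "y = pw x j" by auto
    have "pw x j = x * pw x (j - 2) * x"
      using pw_add[of x 0 "j - 2"] pw_add[of x "Suc (j - 2)" 0] j
      by (simp add: numeral_2_eq_2 Suc_diff_Suc)
    then show "y \<in> span B" using B j by simp
  qed
  then have "card (pw x ` {2..<2 + Suc (card B)}) \<le> card B"
    using independent_span_bound[OF B(1)] ind by blast
  then show False using ind[of 2 "Suc (card B)"] by simp
qed

text \<open>\<open>pw x N * Y\<close> is the Fitting idempotent of \<open>x\<close>: on its image
  \<open>x\<close> is invertible, on the complement nilpotent. \<open>Y\<close> is a linear
  combination of powers of \<open>x\<close>; hence it commutes with \<open>x\<close> and stays in
  \<open>S\<close>.\<close>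

theorem fitting:
  assumes S: "subspace S" and mult: "\<And>x y. x \<in> S \<Longrightarrow> y \<in> S \<Longrightarrow> x * y \<in> S" and x: "x \<in> S"
  shows "\<exists>N Y. Y \<in> S \<and> x * Y = Y * x \<and> pw x N * pw x N * Y = pw x N"
proof -
  obtain N where N: "pw x N \<in> span (pw x ` {N<..})" using power_in_span by blast
  \<comment> \<open>Multiplying the relation for \<open>pw x N\<close> by further powers shows that
    each later power is also a combination of higher ones; substituting repeatedly pushes the lowest
    exponent up.\<close>
  have step: "pw x (N + k) \<in> span (pw x ` {N + k<..})" for k
  proof (cases k)
    case (Suc j)
    have "pw x j * pw x N \<in> span (pw x ` {N + k<..})"
      by (rule mult_span[OF N]) (auto simp: pw_add Suc simp del: pw.simps intro!: span_base)
    then show ?thesis by (simp add: pw_add Suc add.commute)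
  qed (use N in simp)
  have "pw x N \<in> span (pw x ` {N + k<..})" for k
  proof (induction k)
    case (Suc k)
    have "{N + k<..} = insert (N + Suc k) {N + Suc k<..}" by auto
    then have "pw x N \<in> span (insert (pw x (N + Suc k)) (pw x ` {N + Suc k<..}))" using Suc by simp
    then show ?case using step[of "Suc k"] span_trans by blast
  qed (use N in simp)
  \<comment> \<open>Indices above 2 N + 1 are needed: after splitting off two factors
    \<open>pw x N\<close>, a positive power must remain, since there is no unit to serve as the
    zeroth power.\<close>
  from this[of "Suc N"] have "pw x N \<in> span ((\<lambda>y. pw x N * pw x N * y) ` range (pw x))"
  proof (rule subsetD[OF span_mono, rotated], safe)
    fix j assume "N + Suc N < j"
    then have "Suc (Suc (j - 2)) = j" by simp
    with \<open>N + Suc N < j\<close> have "pw x j = pw x N * pw x N * pw x (j - (N + Suc N) - 1)"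
      by (simp add: pw_add del: pw.simps)
    then show "pw x j \<in> (\<lambda>y. pw x N * pw x N * y) ` range (pw x)" by blast
  qed
  moreover have "\<exists>Y \<in> span (range (pw x)). pw x N * pw x N * Y = z"
    if "z \<in> span ((\<lambda>y. pw x N * pw x N * y) ` range (pw x))" for z
    using that
  proof (induction rule: span_induct_alt)
    case base then show ?case using span_zero by force
  next
    case (step c u v)
    from step obtain y Y where "y \<in> range (pw x)" "u = pw x N * pw x N * y" "Y \<in> span (range (pw x))" "pw x N * pw x N * Y = v" by blast
    then show ?case
      by (intro bexI[of _ "scl c y + Y"]) (auto simp: distrib_left scl_multR intro!: span_add span_scale intro: span_base)
  qed
  ultimately obtain Y where Y: "Y \<in> span (range (pw x))" "pw x N * pw x N * Y = pw x N" by blast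
  have "pw x n \<in> S" for n by (induction n) (auto simp: x mult)
  then have "Y \<in> S" using Y(1) span_minimal[OF _ S] by blast
  moreover have "x * Y = Y * x"
    using Y(1) by (rule span_commute) (use pw_comm[of x 0] in auto)
  ultimately show ?thesis using Y(2) by blast
qed

definition mscl :: "'k \<Rightarrow> 'r fmat \<Rightarrow> 'r fmat" where
  "mscl c X = Fmat (\<lambda>i j. scl c (ent X i j))"

lemma ent_mscl [simp]: "ent (mscl c X) i j = scl c (ent X i j)"
proof -
  obtain N where "bnd X N" using bnd_ex by blast
  then show ?thesis unfolding mscl_def by (subst ent_Fmat[of N]) (auto simp: bnd_def)
qed

text \<open>The entries of X Z Y are finite sums of products x z y with x an entry of X and y an
  entry of Y, and only finitely many positions and pairs (x, y) occur.\<close>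

theorem kalg_fmat: "kalg mscl"
proof -
  interpret m: vector_space mscl
    by unfold_locales (auto intro!: fmat_eqI simp: scale_right_distrib scale_left_distrib)
  have ER: "E i j y \<in> m.span ((\<lambda>b. E i j b) ` B)" if "y \<in> span B" for i j :: nat and y B
    using that
  proof (induction rule: span_induct_alt)
    case base then show ?case by (simp add: m.span_zero)
  next
    case (step c u v)
    have "E i j (scl c u + v) = mscl c (E i j u) + E i j v" by (rule fmat_eqI) simp
    then show ?case using step by (auto intro!: m.span_add m.span_scale intro: m.span_base)
  qed
  show ?thesis
  proof
    fix c and X Y :: "'r fmat"
    obtain N where N: "bnd X N" using bnd_ex by blast
    have "bnd (mscl c X) N" using N by (simp add: bnd_def)
    then show "mscl c X * Y = mscl c (X * Y)" using N
      by (intro fmat_eqI) (simp add: ent_times scl_multL scale_sum_right)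
    show "X * mscl c Y = mscl c (X * Y)" using N
      by (intro fmat_eqI) (simp add: ent_times scl_multR scale_sum_right)
  next
    fix X Y :: "'r fmat"
    obtain N where N: "bnd X N" "bnd Y N" using bnd2 by blast
    obtain B where B: "\<And>x y. finite (B x y) \<and> (\<forall>z. x * z * y \<in> span (B x y))"
      using locally_fin by metis
    define U where "U = (\<Union>i<N. \<Union>k<N. \<Union>l<N. \<Union>j<N. B (ent X i k) (ent Y l j))"
    define V where "V = (\<Union>i<N. \<Union>j<N. (\<lambda>b. E i j b) ` U)"
    have "finite V" unfolding V_def U_def using B by auto
    moreover have "X * Z * Y \<in> m.span V" for Z
    proof -
      have b: "bnd (X * Z * Y) N" unfolding bnd_def
      proof safe
        fix i j assume "N \<le> i" then show "ent (X * Z * Y) i j = 0"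
          unfolding mult.assoc using N(1) by (simp add: ent_times[OF N(1)] bnd_def)
      next
        fix i j assume "N \<le> j" then show "ent (X * Z * Y) i j = 0"
          using N(2) by (simp add: ent_times'[OF N(2)] bnd_def)
      qed
      have "ent (X * Z * Y) i j \<in> span U" if "i < N" "j < N" for i j
      proof -
        have "B (ent X i k) (ent Y l j) \<subseteq> U" if "k < N" "l < N" for k l
          unfolding U_def using that \<open>i < N\<close> \<open>j < N\<close> by blast
        then have "ent X i k * ent Z k l * ent Y l j \<in> span U" if "k < N" "l < N" for k l
          using B span_mono that by blast
        then show ?thesis
          by (simp add: ent_times'[OF N(2)] ent_times[OF N(1)] sum_distrib_right)
            (auto intro!: span_sum)
      qed
      then have "E i j (ent (X * Z * Y) i j) \<in> m.span V" if "i < N" "j < N" for i j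
        using ER[of "ent (X * Z * Y) i j" U i j] that m.span_mono[of "E i j ` U" V]
        unfolding V_def by blast
      then show ?thesis by (subst fmat_expand[OF b]) (auto intro!: m.span_sum)
    qed
    ultimately show "\<exists>B. finite B \<and> (\<forall>Z. X * Z * Y \<in> m.span B)" by blast
  qed
qed

end

lemma kalg_field: "kalg ((*) :: 'k::field \<Rightarrow> 'k \<Rightarrow> 'k)"
proof -
  interpret vector_space "(*) :: 'k \<Rightarrow> 'k \<Rightarrow> 'k" by unfold_locales (auto simp: algebra_simps)
  show ?thesis
  proof
    fix c x y :: 'k
    show "\<exists>B. finite B \<and> (\<forall>z. x * z * y \<in> span B)"
      by (rule exI[of _ "{1}"]) (auto simp: span_singleton)
    show "c * x * y = c * (x * y)" by (rule mult.assoc)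
    show "x * (c * y) = c * (x * y)" by (rule mult.left_commute)
  qed
qed

section \<open>Free idempotents in a subring with local idempotents\<close>

text \<open>Makes a product equation usable by rewriting inside products that are associated to the
  right.\<close>

lemma asr: "(x::'m::semigroup_mult) * y = z \<Longrightarrow> x * (y * w) = z * w"
  by (simp add: mult.assoc[symmetric])

text \<open>Idempotents play the role of projective modules and \<open>hm p q\<close> is the space of morphisms from
  \<open>p\<close> to \<open>q\<close>; composition is the product.\<close>

locale rcat =
  fixes S :: "'m::ring set"
  assumes S0 [simp]: "0 \<in> S"
    and Sadd [intro]: "x \<in> S \<Longrightarrow> y \<in> S \<Longrightarrow> x + y \<in> S"
    and Sdiff [intro]: "x \<in> S \<Longrightarrow> y \<in> S \<Longrightarrow> x - y \<in> S"
    and Smult [intro]: "x \<in> S \<Longrightarrow> y \<in> S \<Longrightarrow> x * y \<in> S"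
begin

definition hm :: "'m \<Rightarrow> 'm \<Rightarrow> 'm set" where
  "hm p q = {x \<in> S. q * x = x \<and> x * p = x}"

definition idp :: "'m \<Rightarrow> bool" where
  "idp p \<longleftrightarrow> p \<in> S \<and> p * p = p"

definition iso :: "'m \<Rightarrow> 'm \<Rightarrow> bool" where
  "iso p q \<longleftrightarrow> (\<exists>x\<in>hm p q. \<exists>y\<in>hm q p. y * x = p \<and> x * y = q)"

definition loc :: "'m \<Rightarrow> bool" where
  "loc g \<longleftrightarrow> idp g \<and> g \<noteq> 0 \<and> (\<forall>x\<in>hm g g. \<forall>y\<in>hm g g. x + y = g \<longrightarrow>
     (\<exists>w\<in>hm g g. w * x = g \<and> x * w = g) \<or> (\<exists>w\<in>hm g g. w * y = g \<and> y * w = g))"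

lemma hmI: "x \<in> S \<Longrightarrow> q * x = x \<Longrightarrow> x * p = x \<Longrightarrow> x \<in> hm p q" by (simp add: hm_def)
lemma hmL: "x \<in> hm p q \<Longrightarrow> q * x = x" by (simp add: hm_def)
lemma hmR: "x \<in> hm p q \<Longrightarrow> x * p = x" by (simp add: hm_def)
lemma hmS: "x \<in> hm p q \<Longrightarrow> x \<in> S" by (simp add: hm_def)
lemma hmL2: "x \<in> hm p q \<Longrightarrow> q * (x * y) = x * y" by (simp add: hm_def mult.assoc[symmetric])
lemma hmR2: "x \<in> hm p q \<Longrightarrow> x * (p * y) = x * y" by (simp add: hm_def mult.assoc[symmetric])
lemmas hmE = hmL hmR hmL2 hmR2

lemma hm_mult [intro]: "x \<in> hm p q \<Longrightarrow> y \<in> hm r p \<Longrightarrow> x * y \<in> hm r q"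
  unfolding hm_def by (auto simp: mult.assoc) (simp add: mult.assoc[symmetric])
lemma hm_add [intro]: "x \<in> hm p q \<Longrightarrow> y \<in> hm p q \<Longrightarrow> x + y \<in> hm p q"
  unfolding hm_def by (auto simp: algebra_simps)
lemma hm_diff [intro]: "x \<in> hm p q \<Longrightarrow> y \<in> hm p q \<Longrightarrow> x - y \<in> hm p q"
  unfolding hm_def by (auto simp: algebra_simps)
lemma hm_0 [simp]: "0 \<in> hm p q" by (simp add: hm_def)
lemma hm_uminus [intro]: "x \<in> hm p q \<Longrightarrow> - x \<in> hm p q"
  using hm_diff[OF hm_0, of x p q] by simp
lemma hm_0L [simp]: "hm p 0 = {0}" and hm_0R [simp]: "hm 0 p = {0}"
  by (auto simp: hm_def)
lemma hm_id: "p \<in> hm p p \<longleftrightarrow> idp p" by (auto simp: hm_def idp_def)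
lemma idp_0 [simp]: "idp 0" by (simp add: idp_def)
lemma idpS: "idp p \<Longrightarrow> p \<in> S" and idpM: "idp p \<Longrightarrow> p * p = p"
  by (simp_all add: idp_def)
lemma idp_hm [intro]: "idp p \<Longrightarrow> p \<in> hm p p" by (simp add: hm_id)

lemma isoE: assumes "iso p q"
  obtains x y where "x \<in> hm p q" "y \<in> hm q p" "y * x = p" "x * y = q"
  using assms by (auto simp: iso_def)

lemma isoI: "x \<in> hm p q \<Longrightarrow> y \<in> hm q p \<Longrightarrow> y * x = p \<Longrightarrow> x * y = q \<Longrightarrow> iso p q"
  by (auto simp: iso_def)

lemma iso_sym: "iso p q \<Longrightarrow> iso q p" by (auto simp: iso_def)
lemma iso_refl: "idp p \<Longrightarrow> iso p p"
  by (rule isoI[of p p p p]) (auto simp: idp_def hm_def)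
lemma iso_trans: assumes "iso p q" "iso q r" shows "iso p r"
proof -
  obtain x y where 1: "x \<in> hm p q" "y \<in> hm q p" "y * x = p" "x * y = q" using assms(1) by (rule isoE)
  obtain u v where 2: "u \<in> hm q r" "v \<in> hm r q" "v * u = q" "u * v = r" using assms(2) by (rule isoE)
  show ?thesis
  proof (rule isoI)
    show "u * x \<in> hm p r" "y * v \<in> hm r p" using 1 2 by auto
    have "y * v * (u * x) = y * ((v * u) * x)" by (simp add: mult.assoc)
    then show "y * v * (u * x) = p" using 1 2 hmL[OF 1(1)] by simp
    have "u * x * (y * v) = u * ((x * y) * v)" by (simp add: mult.assoc)
    then show "u * x * (y * v) = r" using 1 2 hmL[OF 2(2)] by simp
  qed
qed

lemma iso_idp: "iso p q \<Longrightarrow> idp p" "iso p q \<Longrightarrow> idp q"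
proof -
  assume "iso p q"
  then obtain x y where 1: "x \<in> hm p q" "y \<in> hm q p" "y * x = p" "x * y = q" by (rule isoE)
  have "p * p = y * ((x * y) * x)" unfolding 1(3)[symmetric] by (simp add: mult.assoc)
  then show "idp p" using 1 hmL[OF 1(1)] by (auto simp: idp_def dest: hmS)
  have "q * q = x * ((y * x) * y)" unfolding 1(4)[symmetric] by (simp add: mult.assoc)
  then show "idp q" using 1 hmL[OF 1(2)] by (auto simp: idp_def dest: hmS)
qed

lemma iso_0: "iso p 0 \<Longrightarrow> p = 0" "iso 0 p \<Longrightarrow> p = 0"
  by (auto simp: iso_def)

lemma iso_transport:
  assumes "iso p p'" "idp q" "p * q = q" "q * p = q"
  obtains q' where "idp q'" "p' * q' = q'" "q' * p' = q'" "iso q q'" "iso (p - q) (p' - q')"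
proof -
  obtain x y where h: "x \<in> hm p p'" "y \<in> hm p' p" "y * x = p" "x * y = p'" using assms(1) by (rule isoE)
  note s = h(3,4) asr[OF h(3)] asr[OF h(4)] hmE[OF h(1)] hmE[OF h(2)] assms(3,4) asr[OF assms(3)] asr[OF assms(4)]
    idpM[OF assms(2)] asr[OF idpM[OF assms(2)]] idpM[OF iso_idp(1)[OF assms(1)]] asr[OF idpM[OF iso_idp(1)[OF assms(1)]]]
    idpM[OF iso_idp(2)[OF assms(1)]]
  have S: "x \<in> S" "y \<in> S" "q \<in> S" "p \<in> S" "p' \<in> S"
    using h assms(2) idpS hmS iso_idp[OF assms(1)] by blast+
  show ?thesis
  proof (rule that)
    show "idp (x * q * y)" "p' * (x * q * y) = x * q * y" "x * q * y * p' = x * q * y"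
      using S by (auto simp: idp_def mult.assoc s)
    show "iso q (x * q * y)"
      by (rule isoI[of "x * q" _ _ "q * y"]) (use S in \<open>auto simp: hm_def mult.assoc s\<close>)
    show "iso (p - q) (p' - x * q * y)"
      by (rule isoI[of "x * (p - q)" _ _ "(p - q) * y"])
        (use S in \<open>auto simp: hm_def mult.assoc s algebra_simps\<close>)
  qed
qed

lemma iso_oplus:
  assumes "iso p p'" "iso q q'" "p * q = 0" "q * p = 0" "p' * q' = 0" "q' * p' = 0"
  shows "iso (p + q) (p' + q')"
proof -
  obtain x y where h: "x \<in> hm p p'" "y \<in> hm p' p" "y * x = p" "x * y = p'" using assms(1) by (rule isoE)
  obtain u v where k: "u \<in> hm q q'" "v \<in> hm q' q" "v * u = q" "u * v = q'" using assms(2) by (rule isoE)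
  have z: "y * u = y * (p' * (q' * u))" "v * x = v * (q' * (p' * x))" "x * v = x * (p * (q * v))" "u * y = u * (q * (p * y))"
    using hmE[OF h(1)] hmE[OF h(2)] hmE[OF k(1)] hmE[OF k(2)] by (simp_all add: mult.assoc)
  have z: "y * u = 0" "v * x = 0" "x * v = 0" "u * y = 0" unfolding z
    using assms(3-6) by (simp_all add: asr)
  have w: "x * q = x * (p * q)" "u * p = u * (q * p)" "y * q' = y * (p' * q')" "v * p' = v * (q' * p')"
    "q' * x = q' * p' * x" "p' * u = p' * q' * u" "q * y = q * p * y" "p * v = p * q * v"
    using hmE[OF h(1)] hmE[OF h(2)] hmE[OF k(1)] hmE[OF k(2)] by (simp_all add: mult.assoc)
  have w: "x * q = 0" "u * p = 0" "y * q' = 0" "v * p' = 0" "q' * x = 0" "p' * u = 0" "q * y = 0" "p * v = 0"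
    unfolding w using assms(3-6) by simp_all
  show ?thesis
    by (rule isoI[of "x + u" _ _ "y + v"])
      (use h k z w in \<open>auto simp: hm_def algebra_simps\<close>)
qed

text \<open>Here \<open>e\<close> and \<open>f\<close> have the same kernel, and this kernel is the
  image of both complements.\<close>

lemma compl_iso_ker:
  assumes "idp p" "idp e" "idp f" "p * e = e" "e * p = e" "p * f = f" "f * p = f" "e * f = e" "f * e = f"
  shows "iso (p - e) (p - f)"
  by (rule isoI[of "p - e" _ _ "p - f"])
    (use assms in \<open>auto simp: hm_def algebra_simps idp_def\<close>)

text \<open>Here \<open>e\<close> and \<open>f\<close> have the same image, so both complements are
  isomorphic to the quotient of \<open>p\<close> by it.\<close>

lemma compl_iso_im:
  assumes "idp p" "idp e" "idp f" "p * e = e" "e * p = e" "p * f = f" "f * p = f" "e * f = f" "f * e = e"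
  shows "iso (p - e) (p - f)"
  by (rule isoI[of "p - f" _ _ "p - e"])
    (use assms in \<open>auto simp: hm_def algebra_simps idp_def\<close>)

lemma idp_add: "idp p \<Longrightarrow> idp q \<Longrightarrow> p * q = 0 \<Longrightarrow> q * p = 0 \<Longrightarrow> idp (p + q)"
  by (auto simp: idp_def algebra_simps)

lemma loc_iso: assumes "loc g" "iso g h" shows "loc h"
proof -
  obtain x y where xy: "x \<in> hm g h" "y \<in> hm h g" "y * x = g" "x * y = h" using assms(2) by (rule isoE)
  have inv: "\<exists>w\<in>hm h h. w * a = h \<and> a * w = h" if a: "a \<in> hm h h" and v: "v \<in> hm g g" "v * (y * a * x) = g" "y * a * x * v = g" for a v
  proof (rule bexI[of _ "x * v * y"])
    have "x * v * y * a = x * v * y * a * (x * y)" using a xy(4) by (simp add: mult.assoc hmR)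
    also have "\<dots> = x * (v * (y * a * x)) * y" by (simp add: mult.assoc)
    finally have 1: "x * v * y * a = h" using v xy hmR[OF xy(1)] by simp
    have "a * (x * v * y) = (x * y) * a * (x * v * y)" using a xy(4) by (simp add: mult.assoc hmL hmL2)
    also have "\<dots> = x * (y * a * x * v) * y" by (simp add: mult.assoc)
    finally have 2: "a * (x * v * y) = h" using v xy hmR[OF xy(1)] by simp
    show "x * v * y * a = h \<and> a * (x * v * y) = h" using 1 2 by simp
    show "x * v * y \<in> hm h h" using xy v by auto
  qed
  have sum: "y * a * x + y * b * x = g" if "a + b = h" for a b
  proof -
    have "y * a * x + y * b * x = y * (a + b) * x" by (simp add: algebra_simps)
    then show ?thesis using that xy hmR[OF xy(2)] by simp
  qed
  have hm: "y * a * x \<in> hm g g" if "a \<in> hm h h" for a using that xy by auto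
  have "h \<noteq> 0" using assms iso_0 by (auto simp: loc_def)
  then show ?thesis unfolding loc_def
  proof (intro conjI ballI impI iso_idp(2)[OF assms(2)])
    fix a b assume ab: "a \<in> hm h h" "b \<in> hm h h" "a + b = h"
    have "(\<exists>v\<in>hm g g. v * (y * a * x) = g \<and> y * a * x * v = g) \<or> (\<exists>v\<in>hm g g. v * (y * b * x) = g \<and> y * b * x * v = g)"
      using assms(1) hm[OF ab(1)] hm[OF ab(2)] sum[OF ab(3)] unfolding loc_def by blast
    then show "(\<exists>w\<in>hm h h. w * a = h \<and> a * w = h) \<or> (\<exists>w\<in>hm h h. w * b = h \<and> b * w = h)"
      using inv[OF ab(1)] inv[OF ab(2)] by blast
  qed
qed

lemma loc_idem: assumes "loc g" "idp f" "g * f = f" "f * g = f" shows "f = 0 \<or> f = g"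
proof -
  have 1: "f \<in> hm g g" "g - f \<in> hm g g" "f + (g - f) = g"
    using assms by (auto simp: hm_def loc_def idp_def algebra_simps)
  have f: "f * (g - f) = 0" using assms by (simp add: algebra_simps idp_def)
  consider w where "w * f = g" | w where "w \<in> hm g g" "(g - f) * w = g"
    using assms(1) 1 unfolding loc_def by metis
  then show ?thesis
  proof cases
    case 1
    then have "w * f * (g - f) = g - f" using \<open>g - f \<in> hm g g\<close> by (simp add: hmL)
    then show ?thesis using f by (simp add: mult.assoc)
  next
    case 2
    then have "f * ((g - f) * w) = f" using assms by simp
    then show ?thesis using f by (simp add: mult.assoc[symmetric])
  qed
qed

text \<open>The exchange step of the Krull-Schmidt theorem: if the local summand \<open>g\<close>
  survives the passage through \<open>q\<close>, a copy of \<open>g\<close> splits off from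
  \<open>q\<close>, and the complements of both copies in \<open>p\<close> are isomorphic.\<close>

lemma exchange:
  assumes p: "idp p" "idp g" "idp q" "p * g = g" "g * p = g" "p * q = q" "q * p = q"
    and w: "w \<in> hm g g" "w * (g * q * g) = g" "g * q * g * w = g"
  obtains f where "idp f" "q * f = f" "f * q = f" "iso g f" "iso (p - g) (p - f)"
proof -
  note i = idpM[OF p(1)] idpM[OF p(2)] idpM[OF p(3)]
  have w2: "w * (q * g) = g" "g * (q * w) = g"
    using w(2,3) hmE[OF w(1)] by (simp_all add: mult.assoc)
  have w3: "w * (q * w) = w" using w2(2) hmR2[OF w(1), of "q * w"] hmR[OF w(1)] by simp
  note s = i p(4-7) hmE[OF w(1)] i[THEN asr] p(4-7)[THEN asr] w3 asr[OF w3, unfolded mult.assoc] w2 asr[OF w2(1), unfolded mult.assoc] asr[OF w2(2), unfolded mult.assoc]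
  have S: "p \<in> S" "q \<in> S" "g \<in> S" "w \<in> S" using p w by (auto dest: idpS hmS)
  have pw: "p * w = w" "w * p = w"
    using s(8,9) p(4,5) by (metis mult.assoc)+
  define f where "f = q * w * q"
  \<comment> \<open>\<open>h\<close> mediates between the two summands: it has the kernel of
    \<open>g\<close> and the image of \<open>f\<close>, so the two complement lemmas
    compose.\<close>
  define h where "h = q * w"
  have f: "idp f" "q * f = f" "f * q = f" and h: "idp h"
    using S by (auto simp: idp_def f_def h_def mult.assoc s)
  have e: "h * g = h" "g * h = g" "h * f = f" "f * h = h" "p * f = f" "f * p = f" "p * h = h" "h * p = h"
    by (simp_all add: f_def h_def mult.assoc s pw pw[THEN asr])
  show ?thesis
  proof (rule that[OF f])
    show "iso g f"
      by (rule isoI[of "q * w" _ _ "g * q"]) (use S in \<open>auto simp: hm_def f_def mult.assoc s\<close>)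
    have "iso (p - g) (p - h)" by (rule compl_iso_ker) (use p h e in auto)
    moreover have "iso (p - h) (p - f)" by (rule compl_iso_im) (use p f h e in auto)
    ultimately show "iso (p - g) (p - f)" by (rule iso_trans)
  qed
qed

end

text \<open>\<open>G False\<close> and \<open>G True\<close> are the two indecomposable projectives; there are no nonzero maps from
  the first to the second.\<close>

locale tri = rcat S for S :: "'m::ring set" +
  fixes G :: "bool \<Rightarrow> 'm"
  assumes Gloc: "loc (G b)"
    and Gtri: "hm (G False) (G True) = {0}"
    and fit: "x \<in> S \<Longrightarrow> \<exists>N Y. Y \<in> S \<and> x * Y = Y * x \<and> pw x N * pw x N * Y = pw x N"
begin

section \<open>Krull-Schmidt for direct sums of the two indecomposable projectives\<close>

lemma Gidp [simp]: "idp (G b)" and Gnz [simp]: "G b \<noteq> 0"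
  using Gloc[of b] by (auto simp: loc_def)

lemma G_iso: "iso (G b) (G c) \<Longrightarrow> b = c"
proof (rule ccontr)
  assume i: "iso (G b) (G c)" "b \<noteq> c"
  then have "iso (G False) (G True)" by (cases b; cases c) (auto intro: iso_sym)
  then show False using Gtri by (auto elim!: isoE)
qed

text \<open>Internal direct sums of copies of the two projectives. The multiset is the class in the
  Grothendieck group; it is well defined by \<open>fr_unique\<close> and determines the idempotent
  up to isomorphism by \<open>fr_iso_eq\<close>.\<close>

inductive fr :: "'m \<Rightarrow> bool multiset \<Rightarrow> bool" where
  fr0: "fr 0 {#}"
| frS: "fr p N \<Longrightarrow> iso (G b) g \<Longrightarrow> p * g = 0 \<Longrightarrow> g * p = 0 \<Longrightarrow> fr (p + g) (add_mset b N)"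

lemma fr_idp: "fr p N \<Longrightarrow> idp p"
  by (induction rule: fr.induct) (auto intro: idp_add iso_idp)

lemma fr_empty: "fr p {#} \<Longrightarrow> p = 0"
  by (erule fr.cases) auto

lemma fr_0: "fr 0 N \<Longrightarrow> N = {#}"
proof (erule fr.cases)
  fix p M b g assume h: "0 = p + g" "N = add_mset b M" "iso (G b) g" "p * g = 0"
  have "g = (p + g) * g" using h(4) iso_idp(2)[OF h(3)] by (simp add: distrib_right idp_def)
  then have "g = 0" using h(1) by simp
  then show ?thesis using iso_0(1) h(3) by force
qed auto

lemma fr_G: "fr (G b) {#b#}"
  using frS[OF fr0 iso_refl[OF Gidp], of b] by simp

lemma fr_single: "iso (G b) g \<Longrightarrow> fr g {#b#}"
  using frS[OF fr0, of b g] by simp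

lemma fr_iso: "fr p N \<Longrightarrow> iso p q \<Longrightarrow> fr q N"
proof (induction arbitrary: q rule: fr.induct)
  case fr0 then show ?case using iso_0 fr.fr0 by blast
next
  case (frS p N b g)
  have gi: "idp g" "g * g = g" using iso_idp(2)[OF frS(2)] by (auto simp: idp_def)
  obtain g' where g': "idp g'" "q * g' = g'" "g' * q = g'" "iso g g'" "iso (p + g - g) (q - g')"
    by (rule iso_transport[OF frS(6) gi(1)]) (use frS gi in \<open>auto simp: algebra_simps\<close>)
  have "fr (q - g') N" using frS(5) g'(5) by simp
  from fr.frS[OF this, of b g'] show ?case
    using g' frS(2) iso_trans by (simp add: algebra_simps idp_def)
qed

lemma fr_add: "fr q M \<Longrightarrow> fr p N \<Longrightarrow> p * q = 0 \<Longrightarrow> q * p = 0 \<Longrightarrow> fr (p + q) (N + M)"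
proof (induction rule: fr.induct)
  case (frS q M b g)
  have gi: "g * g = g" "q * q = q" using iso_idp(2)[OF frS(2)] fr_idp[OF frS(1)] by (auto simp: idp_def)
  have "q = (q + g) * q" "q = q * (q + g)" "g = (q + g) * g" "g = g * (q + g)"
    using frS gi by (auto simp: algebra_simps)
  then have z: "p * q = 0" "q * p = 0" "p * g = 0" "g * p = 0"
    using frS(7,8) by (metis mult.assoc mult_zero_left mult_zero_right)+
  have "fr (p + q + g) (add_mset b (N + M))"
    by (rule fr.frS) (use frS z in \<open>auto simp: algebra_simps\<close>)
  then show ?case by (simp add: add.assoc)
qed simp

text \<open>Cancellation of one summand. The local \<open>g\<close> is exchanged either with the
  last summand of the given decomposition, which then must have the same label, or with a summand of
  the rest, where induction applies.\<close>

lemma fr_remove: "fr p M \<Longrightarrow> iso (G b) g \<Longrightarrow> p * g = g \<Longrightarrow> g * p = g \<Longrightarrow> b \<in># M \<and> fr (p - g) (M - {#b#})"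
proof (induction arbitrary: g rule: fr.induct)
  case fr0 then show ?case using iso_0(1) by fastforce
next
  case (frS p M c f)
  have gi: "idp g" and fi: "idp f" using iso_idp(2) frS by blast+
  have pi: "idp p" using frS fr_idp by blast
  have pfi: "idp (p + f)" using pi fi frS(3,4) by (rule idp_add)
  have gl: "loc g" using loc_iso[OF Gloc frS(6)] .
  have sums: "g * f * g + g * p * g = g"
  proof -
    have "g * f * g + g * p * g = g * (p + f) * g" by (simp add: algebra_simps)
    then show ?thesis using frS(8) gi by (simp add: idp_def)
  qed
  have hm: "g * f * g \<in> hm g g" "g * p * g \<in> hm g g"
    using gi fi pi by (auto simp: hm_def idp_def mult.assoc) (simp_all add: mult.assoc[symmetric])
  have e: "(p + f) * f = f" "f * (p + f) = f" "(p + f) * p = p" "p * (p + f) = p"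
    using frS(3,4) fi pi by (simp_all add: algebra_simps idp_def)
  consider w where "w \<in> hm g g" "w * (g * f * g) = g" "g * f * g * w = g"
    | w where "w \<in> hm g g" "w * (g * p * g) = g" "g * p * g * w = g"
    using gl hm sums unfolding loc_def by blast
  then show ?case
  proof cases
    case 1
    obtain f1 where f1: "idp f1" "f * f1 = f1" "f1 * f = f1" "iso g f1" "iso (p + f - g) (p + f - f1)"
      by (rule exchange[OF pfi gi fi frS(7,8) e(1,2) 1])
    \<comment> \<open>\<open>f1\<close> is a nonzero idempotent below the local idempotent
      \<open>f\<close>.\<close>
    have "f1 = f" using loc_idem[OF loc_iso[OF Gloc frS(2)] f1(1-3)] f1(4) iso_0(1)[of g] gl by (auto simp: loc_def)
    then have i: "iso (p + f - g) p" "iso g f" using f1 by simp_all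
    have "b = c" using G_iso iso_trans[OF frS(6) iso_trans[OF i(2) iso_sym[OF frS(2)]]] by blast
    then show ?thesis using fr_iso[OF frS(1) iso_sym[OF i(1)]] by simp
  next
    case 2
    obtain f1 where f1: "idp f1" "p * f1 = f1" "f1 * p = f1" "iso g f1" "iso (p + f - g) (p + f - f1)"
      by (rule exchange[OF pfi gi pi frS(7,8) e(3,4) 2])
    have IH: "b \<in># M \<and> fr (p - f1) (M - {#b#})"
      by (rule frS(5)) (use f1 frS(6) iso_trans in blast)+
    have "f1 * f = f1 * (p * f)" "f * f1 = f * p * f1" using f1 by (simp_all add: asr mult.assoc)
    then have "f1 * f = 0" "f * f1 = 0" using frS(3,4) by simp_all
    then have "fr (p - f1 + f) (add_mset c (M - {#b#}))"
      by (intro fr.frS) (use IH frS in \<open>auto simp: algebra_simps\<close>)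
    then have "fr (p + f - g) (add_mset c (M - {#b#}))"
      using fr_iso iso_sym[OF f1(5)] by (simp add: algebra_simps)
    then show ?thesis using IH by auto
  qed
qed

lemma fr_unique: "fr p N \<Longrightarrow> fr p M \<Longrightarrow> N = M"
proof (induction arbitrary: M rule: fr.induct)
  case fr0 then show ?case using fr_0 by simp
next
  case (frS p N b g)
  have gi: "g * g = g" using iso_idp(2)[OF frS(2)] by (auto simp: idp_def)
  have "b \<in># M \<and> fr (p + g - g) (M - {#b#})"
    by (rule fr_remove) (use frS gi in \<open>auto simp: algebra_simps\<close>)
  then show ?case using frS(5)[of "M - {#b#}"] by simp
qed

text \<open>Direct summands of free objects are free: one local summand of \<open>p\<close> can be
  exchanged into \<open>q\<close> or into \<open>p - q\<close>, and removing it there lowers the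
  size.\<close>

lemma fr_split: "fr p N \<Longrightarrow> idp q \<Longrightarrow> p * q = q \<Longrightarrow> q * p = q \<Longrightarrow>
  \<exists>M K. fr q M \<and> fr (p - q) K \<and> N = M + K"
proof (induction "size N" arbitrary: p N q)
  case 0 then have "p = 0" "N = {#}" using fr_empty by auto
  with 0 show ?case using fr0 by auto
next
  case (Suc n)
  obtain b where b: "b \<in># N" using Suc(2) by (cases N) auto
  from Suc(3) Suc(2) obtain p0 M0 c g where g: "p = p0 + g" "fr p0 M0" "iso (G c) g" "p0 * g = 0" "g * p0 = 0" "N = add_mset c M0"
    by (cases rule: fr.cases) auto
  have gi: "idp g" using iso_idp(2) g by blast
  have pi: "idp p" using Suc fr_idp by blast
  have gl: "loc g" using loc_iso[OF Gloc g(3)] .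
  have pg: "p * g = g" "g * p = g" using g gi by (simp_all add: algebra_simps idp_def)
  have qc: "idp (p - q)" "p * (p - q) = p - q" "(p - q) * p = p - q"
    using Suc(4-6) pi by (auto simp: algebra_simps idp_def)
  have sums: "g * q * g + g * (p - q) * g = g"
  proof -
    have "g * q * g + g * (p - q) * g = g * p * g" by (simp add: algebra_simps)
    then show ?thesis using pg gi by (simp add: idp_def)
  qed
  have hm: "g * x * g \<in> hm g g" if "x \<in> S" for x
    using gi that by (auto simp: hm_def idp_def mult.assoc) (simp_all add: mult.assoc[symmetric])
  consider w where "w \<in> hm g g" "w * (g * q * g) = g" "g * q * g * w = g"
    | w where "w \<in> hm g g" "w * (g * (p - q) * g) = g" "g * (p - q) * g * w = g"
    using gl hm[OF idpS[OF Suc(4)]] hm[OF idpS[OF qc(1)]] sums unfolding loc_def by blast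
  then show ?case
  proof cases
    case 1
    obtain f where f: "idp f" "q * f = f" "f * q = f" "iso g f"
      by (rule exchange[OF pi gi Suc(4) pg Suc(5,6) 1])
    have pf: "p * f = f" "f * p = f" using f Suc(5,6) by (metis mult.assoc)+
    have r: "c \<in># N \<and> fr (p - f) (N - {#c#})"
      by (rule fr_remove[OF Suc(3)]) (use f pf g(3) iso_trans in blast)+
    have "\<exists>M K. fr (q - f) M \<and> fr (p - f - (q - f)) K \<and> N - {#c#} = M + K"
      by (rule Suc(1)) (use r Suc f pf in \<open>auto simp: algebra_simps idp_def size_Diff_singleton\<close>)
    then obtain M K where MK: "fr (q - f) M" "fr (p - q) K" "N - {#c#} = M + K" by auto
    have "fr (q - f + f) (add_mset c M)"
      by (rule frS[OF MK(1)]) (use f g(3) iso_trans in \<open>auto simp: algebra_simps idp_def\<close>)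
    moreover have "N = add_mset c M + K" using MK(3) insert_DiffM[of c N] r by simp
    ultimately show ?thesis using MK(2) by auto
  next
    case 2
    obtain f where f: "idp f" "(p - q) * f = f" "f * (p - q) = f" "iso g f"
      by (rule exchange[OF pi gi qc(1) pg qc(2,3) 2])
    have pf: "p * f = f" "f * p = f" using f qc by (metis mult.assoc)+
    have qf: "q * f = 0" "f * q = 0" using f(2,3) pf by (simp_all add: algebra_simps)
    have r: "c \<in># N \<and> fr (p - f) (N - {#c#})"
      by (rule fr_remove[OF Suc(3)]) (use f pf g(3) iso_trans in blast)+
    have "\<exists>M K. fr q M \<and> fr (p - f - q) K \<and> N - {#c#} = M + K"
      by (rule Suc(1)) (use r Suc f pf qf in \<open>auto simp: algebra_simps idp_def size_Diff_singleton\<close>)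
    then obtain M K where MK: "fr q M" "fr (p - f - q) K" "N - {#c#} = M + K" by auto
    have "fr (p - f - q + f) (add_mset c K)"
      by (rule frS[OF MK(2)]) (use f g(3) pf qf iso_trans in \<open>auto simp: algebra_simps idp_def\<close>)
    moreover have "N = M + add_mset c K" using MK(3) insert_DiffM[of c N] r by simp
    ultimately show ?thesis using MK(1) by (auto simp: algebra_simps)
  qed
qed

lemma fr_iso_eq: "fr p N \<Longrightarrow> fr q N \<Longrightarrow> iso p q"
proof (induction arbitrary: q rule: fr.induct)
  case fr0 then show ?case using fr_empty iso_refl[OF idp_0] by blast
next
  case (frS p N b g)
  \<comment> \<open>A summand with the label of \<open>g\<close> is located inside \<open>q\<close>;
    cancelling it leaves equal multisets for the induction hypothesis.\<close>
  have "\<exists>g'. iso (G b) g' \<and> q * g' = g' \<and> g' * q = g'" if "fr q K" "b \<in># K" for q K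
    using that
  proof (induction rule: fr.induct)
    case (frS q K c g)
    have gi: "g * g = g" "q * q = q" using iso_idp(2)[OF frS(2)] fr_idp[OF frS(1)] by (auto simp: idp_def)
    show ?case
    proof (cases "c = b")
      case True then show ?thesis using frS gi by (intro exI[of _ g]) (auto simp: algebra_simps)
    next
      case False
      then obtain g' where g': "iso (G b) g'" "q * g' = g'" "g' * q = g'" using frS by auto
      have "g' * g = g' * q * g" "g * g' = g * (q * g')" using g' by simp_all
      then have "g' * g = 0" "g * g' = 0" using frS(3,4) by (simp_all add: mult.assoc asr)
      then show ?thesis using g' by (intro exI[of _ g']) (auto simp: algebra_simps)
    qed
  qed simp
  from this[OF frS(6)] obtain g' where g': "iso (G b) g'" "q * g' = g'" "g' * q = g'" by auto
  have "fr (q - g') N" using fr_remove[OF frS(6) g'] by simp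
  then have "iso p (q - g')" using frS(5) by blast
  moreover have "iso g g'" using iso_trans[OF iso_sym[OF frS(2)] g'(1)] .
  moreover have "g' * g' = g'" using iso_idp(2)[OF g'(1)] by (simp add: idp_def)
  ultimately have "iso (p + g) (q - g' + g')"
    by (intro iso_oplus) (use frS(3,4) g' in \<open>auto simp: algebra_simps\<close>)
  then show ?case by simp
qed

lemma fr_has_G: assumes "fr p N" "b \<in># N"
  obtains x y where "x \<in> hm (G b) p" "y \<in> hm p (G b)" "y * x = G b"
proof -
  obtain M where "N = add_mset b M" using assms(2) by (metis mset_add)
  moreover have "\<exists>x\<in>hm (G b) p. \<exists>y\<in>hm p (G b). y * x = G b" if "fr p N" "b \<in># N" for N
    using that
  proof (induction rule: fr.induct)
    case (frS q K c g)
    show ?case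
    proof (cases "c = b")
      case True
      then obtain x y where x: "x \<in> hm (G b) g" "y \<in> hm g (G b)" "y * x = G b" using frS(2) by (auto elim: isoE)
      have "q * x = q * g * x" "y * q = y * (g * q)" using x by (simp_all add: mult.assoc hmL hmR asr hmE)
      then have "x \<in> hm (G b) (q + g)" "y \<in> hm (q + g) (G b)"
        using x frS(3,4) by (auto simp: hm_def algebra_simps)
      then show ?thesis using x by blast
    next
      case False
      then obtain x y where x: "x \<in> hm (G b) q" "y \<in> hm q (G b)" "y * x = G b" using frS by auto
      have "g * x = g * q * x" "y * g = y * (q * g)" using x by (simp_all add: mult.assoc hmL hmR asr hmE)
      then have "x \<in> hm (G b) (q + g)" "y \<in> hm (q + g) (G b)"
        using x frS(3,4) by (auto simp: hm_def algebra_simps)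
      then show ?thesis using x by blast
    qed
  qed simp
  ultimately show ?thesis using assms that by blast
qed

text \<open>If \<open>w * x * w = w\<close> then \<open>w * x\<close> and \<open>x * w\<close> are
  isomorphic idempotents, so membership says that \<open>x\<close> restricts to no isomorphism
  between nonzero summands. This is the categorical radical; closure under addition is needed, and
  proved, only for local corners (\<open>rad_add\<close>).\<close>

definition rad :: "'m \<Rightarrow> 'm \<Rightarrow> 'm set" where
  "rad p q = {x \<in> hm p q. \<forall>w\<in>hm q p. w * x * w = w \<longrightarrow> w = 0}"

lemma radD: "x \<in> rad p q \<Longrightarrow> w \<in> hm q p \<Longrightarrow> w * x * w = w \<Longrightarrow> w = 0"
  by (auto simp: rad_def)

lemma rad_hm: "x \<in> rad p q \<Longrightarrow> x \<in> hm p q"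
  by (auto simp: rad_def)

lemma rad_0 [simp]: "0 \<in> rad p q" by (simp add: rad_def)

lemma rad_mult: assumes x: "x \<in> rad p q" and a: "a \<in> hm q q'" and b: "b \<in> hm p' p"
  shows "a * x * b \<in> rad p' q'"
proof -
  have "w = 0" if w: "w \<in> hm q' p'" "w * (a * x * b) * w = w" for w
  proof -
    have w2: "w * (a * (x * (b * w))) = w" using w(2) by (simp add: mult.assoc)
    \<comment> \<open>A witness \<open>w\<close> for the composite yields the witness
      \<open>b * w * a\<close> for \<open>x\<close>; substituting \<open>w\<close> into itself once
      then exposes this factor.\<close>
    have "b * w * a = 0"
      by (rule radD[OF x]) (use w a b in \<open>auto simp: mult.assoc w2 asr[OF w2, unfolded mult.assoc]\<close>)
    then have "w * (a * (x * (b * (w * (a * (x * (b * w))))))) = 0" by (simp add: mult.assoc[symmetric])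
    then show "w = 0" by (simp add: w2)
  qed
  then show ?thesis using assms rad_hm[OF x] by (auto simp: rad_def)
qed

lemma rad_multL: assumes x: "x \<in> rad p q" and a: "a \<in> hm q q'" and "idp p" shows "a * x \<in> rad p q'"
  using rad_mult[OF x a, of p p] assms rad_hm[OF x] by (auto simp: mult.assoc hmR idp_hm)

text \<open>The size of \<open>w * Y\<close> is bounded by that of \<open>p\<close>, so a largest
  split part exists. A nonzero obstruction \<open>v\<close> to the remainder being radical would
  allow \<open>w\<close> to be enlarged.\<close>

lemma split_rad: assumes "fr p N" "idp q" and Y: "Y \<in> hm p q"
  obtains w where "w \<in> hm q p" "w * Y * w = w" "Y - Y * w * Y \<in> rad p q"
proof -
  let ?P = "\<lambda>k. \<exists>w M. w \<in> hm q p \<and> w * Y * w = w \<and> fr (w * Y) M \<and> size M = k"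
  have pi: "idp p" using assms fr_idp by blast
  have fr: "\<exists>M K. fr (w * Y) M \<and> fr (p - w * Y) K \<and> N = M + K" if "w \<in> hm q p" "w * Y * w = w" for w
    by (rule fr_split[OF assms(1)])
      (use that Y in \<open>auto simp: idp_def mult.assoc[symmetric] dest: hmS hmL hmR\<close>, simp add: mult.assoc hmR[OF Y])
  have "?P 0" using fr0 by (intro exI[of _ 0] exI[of _ "{#}"]) auto
  moreover have "k \<le> size N" if "?P k" for k
  proof -
    from that obtain w M where w: "w \<in> hm q p" "w * Y * w = w" "fr (w * Y) M" "size M = k" by blast
    from fr[OF w(1,2)] obtain M' K where "fr (w * Y) M'" "N = M' + K" by blast
    then show ?thesis using fr_unique[OF w(3)] w(4) by auto
  qed
  ultimately obtain k where k: "?P k" "\<And>j. ?P j \<Longrightarrow> j \<le> k"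
    using Nat.ex_has_greatest_nat[of ?P 0 "size N"] by blast
  then obtain w M where w: "w \<in> hm q p" "w * Y * w = w" "fr (w * Y) M" "size M = k" by blast
  have w2: "w * (Y * w) = w" using w by (simp add: mult.assoc)
  note s = w2 asr[OF w2, unfolded mult.assoc] hmE[OF Y] hmE[OF w(1)]
  show ?thesis
  proof (rule that[OF w(1,2)])
    have "v = 0" if v: "v \<in> hm q p" "v * (Y - Y * w * Y) * v = v" for v
    proof -
      \<comment> \<open>\<open>v\<close> compressed to the complements of the summands already split
        off: this makes \<open>u\<close> orthogonal to \<open>w\<close>, so that
        \<open>w + u\<close> splits again.\<close>
      define u where "u = (p - w * Y) * v * (q - Y * w)"
      have uh: "u \<in> hm q p" unfolding u_def using pi assms(2) Y w v by (auto intro!: hm_mult)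
      have a: "(q - Y * w) * Y = Y - Y * w * Y" "Y * (p - w * Y) = Y - Y * w * Y"
        by (simp_all add: algebra_simps s)
      have a2: "(q - Y * w) * (Y * (p - w * Y)) = Y - Y * w * Y"
        unfolding a(2) using a(1) by (simp add: algebra_simps s)
      have "u * Y * u = (p - w * Y) * v * ((q - Y * w) * (Y * (p - w * Y))) * v * (q - Y * w)"
        by (simp add: u_def mult.assoc)
      also have "\<dots> = (p - w * Y) * (v * (Y - Y * w * Y) * v) * (q - Y * w)"
        unfolding a2 by (simp add: mult.assoc)
      finally have uYu: "u * Y * u = u" unfolding v(2) by (simp add: u_def)
      have orth: "u * (Y * w) = 0" "w * (Y * u) = 0"
        by (simp_all add: u_def mult.assoc algebra_simps s idpM[OF pi] idpM[OF assms(2)])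
      have wu: "w + u \<in> hm q p" "(w + u) * Y * (w + u) = w + u"
        using w uh uYu orth by (auto simp: algebra_simps)
      obtain M' where M': "fr (u * Y) M'" using fr[OF uh uYu] by blast
      have "fr (w * Y + u * Y) (M + M')"
        by (rule fr_add[OF M' w(3)]) (use orth in \<open>simp_all add: mult.assoc asr[OF orth(1), unfolded mult.assoc] asr[OF orth(2), unfolded mult.assoc]\<close>)
      then have "?P (size (M + M'))"
        using wu by (intro exI[of _ "w + u"] exI[of _ "M + M'"]) (simp add: distrib_right)
      then have "size (M + M') \<le> k" by (rule k(2))
      then have "M' = {#}" using w(4) by simp
      then have "u * Y = 0" using M' fr_empty by blast
      then have u0: "u = 0" using uYu by simp
      \<comment> \<open>\<open>v\<close> is recovered from \<open>u\<close>: inserting the relation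
        for \<open>v\<close> into itself produces \<open>u\<close> as a factor.\<close>
      have "v = v * ((q - Y * w) * (Y * (p - w * Y))) * v" unfolding a2 using v(2) by simp
      also have "\<dots> = v * ((q - Y * w) * (Y * (p - w * Y))) * (v * ((q - Y * w) * (Y * (p - w * Y))) * v)"
        using calculation by simp
      also have "\<dots> = v * ((q - Y * w) * (Y * (u * (Y * ((p - w * Y) * v)))))"
        by (simp add: u_def mult.assoc)
      finally show "v = 0" using u0 by simp
    qed
    then show "Y - Y * w * Y \<in> rad p q" using Y w by (auto simp: rad_def)
  qed
qed

lemma loc_sum: assumes "loc g" "x \<in> hm g g" "y \<in> hm g g" "x + y = g"
  obtains w where "w \<in> hm g g" "w * x = g" "x * w = g" | w where "w \<in> hm g g" "w * y = g" "y * w = g"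
  using assms unfolding loc_def by blast

lemma rad_sum2: assumes "loc g" "x \<in> rad g g" "y \<in> rad g g" shows "x + y \<noteq> g"
proof
  assume e: "x + y = g"
  have gi: "g \<noteq> 0" using assms by (simp add: loc_def)
  have F: False if "z \<in> rad g g" "w \<in> hm g g" "w * z = g" for z w
    using radD[OF that(1,2)] that gi by (simp add: hmL)
  show False using loc_sum[OF assms(1) rad_hm[OF assms(2)] rad_hm[OF assms(3)] e]
    F[OF assms(2)] F[OF assms(3)] by blast
qed

text \<open>A witness \<open>w\<close> against the sum makes \<open>w * (x + y)\<close> a nonzero
  idempotent below the local \<open>g\<close>, hence \<open>g\<close> itself, and then one radical
  summand would be invertible.\<close>

lemma rad_add: assumes g: "loc g" "x \<in> rad g g" "y \<in> rad g g" shows "x + y \<in> rad g g"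
proof -
  have gi: "idp g" using g by (simp add: loc_def)
  have "w = 0" if w: "w \<in> hm g g" "w * (x + y) * w = w" for w
  proof (rule ccontr)
    assume nz: "w \<noteq> 0"
    have "idp (w * (x + y))" "g * (w * (x + y)) = w * (x + y)" "w * (x + y) * g = w * (x + y)"
      using w g rad_hm[OF g(2)] rad_hm[OF g(3)]
      by (auto simp: idp_def mult.assoc[symmetric] hmL dest: hmS) (auto simp: mult.assoc algebra_simps hmR)
    from loc_idem[OF g(1) this] have "w * (x + y) = 0 \<or> w * (x + y) = g" .
    then have "w * x + w * y = g" using w nz by (auto simp: distrib_left)
    then show False using rad_sum2[OF g(1) rad_multL[OF g(2) w(1) gi] rad_multL[OF g(3) w(1) gi]] by blast
  qed
  moreover have "x + y \<in> hm g g" using rad_hm[OF g(2)] rad_hm[OF g(3)] by (rule hm_add)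
  ultimately show ?thesis unfolding rad_def by blast
qed

end

section \<open>Two-term complexes\<close>

context tri begin

text \<open>A complex is a triple \<open>(p, q, d)\<close> with \<open>p\<close> in degree \<open>-1\<close>; \<open>hom1 X Y\<close> says
  \<open>Hom(X, Y[1]) = 0\<close>, and \<open>hr X Y\<close> that \<open>Y\<close> is a retract of \<open>X\<close> up to homotopy.\<close>

definition pure :: "bool \<Rightarrow> 'm \<Rightarrow> bool" where
  "pure b p \<longleftrightarrow> (\<exists>n. fr p (replicate_mset n b))"

definition cx :: "'m \<times> 'm \<times> 'm \<Rightarrow> bool" where
  "cx = (\<lambda>(p, q, d). (\<exists>N. fr p N) \<and> (\<exists>N. fr q N) \<and> d \<in> hm p q)"

definition hom1 :: "'m \<times> 'm \<times> 'm \<Rightarrow> 'm \<times> 'm \<times> 'm \<Rightarrow> bool" where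
  "hom1 = (\<lambda>(p, q, d) (p', q', d'). \<forall>f\<in>hm p q'. \<exists>h\<in>hm q q'. \<exists>h'\<in>hm p p'. f = h * d + d' * h')"

definition hr :: "'m \<times> 'm \<times> 'm \<Rightarrow> 'm \<times> 'm \<times> 'm \<Rightarrow> bool" where
  "hr = (\<lambda>(p, q, d) (p', q', d'). \<exists>i1\<in>hm p' p. \<exists>i0\<in>hm q' q. \<exists>r1\<in>hm p p'. \<exists>r0\<in>hm q q'. \<exists>s\<in>hm q' p'.
     i0 * d' = d * i1 \<and> r0 * d = d' * r1 \<and> p' = r1 * i1 + s * d' \<and> q' = r0 * i0 + d' * s)"

definition kiso :: "'m \<times> 'm \<times> 'm \<Rightarrow> 'm \<times> 'm \<times> 'm \<Rightarrow> bool" where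
  "kiso = (\<lambda>(p, q, d) (p', q', d'). \<exists>i1\<in>hm p' p. \<exists>i0\<in>hm q' q. \<exists>r1\<in>hm p p'. \<exists>r0\<in>hm q q'. \<exists>s\<in>hm q' p'. \<exists>t\<in>hm q p.
     i0 * d' = d * i1 \<and> r0 * d = d' * r1 \<and> p' = r1 * i1 + s * d' \<and> q' = r0 * i0 + d' * s \<and>
     p = i1 * r1 + t * d \<and> q = i0 * r0 + d * t)"

definition siso :: "'m \<times> 'm \<times> 'm \<Rightarrow> 'm \<times> 'm \<times> 'm \<Rightarrow> bool" where
  "siso = (\<lambda>(p, q, d) (p', q', d'). \<exists>i1\<in>hm p' p. \<exists>i0\<in>hm q' q. \<exists>r1\<in>hm p p'. \<exists>r0\<in>hm q q'.
     i0 * d' = d * i1 \<and> r0 * d = d' * r1 \<and> p' = r1 * i1 \<and> q' = r0 * i0 \<and> p = i1 * r1 \<and> q = i0 * r0)"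

definition zk :: "'m \<times> 'm \<times> 'm \<Rightarrow> bool" where
  "zk = (\<lambda>(p, q, d). \<exists>s\<in>hm q p. p = s * d \<and> q = d * s)"

text \<open>The shapes that indecomposable minimal presilting complexes take
  (\<open>gd_of_lc\<close>). In each of them Hom(q, p) = 0, so homotopies vanish and homotopy
  equivalences are isomorphisms of complexes.\<close>

definition gd :: "'m \<times> 'm \<times> 'm \<Rightarrow> bool" where
  "gd = (\<lambda>(p, q, d). p = 0 \<or> q = 0 \<or> (pure True p \<and> pure False q))"

text \<open>Complexes P_2^k -> P_1^j; these are the ones with g-vector in the quadrant (+,
  -).\<close>

definition pm :: "'m \<times> 'm \<times> 'm \<Rightarrow> bool" where
  "pm = (\<lambda>(p, q, d). pure True p \<and> pure False q \<and> d \<in> hm p q)"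

text \<open>Indecomposability in the category of complexes, before passing to homotopy: the only
  idempotent chain endomorphisms are 0 and the identity.\<close>

definition lc :: "'m \<times> 'm \<times> 'm \<Rightarrow> bool" where
  "lc = (\<lambda>(p, q, d). (p \<noteq> 0 \<or> q \<noteq> 0) \<and> (\<forall>e\<in>hm p p. \<forall>f\<in>hm q q. e * e = e \<longrightarrow> f * f = f \<longrightarrow> f * d = d * e \<longrightarrow>
     (e = 0 \<and> f = 0) \<or> (e = p \<and> f = q)))"

definition nm :: "'m \<Rightarrow> bool multiset" where "nm p = (THE N. fr p N)"

definition gv :: "'m \<times> 'm \<times> 'm \<Rightarrow> real \<times> real" where
  "gv = (\<lambda>(p, q, d). (real (count (nm q) False) - real (count (nm p) False),
     real (count (nm q) True) - real (count (nm p) True)))"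

lemma hrI: "i1 \<in> hm p' p \<Longrightarrow> i0 \<in> hm q' q \<Longrightarrow> r1 \<in> hm p p' \<Longrightarrow> r0 \<in> hm q q' \<Longrightarrow> s \<in> hm q' p' \<Longrightarrow>
    i0 * d' = d * i1 \<Longrightarrow> r0 * d = d' * r1 \<Longrightarrow> p' = r1 * i1 + s * d' \<Longrightarrow> q' = r0 * i0 + d' * s \<Longrightarrow>
    hr (p, q, d) (p', q', d')"
  unfolding hr_def by blast

lemma kisoI: "i1 \<in> hm p' p \<Longrightarrow> i0 \<in> hm q' q \<Longrightarrow> r1 \<in> hm p p' \<Longrightarrow> r0 \<in> hm q q' \<Longrightarrow> s \<in> hm q' p' \<Longrightarrow> t \<in> hm q p \<Longrightarrow>
    i0 * d' = d * i1 \<Longrightarrow> r0 * d = d' * r1 \<Longrightarrow> p' = r1 * i1 + s * d' \<Longrightarrow> q' = r0 * i0 + d' * s \<Longrightarrow>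
    p = i1 * r1 + t * d \<Longrightarrow> q = i0 * r0 + d * t \<Longrightarrow> kiso (p, q, d) (p', q', d')"
  unfolding kiso_def by blast

lemma sisoI: "i1 \<in> hm p' p \<Longrightarrow> i0 \<in> hm q' q \<Longrightarrow> r1 \<in> hm p p' \<Longrightarrow> r0 \<in> hm q q' \<Longrightarrow>
    i0 * d' = d * i1 \<Longrightarrow> r0 * d = d' * r1 \<Longrightarrow> p' = r1 * i1 \<Longrightarrow> q' = r0 * i0 \<Longrightarrow>
    p = i1 * r1 \<Longrightarrow> q = i0 * r0 \<Longrightarrow> siso (p, q, d) (p', q', d')"
  unfolding siso_def by blast

lemma nm_eq: "fr p N \<Longrightarrow> nm p = N"
  unfolding nm_def using fr_unique by blast

lemma cx_idp: "cx (p, q, d) \<Longrightarrow> idp p" "cx (p, q, d) \<Longrightarrow> idp q" "cx (p, q, d) \<Longrightarrow> d \<in> hm p q"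
  by (auto simp: cx_def dest: fr_idp)

lemma pm_cx: "pm X \<Longrightarrow> cx X" and pm_gd: "pm X \<Longrightarrow> gd X"
  by (auto simp: pm_def cx_def gd_def pure_def)

lemma kiso_hr: "kiso X Y \<Longrightarrow> hr X Y \<and> hr Y X"
  unfolding kiso_def hr_def by (cases X; cases Y) (clarsimp, safe, blast+)

lemma kiso_sym: "kiso X Y \<Longrightarrow> kiso Y X"
  unfolding kiso_def by (cases X; cases Y) (clarsimp, blast)

lemma siso_kiso: "siso X Y \<Longrightarrow> kiso X Y"
  unfolding kiso_def siso_def
  by (cases X; cases Y) (clarsimp, metis add.right_neutral hm_0 mult_zero_left mult_zero_right)

lemma siso_iso: "siso (p, q, d) (p', q', d') \<Longrightarrow> iso p p' \<and> iso q q'"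
  unfolding siso_def iso_def by (auto 0 4)

lemma siso_gv: assumes "siso X Y" "cx X" shows "gv Y = gv X" "cx Y \<or> snd (snd Y) \<notin> hm (fst Y) (fst (snd Y))"
proof -
  obtain p q d p' q' d' where [simp]: "X = (p, q, d)" "Y = (p', q', d')" by (cases X; cases Y)
  obtain N M where "fr p N" "fr q M" using assms(2) by (auto simp: cx_def)
  moreover have "iso p p'" "iso q q'" using siso_iso assms(1) by auto
  ultimately have *: "fr p N" "fr q M" "fr p' N" "fr q' M" using fr_iso by auto
  then have "nm p' = nm p" "nm q' = nm q" using nm_eq by auto
  then show "gv Y = gv X" by (simp add: gv_def)
  show "cx Y \<or> snd (snd Y) \<notin> hm (fst Y) (fst (snd Y))" using * by (auto simp: cx_def)
qed

lemma siso_mk: assumes "cx (p, q, d)" "iso p p'" "iso q q'"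
  obtains d' where "cx (p', q', d')" "siso (p, q, d) (p', q', d')"
proof -
  obtain x y where 1: "x \<in> hm p p'" "y \<in> hm p' p" "y * x = p" "x * y = p'" using assms(2) by (rule isoE)
  obtain u v where 2: "u \<in> hm q q'" "v \<in> hm q' q" "v * u = q" "u * v = q'" using assms(3) by (rule isoE)
  obtain N M where N: "fr p N" "fr q M" "d \<in> hm p q" using assms(1) by (auto simp: cx_def)
  have "fr p' N" "fr q' M" using N assms fr_iso by auto
  moreover have d: "u * d * y \<in> hm p' q'" using 1 2 N by auto
  moreover have "v * (u * d * y) = d * y" "u * d = u * d * y * x"
    using 1 2 N(3) by (simp_all add: mult.assoc[symmetric] hmL) (simp add: mult.assoc hmR)
  ultimately show ?thesis
    using 1 2 by (intro that[of "u * d * y"] sisoI[of y _ _ v _ _ x u]) (auto simp: cx_def)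
qed

lemma siso_lc: assumes "siso X Y" "lc X" shows "lc Y"
proof -
  obtain p q d p' q' d' where XY [simp]: "X = (p, q, d)" "Y = (p', q', d')" by (cases X; cases Y)
  obtain i1 i0 r1 r0 where h: "i1 \<in> hm p' p" "i0 \<in> hm q' q" "r1 \<in> hm p p'" "r0 \<in> hm q q'"
    and e: "i0 * d' = d * i1" "r0 * d = d' * r1" "r1 * i1 = p'" "r0 * i0 = q'" "i1 * r1 = p" "i0 * r0 = q"
    using assms(1) unfolding siso_def by auto
  have nz: "p' \<noteq> 0 \<or> q' \<noteq> 0"
    using assms(2) siso_iso[of p q d p' q' d'] assms(1) iso_0(1)[of p] iso_0(1)[of q] by (auto simp: lc_def)
  have "(a = 0 \<and> b = 0) \<or> (a = p' \<and> b = q')"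
    if ab: "a \<in> hm p' p'" "b \<in> hm q' q'" "a * a = a" "b * b = b" "b * d' = d' * a" for a b
  proof -
    have 1: "i1 * a * r1 * (i1 * a * r1) = i1 * a * r1" "i0 * b * r0 * (i0 * b * r0) = i0 * b * r0"
      using e(3,4) ab hmR[OF ab(1)] hmR[OF ab(2)] by (simp_all add: mult.assoc asr[OF e(3)] asr[OF e(4)] hmE asr[OF ab(3)] asr[OF ab(4)])
    have "i0 * b * r0 * d = i0 * (b * d') * r1" by (simp add: mult.assoc e)
    also have "\<dots> = d * i1 * a * r1" by (simp add: ab(5) e(1)[symmetric] mult.assoc)
    finally have 2: "i0 * b * r0 * d = d * (i1 * a * r1)" by (simp add: mult.assoc)
    have 3: "i1 * a * r1 \<in> hm p p" "i0 * b * r0 \<in> hm q q" using h ab by auto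
    have A: "a = r1 * (i1 * a * r1) * i1" "b = r0 * (i0 * b * r0) * i0"
      using e ab by (simp_all add: mult.assoc asr[OF e(3)] asr[OF e(4)] hmL hmR)
    have "(i1 * a * r1 = 0 \<and> i0 * b * r0 = 0) \<or> (i1 * a * r1 = p \<and> i0 * b * r0 = q)"
      using assms(2) 1 2 3 by (auto simp: lc_def)
    then show ?thesis
    proof
      assume "i1 * a * r1 = 0 \<and> i0 * b * r0 = 0" then show ?thesis using A by simp
    next
      assume "i1 * a * r1 = p \<and> i0 * b * r0 = q"
      then have "a = r1 * p * i1" "b = r0 * q * i0" using A by simp_all
      then show ?thesis using h e by (simp add: hmR)
    qed
  qed
  then show ?thesis using nz by (auto simp: lc_def)
qed

text \<open>The identity of p' is \<open>r1 * i1 + s * d'\<close>. The first term routes a map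
  through X, where it is null-homotopic by assumption; the second is null-homotopic as it
  stands.\<close>

lemma hom1_hrL: assumes "hr X X'" "hom1 X Y" "cx X'" "cx Y" shows "hom1 X' Y"
proof -
  obtain p q d p' q' d' a b c where [simp]: "X = (p, q, d)" "X' = (p', q', d')" "Y = (a, b, c)"
    by (cases X; cases X'; cases Y)
  obtain i1 i0 r1 r0 s where h: "i1 \<in> hm p' p" "i0 \<in> hm q' q" "r1 \<in> hm p p'" "r0 \<in> hm q q'" "s \<in> hm q' p'"
    and e: "i0 * d' = d * i1" "r0 * d = d' * r1" "p' = r1 * i1 + s * d'" "q' = r0 * i0 + d' * s"
    using assms(1) unfolding hr_def by auto
  have "\<exists>u\<in>hm q' b. \<exists>u'\<in>hm p' a. f = u * d' + c * u'" if f: "f \<in> hm p' b" for f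
  proof -
    have "f * r1 \<in> hm p b" using f h by auto
    then obtain u u' where u: "u \<in> hm q b" "u' \<in> hm p a" "f * r1 = u * d + c * u'"
      using assms(2) by (auto simp: hom1_def)
    have "f = f * (r1 * i1 + s * d')" unfolding e(3)[symmetric] using f by (simp add: hmR)
    also have "\<dots> = (f * r1) * i1 + f * s * d'" by (simp add: distrib_left mult.assoc)
    also have "\<dots> = (u * i0 + f * s) * d' + c * (u' * i1)" unfolding u(3) by (simp add: algebra_simps e(1))
    finally show ?thesis using u h f by (intro bexI[of _ "u * i0 + f * s"] bexI[of _ "u' * i1"]) auto
  qed
  then show ?thesis by (auto simp: hom1_def)
qed

lemma hom1_hrR: assumes "hr X X'" "hom1 Y X" "cx X'" "cx Y" shows "hom1 Y X'"
proof -
  obtain p q d p' q' d' a b c where [simp]: "X = (p, q, d)" "X' = (p', q', d')" "Y = (a, b, c)"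
    by (cases X; cases X'; cases Y)
  obtain i1 i0 r1 r0 s where h: "i1 \<in> hm p' p" "i0 \<in> hm q' q" "r1 \<in> hm p p'" "r0 \<in> hm q q'" "s \<in> hm q' p'"
    and e: "i0 * d' = d * i1" "r0 * d = d' * r1" "p' = r1 * i1 + s * d'" "q' = r0 * i0 + d' * s"
    using assms(1) unfolding hr_def by auto
  have "\<exists>u\<in>hm b q'. \<exists>u'\<in>hm a p'. f = u * c + d' * u'" if f: "f \<in> hm a q'" for f
  proof -
    have "i0 * f \<in> hm a q" using f h by auto
    then obtain u u' where u: "u \<in> hm b q" "u' \<in> hm a p" "i0 * f = u * c + d * u'"
      using assms(2) by (auto simp: hom1_def)
    have "f = (r0 * i0 + d' * s) * f" unfolding e(4)[symmetric] using f by (simp add: hmL)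
    also have "\<dots> = r0 * (i0 * f) + d' * (s * f)" by (simp add: distrib_right mult.assoc)
    also have "\<dots> = (r0 * u) * c + d' * (r1 * u' + s * f)" unfolding u(3) by (simp add: algebra_simps asr[OF e(2)])
    finally show ?thesis using u h f by (intro bexI[of _ "r0 * u"] bexI[of _ "r1 * u' + s * f"]) auto
  qed
  then show ?thesis by (auto simp: hom1_def)
qed

lemma hom1_siso: assumes "siso X X'" "siso Y Y'" "cx X'" "cx Y'" "cx Y" "hom1 X Y" shows "hom1 X' Y'"
  using assms hom1_hrL hom1_hrR kiso_hr siso_kiso by meson

lemma zk_hr: assumes "hr X X'" "zk X" shows "zk X'"
proof -
  obtain p q d p' q' d' where [simp]: "X = (p, q, d)" "X' = (p', q', d')" by (cases X; cases X')
  obtain i1 i0 r1 r0 s where h: "i1 \<in> hm p' p" "i0 \<in> hm q' q" "r1 \<in> hm p p'" "r0 \<in> hm q q'" "s \<in> hm q' p'"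
    and e: "i0 * d' = d * i1" "r0 * d = d' * r1" "p' = r1 * i1 + s * d'" "q' = r0 * i0 + d' * s"
    using assms(1) unfolding hr_def by auto
  obtain t where t: "t \<in> hm q p" "p = t * d" "q = d * t" using assms(2) by (auto simp: zk_def)
  have "r1 * i1 = r1 * (t * d) * i1" unfolding t(2)[symmetric] using h by (simp add: hmR)
  then have "r1 * i1 = r1 * t * i0 * d'" by (simp add: mult.assoc e(1))
  moreover have "r0 * i0 = r0 * (d * t) * i0" unfolding t(3)[symmetric] using h by (simp add: hmR)
  then have "r0 * i0 = d' * (r1 * t * i0)" by (simp add: mult.assoc asr[OF e(2)])
  ultimately have "p' = (r1 * t * i0 + s) * d'" "q' = d' * (r1 * t * i0 + s)"
    using e(3,4) by (simp_all add: algebra_simps)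
  then show ?thesis using h t by (auto simp: zk_def intro!: bexI[of _ "r1 * t * i0 + s"])
qed

text \<open>\<open>split_rad\<close> applied to the differential isolates a contractible summand
  from \<open>w * d\<close> to \<open>d * w\<close>. These two idempotents are isomorphic, so the
  g-vector does not change when they are cut off.\<close>

lemma minimal_model: assumes "cx X"
  obtains p q d where "cx (p, q, d)" "kiso X (p, q, d)" "d \<in> rad p q" "gv (p, q, d) = gv X"
proof -
  obtain p q d where X [simp]: "X = (p, q, d)" by (cases X)
  obtain N M where fr: "fr p N" "fr q M" and d: "d \<in> hm p q" using assms by (auto simp: cx_def)
  have i: "idp p" "idp q" using fr fr_idp by auto
  obtain w where w: "w \<in> hm q p" "w * d * w = w" "d - d * w * d \<in> rad p q" using split_rad[OF fr(1) i(2) d] .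
  have w2: "w * (d * w) = w" using w by (simp add: mult.assoc)
  note s = w2 asr[OF w2, unfolded mult.assoc] hmE[OF d] hmE[OF w(1)] idpM[OF i(1)] idpM[OF i(2)]
  have S: "w \<in> S" "d \<in> S" "p \<in> S" "q \<in> S" using w d i by (auto dest: hmS idpS)
  obtain M1 K1 where 1: "fr (w * d) M1" "fr (p - w * d) K1" "N = M1 + K1"
    using fr_split[OF fr(1), of "w * d"] S by (auto simp: idp_def mult.assoc s)
  obtain M2 K2 where 2: "fr (d * w) M2" "fr (q - d * w) K2" "M = M2 + K2"
    using fr_split[OF fr(2), of "d * w"] S by (auto simp: idp_def mult.assoc s)
  have "iso (w * d) (d * w)"
    by (rule isoI[of "d * w * d" _ _ "w"]) (use S in \<open>auto simp: hm_def mult.assoc s\<close>)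
  then have 3: "M1 = M2" using fr_iso[OF 1(1)] fr_unique 2(1) by blast
  define p' q' d' where "p' = p - w * d" and "q' = q - d * w" and "d' = d - d * w * d"
  have h: "p' \<in> hm p' p" "p' \<in> hm p p'" "q' \<in> hm q' q" "q' \<in> hm q q'" "d' \<in> hm p' q'"
    "p' * p' = p'" "q' * q' = q'" "q' * d = d'" "d * p' = d'" "q' * d' = d'" "d' * p' = d'"
    using S by (auto simp: hm_def p'_def q'_def d'_def algebra_simps s)
  show ?thesis
  proof (rule that)
    show "cx (p', q', d')" using 1 2 h by (auto simp: cx_def p'_def q'_def)
    show "gv (p', q', d') = gv X"
      using nm_eq[OF fr(1)] nm_eq[OF fr(2)] nm_eq[OF 1(2)] nm_eq[OF 2(2)] 1(3) 2(3) 3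
      by (simp add: gv_def p'_def q'_def)
    show "kiso X (p', q', d')" unfolding X
      by (rule kisoI[of p' _ _ q' _ _ p' q' 0 w]) (use h w(1) in \<open>auto simp: p'_def q'_def\<close>)
    have "\<And>v. v \<in> hm q' p' \<Longrightarrow> v \<in> hm q p"
      using h hm_mult[OF h(1)] by (metis hmL hmR hm_mult)
    then show "d' \<in> rad p' q'" using w(3) h(5) unfolding rad_def d'_def by auto
  qed
qed

text \<open>For a common summand G b, the map p -> G b -> q would be null-homotopic; restricted to G
  b this expresses the identity as a sum of two maps through the radical differential.\<close>

lemma rigid_disjoint: assumes "fr p N" "fr q M" "hom1 (p, q, d) (p, q, d)" "d \<in> rad p q" "b \<in># N" "b \<in># M" shows False
proof -
  obtain x y where x: "x \<in> hm (G b) p" "y \<in> hm p (G b)" "y * x = G b" using fr_has_G assms by blast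
  obtain u v where u: "u \<in> hm (G b) q" "v \<in> hm q (G b)" "v * u = G b" using fr_has_G assms by blast
  have "u * y \<in> hm p q" using x u by auto
  then obtain h h' where h: "h \<in> hm q q" "h' \<in> hm p p" "u * y = h * d + d * h'"
    using assms(3) by (auto simp: hom1_def)
  have "v * h * d * x + v * d * (h' * x) = v * (u * y) * x" unfolding h(3) by (simp add: algebra_simps)
  also have "\<dots> = (v * u) * (y * x)" by (simp add: mult.assoc)
  also have "\<dots> = G b" using x u idpM[OF Gidp] by simp
  finally have "v * h * d * x + v * d * (h' * x) = G b" .
  moreover have "v * h * d * x \<in> rad (G b) (G b)" "v * d * (h' * x) \<in> rad (G b) (G b)"
    using x u h by (auto intro!: rad_mult[OF assms(4)])
  ultimately show False using rad_sum2[OF Gloc] by blast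
qed

lemma hm_nz: "fr p N \<Longrightarrow> b \<in># N \<Longrightarrow> hm p (G b) \<noteq> {0} \<and> hm (G b) p \<noteq> {0}"
proof -
  assume "fr p N" "b \<in># N"
  then obtain x y where "x \<in> hm (G b) p" "y \<in> hm p (G b)" "y * x = G b" by (rule fr_has_G)
  then show ?thesis by (metis Gnz mult_zero_left mult_zero_right singletonD)
qed

lemma pure_G [simp]: "pure b (G b)" using fr_G[of b] by (auto simp: pure_def intro: exI[of _ 1])
lemma pure_0 [simp]: "pure b 0" using fr0 by (auto simp: pure_def intro: exI[of _ 0])
lemma pure_idp: "pure b p \<Longrightarrow> idp p" by (auto simp: pure_def dest: fr_idp)

lemma fr_replicate_Suc: assumes "fr p (replicate_mset (Suc n) b)"
  obtains p0 g where "p = p0 + g" "iso (G b) g" "p0 * g = 0" "g * p0 = 0" "fr p0 (replicate_mset n b)"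
  using assms
proof (cases rule: fr.cases)
  case (frS p0 M c g)
  have "c \<in># replicate_mset (Suc n) b" unfolding frS(2) by simp
  then have "c = b" by (simp del: replicate_mset_Suc split: if_splits)
  then show ?thesis using frS that by simp
qed simp

lemma pure_hm_G: "pure b p \<Longrightarrow> pure c q \<Longrightarrow> hm (G b) (G c) = {0} \<Longrightarrow> hm p q = {0}"
proof -
  have L: "hm p r = {0}" if "fr p (replicate_mset n b)" "hm (G b) r = {0}" for p n b r
    using that
  proof (induction n arbitrary: p)
    case 0 then have "p = 0" using fr_empty by simp
    then show ?case by simp
  next
    case (Suc n)
    obtain p0 g where g: "p = p0 + g" "iso (G b) g" "p0 * g = 0" "g * p0 = 0" "fr p0 (replicate_mset n b)"
      using fr_replicate_Suc[OF Suc.prems(1)] .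
    have z: "hm p0 r = {0}" using Suc.IH[OF g(5) Suc.prems(2)] .
    obtain x y where x: "x \<in> hm (G b) g" "y \<in> hm g (G b)" "y * x = G b" "x * y = g" using g(2) by (auto elim: isoE)
    have "f = 0" if f: "f \<in> hm p r" for f
    proof -
      have pp: "idp p0" "idp g" "p0 \<in> hm p0 p" "g \<in> hm g p" using g fr_idp iso_idp(2)[OF g(2)] by (auto simp: hm_def idp_def algebra_simps)
      have "f * p0 \<in> hm p0 r" "f * g * x \<in> hm (G b) r"
        using hm_mult[OF f pp(3)] hm_mult[OF hm_mult[OF f pp(4)] x(1)] by simp_all
      then have "f * p0 = 0" "f * g * x * y = 0" using z Suc.prems(2) by auto
      moreover have "f * g * x * y = f * g" using x pp by (simp add: mult.assoc idp_def)
      ultimately show ?thesis using hmR[OF f] g(1) by (simp add: distrib_left)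
    qed
    then show ?case by auto
  qed
  have R: "hm r p = {0}" if "fr p (replicate_mset n b)" "hm r (G b) = {0}" for p n b r
    using that
  proof (induction n arbitrary: p)
    case 0 then have "p = 0" using fr_empty by simp
    then show ?case by simp
  next
    case (Suc n)
    obtain p0 g where g: "p = p0 + g" "iso (G b) g" "p0 * g = 0" "g * p0 = 0" "fr p0 (replicate_mset n b)"
      using fr_replicate_Suc[OF Suc.prems(1)] .
    have z: "hm r p0 = {0}" using Suc.IH[OF g(5) Suc.prems(2)] .
    obtain x y where x: "x \<in> hm (G b) g" "y \<in> hm g (G b)" "y * x = G b" "x * y = g" using g(2) by (auto elim: isoE)
    have "f = 0" if f: "f \<in> hm r p" for f
    proof -
      have pp: "idp p0" "idp g" "p0 \<in> hm p p0" "g \<in> hm p g" using g fr_idp iso_idp(2)[OF g(2)] by (auto simp: hm_def idp_def algebra_simps)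
      have "p0 * f \<in> hm r p0" "y * (g * f) \<in> hm r (G b)"
        using hm_mult[OF pp(3) f] hm_mult[OF x(2) hm_mult[OF pp(4) f]] by simp_all
      then have "p0 * f = 0" "x * (y * (g * f)) = 0" using z Suc.prems(2) by auto
      moreover have "x * (y * (g * f)) = g * f" using x pp by (simp add: idp_def mult.assoc[symmetric])
      ultimately show ?thesis using hmL[OF f] g(1) by (simp add: distrib_right)
    qed
    then show ?case by auto
  qed
  assume "pure b p" "pure c q" "hm (G b) (G c) = {0}"
  then show ?thesis unfolding pure_def using L R by blast
qed

lemma hm_FT: "pure False p \<Longrightarrow> pure True q \<Longrightarrow> hm p q = {0}"
  using pure_hm_G Gtri by blast

lemma gd_htpy0: "gd (p, q, d) \<Longrightarrow> hm q p = {0}"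
  by (auto simp: gd_def hm_FT)

lemma lc_sub: assumes "lc (p, q, d)" "idp p" "idp q" "d \<in> hm p q" "e \<in> hm p p" "f \<in> hm q q" "e * e = e" "f * f = f" "f * d = d * e"
  shows "(e = 0 \<and> f = 0) \<or> (e = p \<and> f = q)"
  using assms unfolding lc_def by blast

text \<open>By \<open>rigid_disjoint\<close> the two terms share no summand, so with both nonzero
  each is a power of one projective. For P_1^n -> P_2^k the differential is zero by triangularity
  and the complex would decompose.\<close>

lemma gd_of_lc: assumes "cx (p, q, d)" "lc (p, q, d)" "hom1 (p, q, d) (p, q, d)" "d \<in> rad p q" shows "gd (p, q, d)"
proof (cases "p = 0 \<or> q = 0")
  case True then show ?thesis by (auto simp: gd_def)
next
  case False
  obtain N M where fr: "fr p N" "fr q M" and d: "d \<in> hm p q" using assms by (auto simp: cx_def)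
  have dj: "\<not> (b \<in># N \<and> b \<in># M)" for b using rigid_disjoint[OF fr assms(3,4)] by blast
  obtain b where b: "b \<in># N" using False fr fr_empty by (cases N) auto
  obtain c where c: "c \<in># M" using False fr fr_empty by (cases M) auto
  have "b \<noteq> c" using dj b c by blast
  have "x = b" if "x \<in># N" for x using dj[of x] that c \<open>b \<noteq> c\<close> by (cases x; cases b; cases c) auto
  moreover have "x = c" if "x \<in># M" for x using dj[of x] that b \<open>b \<noteq> c\<close> by (cases x; cases b; cases c) auto
  ultimately have "set_mset N \<subseteq> {b}" "set_mset M \<subseteq> {c}" by auto
  then have "N = replicate_mset (size N) b" "M = replicate_mset (size M) c"
    using set_mset_subset_singletonD[of N b] set_mset_subset_singletonD[of M c] by blast+
  then have "fr p (replicate_mset (size N) b)" "fr q (replicate_mset (size M) c)" using fr by simp_all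
  then have P: "pure b p" "pure c q" unfolding pure_def by blast+
  show ?thesis
  proof (cases b)
    case True then show ?thesis using P \<open>b \<noteq> c\<close> by (cases c) (auto simp: gd_def)
  next
    case bF: False
    then have "c" using \<open>b \<noteq> c\<close> by simp
    then have "d = 0" using hm_FT P d bF by auto
    moreover have "idp p" "idp q" using cx_idp assms by auto
    ultimately have "(p = 0 \<and> 0 = (0::'m)) \<or> (p = p \<and> 0 = q)"
      by (intro lc_sub[OF assms(2)]) (auto simp: idp_def hm_id)
    then show ?thesis using False by simp
  qed
qed

lemma lc_not_zk: assumes "gd X" "lc X" shows "\<not> zk X"
proof
  assume z: "zk X"
  obtain p q d where [simp]: "X = (p, q, d)" by (cases X)
  obtain s where "s \<in> hm q p" "p = s * d" "q = d * s" using z by (auto simp: zk_def)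
  then show False using gd_htpy0[of p q d] assms by (auto simp: lc_def)
qed

text \<open>A decomposition of a complex homotopy equivalent to X is carried over to an idempotent
  chain endomorphism of X; as this is trivial, one of the two parts is contractible.\<close>

lemma lc_kiso_sub:
  assumes X: "gd X" "lc X" "cx X" and Y: "cx (p, q, d)" "kiso X (p, q, d)"
    and e: "e \<in> hm p p" "f \<in> hm q q" "e * e = e" "f * f = f" "f * d = d * e"
  shows "zk (e, f, d * e) \<or> zk (p - e, q - f, d * (p - e))"
proof -
  obtain a b c where X' [simp]: "X = (a, b, c)" by (cases X)
  obtain i1 i0 r1 r0 s t where h: "i1 \<in> hm p a" "i0 \<in> hm q b" "r1 \<in> hm a p" "r0 \<in> hm b q" "s \<in> hm q p" "t \<in> hm b a"
    and k: "i0 * d = c * i1" "r0 * c = d * r1" "p = r1 * i1 + s * d" "q = r0 * i0 + d * s" "a = i1 * r1 + t * c" "b = i0 * r0 + c * t"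
    using Y(2) unfolding kiso_def by auto
  have i: "idp p" "idp q" "idp a" "idp b" "d \<in> hm p q" "c \<in> hm a b" using X(3) Y(1) cx_idp by auto
  have H: "u = 0" if "u \<in> hm b a" for u using gd_htpy0[of a b c] X that by auto
  have t0: "t = 0" using H h by blast
  have k2: "i1 * r1 = a" "i0 * r0 = b" using k t0 by simp_all
  have r: "r1 * i1 = p - s * d" "r0 * i0 = q - d * s" using k(3,4) by (simp_all add: algebra_simps)
  \<comment> \<open>The idempotent pair transported to X. Its square differs from it by terms that
    factor through a map from \<open>b\<close> to \<open>a\<close>, and there are no such maps
    except 0.\<close>
  define E F where "E = i1 * e * r1" and "F = i0 * f * r0"
  have "E * E = i1 * e * (r1 * i1) * e * r1" by (simp add: E_def mult.assoc)
  also have "\<dots> = i1 * (e * e) * r1 - (i1 * (e * (s * (d * (e * r1)))))"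
    unfolding r using e by (simp add: algebra_simps hmE[OF e(1)])
  also have "i1 * (e * (s * (d * (e * r1)))) = (i1 * e * s * f * r0) * c"
    by (simp add: mult.assoc asr[OF e(5)] k(2))
  also have "i1 * e * s * f * r0 = 0" by (rule H) (use h e in auto)
  finally have EE: "E * E = E" by (simp add: E_def e)
  have "F * F = i0 * f * (r0 * i0) * f * r0" by (simp add: F_def mult.assoc)
  also have "\<dots> = i0 * (f * f) * r0 - (i0 * (f * (d * (s * (f * r0)))))"
    unfolding r using e by (simp add: algebra_simps hmE[OF e(2)])
  also have "i0 * (f * (d * (s * (f * r0)))) = c * (i1 * e * s * f * r0)"
    by (simp add: mult.assoc asr[OF e(5)] asr[OF k(1)])
  also have "i1 * e * s * f * r0 = 0" by (rule H) (use h e in auto)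
  finally have FF: "F * F = F" by (simp add: F_def e)
  have FE: "F * c = c * E"
    by (simp add: E_def F_def mult.assoc k(2)) (simp add: asr[OF e(5)] asr[OF k(1)] mult.assoc)
  have hmEF: "E \<in> hm a a" "F \<in> hm b b" unfolding E_def F_def using h e by auto
  \<comment> \<open>If the transported pair vanishes, transporting it back along
    \<open>r1 * i1 = p - s * d\<close> and \<open>r0 * i0 = q - d * s\<close> shows that the
    original pair is null-homotopic.\<close>
  have key: "zk (e, f, d * e)"
    if e: "e \<in> hm p p" "f \<in> hm q q" "e * e = e" "f * f = f" "f * d = d * e" and z: "i1 * e * r1 = 0" "i0 * f * r0 = 0" for e f
  proof -
    have "0 = r1 * (i1 * e * r1) * i1" using z by simp
    also have "\<dots> = (r1 * i1) * e * (r1 * i1)" by (simp add: mult.assoc)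
    also have "\<dots> = e - e * s * d - s * d * e + s * d * e * s * d"
      unfolding r using hmL[OF e(1)] hmR[OF e(1)] by (simp add: algebra_simps hmE[OF e(1)])
    finally have 1: "e = e * s * d + s * d * e - s * d * e * s * d" by (simp add: algebra_simps)
    have "0 = r0 * (i0 * f * r0) * i0" using z by simp
    also have "\<dots> = (r0 * i0) * f * (r0 * i0)" by (simp add: mult.assoc)
    also have "\<dots> = f - f * d * s - d * s * f + d * s * f * d * s"
      unfolding r using hmL[OF e(2)] hmR[OF e(2)] by (simp add: algebra_simps hmE[OF e(2)])
    finally have 2: "f = f * d * s + d * s * f - d * s * f * d * s" by (simp add: algebra_simps)
    \<comment> \<open>Multiplying equation 1 by \<open>e\<close> on both sides gives e = (2 e s - e
      s d e s) d e; cut down by \<open>f\<close> on the right, the factor in front is the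
      contraction.\<close>
    define v where "v = e * s * f + e * s * f - e * s * d * e * s * f"
    have ee: "e * (e * y) = e * y" "f * (f * y) = f * y" "f * (d * y) = d * (e * y)" for y
      using e by (simp_all add: mult.assoc[symmetric])
    have "e = e * e * e" using e by simp
    also have "\<dots> = e * (e * s * d + s * d * e - s * d * e * s * d) * e" using 1 by simp
    also have "\<dots> = v * (d * e)" unfolding v_def by (simp add: algebra_simps ee e(3,4,5))
    finally have 3: "e = v * (d * e)" .
    have "f = f * f * f" using e by simp
    also have "\<dots> = f * (f * d * s + d * s * f - d * s * f * d * s) * f" using 2 by simp
    also have "\<dots> = d * e * v" unfolding v_def by (simp add: algebra_simps ee e(3,4,5))
    finally have 4: "f = d * e * v" .
    have "v \<in> hm f e"
      unfolding v_def using e h(5) i(5) by (auto simp: hm_def algebra_simps ee intro!: Sadd Sdiff Smult)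
    then show ?thesis using 3 4 by (auto simp: zk_def)
  qed
  have "(E = 0 \<and> F = 0) \<or> (E = a \<and> F = b)"
    using lc_sub[of a b c E F] X(2) i hmEF EE FF FE by simp
  then show ?thesis
  proof
    assume "E = 0 \<and> F = 0"
    then show ?thesis using key[OF e] by (simp add: E_def F_def)
  next
    assume a: "E = a \<and> F = b"
    have pe: "p - e \<in> hm p p" "q - f \<in> hm q q" "(p - e) * (p - e) = p - e" "(q - f) * (q - f) = q - f" "(q - f) * d = d * (p - e)"
      using i e by (auto simp: hm_def idp_def algebra_simps dest: hmS)
    have "i1 * (p - e) * r1 = 0" "i0 * (q - f) * r0 = 0"
      using a k2 h by (simp_all add: E_def F_def algebra_simps hmE)
    then show ?thesis using key[OF pe] by simp
  qed
qed

lemma sub_cx: assumes "cx (p, q, d)" "e \<in> hm p p" "f \<in> hm q q" "e * e = e" "f * f = f" "f * d = d * e"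
  shows "cx (e, f, d * e)"
proof -
  obtain N M where "fr p N" "fr q M" and d: "d \<in> hm p q" using assms by (auto simp: cx_def)
  then have "\<exists>N. fr e N" "\<exists>N. fr f N"
    using fr_split[of p N e] fr_split[of q M f] assms by (auto simp: idp_def hmE dest: hmS)
  moreover have "d * e \<in> hm e f" using assms d by (auto simp: hm_def mult.assoc asr[OF assms(6)])
  ultimately show ?thesis by (simp add: cx_def)
qed

lemma sub_hr: assumes "cx (p, q, d)" "e \<in> hm p p" "f \<in> hm q q" "e * e = e" "f * f = f" "f * d = d * e"
  shows "hr (p, q, d) (e, f, d * e)"
proof -
  have h: "e \<in> hm e p" "e \<in> hm p e" "f \<in> hm f q" "f \<in> hm q f" "d * e * e = d * e" "f * (d * e) = d * e"
    using assms by (auto simp: hm_def mult.assoc asr[OF assms(6)])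
  then show ?thesis
    by (intro hrI[of e _ _ f _ _ e f 0]) (use assms(4-6) in \<open>auto simp: mult.assoc\<close>)
qed

lemma sub_hom1L: assumes "cx (p, q, d)" "e \<in> hm p p" "f \<in> hm q q" "e * e = e" "f * f = f" "f * d = d * e"
  and "hom1 (e, f, d * e) Y" "hom1 (p - e, q - f, d * (p - e)) Y"
  shows "hom1 (p, q, d) Y"
proof -
  obtain a b c where [simp]: "Y = (a, b, c)" by (cases Y)
  have i: "idp p" "idp q" "d \<in> hm p q" using cx_idp assms by auto
  have "\<exists>h\<in>hm q b. \<exists>h'\<in>hm p a. x = h * d + c * h'" if x: "x \<in> hm p b" for x
  proof -
    have "x * e \<in> hm e b" "x * (p - e) \<in> hm (p - e) b"
      using x assms(2,4) i by (auto simp: hm_def idp_def algebra_simps asr[OF hmL[OF x]])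
    then obtain h1 h1' h2 h2' where h: "h1 \<in> hm f b" "h1' \<in> hm e a" "x * e = h1 * (d * e) + c * h1'"
      "h2 \<in> hm (q - f) b" "h2' \<in> hm (p - e) a" "x * (p - e) = h2 * (d * (p - e)) + c * h2'"
      using assms(7,8) unfolding hom1_def by simp blast
    have 1: "h1 * (d * e) = h1 * d" using hmR[OF h(1)] assms(6) by (metis mult.assoc)
    have "d * (p - e) = (q - f) * d" using assms(6) i by (simp add: algebra_simps hmE)
    then have 2: "h2 * (d * (p - e)) = h2 * d" using hmR[OF h(4)] by (metis mult.assoc)
    have 3: "h1 \<in> hm q b" "h2 \<in> hm q b" "h1' \<in> hm p a" "h2' \<in> hm p a"
      using h(1,2,4,5) hm_mult[OF h(1), of f q] hm_mult[OF h(2), of e p] hm_mult[OF h(4), of "q - f" q] hm_mult[OF h(5), of "p - e" p]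
        assms(2-5) i by (auto simp: hm_def idp_def algebra_simps)
    have "x = x * e + x * (p - e)" using x by (simp add: algebra_simps hmR)
    also have "\<dots> = (h1 + h2) * d + c * (h1' + h2')"
      unfolding h(3,6) 1 2 by (simp add: algebra_simps)
    finally show ?thesis using 3 by blast
  qed
  then show ?thesis by (auto simp: hom1_def)
qed

lemma sub_hom1R: assumes "cx (p, q, d)" "e \<in> hm p p" "f \<in> hm q q" "e * e = e" "f * f = f" "f * d = d * e"
  and "hom1 Y (e, f, d * e)" "hom1 Y (p - e, q - f, d * (p - e))"
  shows "hom1 Y (p, q, d)"
proof -
  obtain a b c where [simp]: "Y = (a, b, c)" by (cases Y)
  have i: "idp p" "idp q" "d \<in> hm p q" using cx_idp assms by auto
  have "\<exists>h\<in>hm b q. \<exists>h'\<in>hm a p. x = h * c + d * h'" if x: "x \<in> hm a q" for x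
  proof -
    have "f * x \<in> hm a f" "(q - f) * x \<in> hm a (q - f)"
      using x assms(3,5) i by (auto simp: hm_def idp_def algebra_simps asr[OF assms(5)] asr[OF hmL[OF assms(3)]])
    then obtain h1 h1' h2 h2' where h: "h1 \<in> hm b f" "h1' \<in> hm a e" "f * x = h1 * c + d * e * h1'"
      "h2 \<in> hm b (q - f)" "h2' \<in> hm a (p - e)" "(q - f) * x = h2 * c + d * (p - e) * h2'"
      using assms(7,8) unfolding hom1_def by simp blast
    have 1: "d * e * h1' = d * h1'" "d * (p - e) * h2' = d * h2'" using hmL[OF h(2)] hmL[OF h(5)] by (simp_all add: mult.assoc)
    have 3: "h1 \<in> hm b q" "h2 \<in> hm b q" "h1' \<in> hm a p" "h2' \<in> hm a p"
      using h(1,2,4,5) hm_mult[OF _ h(1), of f q] hm_mult[OF _ h(2), of e p] hm_mult[OF _ h(4), of "q - f" q] hm_mult[OF _ h(5), of "p - e" p]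
        assms(2-5) i by (auto simp: hm_def idp_def algebra_simps)
    have "x = f * x + (q - f) * x" using x by (simp add: algebra_simps hmL)
    also have "\<dots> = (h1 + h2) * c + d * (h1' + h2')"
      unfolding h(3,6) 1 by (simp add: algebra_simps)
    finally show ?thesis using 3 by blast
  qed
  then show ?thesis by (auto simp: hom1_def)
qed

end

section \<open>The fan of a triangular category\<close>

lemma subset_three:
  assumes "A \<subseteq> {a, b, c}" "a \<in> A" "\<not> (b \<in> A \<and> c \<in> A)" shows "A = {a} \<or> A = {a, b} \<or> A = {a, c}"
  using assms by (cases "b \<in> A"; cases "c \<in> A") blast+

context tri begin

text \<open>Members of \<open>F\<close> may be isomorphic to each other: they then have equal
  g-vectors, so the cone is the same as for a basic complex.\<close>

definition gfs :: "(real \<times> real) set set" where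
  "gfs = {cone_gen (gv ` F) | F. finite F \<and> (\<forall>X\<in>F. cx X \<and> lc X \<and> gd X) \<and> (\<forall>X\<in>F. \<forall>Y\<in>F. hom1 X Y)}"

definition pmf :: "('m \<times> 'm \<times> 'm) set set" where
  "pmf = {F. finite F \<and> (\<forall>X\<in>F. pm X \<and> lc X) \<and> (\<forall>X\<in>F. \<forall>Y\<in>F. hom1 X Y)}"

lemma lc_p0: assumes "cx (0, q, d)" "lc (0, q, d)" shows "\<exists>b. iso (G b) q"
proof -
  obtain N where N: "fr q N" and d: "d = 0" and i: "idp q" using assms(1) by (auto simp: cx_def dest: fr_idp)
  have "q \<noteq> 0" using assms(2) by (auto simp: lc_def)
  then obtain b where "b \<in># N" using N fr_empty by (cases N) auto
  then obtain x y where x: "x \<in> hm (G b) q" "y \<in> hm q (G b)" "y * x = G b" using fr_has_G N by blast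
  have "x * y \<in> hm q q" "x * y * (x * y) = x * y"
    using x by (auto simp: mult.assoc asr[OF x(3)] hmL)
  then have "x * y = 0 \<or> x * y = q" using lc_sub[OF assms(2), of 0 "x * y"] i by (auto simp: d)
  moreover have "x * y \<noteq> 0" using x Gnz[of b] by (metis hmL hmR mult.assoc mult_zero_left mult_zero_right)
  ultimately show ?thesis using x by (auto simp: iso_def)
qed

lemma lc_q0: assumes "cx (p, 0, d)" "lc (p, 0, d)" shows "\<exists>b. iso (G b) p"
proof -
  obtain N where N: "fr p N" and d: "d = 0" and i: "idp p" using assms(1) by (auto simp: cx_def dest: fr_idp)
  have "p \<noteq> 0" using assms(2) by (auto simp: lc_def)
  then obtain b where "b \<in># N" using N fr_empty by (cases N) auto
  then obtain x y where x: "x \<in> hm (G b) p" "y \<in> hm p (G b)" "y * x = G b" using fr_has_G N by blast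
  have "x * y \<in> hm p p" "x * y * (x * y) = x * y"
    using x by (auto simp: mult.assoc asr[OF x(3)] hmL)
  then have "x * y = 0 \<or> x * y = p" using lc_sub[OF assms(2), of "x * y" 0] i by (auto simp: d)
  moreover have "x * y \<noteq> 0" using x Gnz[of b] by (metis hmL hmR mult.assoc mult_zero_left mult_zero_right)
  ultimately show ?thesis using x by (auto simp: iso_def)
qed

lemma nm_0 [simp]: "nm 0 = {#}" using nm_eq[OF fr0] .
lemma nm_iso: "iso (G b) q \<Longrightarrow> nm q = {#b#}" using nm_eq[OF fr_single] .
lemma iso_pure: "iso (G b) q \<Longrightarrow> pure b q"
  using fr_single[of b q] by (auto simp: pure_def intro: exI[of _ 1])
lemma nm_pure: "pure b p \<Longrightarrow> nm p = replicate_mset (size (nm p)) b"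
  unfolding pure_def using nm_eq by auto

lemma iso_hm: assumes "iso p p'" "iso q q'" "hm p q = {0}" shows "hm p' q' = {0}"
proof -
  obtain x y where 1: "x \<in> hm p p'" "y \<in> hm p' p" "y * x = p" "x * y = p'" using assms(1) by (rule isoE)
  obtain u v where 2: "u \<in> hm q q'" "v \<in> hm q' q" "v * u = q" "u * v = q'" using assms(2) by (rule isoE)
  have "f = 0" if f: "f \<in> hm p' q'" for f
  proof -
    have "v * f * x \<in> hm p q" using 1 2 f by auto
    then have "u * (v * f * x) * y = 0" using assms(3) by simp
    moreover have "u * (v * f * x) * y = (u * v) * f * (x * y)" by (simp add: mult.assoc)
    ultimately show ?thesis using 1 2 f by (simp add: hmL hmR mult.assoc)
  qed
  then show ?thesis by auto
qed

text \<open>A complex concentrated in one degree is a single projective by indecomposability. Of the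
  four such stalks, (0 -> P_1) and (P_2 -> 0) already satisfy \<open>pm\<close>, with one term zero;
  only the two others need cases of their own.\<close>

lemma kinds: assumes "cx X" "lc X" "gd X"
  obtains "pm X" | q d where "X = (0, q, d)" "iso (G True) q" "gv X = (0, 1)"
    | p d where "X = (p, 0, d)" "iso (G False) p" "gv X = (-1, 0)"
proof -
  obtain p q d where X: "X = (p, q, d)" by (cases X)
  consider "p = 0" | "q = 0" | "pure True p" "pure False q" using assms(3) by (auto simp: gd_def X)
  then show ?thesis
  proof cases
    case 1
    then obtain b where b: "iso (G b) q" using lc_p0 assms X by blast
    then have "pure b q" by (rule iso_pure)
    then show ?thesis using that b 1 assms(1) nm_iso[OF b]
      by (cases b) (auto simp: X gv_def pm_def cx_def)
  next
    case 2
    then obtain b where b: "iso (G b) p" using lc_q0 assms X by blast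
    then have "pure b p" by (rule iso_pure)
    then show ?thesis using that b 2 assms(1) nm_iso[OF b]
      by (cases b) (auto simp: X gv_def pm_def cx_def)
  next
    case 3
    then show ?thesis using that(1) assms(1) by (auto simp: pm_def X cx_def)
  qed
qed

lemma lc_G: "lc (0, G b, 0)" "lc (G b, 0, 0)"
  using Gnz[of b] loc_idem[OF Gloc[of b]] by (auto simp: lc_def hm_def idp_def)

lemma cx_G: "cx (0, G b, 0)" "cx (G b, 0, 0)"
  using fr0 fr_G by (auto simp: cx_def)

lemma pure_nz_hm: assumes "pure b p" "p \<noteq> 0" shows "hm p (G b) \<noteq> {0}" "hm (G b) p \<noteq> {0}"
proof -
  obtain n where n: "fr p (replicate_mset n b)" using assms(1) by (auto simp: pure_def)
  have "n \<noteq> 0"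
  proof
    assume "n = 0" then show False using n assms(2) fr_empty[of p] by simp
  qed
  then show "hm p (G b) \<noteq> {0}" "hm (G b) p \<noteq> {0}" using hm_nz[OF n, of b] by (cases n; simp)+
qed

text \<open>A member (0 -> P_2) or (P_1 -> 0) forces all other members to be stalks. So everything
  outside the quadrant (+, -) consists of the three undivided quadrants and of the two rays bounding
  the quadrant (-, +).\<close>

theorem gfs_eq: "gfs = {cone_gen (gv ` F) | F. F \<in> pmf} \<union> {cone_gen {(0,1)}, cone_gen {(0,1),(1,0)},
    cone_gen {(0,1),(-1,0)}, cone_gen {(-1,0)}, cone_gen {(-1,0),(0,-1)}}" (is "_ = ?R")
proof
  show "gfs \<subseteq> ?R"
  proof
    fix C assume "C \<in> gfs"
    then obtain F where C: "C = cone_gen (gv ` F)" and F: "finite F" "\<And>X. X \<in> F \<Longrightarrow> cx X \<and> lc X \<and> gd X"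
      "\<And>X Y. X \<in> F \<Longrightarrow> Y \<in> F \<Longrightarrow> hom1 X Y" unfolding gfs_def by blast
    show "C \<in> ?R"
    proof (cases "\<exists>q d. (0, q, d) \<in> F \<and> iso (G True) q")
      case True
      then obtain q d where Z: "(0, q, d) \<in> F" "iso (G True) q" by blast
      have gZ: "gv (0, q, d) = (0, 1)" using nm_iso[OF Z(2)] by (simp add: gv_def)
      have other: "gv X \<in> {(0,1), (1,0), (-1,0)} \<and> (gv X = (1, 0) \<longrightarrow> (\<exists>r e. X = (0, r, e) \<and> iso (G False) r))
          \<and> (gv X = (-1, 0) \<longrightarrow> (\<exists>r e. X = (r, 0, e) \<and> iso (G False) r))" if X: "X \<in> F" for X
      proof -
        have "cx X" "lc X" "gd X" using F X by auto
        then show ?thesis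
        proof (cases rule: kinds)
          case 1
          obtain a b c where abc: "X = (a, b, c)" by (cases X)
          have P: "pure True a" "pure False b" using 1 by (auto simp: pm_def abc)
          \<comment> \<open>There are no maps b -> P_2, so vanishing of the extensions by (0 -> P_2)
            gives Hom(a, P_2) = 0, hence a = 0 and the complex is (0 -> P_1).\<close>
          have "hm b q = {0}" using iso_hm[OF iso_refl Z(2)] hm_FT[OF P(2) pure_G[of True]] pure_idp[OF P(2)] by blast
          moreover have "\<forall>f\<in>hm a q. \<exists>h\<in>hm b q. f = h * c"
            using F(3)[OF X Z(1)] by (auto simp: hom1_def abc)
          ultimately have "hm a q = {0}" by auto
          then have "hm a (G True) = {0}" using iso_hm[OF iso_refl iso_sym[OF Z(2)]] pure_idp[OF P(1)] by blast
          then have a0: "a = 0" using pure_nz_hm P by blast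
          then obtain b' where b': "iso (G b') b" using lc_p0 \<open>cx X\<close> \<open>lc X\<close> abc by blast
          have "b' = False"
          proof (rule ccontr)
            assume "b' \<noteq> False"
            then have "nm b = {#True#}" using nm_iso[OF b'] by simp
            then show False using nm_pure[OF P(2)] by simp
          qed
          then show ?thesis using a0 b' nm_iso[OF b'] by (auto simp: gv_def abc)
        qed auto
      qed
      \<comment> \<open>The identity of P_1 is a map from (P_1 -> 0) to the shift of (0 -> P_1) that
        no homotopy kills.\<close>
      have notboth: "\<not> ((1, 0) \<in> gv ` F \<and> (-1, 0) \<in> gv ` F)"
      proof
        assume "(1, 0) \<in> gv ` F \<and> (-1, 0) \<in> gv ` F"
        then obtain X Y where "X \<in> F" "Y \<in> F" "gv X = (1, 0)" "gv Y = (-1, 0)" by (metis imageE)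
        then obtain r e r' e' where "(0, r, e) \<in> F" "(r', 0, e') \<in> F" "iso (G False) r" "iso (G False) r'"
          using other by metis
        then have "hom1 (r', 0, e') (0, r, e)" "cx (0, r, e)" using F by auto
        then have "hm r' r = {0}" by (auto simp: hom1_def cx_def)
        then have "hm (G False) (G False) = {0}"
          using iso_hm[OF iso_sym iso_sym] \<open>iso (G False) r\<close> \<open>iso (G False) r'\<close> by blast
        then show False using idp_hm[OF Gidp[of False]] by auto
      qed
      have "gv ` F \<subseteq> {(0,1), (1,0), (-1,0)}" "(0,1) \<in> gv ` F" using other gZ Z(1) by (blast, metis imageI)
      then have "gv ` F = {(0,1)} \<or> gv ` F = {(0,1), (1,0)} \<or> gv ` F = {(0,1), (-1,0)}"
        using notboth by (rule subset_three)
      then show ?thesis using C by auto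
    next
      case noZ: False
      show ?thesis
      proof (cases "\<exists>p d. (p, 0, d) \<in> F \<and> iso (G False) p")
        case True
        then obtain p d where Z: "(p, 0, d) \<in> F" "iso (G False) p" by blast
        have gZ: "gv (p, 0, d) = (-1, 0)" using nm_iso[OF Z(2)] by (simp add: gv_def)
        have "gv X \<in> {(-1,0), (0,-1)}" if X: "X \<in> F" for X
        proof -
          have "cx X" "lc X" "gd X" using F X by auto
          then show ?thesis
          proof (cases rule: kinds)
            case 1
            obtain a b c where abc: "X = (a, b, c)" by (cases X)
            have P: "pure True a" "pure False b" using 1 by (auto simp: pm_def abc)
            \<comment> \<open>Dually, there are no maps P_1 -> a, so rigidity gives Hom(P_1, b) = 0,
              hence b = 0 and the complex is (P_2 -> 0).\<close>
            have "hm p a = {0}" using iso_hm[OF Z(2) iso_refl] hm_FT[OF pure_G[of False] P(1)] pure_idp[OF P(1)] by blast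
            moreover have "\<forall>f\<in>hm p b. \<exists>h\<in>hm p a. f = c * h"
              using F(3)[OF Z(1) X] by (auto simp: hom1_def abc)
            ultimately have "hm p b = {0}" by auto
            then have "hm (G False) b = {0}" using iso_hm[OF iso_sym[OF Z(2)] iso_refl] pure_idp[OF P(2)] by blast
            then have a0: "b = 0" using pure_nz_hm P by blast
            then obtain b' where b': "iso (G b') a" using lc_q0 \<open>cx X\<close> \<open>lc X\<close> abc by blast
            have "b' = True"
            proof (rule ccontr)
              assume "b' \<noteq> True"
              then have "nm a = {#False#}" using nm_iso[OF b'] by simp
              then show False using nm_pure[OF P(1)] by simp
            qed
            then show ?thesis using a0 b' nm_iso[OF b'] by (auto simp: gv_def abc)
          next
            case (2 q d) then show ?thesis using noZ X by blast
          qed auto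
        qed
        then have "gv ` F \<subseteq> {(-1,0), (0,-1)}" "(-1,0) \<in> gv ` F" using gZ Z(1) by (blast, metis imageI)
        then have "gv ` F = {(-1,0)} \<or> gv ` F = {(-1,0), (0,-1)}" by auto
        then show ?thesis using C by auto
      next
        case False
        have "pm X" if X: "X \<in> F" for X
        proof -
          have "cx X" "lc X" "gd X" using F X by auto
          then show ?thesis by (cases rule: kinds) (use False noZ X in blast)+
        qed
        then have "F \<in> pmf" using F by (auto simp: pmf_def)
        then show ?thesis using C by blast
      qed
    qed
  qed
next
  have gdG: "gd (0, G b, 0)" "gd (G b, 0, 0)" for b by (auto simp: gd_def)
  have h: "hom1 (0, G b, 0) Y" "hom1 Y (G b, 0, 0)" for b Y
    unfolding hom1_def using hm_0 by (cases Y; simp; blast)+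
  have h2: "hom1 (G False, 0, 0) (0, G True, 0)"
    using Gtri by (auto simp: hom1_def)
  have g: "gv (0, G True, 0) = (0, 1)" "gv (0, G False, 0) = (1, 0)" "gv (G False, 0, 0) = (-1, 0)" "gv (G True, 0, 0) = (0, -1)"
    using nm_iso[OF iso_refl[OF Gidp]] by (auto simp: gv_def)
  have I: "cone_gen (gv ` F) \<in> gfs" if "finite F" "\<And>X. X \<in> F \<Longrightarrow> cx X \<and> lc X \<and> gd X" "\<And>X Y. X \<in> F \<Longrightarrow> Y \<in> F \<Longrightarrow> hom1 X Y" for F
    using that unfolding gfs_def by blast
  note hh = h(1)[where b = True] h(1)[where b = False] h(2)[where b = True] h(2)[where b = False] h2 lc_G[of True] lc_G[of False]
    cx_G[of True] cx_G[of False] gdG[of True] gdG[of False]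
  have "cone_gen (gv ` {(0, G True, 0)}) \<in> gfs" "cone_gen (gv ` {(0, G True, 0), (0, G False, 0)}) \<in> gfs"
    "cone_gen (gv ` {(0, G True, 0), (G False, 0, 0)}) \<in> gfs" "cone_gen (gv ` {(G False, 0, 0)}) \<in> gfs"
    "cone_gen (gv ` {(G False, 0, 0), (G True, 0, 0)}) \<in> gfs"
    by (rule I; use hh in \<open>simp; blast?\<close>)+
  moreover have "cone_gen (gv ` F) \<in> gfs" if "F \<in> pmf" for F
    using that pm_cx pm_gd unfolding pmf_def by (intro I) auto
  ultimately show "?R \<subseteq> gfs" by (auto simp: g)
qed

section \<open>Minimal left approximations\<close>

text \<open>A summand of \<open>p0\<close> that annihilates \<open>m\<close>, chosen as large as
  possible, is discarded. If some \<open>z\<close> with \<open>z * m = 0\<close> were split by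
  \<open>k\<close>, the idempotent \<open>k * z\<close> would be a further summand of this
  kind.\<close>

lemma minimal_approx:
  assumes "fr p0 (replicate_mset L False)" "m \<in> hm (G True) p0"
    and appr: "\<And>f. f \<in> hm (G True) (G False) \<Longrightarrow> \<exists>z\<in>hm p0 (G False). f = z * m"
  obtains p l where "fr p (replicate_mset l False)" "m \<in> hm (G True) p" "p0 * p = p" "p * p0 = p"
    "\<And>f. f \<in> hm (G True) (G False) \<Longrightarrow> \<exists>z\<in>hm p (G False). f = z * m"
    "\<And>z k. z \<in> hm p (G False) \<Longrightarrow> z * m = 0 \<Longrightarrow> k \<in> hm (G False) p \<Longrightarrow> z * k \<noteq> G False"
proof -
  let ?P = "\<lambda>k. \<exists>e M. e \<in> hm p0 p0 \<and> e * e = e \<and> e * m = 0 \<and> fr e M \<and> size M = k"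
  have pi: "idp p0" using assms fr_idp by blast
  have spl: "\<exists>M K. fr e M \<and> fr (p0 - e) K \<and> replicate_mset L False = M + K" if "e \<in> hm p0 p0" "e * e = e" for e
    by (rule fr_split[OF assms(1)]) (use that in \<open>auto simp: idp_def dest: hmS hmL hmR\<close>)
  have "?P 0" using fr0 by (intro exI[of _ 0] exI[of _ "{#}"]) auto
  moreover have "k \<le> L" if "?P k" for k
  proof -
    from that obtain e M where e: "e \<in> hm p0 p0" "e * e = e" "fr e M" "size M = k" by blast
    from spl[OF e(1,2)] obtain M' K where M': "fr e M'" "replicate_mset L False = M' + K" by blast
    have "size (replicate_mset L False) = size M' + size K" using M'(2) by simp
    then show ?thesis using fr_unique[OF e(3) M'(1)] e(4) by simp
  qed
  ultimately obtain k where k: "?P k" "\<And>j. ?P j \<Longrightarrow> j \<le> k"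
    using Nat.ex_has_greatest_nat[of ?P 0 L] by blast
  then obtain e M where e: "e \<in> hm p0 p0" "e * e = e" "e * m = 0" "fr e M" "size M = k" by blast
  obtain M' K where K: "fr (p0 - e) K" "replicate_mset L False = M' + K" using spl[OF e(1,2)] by blast
  have "K = replicate_mset (size K) False" using K(2) by (metis msubseteq_replicate_msetE mset_subset_eq_add_right size_replicate_mset)
  then have fp: "fr (p0 - e) (replicate_mset (size K) False)" using K(1) by simp
  define p where "p = p0 - e"
  have ep: "e * p = 0" "p * e = 0" "p * p = p" "p0 * p = p" "p * p0 = p"
    using e(1,2) pi by (simp_all add: p_def algebra_simps hmE idpM)
  have pm: "p * m = m" using assms(2) e(3) by (simp add: p_def algebra_simps hmL)
  have pS: "p \<in> hm p p0" "p \<in> hm p0 p" using e(1) pi ep by (auto simp: hm_def p_def idp_def)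
  show ?thesis
  proof (rule that)
    show "fr p (replicate_mset (size K) False)" "p0 * p = p" "p * p0 = p" using fp ep by (simp_all add: p_def)
    show "m \<in> hm (G True) p" using assms(2) pm by (auto simp: hm_def)
    fix f assume "f \<in> hm (G True) (G False)"
    then obtain z where z: "z \<in> hm p0 (G False)" "f = z * m" using appr by blast
    have "z * p \<in> hm p (G False)" using z pS by auto
    moreover have "f = z * p * m" using z pm by (simp add: mult.assoc)
    ultimately show "\<exists>z\<in>hm p (G False). f = z * m" by blast
  next
    fix z c assume z: "z \<in> hm p (G False)" "z * m = 0" "c \<in> hm (G False) p"
    show "z * c \<noteq> G False"
    proof
      assume zc: "z * c = G False"
      \<comment> \<open>The extra summand cut out by \<open>z\<close> and its section
        \<open>c\<close>; it is a copy of P_1 inside the remaining \<open>p\<close>, orthogonal to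
        \<open>e\<close>.\<close>
      have cz: "c * z * (c * z) = c * z" "c * z * m = 0"
        using z by (simp_all add: mult.assoc asr[OF zc] hmL)
      have h: "c * z \<in> hm p p" using z by auto
      have h0: "c * z \<in> hm p0 p0" using hm_mult[OF pS(1) hm_mult[OF h pS(2)]] by (simp only: hmR[OF h] hmL[OF h])
      obtain M1 where M1: "fr (c * z) M1" using spl[OF h0 cz(1)] by blast
      have o: "e * (c * z) = 0" "c * z * e = 0"
        using ep hmL[OF h] hmR[OF h] by (metis mult.assoc mult_zero_left mult_zero_right)+
      have "fr (e + c * z) (M + M1)" by (rule fr_add[OF M1 e(4) o])
      moreover have "e + c * z \<in> hm p0 p0" "(e + c * z) * (e + c * z) = e + c * z" "(e + c * z) * m = 0"
        using e h0 o cz by (auto simp: algebra_simps)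
      ultimately have "?P (size (M + M1))" by blast
      then have "size (M + M1) \<le> k" by (rule k(2))
      then have "M1 = {#}" using e(5) by simp
      then have "c * z = 0" using M1 fr_empty by blast
      then have "z * c * (z * c) = 0" by (simp add: mult.assoc asr)
      then show False using zc idpM[OF Gidp[of False]] by simp
    qed
  qed
qed

end

section \<open>Matrices over an algebra as morphisms\<close>

context tri begin

lemma kiso_siso_trans: assumes "kiso X Y" "siso Y Z" "cx X" "cx Y" shows "kiso X Z"
proof -
  obtain p q d p' q' d' a b c where [simp]: "X = (p, q, d)" "Y = (p', q', d')" "Z = (a, b, c)" by (cases X; cases Y; cases Z)
  obtain i1 i0 r1 r0 s t where h: "i1 \<in> hm p' p" "i0 \<in> hm q' q" "r1 \<in> hm p p'" "r0 \<in> hm q q'" "s \<in> hm q' p'" "t \<in> hm q p"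
    and k: "i0 * d' = d * i1" "r0 * d = d' * r1" "p' = r1 * i1 + s * d'" "q' = r0 * i0 + d' * s" "p = i1 * r1 + t * d" "q = i0 * r0 + d * t"
    using assms(1) unfolding kiso_def by auto
  obtain j1 j0 v1 v0 where g: "j1 \<in> hm a p'" "j0 \<in> hm b q'" "v1 \<in> hm p' a" "v0 \<in> hm q' b"
    and e: "j0 * c = d' * j1" "v0 * d' = c * v1" "v1 * j1 = a" "v0 * j0 = b" "j1 * v1 = p'" "j0 * v0 = q'"
    using assms(2) unfolding siso_def by auto
  have r: "r1 * i1 = p' - s * d'" "r0 * i0 = q' - d' * s" using k(3,4) by (simp_all add: algebra_simps)
  have "v1 * r1 * (i1 * j1) = v1 * (r1 * i1) * j1" by (simp add: mult.assoc)
  also have "\<dots> = a - v1 * s * j0 * c" unfolding r using g e by (simp add: algebra_simps hmE)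
  finally have 1: "a = v1 * r1 * (i1 * j1) + v1 * s * j0 * c" by simp
  have "v0 * r0 * (i0 * j0) = v0 * (r0 * i0) * j0" by (simp add: mult.assoc)
  also have "\<dots> = b - c * (v1 * s * j0)" unfolding r using g e by (simp add: algebra_simps hmE asr[OF e(2)])
  finally have 2: "b = v0 * r0 * (i0 * j0) + c * (v1 * s * j0)" by simp
  have 3: "i1 * j1 * (v1 * r1) = i1 * r1" "i0 * j0 * (v0 * r0) = i0 * r0"
    using h by (simp_all add: mult.assoc asr[OF e(5)] asr[OF e(6)] hmL)
  have 4: "i0 * j0 * c = d * (i1 * j1)" "v0 * r0 * d = c * (v1 * r1)"
    by (simp_all add: mult.assoc e(1) asr[OF k(1)] k(2) asr[OF e(2)])
  have 5: "p = i1 * j1 * (v1 * r1) + t * d" "q = i0 * j0 * (v0 * r0) + d * t" using 3 k(5,6) by simp_all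
  have "v1 * s * j0 \<in> hm b a" using h g by auto
  then have "kiso (p, q, d) (a, b, c)"
    by (rule kisoI[OF hm_mult[OF h(1) g(1)] hm_mult[OF h(2) g(2)] hm_mult[OF g(3) h(3)] hm_mult[OF g(4) h(4)] _ h(6) 4 1 2 5])
  then show ?thesis by simp
qed

lemma siso_sum:
  assumes "e \<in> hm p p" "f \<in> hm q q" "e * e = e" "f * f = f" "f * d = d * e" "cx (p, q, d)"
    and "e' \<in> hm p' p'" "f' \<in> hm q' q'" "e' * e' = e'" "f' * f' = f'" "f' * d' = d' * e'" "cx (p', q', d')"
    and "siso (e, f, d * e) (e', f', d' * e')" "siso (p - e, q - f, d * (p - e)) (p' - e', q' - f', d' * (p' - e'))"
  shows "siso (p, q, d) (p', q', d')"
proof -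
  have i: "idp p" "idp q" "idp p'" "idp q'" "d \<in> hm p q" "d' \<in> hm p' q'" using assms(6,12) cx_idp by auto
  obtain i1 i0 r1 r0 where h: "i1 \<in> hm e' e" "i0 \<in> hm f' f" "r1 \<in> hm e e'" "r0 \<in> hm f f'"
    and k: "i0 * (d' * e') = d * e * i1" "r0 * (d * e) = d' * e' * r1" "r1 * i1 = e'" "r0 * i0 = f'" "i1 * r1 = e" "i0 * r0 = f"
    using assms(13) unfolding siso_def by auto
  obtain j1 j0 v1 v0 where g: "j1 \<in> hm (p' - e') (p - e)" "j0 \<in> hm (q' - f') (q - f)" "v1 \<in> hm (p - e) (p' - e')" "v0 \<in> hm (q - f) (q' - f')"
    and l: "j0 * (d' * (p' - e')) = d * (p - e) * j1" "v0 * (d * (p - e)) = d' * (p' - e') * v1" "v1 * j1 = p' - e'" "v0 * j0 = q' - f'" "j1 * v1 = p - e" "j0 * v0 = q - f"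
    using assms(14) unfolding siso_def by auto
  have sub: "x \<in> hm P Q" if "x \<in> hm E F" "P * E = E" "E * P = E" "Q * F = F" for x E F P Q
    using that by (auto simp: hm_def) (metis mult.assoc)+
  have ee: "p * e = e" "e * p = e" "q * f = f" "f * q = f" "p' * e' = e'" "e' * p' = e'" "q' * f' = f'" "f' * q' = f'"
    using assms(1,2,7,8) by (auto simp: hm_def)
  have ff: "p * (p - e) = p - e" "(p - e) * p = p - e" "q * (q - f) = q - f" "(q - f) * q = q - f" "p' * (p' - e') = p' - e'" "(p' - e') * p' = p' - e'" "q' * (q' - f') = q' - f'" "(q' - f') * q' = q' - f'"
    using ee i by (simp_all add: algebra_simps idp_def)
  have H: "i1 \<in> hm p' p" "i0 \<in> hm q' q" "r1 \<in> hm p p'" "r0 \<in> hm q q'" "j1 \<in> hm p' p" "j0 \<in> hm q' q" "v1 \<in> hm p p'" "v0 \<in> hm q q'"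
    using sub[OF h(1)] sub[OF h(2)] sub[OF h(3)] sub[OF h(4)] sub[OF g(1)] sub[OF g(2)] sub[OF g(3)] sub[OF g(4)] ee ff by blast+
  have z: "x * y = 0" if "x \<in> hm E F" "y \<in> hm E' F'" "E * F' = 0" for x y E F E' F'
    using that by (metis hmL hmR mult.assoc mult_zero_left mult_zero_right)
  have o: "e * (p - e) = 0" "(p - e) * e = 0" "f * (q - f) = 0" "(q - f) * f = 0" "e' * (p' - e') = 0" "(p' - e') * e' = 0" "f' * (q' - f') = 0" "(q' - f') * f' = 0"
    using ee assms(3,4,9,10) by (simp_all add: algebra_simps)
  have Z: "r1 * j1 = 0" "v1 * i1 = 0" "r0 * j0 = 0" "v0 * i0 = 0" "i1 * v1 = 0" "j1 * r1 = 0" "i0 * v0 = 0" "j0 * r0 = 0"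
    using z[OF h(3) g(1)] z[OF g(3) h(1)] z[OF h(4) g(2)] z[OF g(4) h(2)] z[OF h(1) g(3)] z[OF g(1) h(3)] z[OF h(2) g(4)] z[OF g(2) h(4)] o by blast+
  have D: "d' * (p' - e') = (q' - f') * d'" "d * (p - e) = (q - f) * d" "d * e = f * d" "d' * e' = f' * d'"
    using assms i by (simp_all add: algebra_simps hmE)
  have 1: "i0 * d' = d * i1" using k(1) hmL[OF h(1)] hmR2[OF h(2), of d'] D(4) by (simp add: mult.assoc)
  have 2: "j0 * d' = d * j1" using l(1) hmL[OF g(1)] hmR2[OF g(2), of d'] by (simp add: mult.assoc D(1))
  have 3: "r0 * d = d' * r1" using k(2) hmL[OF h(3)] hmR2[OF h(4), of d] D(3) by (simp add: mult.assoc)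
  have 4: "v0 * d = d' * v1" using l(2) hmL[OF g(3)] hmR2[OF g(4), of d] by (simp add: mult.assoc D(2))
  show ?thesis
    by (rule sisoI[of "i1 + j1" _ _ "i0 + j0" _ _ "r1 + v1" "r0 + v0"])
      (use H Z 1 2 3 4 k(3-6) l(3-6) in \<open>auto simp: distrib_left distrib_right\<close>)
qed

text \<open>The contraction \<open>s\<close> of the summand satisfies s d s = s, which a radical
  \<open>d\<close> allows only for s = 0.\<close>

lemma sub_zk_rad: assumes "cx (p, q, d)" "d \<in> rad p q" "e \<in> hm p p" "f \<in> hm q q" "zk (e, f, d * e)" shows "e = 0 \<and> f = 0"
proof -
  obtain s where s: "s \<in> hm f e" "e = s * (d * e)" "f = d * e * s" using assms(5) by (auto simp: zk_def)
  have es: "e * s = s" using hmL[OF s(1)] .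
  have "p * s = s" using hmL[OF s(1)] hmL2[OF assms(3), of s] by simp
  moreover have "s * q = s" using hmR[OF s(1)] hmR[OF assms(4)] mult.assoc[of s f q] by simp
  ultimately have "s \<in> hm q p" using hmS[OF s(1)] by (simp add: hm_def)
  moreover have "s * d * s = s" using s(2) es by (metis mult.assoc)
  ultimately have "s = 0" using radD[OF assms(2)] by blast
  then show ?thesis using s by simp
qed

lemma pure_iso: "pure b p \<Longrightarrow> iso p q \<Longrightarrow> pure b q"
  unfolding pure_def using fr_iso by blast

lemma gd_siso: assumes "siso X Y" "gd X" shows "gd Y"
proof -
  obtain p q d p' q' d' where [simp]: "X = (p, q, d)" "Y = (p', q', d')" by (cases X; cases Y)
  have "iso p p'" "iso q q'" using siso_iso assms(1) by auto
  then show ?thesis using assms(2) pure_iso iso_0 unfolding gd_def by auto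
qed

lemma gd_kiso_siso: assumes "kiso X Y" "gd X" "gd Y" shows "siso X Y"
proof -
  obtain p q d p' q' d' where [simp]: "X = (p, q, d)" "Y = (p', q', d')" by (cases X; cases Y)
  have "hm q p = {0}" "hm q' p' = {0}" using gd_htpy0 assms by auto
  then show ?thesis using assms(1) unfolding kiso_def siso_def by auto
qed

end

section \<open>From projective modules and complexes over an algebra to idempotent matrices\<close>

definition sc :: "'r::ring set \<Rightarrow> 'r fmat set" where
  "sc S = {X. \<forall>i j. ent X i j \<in> S}"

lemma sc_iff: "X \<in> sc S \<longleftrightarrow> (\<forall>i j. ent X i j \<in> S)" by (simp add: sc_def)
lemma scD: "X \<in> sc S \<Longrightarrow> ent X i j \<in> S" by (simp add: sc_def)

lemma rcat_sc: assumes "rcat S" shows "rcat (sc S)"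
proof -
  interpret rcat S by fact
  have sum: "(\<And>i. i \<in> I \<Longrightarrow> f i \<in> S) \<Longrightarrow> sum f I \<in> S" for f :: "nat \<Rightarrow> 'a" and I
    by (induction I rule: infinite_finite_induct) auto
  show ?thesis
  proof
    fix x y assume "x \<in> sc S" "y \<in> sc S"
    then show "x * y \<in> sc S" by (auto simp: sc_def ent_times_supp intro!: sum)
  qed (auto simp: sc_def)
qed

text \<open>\<open>corner\<close> asks only that \<Lambda> be the corner of \<open>S\<close> at the
  image of 1, so \<open>S\<close> may be larger. This leaves room in \<open>S\<close> for
  idempotents outside \<Lambda>, such as the one for P_1^l.\<close>

locale rep = tri "sc S" "\<lambda>b. E 0 0 (\<phi> (lab e1 e2 b))"
  for A :: "('k::field, 'a) module" and e1 e2 :: 'a and \<phi> :: "'a \<Rightarrow> 'r::ring" and S :: "'r set" +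
  assumes rcS: "rcat S"
    and ringA: "ring A"
    and eA: "e1 \<in> carrier A" "e2 \<in> carrier A" "e1 \<oplus>\<^bsub>A\<^esub> e2 = \<one>\<^bsub>A\<^esub>"
    and orthA: "e1 \<otimes>\<^bsub>A\<^esub> e2 = \<zero>\<^bsub>A\<^esub>" "e2 \<otimes>\<^bsub>A\<^esub> e1 = \<zero>\<^bsub>A\<^esub>"
    and inj: "inj_on \<phi> (carrier A)"
    and \<phi>_add: "x \<in> carrier A \<Longrightarrow> y \<in> carrier A \<Longrightarrow> \<phi> (x \<oplus>\<^bsub>A\<^esub> y) = \<phi> x + \<phi> y"
    and \<phi>_mult: "x \<in> carrier A \<Longrightarrow> y \<in> carrier A \<Longrightarrow> \<phi> (x \<otimes>\<^bsub>A\<^esub> y) = \<phi> x * \<phi> y"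
    and corner: "\<phi> ` carrier A = {x \<in> S. \<phi> \<one>\<^bsub>A\<^esub> * x = x \<and> x * \<phi> \<one>\<^bsub>A\<^esub> = x}"
begin

interpretation A: ring A by (rule ringA)

abbreviation "L \<equiv> lab e1 e2"
abbreviation g :: "bool \<Rightarrow> 'r" where "g b \<equiv> \<phi> (L b)"

lemma LA [simp]: "L b \<in> carrier A" using eA by (simp add: lab_def)
lemma \<phi>_zero [simp]: "\<phi> \<zero>\<^bsub>A\<^esub> = 0" using \<phi>_add[of "\<zero>\<^bsub>A\<^esub>" "\<zero>\<^bsub>A\<^esub>"] by simp
lemma \<phi>S [simp]: "x \<in> carrier A \<Longrightarrow> \<phi> x \<in> S" using corner by blast
lemma g_idem [simp]: "g b * g b = g b" using Gidp[of b] by (simp add: idp_def)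
lemma g_orth: "b \<noteq> c \<Longrightarrow> g b * g c = 0"
  using orthA \<phi>_mult[OF LA LA, of b c] by (cases b; cases c) (auto simp: lab_def)
lemma g_nz [simp]: "g b \<noteq> 0" using Gnz[of b] by (metis E_zero)

lemma corner_g: assumes "x \<in> S" "g b * x = x" "x * g c = x" shows "x \<in> \<phi> ` carrier A"
proof -
  have "\<phi> \<one>\<^bsub>A\<^esub> * g b = g b" "g c * \<phi> \<one>\<^bsub>A\<^esub> = g c"
    using \<phi>_mult[of "\<one>\<^bsub>A\<^esub>" "L b"] \<phi>_mult[of "L c" "\<one>\<^bsub>A\<^esub>"] by auto
  then have "\<phi> \<one>\<^bsub>A\<^esub> * x = x" "x * \<phi> \<one>\<^bsub>A\<^esub> = x" using assms by (metis mult.assoc)+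
  then show ?thesis using corner assms(1) by blast
qed

lemma \<phi>_finsum: "(\<And>i. i < n \<Longrightarrow> f i \<in> carrier A) \<Longrightarrow> \<phi> (finsum A f {..<n::nat}) = (\<Sum>i<n. \<phi> (f i))"
proof (induction n)
  case (Suc n)
  then have "f \<in> {..<n} \<rightarrow> carrier A" "f n \<in> carrier A" by auto
  then show ?case using Suc by (simp add: lessThan_Suc A.finsum_insert \<phi>_add add.commute)
qed simp

definition dgl :: "bool list \<Rightarrow> 'r fmat" where
  "dgl ps = Fmat (\<lambda>t s. if t = s \<and> t < length ps then g (ps ! t) else 0)"

lemma ent_dgl: "ent (dgl ps) t s = (if t = s \<and> t < length ps then g (ps ! t) else 0)"
  unfolding dgl_def by (subst ent_Fmat[of "length ps"]) auto

lemma bnd_dgl: "bnd (dgl ps) (length ps)" by (auto simp: bnd_def ent_dgl)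

lemma ent_dgl_times: "ent (dgl ps * X) t s = (if t < length ps then g (ps ! t) * ent X t s else 0)"
proof -
  have "ent (dgl ps * X) t s = (\<Sum>k<length ps. if k = t then g (ps ! t) * ent X t s else 0)"
    unfolding ent_times[OF bnd_dgl] by (rule sum.cong) (auto simp: ent_dgl)
  then show ?thesis by simp
qed

lemma ent_times_dgl: "ent (X * dgl ps) t s = (if s < length ps then ent X t s * g (ps ! s) else 0)"
proof -
  have "ent (X * dgl ps) t s = (\<Sum>k<length ps. if k = s then ent X t s * g (ps ! s) else 0)"
    unfolding ent_times'[OF bnd_dgl] by (rule sum.cong) (auto simp: ent_dgl)
  then show ?thesis by simp
qed

lemma dgl_idp: "idp (dgl ps)"
  using rcS by (auto simp: idp_def sc_iff ent_dgl rcat.S0 fmat_eq_iff ent_dgl_times)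

lemma hm_dgl: "X \<in> hm (dgl ps) (dgl qs) \<longleftrightarrow> (\<forall>t s. if t < length qs \<and> s < length ps
   then ent X t s \<in> S \<and> g (qs ! t) * ent X t s = ent X t s \<and> ent X t s * g (ps ! s) = ent X t s else ent X t s = 0)"
proof
  assume X: "X \<in> hm (dgl ps) (dgl qs)"
  have 1: "(if t < length qs then g (qs ! t) * ent X t s else 0) = ent X t s" for t s
    using arg_cong[OF hmL[OF X], of "\<lambda>Y. ent Y t s"] by (simp only: ent_dgl_times)
  have 2: "(if s < length ps then ent X t s * g (ps ! s) else 0) = ent X t s" for t s
    using arg_cong[OF hmR[OF X], of "\<lambda>Y. ent Y t s"] by (simp only: ent_times_dgl)
  have 3: "ent X t s \<in> S" for t s using hmS[OF X] scD by blast
  show "\<forall>t s. if t < length qs \<and> s < length ps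
   then ent X t s \<in> S \<and> g (qs ! t) * ent X t s = ent X t s \<and> ent X t s * g (ps ! s) = ent X t s else ent X t s = 0"
  proof (intro allI)
    fix t s
    show "if t < length qs \<and> s < length ps
     then ent X t s \<in> S \<and> g (qs ! t) * ent X t s = ent X t s \<and> ent X t s * g (ps ! s) = ent X t s else ent X t s = 0"
      using 1[of t s] 2[of s t] 3[of t s] by (cases "t < length qs"; cases "s < length ps") simp_all
  qed
next
  assume a: "\<forall>t s. if t < length qs \<and> s < length ps
   then ent X t s \<in> S \<and> g (qs ! t) * ent X t s = ent X t s \<and> ent X t s * g (ps ! s) = ent X t s else ent X t s = 0"
  have 0: "(0::'r) \<in> S" using rcS by (rule rcat.S0)
  have *: "ent X t s \<in> S \<and> ent (dgl qs * X) t s = ent X t s \<and> ent (X * dgl ps) t s = ent X t s" for t s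
    using a[rule_format, of t s] 0 unfolding ent_dgl_times ent_times_dgl
    by (cases "t < length qs"; cases "s < length ps") simp_all
  then show "X \<in> hm (dgl ps) (dgl qs)" by (auto simp: hm_def sc_iff fmat_eq_iff)
qed

definition \<Phi> :: "(nat \<Rightarrow> nat \<Rightarrow> 'a) \<Rightarrow> 'r fmat" where
  "\<Phi> M = Fmat (\<lambda>t s. \<phi> (M t s))"

lemma morD: "is_mor A e1 e2 ps qs M \<Longrightarrow> M t s \<in> carrier A"
  unfolding is_mor_def by (metis A.zero_closed)

lemma ent_\<Phi>: "is_mor A e1 e2 ps qs M \<Longrightarrow> ent (\<Phi> M) t s = \<phi> (M t s)"
  unfolding \<Phi>_def by (subst ent_Fmat[of "length ps + length qs"]) (auto simp: is_mor_def)

lemma mor_iff: "is_mor A e1 e2 ps qs M \<longleftrightarrow> (\<forall>t s. M t s \<in> carrier A) \<and> (\<forall>t s. if t < length qs \<and> s < length ps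
   then g (qs ! t) * \<phi> (M t s) = \<phi> (M t s) \<and> \<phi> (M t s) * g (ps ! s) = \<phi> (M t s) else \<phi> (M t s) = 0)" (is "_ \<longleftrightarrow> ?C \<and> ?D")
proof -
  have 1: "M t s = L b \<otimes>\<^bsub>A\<^esub> M t s \<otimes>\<^bsub>A\<^esub> L c \<longleftrightarrow> g b * \<phi> (M t s) = \<phi> (M t s) \<and> \<phi> (M t s) * g c = \<phi> (M t s)"
    if "M t s \<in> carrier A" for t s b c
  proof -
    have "M t s = L b \<otimes>\<^bsub>A\<^esub> M t s \<otimes>\<^bsub>A\<^esub> L c \<longleftrightarrow> \<phi> (M t s) = \<phi> (L b \<otimes>\<^bsub>A\<^esub> M t s \<otimes>\<^bsub>A\<^esub> L c)"
      using inj that by (subst inj_on_eq_iff[OF inj]) auto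
    also have "\<dots> \<longleftrightarrow> \<phi> (M t s) = g b * \<phi> (M t s) * g c" using that by (simp add: \<phi>_mult)
    also have "\<dots> \<longleftrightarrow> g b * \<phi> (M t s) = \<phi> (M t s) \<and> \<phi> (M t s) * g c = \<phi> (M t s)"
      using g_idem by (metis mult.assoc)
    finally show ?thesis .
  qed
  have 2: "M t s = \<zero>\<^bsub>A\<^esub> \<longleftrightarrow> \<phi> (M t s) = 0" if "M t s \<in> carrier A" for t s
    using inj_on_eq_iff[OF inj that A.zero_closed] by simp
  have 3: "is_mor A e1 e2 ps qs M \<Longrightarrow> ?C" using morD by blast
  show ?thesis
  proof (cases ?C)
    case True then show ?thesis unfolding is_mor_def using 1 2 by (metis (no_types, lifting))
  qed (use 3 in blast)
qed

lemma \<Phi>_hm: "is_mor A e1 e2 ps qs M \<Longrightarrow> \<Phi> M \<in> hm (dgl ps) (dgl qs)"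
  unfolding hm_dgl by (simp add: ent_\<Phi>) (metis mor_iff \<phi>S)

lemma \<Phi>_inj: "is_mor A e1 e2 ps qs M \<Longrightarrow> is_mor A e1 e2 ps' qs' N \<Longrightarrow> \<Phi> M = \<Phi> N \<Longrightarrow> M = N"
proof (intro ext)
  fix t s assume M: "is_mor A e1 e2 ps qs M" and N: "is_mor A e1 e2 ps' qs' N" and e: "\<Phi> M = \<Phi> N"
  have "\<phi> (M t s) = \<phi> (N t s)" using arg_cong[OF e, of "\<lambda>X. ent X t s"] by (simp add: ent_\<Phi>[OF M] ent_\<Phi>[OF N])
  then show "M t s = N t s" by (rule inj_onD[OF inj _ morD[OF M] morD[OF N]])
qed

lemma \<Phi>_surj: assumes "X \<in> hm (dgl ps) (dgl qs)" obtains M where "is_mor A e1 e2 ps qs M" "\<Phi> M = X"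
proof -
  have ex: "\<exists>m\<in>carrier A. \<phi> m = ent X t s" for t s
  proof (cases "t < length qs \<and> s < length ps")
    case True
    then have "ent X t s \<in> \<phi> ` carrier A" using assms corner_g unfolding hm_dgl by meson
    then show ?thesis by force
  next
    case False
    then have "ent X t s = 0" using assms unfolding hm_dgl by meson
    then show ?thesis using \<phi>_zero A.zero_closed by metis
  qed
  define M where "M t s = (SOME m. m \<in> carrier A \<and> \<phi> m = ent X t s)" for t s
  have M: "M t s \<in> carrier A" "\<phi> (M t s) = ent X t s" for t s
    using someI_ex[of "\<lambda>m. m \<in> carrier A \<and> \<phi> m = ent X t s"] ex[of t s] unfolding M_def by blast+
  have m: "is_mor A e1 e2 ps qs M" unfolding mor_iff M(2) using assms M(1) unfolding hm_dgl by meson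
  then show ?thesis using that by (auto simp: fmat_eq_iff ent_\<Phi> M)
qed

lemma mor_of_ent: assumes "\<And>t s. M t s \<in> carrier A" "\<And>t s. \<phi> (M t s) = ent X t s" "X \<in> hm (dgl ps) (dgl qs)"
  shows "is_mor A e1 e2 ps qs M" "\<Phi> M = X"
proof -
  show m: "is_mor A e1 e2 ps qs M" unfolding mor_iff using assms unfolding hm_dgl by auto
  show "\<Phi> M = X" using assms by (auto simp: fmat_eq_iff ent_\<Phi>[OF m])
qed

lemma mor_mcomp: assumes "is_mor A e1 e2 ps qs M" "is_mor A e1 e2 qs rs N" "n = length qs"
  shows "is_mor A e1 e2 ps rs (mcomp A n N M)" "\<Phi> (mcomp A n N M) = \<Phi> N * \<Phi> M"
proof -
  have c: "N t r \<otimes>\<^bsub>A\<^esub> M r s \<in> carrier A" for t r s using morD assms by blast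
  then have cc: "mcomp A n N M t s \<in> carrier A" for t s unfolding mcomp_def by (auto intro!: A.finsum_closed)
  have b: "bnd (\<Phi> N) (length qs + length rs)"
    using assms(2) by (auto simp: bnd_def ent_\<Phi>[OF assms(2)] mor_iff)
  have "ent (\<Phi> N * \<Phi> M) t s = (\<Sum>r<length qs + length rs. \<phi> (N t r) * \<phi> (M r s))" for t s
    by (simp add: ent_times[OF b] ent_\<Phi>[OF assms(1)] ent_\<Phi>[OF assms(2)])
  also have "\<dots> t s = (\<Sum>r<length qs. \<phi> (N t r) * \<phi> (M r s))" for t s
    by (rule sum.mono_neutral_right) (use assms(1) in \<open>auto simp: mor_iff\<close>)
  finally have e: "\<phi> (mcomp A n N M t s) = ent (\<Phi> N * \<Phi> M) t s" for t s
    unfolding mcomp_def using c \<phi>_finsum[of n] assms(3) by (simp add: \<phi>_mult morD[OF assms(1)] morD[OF assms(2)])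
  show "is_mor A e1 e2 ps rs (mcomp A n N M)" "\<Phi> (mcomp A n N M) = \<Phi> N * \<Phi> M"
    using mor_of_ent[OF cc e] \<Phi>_hm[OF assms(1)] \<Phi>_hm[OF assms(2)] by blast+
qed

lemma mor_madd: assumes "is_mor A e1 e2 ps qs M" "is_mor A e1 e2 ps qs N"
  shows "is_mor A e1 e2 ps qs (madd A M N)" "\<Phi> (madd A M N) = \<Phi> M + \<Phi> N"
proof -
  have c: "madd A M N t s \<in> carrier A" for t s unfolding madd_def using morD assms by blast
  have e: "\<phi> (madd A M N t s) = ent (\<Phi> M + \<Phi> N) t s" for t s
    unfolding madd_def using assms by (simp add: \<phi>_add ent_\<Phi>[OF assms(1)] ent_\<Phi>[OF assms(2)] morD[OF assms(1)] morD[OF assms(2)])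
  show "is_mor A e1 e2 ps qs (madd A M N)" "\<Phi> (madd A M N) = \<Phi> M + \<Phi> N"
    using mor_of_ent[OF c e] \<Phi>_hm[OF assms(1)] \<Phi>_hm[OF assms(2)] by blast+
qed

lemma mor_mid: "is_mor A e1 e2 ps ps (mid A e1 e2 ps)" "\<Phi> (mid A e1 e2 ps) = dgl ps"
proof -
  have 1: "mid A e1 e2 ps t s \<in> carrier A" for t s by (auto simp: mid_def)
  have 2: "\<phi> (mid A e1 e2 ps t s) = ent (dgl ps) t s" for t s by (auto simp: mid_def ent_dgl)
  show "is_mor A e1 e2 ps ps (mid A e1 e2 ps)" "\<Phi> (mid A e1 e2 ps) = dgl ps"
    using mor_of_ent[OF 1 2] idp_hm[OF dgl_idp] by blast+
qed

lemma mor_mzero: "is_mor A e1 e2 ps qs (mzero A)" "\<Phi> (mzero A) = 0"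
proof -
  have 1: "mzero A t s \<in> carrier A" for t s by (auto simp: mzero_def)
  have 2: "\<phi> (mzero A t s) = ent 0 t s" for t s by (auto simp: mzero_def)
  show "is_mor A e1 e2 ps qs (mzero A)" "\<Phi> (mzero A) = 0"
    using mor_of_ent[OF 1 2 hm_0] by blast+
qed

lemma fr_dgl: "fr (dgl ps) (mset ps)"
proof (induction ps rule: rev_induct)
  case Nil
  have "dgl [] = 0" by (simp add: fmat_eq_iff ent_dgl)
  then show ?case using fr0 by simp
next
  case (snoc b ps)
  let ?n = "length ps"
  let ?g = "E ?n ?n (g b)"
  have eq: "dgl (ps @ [b]) = dgl ps + ?g"
    by (auto simp: fmat_eq_iff ent_dgl nth_append)
  have i: "local.iso (E 0 0 (g b)) ?g"
    by (rule isoI[of "E ?n 0 (g b)" _ _ "E 0 ?n (g b)"])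
      (use rcS in \<open>auto simp: hm_def sc_iff rcat.S0\<close>)
  have "dgl ps * ?g = 0" "?g * dgl ps = 0"
    by (auto simp: fmat_eq_iff ent_dgl_times ent_times_dgl ent_dgl)
  from frS[OF snoc i this] show ?case by (simp add: eq)
qed

definition cxr :: "'a cx \<Rightarrow> 'r fmat \<times> 'r fmat \<times> 'r fmat" where
  "cxr T = (dgl (cm1 T), dgl (c0 T), \<Phi> (cd T))"

lemma cxr_cx: "is_cx A e1 e2 T \<Longrightarrow> cx (cxr T)"
  using fr_dgl \<Phi>_hm by (auto simp: is_cx_def cxr_def cx_def)

lemma cxr_gv: "gv (cxr T) = gvec T"
proof -
  have l: "length (filter (\<lambda>x. x = c) ps) = count (mset ps) c" for c :: bool and ps
    by (induction ps) auto
  show ?thesis by (simp add: l del: eq_True eq_False add: gvec_def gv_def cxr_def nm_eq[OF fr_dgl] cnt_def)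
qed

lemma cxr_hom1: assumes "is_cx A e1 e2 T"
  shows "presilting A e1 e2 T \<longleftrightarrow> hom1 (cxr T) (cxr T)"
proof
  have d: "is_mor A e1 e2 (cm1 T) (c0 T) (cd T)" using assms by (simp add: is_cx_def)
  {
    assume p: "presilting A e1 e2 T"
    show "hom1 (cxr T) (cxr T)" unfolding hom1_def cxr_def prod.case
    proof
      fix F assume "F \<in> hm (dgl (cm1 T)) (dgl (c0 T))"
      then obtain f where f: "is_mor A e1 e2 (cm1 T) (c0 T) f" "\<Phi> f = F" by (rule \<Phi>_surj)
      obtain h h' where h: "is_mor A e1 e2 (c0 T) (c0 T) h" "is_mor A e1 e2 (cm1 T) (cm1 T) h'"
        "f = madd A (mcomp A (length (c0 T)) h (cd T)) (mcomp A (length (cm1 T)) (cd T) h')"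
        using p f(1) unfolding presilting_def by blast
      note mm = mor_mcomp[OF d h(1) refl] mor_mcomp[OF h(2) d refl]
      have "F = \<Phi> h * \<Phi> (cd T) + \<Phi> (cd T) * \<Phi> h'"
        unfolding f(2)[symmetric] h(3) by (simp add: mor_madd(2)[OF mm(1,3)] mm)
      then show "\<exists>h\<in>hm (dgl (c0 T)) (dgl (c0 T)). \<exists>h'\<in>hm (dgl (cm1 T)) (dgl (cm1 T)). F = h * \<Phi> (cd T) + \<Phi> (cd T) * h'"
        using \<Phi>_hm h by blast
    qed
  next
    assume hm: "hom1 (cxr T) (cxr T)"
    show "presilting A e1 e2 T" unfolding presilting_def
    proof (intro conjI allI impI assms)
      fix f assume f: "is_mor A e1 e2 (cm1 T) (c0 T) f"
      obtain H H' where H: "H \<in> hm (dgl (c0 T)) (dgl (c0 T))" "H' \<in> hm (dgl (cm1 T)) (dgl (cm1 T))" "\<Phi> f = H * \<Phi> (cd T) + \<Phi> (cd T) * H'"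
        using hm \<Phi>_hm[OF f] unfolding hom1_def cxr_def prod.case by blast
      obtain h h' where h: "is_mor A e1 e2 (c0 T) (c0 T) h" "\<Phi> h = H" "is_mor A e1 e2 (cm1 T) (cm1 T) h'" "\<Phi> h' = H'"
        using \<Phi>_surj H by metis
      note mm = mor_mcomp[OF d h(1) refl] mor_mcomp[OF h(3) d refl]
      have "f = madd A (mcomp A (length (c0 T)) h (cd T)) (mcomp A (length (cm1 T)) (cd T) h')"
        by (rule \<Phi>_inj[OF f mor_madd(1)[OF mm(1,3)]]) (simp add: mor_madd(2)[OF mm(1,3)] mm h H(3))
      then show "\<exists>h h'. is_mor A e1 e2 (c0 T) (c0 T) h \<and> is_mor A e1 e2 (cm1 T) (cm1 T) h' \<and>
           f = madd A (mcomp A (length (c0 T)) h (cd T)) (mcomp A (length (cm1 T)) (cd T) h')" using h by blast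
    qed
  }
qed

lemma homotopic_iff: assumes "is_cx A e1 e2 T" "is_cx A e1 e2 T'"
  "is_mor A e1 e2 (cm1 T) (cm1 T') (fst f)" "is_mor A e1 e2 (c0 T) (c0 T') (snd f)"
  "is_mor A e1 e2 (cm1 T) (cm1 T') (fst f')" "is_mor A e1 e2 (c0 T) (c0 T') (snd f')"
  shows "homotopic A e1 e2 T T' f f' \<longleftrightarrow> (\<exists>h\<in>hm (dgl (c0 T)) (dgl (cm1 T')).
     \<Phi> (snd f) = \<Phi> (snd f') + \<Phi> (cd T') * h \<and> \<Phi> (fst f) = \<Phi> (fst f') + h * \<Phi> (cd T))"
proof
  have d: "is_mor A e1 e2 (cm1 T) (c0 T) (cd T)" "is_mor A e1 e2 (cm1 T') (c0 T') (cd T')" using assms by (simp_all add: is_cx_def)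
  {
    assume "homotopic A e1 e2 T T' f f'"
    then obtain h where h: "is_mor A e1 e2 (c0 T) (cm1 T') h" "snd f = madd A (snd f') (mcomp A (length (cm1 T')) (cd T') h)"
      "fst f = madd A (fst f') (mcomp A (length (c0 T)) h (cd T))" unfolding homotopic_def by blast
    note mm = mor_mcomp[OF d(1) h(1) refl] mor_mcomp[OF h(1) d(2) refl]
    show "\<exists>h\<in>hm (dgl (c0 T)) (dgl (cm1 T')).
     \<Phi> (snd f) = \<Phi> (snd f') + \<Phi> (cd T') * h \<and> \<Phi> (fst f) = \<Phi> (fst f') + h * \<Phi> (cd T)"
      by (rule bexI[OF _ \<Phi>_hm[OF h(1)]]) (simp add: h(2,3) mor_madd[OF assms(6) mm(3)] mor_madd[OF assms(5) mm(1)] mm)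
  next
    assume "\<exists>h\<in>hm (dgl (c0 T)) (dgl (cm1 T')).
     \<Phi> (snd f) = \<Phi> (snd f') + \<Phi> (cd T') * h \<and> \<Phi> (fst f) = \<Phi> (fst f') + h * \<Phi> (cd T)"
    then obtain H where H: "H \<in> hm (dgl (c0 T)) (dgl (cm1 T'))" "\<Phi> (snd f) = \<Phi> (snd f') + \<Phi> (cd T') * H" "\<Phi> (fst f) = \<Phi> (fst f') + H * \<Phi> (cd T)" by blast
    obtain h where h: "is_mor A e1 e2 (c0 T) (cm1 T') h" "\<Phi> h = H" using \<Phi>_surj H(1) by blast
    note mm = mor_mcomp[OF d(1) h(1) refl] mor_mcomp[OF h(1) d(2) refl]
    have "snd f = madd A (snd f') (mcomp A (length (cm1 T')) (cd T') h)"
      by (rule \<Phi>_inj[OF assms(4) mor_madd(1)[OF assms(6) mm(3)]]) (simp add: mor_madd[OF assms(6) mm(3)] mm h H)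
    moreover have "fst f = madd A (fst f') (mcomp A (length (c0 T)) h (cd T))"
      by (rule \<Phi>_inj[OF assms(3) mor_madd(1)[OF assms(5) mm(1)]]) (simp add: mor_madd[OF assms(5) mm(1)] mm h H)
    ultimately show "homotopic A e1 e2 T T' f f'" unfolding homotopic_def using h(1) by blast
  }
qed

lemma zero_K_iff: assumes "is_cx A e1 e2 T" shows "zero_K A e1 e2 T \<longleftrightarrow> zk (cxr T)"
  unfolding zero_K_def zk_def cxr_def prod.case
  by (subst homotopic_iff) (auto simp: assms chain_id_def mor_mid mor_mzero)

lemma iso_K_iff: assumes "is_cx A e1 e2 T" "is_cx A e1 e2 T'" shows "iso_K A e1 e2 T T' \<longleftrightarrow> kiso (cxr T) (cxr T')"
proof
  have d: "is_mor A e1 e2 (cm1 T) (c0 T) (cd T)" "is_mor A e1 e2 (cm1 T') (c0 T') (cd T')" using assms by (simp_all add: is_cx_def)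
  {
    assume "iso_K A e1 e2 T T'"
    then obtain f g where fg: "chain_map A e1 e2 T T' f" "chain_map A e1 e2 T' T g"
      "homotopic A e1 e2 T T (chain_comp A T' g f) (chain_id A e1 e2 T)"
      "homotopic A e1 e2 T' T' (chain_comp A T f g) (chain_id A e1 e2 T')" unfolding iso_K_def by blast
    have f: "is_mor A e1 e2 (cm1 T) (cm1 T') (fst f)" "is_mor A e1 e2 (c0 T) (c0 T') (snd f)"
      "mcomp A (length (cm1 T')) (cd T') (fst f) = mcomp A (length (c0 T)) (snd f) (cd T)" using fg(1) by (auto simp: chain_map_def)
    have g: "is_mor A e1 e2 (cm1 T') (cm1 T) (fst g)" "is_mor A e1 e2 (c0 T') (c0 T) (snd g)"
      "mcomp A (length (cm1 T)) (cd T) (fst g) = mcomp A (length (c0 T')) (snd g) (cd T')" using fg(2) by (auto simp: chain_map_def)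
    have fe: "\<Phi> (snd f) * \<Phi> (cd T) = \<Phi> (cd T') * \<Phi> (fst f)" "\<Phi> (snd g) * \<Phi> (cd T') = \<Phi> (cd T) * \<Phi> (fst g)"
      using arg_cong[OF f(3), of \<Phi>] arg_cong[OF g(3), of \<Phi>]
      by (simp_all add: mor_mcomp[OF f(1) d(2)] mor_mcomp[OF d(1) f(2)] mor_mcomp[OF g(1) d(1)] mor_mcomp[OF d(2) g(2)])
    note mm = mor_mcomp[OF f(1) g(1) refl] mor_mcomp[OF f(2) g(2) refl] mor_mcomp[OF g(1) f(1) refl] mor_mcomp[OF g(2) f(2) refl]
    obtain h where h: "h \<in> hm (dgl (c0 T)) (dgl (cm1 T))" "\<Phi> (snd g) * \<Phi> (snd f) = dgl (c0 T) + \<Phi> (cd T) * h"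
        "\<Phi> (fst g) * \<Phi> (fst f) = dgl (cm1 T) + h * \<Phi> (cd T)"
      using fg(3) by (subst (asm) homotopic_iff) (auto simp: assms chain_comp_def chain_id_def mor_mid mm)
    obtain k where k: "k \<in> hm (dgl (c0 T')) (dgl (cm1 T'))" "\<Phi> (snd f) * \<Phi> (snd g) = dgl (c0 T') + \<Phi> (cd T') * k"
        "\<Phi> (fst f) * \<Phi> (fst g) = dgl (cm1 T') + k * \<Phi> (cd T')"
      using fg(4) by (subst (asm) homotopic_iff) (auto simp: assms chain_comp_def chain_id_def mor_mid mm)
    \<comment> \<open>Signs: \<open>homotopic\<close> expresses the composite as the identity plus a
      null-homotopic map, \<open>kiso\<close> the identity as the composite plus such a map.\<close>
    show "kiso (cxr T) (cxr T')" unfolding cxr_def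
      by (rule kisoI[of "\<Phi> (fst g)" _ _ "\<Phi> (snd g)" _ _ "\<Phi> (fst f)" "\<Phi> (snd f)" "- k" "- h"])
        (use f g h k fe in \<open>auto intro: \<Phi>_hm simp: algebra_simps\<close>)
  next
    assume "kiso (cxr T) (cxr T')"
    then obtain i1 i0 r1 r0 s t where h: "i1 \<in> hm (dgl (cm1 T')) (dgl (cm1 T))" "i0 \<in> hm (dgl (c0 T')) (dgl (c0 T))"
       "r1 \<in> hm (dgl (cm1 T)) (dgl (cm1 T'))" "r0 \<in> hm (dgl (c0 T)) (dgl (c0 T'))" "s \<in> hm (dgl (c0 T')) (dgl (cm1 T'))" "t \<in> hm (dgl (c0 T)) (dgl (cm1 T))"
     and e: "i0 * \<Phi> (cd T') = \<Phi> (cd T) * i1" "r0 * \<Phi> (cd T) = \<Phi> (cd T') * r1" "dgl (cm1 T') = r1 * i1 + s * \<Phi> (cd T')" "dgl (c0 T') = r0 * i0 + \<Phi> (cd T') * s"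
     "dgl (cm1 T) = i1 * r1 + t * \<Phi> (cd T)" "dgl (c0 T) = i0 * r0 + \<Phi> (cd T) * t"
      unfolding kiso_def cxr_def by auto
    obtain f1 f0 g1 g0 where m: "is_mor A e1 e2 (cm1 T) (cm1 T') f1" "\<Phi> f1 = r1" "is_mor A e1 e2 (c0 T) (c0 T') f0" "\<Phi> f0 = r0"
      "is_mor A e1 e2 (cm1 T') (cm1 T) g1" "\<Phi> g1 = i1" "is_mor A e1 e2 (c0 T') (c0 T) g0" "\<Phi> g0 = i0"
      using \<Phi>_surj h by metis
    note mm = mor_mcomp[OF m(1) m(5) refl] mor_mcomp[OF m(3) m(7) refl] mor_mcomp[OF m(5) m(1) refl] mor_mcomp[OF m(7) m(3) refl]
    note md = mor_mcomp[OF m(1) d(2) refl] mor_mcomp[OF d(1) m(3) refl] mor_mcomp[OF m(5) d(1) refl] mor_mcomp[OF d(2) m(7) refl]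
    have 1: "chain_map A e1 e2 T T' (f1, f0)" unfolding chain_map_def fst_conv snd_conv
      using m \<Phi>_inj[OF md(1) md(3)] by (simp add: md m e)
    have 2: "chain_map A e1 e2 T' T (g1, g0)" unfolding chain_map_def fst_conv snd_conv
      using m \<Phi>_inj[OF md(5) md(7)] by (simp add: md m e)
    have 3: "homotopic A e1 e2 T T (chain_comp A T' (g1, g0) (f1, f0)) (chain_id A e1 e2 T)"
      using h e(5,6) by (subst homotopic_iff) (auto simp: assms chain_comp_def chain_id_def mor_mid mm m algebra_simps intro!: bexI[of _ "- t"])
    have 4: "homotopic A e1 e2 T' T' (chain_comp A T (f1, f0) (g1, g0)) (chain_id A e1 e2 T')"
      using h e(3,4) by (subst homotopic_iff) (auto simp: assms chain_comp_def chain_id_def mor_mid mm m algebra_simps intro!: bexI[of _ "- s"])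
    show "iso_K A e1 e2 T T'" unfolding iso_K_def using 1 2 3 4 by blast
  }
qed

end

section \<open>Direct sums of complexes, and the fan of the algebra as the fan of the matrix
  category\<close>

context rep begin

interpretation A: ring A by (rule ringA)

text \<open>The isomorphism that moves the block \<open>ps\<close> from offset \<open>b\<close> to
  offset \<open>a\<close>. With \<open>a = b\<close> it is a block projection; with one offset 0 it
  is the inclusion or the retraction of a summand.\<close>

definition shd :: "nat \<Rightarrow> nat \<Rightarrow> bool list \<Rightarrow> 'r fmat" where
  "shd a b ps = Fmat (\<lambda>t s. if a \<le> t \<and> t < a + length ps \<and> s + a = t + b then g (ps ! (t - a)) else 0)"

lemma ent_shd: "ent (shd a b ps) t s = (if a \<le> t \<and> t < a + length ps \<and> s + a = t + b then g (ps ! (t - a)) else 0)"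
  unfolding shd_def by (subst ent_Fmat[of "a + b + length ps"]) auto

lemma bnd_shd: "bnd (shd a b ps) (a + b + length ps)" by (auto simp: bnd_def ent_shd)

lemma ent_shd_times: "ent (shd a b ps * X) t s = (if a \<le> t \<and> t < a + length ps then g (ps ! (t - a)) * ent X (t - a + b) s else 0)"
proof -
  have "ent (shd a b ps * X) t s = (\<Sum>k<a + b + length ps. if k = t - a + b then (if a \<le> t \<and> t < a + length ps then g (ps ! (t - a)) * ent X (t - a + b) s else 0) else 0)"
    unfolding ent_times[OF bnd_shd] by (rule sum.cong) (auto simp: ent_shd)
  then show ?thesis by (cases "a \<le> t \<and> t < a + length ps") auto
qed

lemma ent_times_shd: "ent (X * shd a b ps) t s = (if b \<le> s \<and> s < b + length ps then ent X t (s - b + a) * g (ps ! (s - b)) else 0)"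
proof -
  have "ent (X * shd a b ps) t s = (\<Sum>k<a + b + length ps. if k = s - b + a then (if b \<le> s \<and> s < b + length ps then ent X t (s - b + a) * g (ps ! (s - b)) else 0) else 0)"
    unfolding ent_times'[OF bnd_shd]
  proof (rule sum.cong[OF refl])
    fix k
    show "ent X t k * ent (shd a b ps) k s = (if k = s - b + a then (if b \<le> s \<and> s < b + length ps then ent X t (s - b + a) * g (ps ! (s - b)) else 0) else 0)"
    proof (cases "a \<le> k \<and> k < a + length ps \<and> s + a = k + b")
      case True
      then have "k = s - b + a" "b \<le> s \<and> s < b + length ps" "k - a = s - b" by auto
      then show ?thesis using True by (simp add: ent_shd)
    qed (auto simp: ent_shd)
  qed
  then show ?thesis by (cases "b \<le> s \<and> s < b + length ps") auto
qed

lemma shd_dgl: "shd 0 0 ps = dgl ps" by (auto simp: fmat_eq_iff ent_shd ent_dgl)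

lemma shd_mult: "shd a b ps * shd b c ps = shd a c ps"
  by (auto simp: fmat_eq_iff ent_shd_times ent_shd)

lemma shd_orth: "b + length ps \<le> c \<or> c + length qs \<le> b \<Longrightarrow> shd a b ps * shd c d qs = 0"
  by (auto simp: fmat_eq_iff ent_shd_times ent_shd)

lemma shd_append: "dgl (ps @ ps') = dgl ps + shd (length ps) (length ps) ps'"
  by (auto simp: fmat_eq_iff ent_shd ent_dgl nth_append)

lemma shd_S: "shd a b ps \<in> sc S"
  using rcat.S0[OF rcS] by (auto simp: sc_iff ent_shd)

lemma ent_shd_conj: "ent (shd a 0 qs * X * shd 0 b ps) t s = (if a \<le> t \<and> t < a + length qs \<and> b \<le> s \<and> s < b + length ps
  then g (qs ! (t - a)) * ent X (t - a) (s - b) * g (ps ! (s - b)) else 0)"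
  by (simp add: ent_times_shd ent_shd_times)

text \<open>The external sum becomes an internal decomposition. The first summand keeps its
  position, hence the equality for \<open>T\<close>; the second is shifted, so \<open>T'\<close> is
  matched only up to isomorphism.\<close>

lemma cx_sum_split:
  assumes T: "is_cx A e1 e2 T" "is_cx A e1 e2 T'" and "cxr (cx_sum A T T') = (p, q, d)"
  shows "is_cx A e1 e2 (cx_sum A T T')"
    and "\<exists>e f. e \<in> hm p p \<and> f \<in> hm q q \<and> e * e = e \<and> f * f = f \<and> f * d = d * e \<and>
      (e, f, d * e) = cxr T \<and> siso (p - e, q - f, d * (p - e)) (cxr T')"
proof -
  obtain ps qs M ps' qs' M' where TT: "T = (ps, qs, M)" "T' = (ps', qs', M')" by (cases T; cases T')
  have M: "is_mor A e1 e2 ps qs M" "is_mor A e1 e2 ps' qs' M'" using T by (simp_all add: is_cx_def TT cm1_def c0_def cd_def)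
  let ?a = "length qs" and ?b = "length ps"
  let ?B = "mblock A ?a ?b M M'"
  \<comment> \<open>Inclusions (J) and retractions (R) of the second summand, in degree 0 and degree
    -1.\<close>
  define J0 J1 R0 R1 where "J0 = shd ?a 0 qs'" and "J1 = shd ?b 0 ps'" and "R0 = shd 0 ?a qs'" and "R1 = shd 0 ?b ps'"
  define D where "D = \<Phi> M + J0 * \<Phi> M' * R1"
  have h: "\<Phi> M \<in> hm (dgl ps) (dgl qs)" "\<Phi> M' \<in> hm (dgl ps') (dgl qs')" using \<Phi>_hm M by auto
  have J: "R0 * J0 = dgl qs'" "R1 * J1 = dgl ps'" "J0 * R0 = dgl (qs @ qs') - dgl qs" "J1 * R1 = dgl (ps @ ps') - dgl ps"
    "dgl qs * J0 = 0" "R0 * dgl qs = 0" "dgl ps * J1 = 0" "R1 * dgl ps = 0"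
    by (simp_all add: J0_def J1_def R0_def R1_def shd_mult shd_append)
      (simp_all add: shd_dgl[symmetric] shd_mult shd_orth)
  have JS: "J0 \<in> sc S" "J1 \<in> sc S" "R0 \<in> sc S" "R1 \<in> sc S" by (simp_all add: J0_def J1_def R0_def R1_def shd_S)
  have dd: "dgl ps * dgl ps = dgl ps" "dgl qs * dgl qs = dgl qs" "dgl ps' * dgl ps' = dgl ps'" "dgl qs' * dgl qs' = dgl qs'"
    using dgl_idp by (auto simp: idp_def)
  have JJ: "J0 * dgl qs' = J0" "J1 * dgl ps' = J1" "dgl qs' * R0 = R0" "dgl ps' * R1 = R1"
    by (simp_all add: J0_def J1_def R0_def R1_def shd_mult flip: shd_dgl)
  have PJ: "dgl (qs @ qs') = dgl qs + J0 * R0" "dgl (ps @ ps') = dgl ps + J1 * R1" by (simp_all add: J)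
  have cv: "?B t s \<in> carrier A" for t s using morD[OF M(1)] morD[OF M(2)] by (simp add: mblock_def)
  have ent: "\<phi> (?B t s) = ent D t s" for t s
  proof -
    have 1: "ent D t s = \<phi> (M t s) + (if ?a \<le> t \<and> t < ?a + length qs' \<and> ?b \<le> s \<and> s < ?b + length ps'
       then g (qs' ! (t - ?a)) * \<phi> (M' (t - ?a) (s - ?b)) * g (ps' ! (s - ?b)) else 0)"
      by (simp add: D_def J0_def R1_def ent_shd_conj ent_\<Phi>[OF M(1)] ent_\<Phi>[OF M(2)])
    have 2: "\<phi> (M t s) = 0" if "\<not> (t < ?a \<and> s < ?b)" using M(1) that unfolding mor_iff by meson
    have 5: "\<phi> (M' t s) = 0" if "\<not> (t < length qs' \<and> s < length ps')" for t s using M(2) that unfolding mor_iff by meson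
    have 4: "g (qs' ! t) * \<phi> (M' t s) * g (ps' ! s) = \<phi> (M' t s)" if "t < length qs'" "s < length ps'" for t s
    proof -
      have "g (qs' ! t) * \<phi> (M' t s) = \<phi> (M' t s) \<and> \<phi> (M' t s) * g (ps' ! s) = \<phi> (M' t s)"
        using M(2) that unfolding mor_iff by meson
      then show ?thesis by simp
    qed
    consider "t < ?a" "s < ?b" | "?a \<le> t" "?b \<le> s" "t - ?a < length qs'" "s - ?b < length ps'"
      | "?a \<le> t" "?b \<le> s" "\<not> (t - ?a < length qs' \<and> s - ?b < length ps')" | "t < ?a" "?b \<le> s" | "?a \<le> t" "s < ?b"
      by linarith
    then show ?thesis
    proof cases
      case 2
      then show ?thesis unfolding 1 using \<open>\<not> (t < ?a \<and> s < ?b) \<Longrightarrow> \<phi> (M t s) = 0\<close> 4[OF 2(3,4)] by (auto simp: mblock_def)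
    next
      case 3
      then show ?thesis unfolding 1 using \<open>\<not> (t < ?a \<and> s < ?b) \<Longrightarrow> \<phi> (M t s) = 0\<close> 5[OF 3(3)] by (auto simp: mblock_def)
    qed (use 2 in \<open>auto simp: 1 mblock_def\<close>)
  qed
  have oo: "J1 * R1 * dgl ps = 0" "dgl ps * (J1 * R1) = 0" "J0 * R0 * dgl qs = 0" "dgl qs * (J0 * R0) = 0"
    "J1 * R1 * (J1 * R1) = J1 * R1" "J0 * R0 * (J0 * R0) = J0 * R0"
    by (simp_all add: mult.assoc J(1,2,5-8) JJ asr[OF J(5)] asr[OF J(7)] asr[OF J(1)] asr[OF J(2)] asr[OF JJ(3)] asr[OF JJ(4)])
  have MJ: "\<Phi> M * J1 = 0" "R0 * \<Phi> M = 0"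
    using hmR2[OF h(1), of J1] hmL[OF h(1)] J(6,7) by (simp, metis mult.assoc mult_zero_left)
  have Dhm: "D \<in> hm (dgl (ps @ ps')) (dgl (qs @ qs'))"
  proof (rule hmI)
    show "D \<in> sc S" unfolding D_def using hmS[OF h(1)] hmS[OF h(2)] JS by auto
    show "dgl (qs @ qs') * D = D" unfolding D_def PJ
      using hmL[OF h(1)] hmL2[OF h(2)] J(1,5) JJ(1) MJ
      by (simp add: algebra_simps asr[OF J(5)] asr[OF J(1)])
    show "D * dgl (ps @ ps') = D" unfolding D_def PJ
      using hmR[OF h(1)] hmR[OF h(2)] J(2,8) JJ(4) MJ
      by (simp add: algebra_simps asr[OF J(2)] asr[OF MJ(1)])
  qed
  have eqs: "cx_sum A T T' = (ps @ ps', qs @ qs', ?B)" by (simp add: cx_sum_def TT cm1_def c0_def cd_def)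
  show "is_cx A e1 e2 (cx_sum A T T')" unfolding is_cx_def eqs
    using mor_of_ent(1)[OF cv ent Dhm] by (simp add: cm1_def c0_def cd_def)
  have B: "\<Phi> ?B = D" by (rule mor_of_ent(2)[OF cv ent Dhm])
  have pqd: "p = dgl (ps @ ps')" "q = dgl (qs @ qs')" "d = D"
    using assms(3) by (simp_all add: eqs cxr_def cm1_def c0_def cd_def B)
  let ?e = "dgl ps" and ?f = "dgl qs"
  have e: "?e \<in> hm p p" "?f \<in> hm q q"
    using dgl_idp oo dd unfolding pqd PJ by (auto simp: hm_def idp_def algebra_simps)
  have De: "D * ?e = \<Phi> M" "?f * D = \<Phi> M"
    unfolding D_def using hmL[OF h(1)] hmR[OF h(1)] J(8,5) by (simp_all add: algebra_simps asr[OF J(5)])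
  have DJ: "D * J1 = J0 * \<Phi> M'" "R0 * D = \<Phi> M' * R1"
    unfolding D_def using MJ J(1,2) hmR[OF h(2)] hmL[OF h(2)] by (simp_all add: algebra_simps asr[OF J(1)] hmL2[OF h(2)])
  have pe: "p - ?e = J1 * R1" "q - ?f = J0 * R0" by (simp_all add: pqd PJ)
  have "siso (p - ?e, q - ?f, d * (p - ?e)) (dgl ps', dgl qs', \<Phi> M')"
    unfolding pe pqd(3)
  proof (rule sisoI[of J1 _ _ J0 _ _ R1 R0])
    show "J1 \<in> hm (dgl ps') (J1 * R1)" "J0 \<in> hm (dgl qs') (J0 * R0)" "R1 \<in> hm (J1 * R1) (dgl ps')" "R0 \<in> hm (J0 * R0) (dgl qs')"
      using J(1,2) JJ JS by (auto simp: hm_def mult.assoc asr[OF J(1)] asr[OF J(2)])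
    show "J0 * \<Phi> M' = D * (J1 * R1) * J1" using J(2) JJ DJ by (simp add: mult.assoc)
    show "R0 * (D * (J1 * R1)) = \<Phi> M' * R1" using J(2) JJ DJ(2) by (simp add: asr[OF DJ(2)] mult.assoc asr[OF J(2)])
    show "dgl ps' = R1 * J1" "dgl qs' = R0 * J0" "J1 * R1 = J1 * R1" "J0 * R0 = J0 * R0" using J by simp_all
  qed
  moreover have "cxr T = (?e, ?f, d * ?e)" "cxr T' = (dgl ps', dgl qs', \<Phi> M')"
    using De by (simp_all add: cxr_def TT cm1_def c0_def cd_def pqd)
  moreover have "?f * d = d * ?e" using De by (simp add: pqd)
  ultimately show "\<exists>e f. e \<in> hm p p \<and> f \<in> hm q q \<and> e * e = e \<and> f * f = f \<and> f * d = d * e \<and>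
      (e, f, d * e) = cxr T \<and> siso (p - e, q - f, d * (p - e)) (cxr T')"
    using e dd by (intro exI[of _ ?e] exI[of _ ?f]) auto
qed

lemma cx_sum_hom1:
  assumes T: "is_cx A e1 e2 T" "is_cx A e1 e2 T'" and Y: "cx Y"
  shows "hom1 (cxr (cx_sum A T T')) Y \<longleftrightarrow> hom1 (cxr T) Y \<and> hom1 (cxr T') Y"
    and "hom1 Y (cxr (cx_sum A T T')) \<longleftrightarrow> hom1 Y (cxr T) \<and> hom1 Y (cxr T')"
proof -
  obtain p q d where pqd: "cxr (cx_sum A T T') = (p, q, d)" by (cases "cxr (cx_sum A T T')")
  note sp = cx_sum_split[OF T pqd]
  obtain e f where e: "e \<in> hm p p" "f \<in> hm q q" "e * e = e" "f * f = f" "f * d = d * e" "cxr T = (e, f, d * e)"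
    and s: "siso (p - e, q - f, d * (p - e)) (cxr T')" using sp(2) by metis
  have C: "cx (p, q, d)" "cx (cxr T)" "cx (cxr T')" using cxr_cx sp(1) T pqd by metis+
  have i: "idp p" "idp q" "d \<in> hm p q" using cx_idp C(1) by auto
  have c: "p - e \<in> hm p p" "q - f \<in> hm q q" "(p - e) * (p - e) = p - e" "(q - f) * (q - f) = q - f" "(q - f) * d = d * (p - e)"
    using e i by (auto simp: algebra_simps hmE idpM intro: idp_hm)
  have c': "cx (p - e, q - f, d * (p - e))" by (rule sub_cx[OF C(1) c])
  have hr1: "hr (p, q, d) (cxr T)" unfolding e(6) by (rule sub_hr[OF C(1) e(1-5)])
  have hr2: "hr (p, q, d) (p - e, q - f, d * (p - e))" by (rule sub_hr[OF C(1) c])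
  have k: "hr (p - e, q - f, d * (p - e)) (cxr T')" "hr (cxr T') (p - e, q - f, d * (p - e))" using kiso_hr[OF siso_kiso[OF s]] by auto
  show "hom1 (cxr (cx_sum A T T')) Y \<longleftrightarrow> hom1 (cxr T) Y \<and> hom1 (cxr T') Y"
    unfolding pqd
  proof
    assume a: "hom1 (p, q, d) Y"
    show "hom1 (cxr T) Y \<and> hom1 (cxr T') Y"
      using hom1_hrL[OF hr1 a C(2) Y] hom1_hrL[OF k(1) hom1_hrL[OF hr2 a c' Y] C(3) Y] by blast
  next
    assume a: "hom1 (cxr T) Y \<and> hom1 (cxr T') Y"
    show "hom1 (p, q, d) Y"
      by (rule sub_hom1L[OF C(1) e(1-5)]) (use a e(6) hom1_hrL[OF k(2) _ c' Y] in auto)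
  qed
  show "hom1 Y (cxr (cx_sum A T T')) \<longleftrightarrow> hom1 Y (cxr T) \<and> hom1 Y (cxr T')"
    unfolding pqd
  proof
    assume a: "hom1 Y (p, q, d)"
    show "hom1 Y (cxr T) \<and> hom1 Y (cxr T')"
      using hom1_hrR[OF hr1 a C(2) Y] hom1_hrR[OF k(1) hom1_hrR[OF hr2 a c' Y] C(3) Y] by blast
  next
    assume a: "hom1 Y (cxr T) \<and> hom1 Y (cxr T')"
    show "hom1 Y (p, q, d)"
      by (rule sub_hom1R[OF C(1) e(1-5)]) (use a e(6) hom1_hrR[OF k(2) _ c' Y] in auto)
  qed
qed

lemma cx_sum_list: assumes "\<forall>T\<in>set Ts. is_cx A e1 e2 T"
  shows "is_cx A e1 e2 (cx_sum_list A Ts)"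
    and "cx Y \<Longrightarrow> hom1 (cxr (cx_sum_list A Ts)) Y \<longleftrightarrow> (\<forall>T\<in>set Ts. hom1 (cxr T) Y)"
    and "cx Y \<Longrightarrow> hom1 Y (cxr (cx_sum_list A Ts)) \<longleftrightarrow> (\<forall>T\<in>set Ts. hom1 Y (cxr T))"
proof -
  have "is_cx A e1 e2 (cx_sum_list A Ts) \<and> (\<forall>Y. cx Y \<longrightarrow> (hom1 (cxr (cx_sum_list A Ts)) Y \<longleftrightarrow> (\<forall>T\<in>set Ts. hom1 (cxr T) Y)) \<and>
    (hom1 Y (cxr (cx_sum_list A Ts)) \<longleftrightarrow> (\<forall>T\<in>set Ts. hom1 Y (cxr T))))"
    using assms
  proof (induction Ts)
    case Nil
    have z: "dgl [] = 0" by (auto simp: fmat_eq_iff ent_dgl)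
    have "hom1 (0, 0, 0) Y" "hom1 Y (0, 0, 0)" for Y by (cases Y; auto simp: hom1_def intro: hm_0)+
    then show ?case using mor_mzero by (simp add: cx_sum_list_def is_cx_def cm1_def c0_def cd_def cxr_def z)
  next
    case (Cons T Ts)
    have e: "cx_sum_list A (T # Ts) = cx_sum A T (cx_sum_list A Ts)" by (simp add: cx_sum_list_def)
    have c: "is_cx A e1 e2 T" "is_cx A e1 e2 (cx_sum_list A Ts)" using Cons by auto
    obtain p q d where pqd: "cxr (cx_sum A T (cx_sum_list A Ts)) = (p, q, d)" by (cases "cxr (cx_sum A T (cx_sum_list A Ts))")
    have IH: "hom1 (cxr (cx_sum_list A Ts)) Y \<longleftrightarrow> (\<forall>T\<in>set Ts. hom1 (cxr T) Y)"
      "hom1 Y (cxr (cx_sum_list A Ts)) \<longleftrightarrow> (\<forall>T\<in>set Ts. hom1 Y (cxr T))" if "cx Y" for Y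
    proof -
      have "\<forall>T\<in>set Ts. is_cx A e1 e2 T" using Cons.prems by simp
      from Cons.IH[OF this] that show "hom1 (cxr (cx_sum_list A Ts)) Y \<longleftrightarrow> (\<forall>T\<in>set Ts. hom1 (cxr T) Y)"
        "hom1 Y (cxr (cx_sum_list A Ts)) \<longleftrightarrow> (\<forall>T\<in>set Ts. hom1 Y (cxr T))" by blast+
    qed
    show ?case unfolding e
      using cx_sum_split(1)[OF c pqd] by (simp add: cx_sum_hom1[OF c] IH)
  qed
  then show "is_cx A e1 e2 (cx_sum_list A Ts)"
    "cx Y \<Longrightarrow> hom1 (cxr (cx_sum_list A Ts)) Y \<longleftrightarrow> (\<forall>T\<in>set Ts. hom1 (cxr T) Y)"
    "cx Y \<Longrightarrow> hom1 Y (cxr (cx_sum_list A Ts)) \<longleftrightarrow> (\<forall>T\<in>set Ts. hom1 Y (cxr T))" by blast+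
qed

lemma presilting_list: assumes "\<forall>T\<in>set Ts. is_cx A e1 e2 T"
  shows "presilting A e1 e2 (cx_sum_list A Ts) \<longleftrightarrow> (\<forall>T\<in>set Ts. \<forall>T'\<in>set Ts. hom1 (cxr T) (cxr T'))"
  using cxr_hom1[OF cx_sum_list(1)[OF assms]] cx_sum_list(2,3)[OF assms] cxr_cx cx_sum_list(1)[OF assms] assms by auto

lemma realize: assumes "cx X" obtains T where "is_cx A e1 e2 T" "siso X (cxr T)"
proof -
  obtain p q d where X: "X = (p, q, d)" by (cases X)
  obtain N M where NM: "fr p N" "fr q M" using assms by (auto simp: cx_def X)
  obtain ps qs where l: "mset ps = N" "mset qs = M" using ex_mset by metis
  have "local.iso p (dgl ps)" "local.iso q (dgl qs)" using fr_iso_eq NM fr_dgl[of ps] fr_dgl[of qs] l by auto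
  then obtain d' where d': "cx (dgl ps, dgl qs, d')" "siso (p, q, d) (dgl ps, dgl qs, d')"
    using siso_mk assms X by blast
  have "d' \<in> hm (dgl ps) (dgl qs)" using d'(1) by (simp add: cx_def)
  then obtain M where M: "is_mor A e1 e2 ps qs M" "\<Phi> M = d'" by (rule \<Phi>_surj)
  show ?thesis
    by (rule that[of "(ps, qs, M)"]) (use M d' X in \<open>simp_all add: is_cx_def cxr_def cm1_def c0_def cd_def\<close>)
qed

text \<open>The minimal model has a radical differential, so no nonzero direct summand of it is
  contractible. An idempotent chain endomorphism that is not trivial would thus split T in the
  homotopy category; rigidity then fixes the shape.\<close>

lemma indec_lc: assumes "indecomposable_K A e1 e2 T" "hom1 (cxr T) (cxr T)"
  obtains X where "cx X" "lc X" "gd X" "kiso (cxr T) X" "gv X = gvec T"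
proof -
  have T: "is_cx A e1 e2 T" "\<not> zero_K A e1 e2 T" using assms(1) by (auto simp: indecomposable_K_def)
  have nd: False if "is_cx A e1 e2 T1" "is_cx A e1 e2 T2" "\<not> zero_K A e1 e2 T1" "\<not> zero_K A e1 e2 T2" "iso_K A e1 e2 T (cx_sum A T1 T2)" for T1 T2
    using assms(1) that unfolding indecomposable_K_def by blast
  have C: "cx (cxr T)" using cxr_cx T by blast
  obtain p q d where X: "cx (p, q, d)" "kiso (cxr T) (p, q, d)" "d \<in> rad p q" "gv (p, q, d) = gv (cxr T)"
    using minimal_model[OF C] .
  have hr: "hr (cxr T) (p, q, d)" "hr (p, q, d) (cxr T)" using kiso_hr[OF X(2)] by auto
  have h: "hom1 (p, q, d) (p, q, d)"
    using hom1_hrR[OF hr(1) hom1_hrL[OF hr(1) assms(2) X(1) C] X(1) X(1)] .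
  have i: "idp p" "idp q" "d \<in> hm p q" using cx_idp X(1) by auto
  have "lc (p, q, d)" unfolding lc_def prod.case
  proof (intro conjI ballI impI)
    show "p \<noteq> 0 \<or> q \<noteq> 0"
    proof (rule ccontr)
      assume "\<not> ?thesis"
      then have "zk (p, q, d)" by (auto simp: zk_def)
      then show False using zk_hr[OF hr(2)] T zero_K_iff by blast
    qed
    fix e f assume e: "e \<in> hm p p" "f \<in> hm q q" "e * e = e" "f * f = f" "f * d = d * e"
    show "(e = 0 \<and> f = 0) \<or> (e = p \<and> f = q)"
    proof (rule ccontr)
      assume n: "\<not> ?thesis"
      have c: "p - e \<in> hm p p" "q - f \<in> hm q q" "(p - e) * (p - e) = p - e" "(q - f) * (q - f) = q - f" "(q - f) * d = d * (p - e)"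
        using e i by (auto simp: algebra_simps hmE idpM intro: idp_hm)
      have c1: "cx (e, f, d * e)" by (rule sub_cx[OF X(1) e])
      have c2: "cx (p - e, q - f, d * (p - e))" by (rule sub_cx[OF X(1) c])
      obtain T1 where T1: "is_cx A e1 e2 T1" "siso (e, f, d * e) (cxr T1)" using realize[OF c1] .
      obtain T2 where T2: "is_cx A e1 e2 T2" "siso (p - e, q - f, d * (p - e)) (cxr T2)" using realize[OF c2] .
      have "\<not> zk (cxr T1)"
      proof
        assume "zk (cxr T1)"
        then have "zk (e, f, d * e)" using zk_hr kiso_hr siso_kiso T1(2) by blast
        then show False using sub_zk_rad[OF X(1,3) e(1,2)] n by simp
      qed
      moreover have "\<not> zk (cxr T2)"
      proof
        assume "zk (cxr T2)"
        then have "zk (p - e, q - f, d * (p - e))" using zk_hr kiso_hr siso_kiso T2(2) by blast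
        then show False using sub_zk_rad[OF X(1,3) c(1,2)] n by simp
      qed
      moreover have "iso_K A e1 e2 T (cx_sum A T1 T2)"
      proof -
        \<comment> \<open>Both the model and the sum \<open>cx_sum A T1 T2\<close> are split
          internally; the parts are matched one by one and glued by \<open>siso_sum\<close>.\<close>
        obtain p' q' d' where pqd: "cxr (cx_sum A T1 T2) = (p', q', d')" by (cases "cxr (cx_sum A T1 T2)")
        note sp = cx_sum_split[OF T1(1) T2(1) pqd]
        obtain e' f' where e': "e' \<in> hm p' p'" "f' \<in> hm q' q'" "e' * e' = e'" "f' * f' = f'" "f' * d' = d' * e'" "cxr T1 = (e', f', d' * e')"
          and s: "siso (p' - e', q' - f', d' * (p' - e')) (cxr T2)" using sp(2) by metis
        have c': "cx (p', q', d')" using cxr_cx sp(1) pqd by metis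
        obtain u v w where uvw: "cxr T2 = (u, v, w)" by (cases "cxr T2")
        have "siso (p, q, d) (p', q', d')"
        proof (rule siso_sum[OF e X(1) e'(1-5) c'])
          show "siso (e, f, d * e) (e', f', d' * e')" using T1(2) e'(6) by simp
          obtain i1 i0 r1 r0 where 1: "i1 \<in> hm u (p - e)" "i0 \<in> hm v (q - f)" "r1 \<in> hm (p - e) u" "r0 \<in> hm (q - f) v"
             "i0 * w = d * (p - e) * i1" "r0 * (d * (p - e)) = w * r1" "u = r1 * i1" "v = r0 * i0" "p - e = i1 * r1" "q - f = i0 * r0"
            using T2(2) unfolding siso_def uvw prod.case by blast
          obtain j1 j0 v1 v0 where 2: "j1 \<in> hm u (p' - e')" "j0 \<in> hm v (q' - f')" "v1 \<in> hm (p' - e') u" "v0 \<in> hm (q' - f') v"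
             "j0 * w = d' * (p' - e') * j1" "v0 * (d' * (p' - e')) = w * v1" "u = v1 * j1" "v = v0 * j0" "p' - e' = j1 * v1" "q' - f' = j0 * v0"
            using s unfolding siso_def uvw prod.case by blast
          show "siso (p - e, q - f, d * (p - e)) (p' - e', q' - f', d' * (p' - e'))"
          proof (rule sisoI[OF hm_mult[OF 1(1) 2(3)] hm_mult[OF 1(2) 2(4)] hm_mult[OF 2(1) 1(3)] hm_mult[OF 2(2) 1(4)]])
            show "i0 * v0 * (d' * (p' - e')) = d * (p - e) * (i1 * v1)"
              unfolding mult.assoc[of i0] 2(6) by (simp only: mult.assoc[symmetric] 1(5))
            show "j0 * r0 * (d * (p - e)) = d' * (p' - e') * (j1 * r1)"
              unfolding mult.assoc[of j0] 1(6) by (simp only: mult.assoc[symmetric] 2(5))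
            have "j1 * r1 * (i1 * v1) = j1 * u * v1" "j0 * r0 * (i0 * v0) = j0 * v * v0" "i1 * v1 * (j1 * r1) = i1 * u * r1" "i0 * v0 * (j0 * r0) = i0 * v * r0"
              using 1(7,8) 2(7,8) by (metis mult.assoc)+
            then show "p' - e' = j1 * r1 * (i1 * v1)" "q' - f' = j0 * r0 * (i0 * v0)" "p - e = i1 * v1 * (j1 * r1)" "q - f = i0 * v0 * (j0 * r0)"
              using 1 2 hmR by metis+
          qed
        qed
        then have "kiso (cxr T) (p', q', d')" using kiso_siso_trans[OF X(2) _ C X(1)] by blast
        then show ?thesis using iso_K_iff[OF T(1) sp(1)] pqd by simp
      qed
      ultimately show False using nd T1(1) T2(1) zero_K_iff by blast
    qed
  qed
  then show ?thesis using that X gd_of_lc[OF X(1) _ h X(3)] cxr_gv by metis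
qed

text \<open>By \<open>lc_kiso_sub\<close> one summand of any decomposition up to homotopy is
  contractible, contrary to the requirement that both be nonzero.\<close>

lemma lc_indec: assumes "cx X" "lc X" "gd X" "is_cx A e1 e2 T" "siso X (cxr T)" shows "indecomposable_K A e1 e2 T"
  unfolding indecomposable_K_def
proof (intro conjI assms notI)
  have l: "lc (cxr T)" using siso_lc assms by blast
  have gT: "gd (cxr T)" using gd_siso assms by blast
  have C: "cx (cxr T)" using cxr_cx assms by blast
  { assume "zero_K A e1 e2 T" then show False using zero_K_iff assms lc_not_zk[OF gT l] by blast }
  assume "\<exists>T1 T2. is_cx A e1 e2 T1 \<and> is_cx A e1 e2 T2 \<and> \<not> zero_K A e1 e2 T1 \<and> \<not> zero_K A e1 e2 T2 \<and> iso_K A e1 e2 T (cx_sum A T1 T2)"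
  then obtain T1 T2 where T1: "is_cx A e1 e2 T1" and T2: "is_cx A e1 e2 T2" and nz: "\<not> zero_K A e1 e2 T1" "\<not> zero_K A e1 e2 T2"
    and k: "iso_K A e1 e2 T (cx_sum A T1 T2)" by blast
  obtain p' q' d' where pqd: "cxr (cx_sum A T1 T2) = (p', q', d')" by (cases "cxr (cx_sum A T1 T2)")
  note sp = cx_sum_split[OF T1 T2 pqd]
  obtain e' f' where e': "e' \<in> hm p' p'" "f' \<in> hm q' q'" "e' * e' = e'" "f' * f' = f'" "f' * d' = d' * e'" "cxr T1 = (e', f', d' * e')"
    and s: "siso (p' - e', q' - f', d' * (p' - e')) (cxr T2)" using sp(2) by metis
  have c': "cx (p', q', d')" using cxr_cx sp(1) pqd by metis
  have "kiso (cxr T) (p', q', d')" using k iso_K_iff[OF assms(4) sp(1)] pqd by simp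
  then have "zk (e', f', d' * e') \<or> zk (p' - e', q' - f', d' * (p' - e'))"
    using lc_kiso_sub[OF gT l C c'] e' by blast
  then have "zk (cxr T1) \<or> zk (cxr T2)" using e'(6) zk_hr kiso_hr siso_kiso s by metis
  then show False using nz zero_K_iff T1 T2 by blast
qed

theorem gfan_eq: "gfan A e1 e2 = gfs"
proof
  show "gfan A e1 e2 \<subseteq> gfs"
  proof
    fix C assume "C \<in> gfan A e1 e2"
    then obtain Ts where C: "C = cone_gen (gvec ` set Ts)" and ind: "\<forall>T\<in>set Ts. indecomposable_K A e1 e2 T"
      and p: "presilting A e1 e2 (cx_sum_list A Ts)" unfolding gfan_def by blast
    have cxs: "\<forall>T\<in>set Ts. is_cx A e1 e2 T" using ind by (auto simp: indecomposable_K_def)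
    then have h: "\<And>T T'. T \<in> set Ts \<Longrightarrow> T' \<in> set Ts \<Longrightarrow> hom1 (cxr T) (cxr T')" using p presilting_list by blast
    have "\<exists>X. cx X \<and> lc X \<and> gd X \<and> kiso (cxr T) X \<and> gv X = gvec T" if "T \<in> set Ts" for T
      using indec_lc[of T] ind h that by metis
    then obtain x where x: "\<And>T. T \<in> set Ts \<Longrightarrow> cx (x T) \<and> lc (x T) \<and> gd (x T) \<and> kiso (cxr T) (x T) \<and> gv (x T) = gvec T"
      by metis
    have "hom1 (x T) (x T')" if T: "T \<in> set Ts" "T' \<in> set Ts" for T T'
    proof -
      have "hr (cxr T) (x T)" "hr (cxr T') (x T')" "cx (cxr T')" using x T kiso_hr cxs cxr_cx by blast+
      then show ?thesis using hom1_hrL hom1_hrR h[OF T] x T by metis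
    qed
    moreover have "gv ` x ` set Ts = gvec ` set Ts" using x by (force simp: image_image)
    ultimately show "C \<in> gfs" unfolding gfs_def C using x by (auto intro!: exI[of _ "x ` set Ts"])
  qed
next
  show "gfs \<subseteq> gfan A e1 e2"
  proof
    fix C assume "C \<in> gfs"
    then obtain F where C: "C = cone_gen (gv ` F)" and F: "finite F" "\<And>X. X \<in> F \<Longrightarrow> cx X \<and> lc X \<and> gd X"
      "\<And>X Y. X \<in> F \<Longrightarrow> Y \<in> F \<Longrightarrow> hom1 X Y" unfolding gfs_def by blast
    have "\<exists>Ts. (\<forall>T\<in>set Ts. \<exists>X\<in>F. is_cx A e1 e2 T \<and> siso X (cxr T)) \<and> gvec ` set Ts = gv ` F \<and>
      (\<forall>i j. i < length Ts \<and> j < length Ts \<and> i \<noteq> j \<longrightarrow> \<not> iso_K A e1 e2 (Ts ! i) (Ts ! j))"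
      using F(1,2)
    proof (induction F rule: finite_induct)
      case empty then show ?case by (intro exI[of _ "[]"]) auto
    next
      case (insert X F)
      have F': "cx Y \<and> lc Y \<and> gd Y" if "Y \<in> F" for Y using insert.prems that by blast
      have "\<exists>Ts. (\<forall>T\<in>set Ts. \<exists>X\<in>F. is_cx A e1 e2 T \<and> siso X (cxr T)) \<and> gvec ` set Ts = gv ` F \<and>
          (\<forall>i j. i < length Ts \<and> j < length Ts \<and> i \<noteq> j \<longrightarrow> \<not> iso_K A e1 e2 (Ts ! i) (Ts ! j))"
        by (rule insert.IH) (rule F')
      then obtain Ts where Ts0: "\<forall>T\<in>set Ts. \<exists>X\<in>F. is_cx A e1 e2 T \<and> siso X (cxr T)" and Ts2: "gvec ` set Ts = gv ` F"
        and Ts3: "\<forall>i j. i < length Ts \<and> j < length Ts \<and> i \<noteq> j \<longrightarrow> \<not> iso_K A e1 e2 (Ts ! i) (Ts ! j)"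
        by (elim exE conjE)
      have Ts: "\<And>T. T \<in> set Ts \<Longrightarrow> \<exists>X\<in>F. is_cx A e1 e2 T \<and> siso X (cxr T)" "gvec ` set Ts = gv ` F"
        "\<And>i j. i < length Ts \<Longrightarrow> j < length Ts \<Longrightarrow> i \<noteq> j \<Longrightarrow> \<not> iso_K A e1 e2 (Ts ! i) (Ts ! j)"
        using Ts0 Ts2 Ts3 by blast+
      obtain T where T: "is_cx A e1 e2 T" "siso X (cxr T)" using realize insert(4) by blast
      have gT: "gvec T = gv X" using siso_gv(1)[OF T(2)] insert(4) cxr_gv by simp
      have gdT: "gd (cxr T)" using gd_siso[OF T(2)] insert(4) by blast
      show ?case
      \<comment> \<open>A representative isomorphic to one already listed is skipped: the list must
        be pairwise non-isomorphic, and the g-vector is there already.\<close>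
      proof (cases "\<exists>T'\<in>set Ts. iso_K A e1 e2 T T'")
        case True
        then obtain T' where T': "T' \<in> set Ts" "iso_K A e1 e2 T T'" by blast
        then obtain X' where X': "X' \<in> F" "is_cx A e1 e2 T'" "siso X' (cxr T')" using Ts(1) by blast
        then have "siso (cxr T) (cxr T')" using gd_kiso_siso gdT gd_siso insert(4) iso_K_iff T T' by blast
        then have "gvec T' = gvec T" using siso_gv(1) cxr_cx T cxr_gv by metis
        then have "gv X \<in> gvec ` set Ts" using T'(1) gT by (metis imageI)
        then show ?thesis using Ts by (intro exI[of _ Ts]) auto
      next
        case False
        have sym: "\<not> iso_K A e1 e2 T' T" if "T' \<in> set Ts" for T'
          using False that Ts(1) iso_K_iff T(1) kiso_sym by metis
        have "\<not> iso_K A e1 e2 ((T # Ts) ! i) ((T # Ts) ! j)" if "i < length (T # Ts)" "j < length (T # Ts)" "i \<noteq> j" for i j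
          using that False sym Ts(3) by (cases i; cases j) auto
        then show ?thesis using Ts T gT by (intro exI[of _ "T # Ts"]) auto
      qed
    qed
    then obtain Ts where Ts0: "\<forall>T\<in>set Ts. \<exists>X\<in>F. is_cx A e1 e2 T \<and> siso X (cxr T)" and Ts2: "gvec ` set Ts = gv ` F"
      and Ts3: "\<forall>i j. i < length Ts \<and> j < length Ts \<and> i \<noteq> j \<longrightarrow> \<not> iso_K A e1 e2 (Ts ! i) (Ts ! j)"
      by (elim exE conjE)
    have Ts: "\<exists>X\<in>F. is_cx A e1 e2 T \<and> siso X (cxr T)" if "T \<in> set Ts" for T using Ts0 that by blast
    have "\<forall>T\<in>set Ts. indecomposable_K A e1 e2 T" using Ts F(2) lc_indec by meson
    moreover have "hom1 (cxr T) (cxr T')" if tt: "T \<in> set Ts" "T' \<in> set Ts" for T T'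
    proof -
      obtain X X' where X: "X \<in> F" "X' \<in> F" "is_cx A e1 e2 T" "is_cx A e1 e2 T'" "siso X (cxr T)" "siso X' (cxr T')"
        using Ts[OF tt(1)] Ts[OF tt(2)] by blast
      show ?thesis using hom1_siso[OF X(5,6) cxr_cx[OF X(3)] cxr_cx[OF X(4)]] F X by blast
    qed
    then have "presilting A e1 e2 (cx_sum_list A Ts)" using presilting_list Ts by blast
    ultimately show "C \<in> gfan A e1 e2" unfolding gfan_def C Ts2[symmetric] using Ts3 by blast
  qed
qed

end

section \<open>The rotated algebra\<close>

text \<open>The Fitting idempotent \<open>e\<close> of \<open>x\<close> is 0 or \<open>g\<close>. If
  it is 0, \<open>x\<close> is nilpotent and g - x is inverted by a geometric series; if it is
  \<open>g\<close>, then \<open>x\<close> itself is invertible.\<close>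

lemma (in rcat) loc_of_prim:
  assumes fit: "\<And>x. x \<in> S \<Longrightarrow> \<exists>N Y. Y \<in> S \<and> x * Y = Y * x \<and> pw x N * pw x N * Y = pw x N"
    and g: "idp g" "g \<noteq> 0" "\<And>e. e \<in> hm g g \<Longrightarrow> e * e = e \<Longrightarrow> e = 0 \<or> e = g"
  shows "loc g"
proof -
  have "(\<exists>w\<in>hm g g. w * x = g \<and> x * w = g) \<or> (\<exists>w\<in>hm g g. w * y = g \<and> y * w = g)"
    if x: "x \<in> hm g g" "x + y = g" for x y
  proof -
    have y: "y = g - x" using x by (simp add: algebra_simps)
    obtain N Y where Y: "Y \<in> S" "x * Y = Y * x" "pw x N * pw x N * Y = pw x N" using fit[OF hmS[OF x(1)]] by blast
    have pc: "pw x n * Y = Y * pw x n" for n by (induction n) (simp_all add: Y mult.assoc, metis Y(2) mult.assoc)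
    have ph: "pw x n \<in> hm g g" for n by (induction n) (use x in auto)
    define e where "e = pw x N * Y"
    have e2: "e = Y * pw x N" by (simp add: e_def pc)
    have eh: "e \<in> hm g g"
    proof (rule hmI)
      show "e \<in> S" using hmS[OF ph] Y(1) by (auto simp: e_def)
      show "g * e = e" by (simp add: e_def hmL2[OF ph])
      show "e * g = e" by (simp add: e2 mult.assoc hmR[OF ph])
    qed
    have ee: "e * e = e"
    proof -
      have "e * e = Y * (pw x N * pw x N * Y)" by (simp add: e_def e2[unfolded e_def] mult.assoc)
      then show ?thesis by (simp add: Y(3) e2)
    qed
    have gi: "g * g = g" using g(1) by (simp add: idp_def)
    from g(3)[OF eh ee] show ?thesis
    proof
      assume e0: "e = 0"
      have "pw x N = pw x N * e" using Y(3) by (simp add: e_def mult.assoc)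
      then have x0: "pw x N = 0" using e0 by simp
      \<comment> \<open>Partial sums g + x + x^2 + ... of the geometric series, with
        \<open>g\<close> as the unit of the corner.\<close>
      define gs where "gs = rec_nat g (\<lambda>n v. g + x * v)"
      have gs: "gs 0 = g" "gs (Suc n) = g + x * gs n" for n by (simp_all add: gs_def)
      have gh: "gs n \<in> hm g g" for n by (induction n) (use x g in \<open>auto simp: gs\<close>)
      have 1: "gs n * x = x * gs n" for n
        by (induction n) (simp_all add: gs hmE[OF x(1)] algebra_simps)
      have 2: "(g - x) * gs n = g - pw x n" for n
      proof (induction n)
        case (Suc n)
        have "(g - x) * gs (Suc n) = g - x + x * ((g - x) * gs n)"
          by (simp add: gs algebra_simps hmE[OF x(1)] hmE[OF gh] gi)
        also have "\<dots> = g - pw x (Suc n)" unfolding Suc by (simp add: algebra_simps hmR[OF x(1)])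
        finally show ?case .
      qed (simp add: gs algebra_simps hmE[OF x(1)] gi)
      have "y * gs N = g" using 2[of N] x0 by (simp add: y)
      moreover have "gs N * y = g" using 2[of N] x0 1[of N] by (simp add: y algebra_simps hmE[OF gh])
      ultimately show ?thesis using gh by blast
    next
      assume eg: "e = g"
      \<comment> \<open>The inverse is Y times the N-th power of \<open>x\<close>. As
        \<open>pw\<close> is shifted, that power is \<open>pw x (N - 1)\<close>, and for N = 0 it is
        the corner unit \<open>g\<close>.\<close>
      define w where "w = g * Y * (if N = 0 then g else pw x (N - 1))"
      have wh: "w \<in> hm g g"
      proof (cases N)
        case 0
        then have "w = g * Y * g" by (simp add: w_def)
        then show ?thesis using Y(1) g(1) gi by (auto simp: hm_def idp_def mult.assoc asr[OF gi])
      next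
        case (Suc n)
        then have "w = g * Y * pw x n" by (simp add: w_def)
        then show ?thesis using Y(1) g(1) gi hmS[OF ph] hmR[OF ph, of n] by (auto simp: hm_def idp_def mult.assoc asr[OF gi])
      qed
      have px: "pw x n * x = pw x (Suc n)" for n using pw_add[of x n 0] by simp
      have wx: "w * x = g * (Y * pw x N)"
        by (cases N) (simp_all add: w_def mult.assoc px hmL[OF x(1)])
      then have "w * x = g" using eg e2 gi by simp
      moreover have "x * w = g"
      proof (cases N)
        case 0
        then have "x * w = x * Y * g" by (simp add: w_def mult.assoc hmR2[OF x(1)])
        then show ?thesis using eg gi 0 by (simp add: e_def)
      next
        case (Suc n)
        then have "x * w = x * Y * pw x n" by (simp add: w_def mult.assoc hmR2[OF x(1)])
        also have "\<dots> = Y * pw x N" using Suc Y(2) by (simp add: mult.assoc)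
        finally show ?thesis using eg e2 by simp
      qed
      ultimately show ?thesis using wh by blast
    qed
  qed
  then show ?thesis using g unfolding loc_def by blast
qed

lemma dg_mult2: "dg n x * dg k y = dg (min n k) (x * y)"
  by (auto simp: fmat_eq_iff)

lemma (in kalg) sub_sc: assumes "subspace S" shows "module.subspace mscl (sc S)"
proof -
  interpret m: kalg mscl by (rule kalg_fmat)
  show ?thesis unfolding m.subspace_def
    using assms by (auto simp: sc_iff subspace_def)
qed

text \<open>\<open>a\<close>, \<open>b\<close>, \<open>p\<close> are P_1, P_2 and P_1^l as pairwise
  orthogonal idempotents of one ring, so that a chain map of m can be a single ring element.
  \<open>min1\<close> is left minimality of m in elementary terms: no z with z m = 0 is a split
  epimorphism onto P_1.\<close>

locale rot = tri "sc S" "\<lambda>c. E 0 0 (if c then b else a)" + kalg scl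
  for S :: "'r::ring set" and a b :: 'r and scl :: "'k::field \<Rightarrow> 'r \<Rightarrow> 'r" +
  fixes p m :: 'r and l :: nat
  assumes rcS: "rcat S" and subS: "subspace S"
    and orth: "a * b = 0" "b * a = 0" "a * p = 0" "p * a = 0" "b * p = 0" "p * b = 0"
    and frp: "fr (E 0 0 p) (replicate_mset l False)"
    and m: "m \<in> S" "p * m = m" "m * b = m"
    and approx1: "f \<in> S \<Longrightarrow> a * f = f \<Longrightarrow> f * b = f \<Longrightarrow> \<exists>z\<in>S. a * z = z \<and> z * p = z \<and> f = z * m"
    and min1: "z \<in> S \<Longrightarrow> a * z = z \<Longrightarrow> z * p = z \<Longrightarrow> z * m = 0 \<Longrightarrow> k \<in> S \<Longrightarrow> p * k = k \<Longrightarrow> k * a = k \<Longrightarrow> z * k \<noteq> a"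
begin

sublocale r: rcat S by (rule rcS)

lemma abp: "a \<in> S" "b \<in> S" "p \<in> S" "a * a = a" "b * b = b" "p * p = p" "a \<noteq> 0" "b \<noteq> 0"
proof -
  have "idp (E 0 0 a)" "idp (E 0 0 b)" "idp (E 0 0 p)" using Gidp[of False] Gidp[of True] fr_idp[OF frp] by auto
  then show "a \<in> S" "b \<in> S" "p \<in> S" "a * a = a" "b * b = b" "p * p = p"
    by (auto simp: idp_def sc_iff split: if_splits)
  show "a \<noteq> 0" "b \<noteq> 0" using Gnz[of False] Gnz[of True] by auto
qed

lemma am: "a * m = 0" "b * m = 0" "m * a = 0" "m * p = 0"
  using m(2,3) orth by (metis mult.assoc mult_zero_left mult_zero_right)+

lemmas idem = abp(4-6) abp(4-6)[THEN asr] orth orth[THEN asr] m(2,3) m(2,3)[THEN asr] am am[THEN asr]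

lemma hm_E: "X \<in> hm (E 0 0 x) (E 0 0 y) \<Longrightarrow> X = E 0 0 (ent X 0 0)"
proof -
  assume X: "X \<in> hm (E 0 0 x) (E 0 0 y)"
  have "ent X i j = 0" if "i \<noteq> 0" for i j using arg_cong[OF hmL[OF X], of "\<lambda>Z. ent Z i j"] that by simp
  moreover have "ent X i j = 0" if "j \<noteq> 0" for i j using arg_cong[OF hmR[OF X], of "\<lambda>Z. ent Z i j"] that by simp
  ultimately show ?thesis by (auto simp: fmat_eq_iff)
qed

lemma hm_E_iff: "E 0 0 z \<in> hm (E 0 0 x) (E 0 0 y) \<longleftrightarrow> z \<in> S \<and> y * z = z \<and> z * x = z"
  by (auto simp: hm_def sc_iff split: if_splits)

lemma dg_S [simp]: "x \<in> S \<Longrightarrow> dg n x \<in> sc S" by (auto simp: sc_iff)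
lemma E_S [simp]: "x \<in> S \<Longrightarrow> E i j x \<in> sc S" by (auto simp: sc_iff)

lemma dg_idp: "x \<in> S \<Longrightarrow> x * x = x \<Longrightarrow> idp (dg n x)" by (auto simp: idp_def)

lemma iso_E: "x \<in> S \<Longrightarrow> x * x = x \<Longrightarrow> local.iso (E 0 0 x) (E n n x)"
  by (rule isoI[of "E n 0 x" _ _ "E 0 n x"]) (auto simp: hm_def)

lemma fr_dg: "fr (dg n a) (replicate_mset n False)" "fr (dg n b) (replicate_mset n True)"
proof -
  have "fr (dg n (if c then b else a)) (replicate_mset n c)" for c
  proof (induction n)
    case 0 then show ?case using fr0 by simp
  next
    case (Suc n)
    let ?x = "if c then b else a"
    have "fr (dg n ?x + E n n ?x) (add_mset c (replicate_mset n c))"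
      by (rule frS[OF Suc]) (use abp iso_E in \<open>auto simp: fmat_eq_iff\<close>)
    then show ?case by (simp add: dg_Suc)
  qed
  from this[of False] this[of True]
  show "fr (dg n a) (replicate_mset n False)" "fr (dg n b) (replicate_mset n True)" by simp_all
qed

lemma fr_dgp: "fr (dg n p) (replicate_mset (n * l) False)"
proof (induction n)
  case 0 then show ?case using fr0 by simp
next
  case (Suc n)
  have "fr (dg n p + E n n p) (replicate_mset (n * l) False + replicate_mset l False)"
    by (rule fr_add[OF fr_iso[OF frp iso_E] Suc]) (use abp in \<open>auto simp: fmat_eq_iff\<close>)
  moreover have "replicate_mset (n * l) False + replicate_mset l False = replicate_mset (Suc n * l) False"
    by (simp add: multiset_eq_iff)
  ultimately show ?case by (simp only: dg_Suc)
qed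

lemma pure_dg: "pure False (dg n a)" "pure True (dg n b)" "pure False (dg n p)"
  using fr_dg fr_dgp by (auto simp: pure_def)

lemma pure_sub: assumes "pure c q" "idp e" "q * e = e" "e * q = e" shows "pure c e"
proof -
  obtain n where n: "fr q (replicate_mset n c)" using assms by (auto simp: pure_def)
  obtain M K where M: "fr e M" "replicate_mset n c = M + K" using fr_split[OF n assms(2-4)] by blast
  have "set_mset M \<subseteq> {c}"
  proof
    fix x assume "x \<in># M"
    then have "x \<in># replicate_mset n c" unfolding M(2) by simp
    then show "x \<in> {c}" by (simp split: if_splits)
  qed
  then have "M = replicate_mset (size M) c" by (rule set_mset_subset_singletonD)
  then show ?thesis using M(1) unfolding pure_def by metis
qed

lemma pure_has: assumes "pure False q" "q \<noteq> 0"
  obtains x y where "x \<in> hm (E 0 0 a) q" "y \<in> hm q (E 0 0 a)" "y * x = E 0 0 a"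
proof -
  obtain n where n: "fr q (replicate_mset n False)" using assms by (auto simp: pure_def)
  have "n \<noteq> 0"
  proof
    assume "n = 0" then show False using n assms(2) fr_empty[of q] by simp
  qed
  then have "False \<in># replicate_mset n False" by simp
  then show ?thesis using fr_has_G[OF n, of False] that by auto
qed

text \<open>Commuting with \<open>b\<close> separates degree -1, which is \<open>b\<close>, from
  degree 0, which is \<open>a + p\<close>; commuting with \<open>m\<close> is the chain map
  condition; \<open>a * g * p = 0\<close> removes the component towards (0 -> P_1). No quotient by
  homotopies is taken, as Hom(p, b) = 0.\<close>

definition Gam :: "'r set" where
  "Gam = {g \<in> S. g * b = b * g \<and> (a + b + p) * g = g \<and> g * (a + b + p) = g \<and> a * g * p = 0 \<and> g * m = m * g}"

lemma GamI: "g \<in> S \<Longrightarrow> g * b = b * g \<Longrightarrow> (a + b + p) * g = g \<Longrightarrow> g * (a + b + p) = g \<Longrightarrow> a * (g * p) = 0 \<Longrightarrow> g * m = m * g \<Longrightarrow> g \<in> Gam"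
  by (simp add: Gam_def mult.assoc)

lemma GamD: assumes "g \<in> Gam" shows "g \<in> S" "g * b = b * g" "(a + b + p) * g = g" "g * (a + b + p) = g" "a * (g * p) = 0" "g * m = m * g"
  using assms by (simp_all add: Gam_def mult.assoc)

lemma rcat_Gam: "rcat Gam"
proof
  show "0 \<in> Gam" by (simp add: Gam_def)
  fix x y assume x: "x \<in> Gam" and y: "y \<in> Gam"
  note X = GamD[OF x] and Y = GamD[OF y]
  show "x + y \<in> Gam"
  proof (rule GamI)
    show "x + y \<in> S" using X Y by auto
    show "(x + y) * b = b * (x + y)" "(x + y) * m = m * (x + y)" by (simp_all add: distrib_left distrib_right X(2,6) Y(2,6))
    show "(a + b + p) * (x + y) = x + y" by (simp add: distrib_left X Y)
    show "(x + y) * (a + b + p) = x + y" by (simp only: distrib_right[of x y] X Y)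
    show "a * ((x + y) * p) = 0" by (simp add: distrib_left distrib_right X Y)
  qed
  show "x - y \<in> Gam"
  proof (rule GamI)
    show "x - y \<in> S" using X Y by auto
    show "(x - y) * b = b * (x - y)" "(x - y) * m = m * (x - y)" by (simp_all add: left_diff_distrib right_diff_distrib X(2,6) Y(2,6))
    show "(a + b + p) * (x - y) = x - y" by (simp add: right_diff_distrib X Y)
    show "(x - y) * (a + b + p) = x - y" by (simp only: left_diff_distrib X Y)
    show "a * ((x - y) * p) = 0" by (simp add: left_diff_distrib right_diff_distrib X Y)
  qed
  show "x * y \<in> Gam"
  proof (rule GamI)
    show "x * y \<in> S" using GamD x y by auto
    show "x * y * b = b * (x * y)" using GamD(2)[OF x] GamD(2)[OF y] by (metis mult.assoc)
    show "(a + b + p) * (x * y) = x * y" using GamD(3)[OF x] by (metis mult.assoc)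
    show "x * y * (a + b + p) = x * y" using GamD(4)[OF y] by (metis mult.assoc)
    show "x * y * m = m * (x * y)" using GamD(6)[OF x] GamD(6)[OF y] by (metis mult.assoc)
    have 1: "x * (y * p) = x * (a * (y * p)) + x * (b * (y * p)) + x * (p * (y * p))"
      using GamD(4)[OF x] by (metis distrib_left distrib_right mult.assoc)
    have "b * (y * p) = y * (b * p)" using GamD(2)[OF y] by (metis mult.assoc)
    then have "x * (y * p) = x * (p * (y * p))" using 1 GamD(5)[OF y] orth by simp
    then have "a * (x * (y * p)) = (a * (x * p)) * (y * p)" by (simp add: mult.assoc)
    then show "a * (x * y * p) = 0" using GamD(5)[OF x] by (simp add: mult.assoc)
  qed
qed

lemma sub_Gam: "subspace Gam"
proof -
  interpret G: rcat Gam by (rule rcat_Gam)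
  have "scl c x \<in> Gam" if x: "x \<in> Gam" for c x
  proof (rule GamI)
    show "scl c x \<in> S" using subS GamD(1)[OF x] by (auto simp: subspace_def)
  qed (use GamD[OF x] in \<open>simp_all only: scl_multL scl_multR scale_zero_right\<close>)
  then show ?thesis unfolding subspace_def by auto
qed

text \<open>A nonzero summand of P_1^l contains a copy of P_1; projecting to it would be a split
  epimorphism that annihilates m.\<close>

lemma min_idem1: assumes "e \<in> S" "p * e = e" "e * p = e" "e * e = e" "e * m = 0" shows "e = 0"
proof (rule ccontr)
  assume "e \<noteq> 0"
  have "pure False (E 0 0 e)"
    by (rule pure_sub[of False "E 0 0 p"]) (use frp assms in \<open>auto simp: pure_def idp_def\<close>)
  moreover have "E 0 0 e \<noteq> 0" using \<open>e \<noteq> 0\<close> by (metis ent_E ent_zero)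
  ultimately obtain x y where xy: "x \<in> hm (E 0 0 a) (E 0 0 e)" "y \<in> hm (E 0 0 e) (E 0 0 a)" "y * x = E 0 0 a"
    by (rule pure_has)
  obtain x' y' where x': "x = E 0 0 x'" "y = E 0 0 y'" using hm_E xy by blast
  have 1: "x' \<in> S" "e * x' = x'" "x' * a = x'" "y' \<in> S" "a * y' = y'" "y' * e = y'" "y' * x' = a"
    using xy unfolding x' hm_E_iff by auto
  have "p * x' = x'" "y' * p = y'" "y' * m = 0" using 1 assms by (metis mult.assoc mult_zero_right)+
  then show False using min1[of y' x'] 1 by blast
qed

text \<open>The point is that \<open>b + p\<close> is primitive. The degree -1 part of an idempotent
  is 0 or \<open>b\<close> since P_2 is indecomposable; after passing to the complement if necessary
  it is 0, and minimality of m kills the rest.\<close>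

lemma tri_R: "tri (sc Gam) (\<lambda>c. E 0 0 (if c then a else b + p))"
proof -
  interpret R: rcat "sc Gam" by (rule rcat_sc[OF rcat_Gam])
  interpret k: kalg mscl by (rule kalg_fmat)
  have fitR: "\<exists>N Y. Y \<in> sc Gam \<and> x * Y = Y * x \<and> pw x N * pw x N * Y = pw x N" if "x \<in> sc Gam" for x
    using k.fitting[OF sub_sc[OF sub_Gam] _ that] by blast
  have aG: "a \<in> Gam" by (rule GamI) (auto simp: abp idem distrib_left distrib_right)
  have bG: "b + p \<in> Gam" using abp m by (intro GamI) (auto simp: idem distrib_left distrib_right)
  have hmE': "x = E 0 0 (ent x 0 0) \<and> ent x 0 0 \<in> Gam \<and> v * ent x 0 0 = ent x 0 0 \<and> ent x 0 0 * u = ent x 0 0"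
    if x: "x \<in> R.hm (E 0 0 u) (E 0 0 v)" for x u v
  proof -
    have "ent x i j = 0" if "i \<noteq> 0" for i j using arg_cong[OF R.hmL[OF x], of "\<lambda>Z. ent Z i j"] that by simp
    moreover have "ent x i j = 0" if "j \<noteq> 0" for i j using arg_cong[OF R.hmR[OF x], of "\<lambda>Z. ent Z i j"] that by simp
    moreover have "v * ent x 0 0 = ent x 0 0" "ent x 0 0 * u = ent x 0 0"
      using arg_cong[OF R.hmL[OF x], of "\<lambda>Z. ent Z 0 0"] arg_cong[OF R.hmR[OF x], of "\<lambda>Z. ent Z 0 0"] by simp_all
    ultimately show ?thesis using scD[OF R.hmS[OF x]] by (auto simp: fmat_eq_iff)
  qed
  have Ei: "R.idp (E 0 0 z)" if "z \<in> Gam" "z * z = z" for z using that rcat.S0[OF rcat_Gam] by (auto simp: R.idp_def sc_iff)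
  have locA: "R.loc (E 0 0 a)"
  proof (rule R.loc_of_prim[OF fitR])
    show "R.idp (E 0 0 a)" "E 0 0 a \<noteq> 0" using Ei[OF aG] abp Gnz[of False] by auto
    fix e assume e: "e \<in> R.hm (E 0 0 a) (E 0 0 a)" "e * e = e"
    then have "idp e" "E 0 0 a * e = e" "e * E 0 0 a = e"
      using R.hmL[OF e(1)] R.hmR[OF e(1)] scD[OF R.hmS[OF e(1)]] GamD(1) by (auto simp: idp_def sc_iff)
    then show "e = 0 \<or> e = E 0 0 a" using loc_idem[OF Gloc[of False]] by simp
  qed
  have locB: "R.loc (E 0 0 (b + p))"
  proof (rule R.loc_of_prim[OF fitR])
    show "R.idp (E 0 0 (b + p))" using Ei[OF bG] abp by (auto simp: idem distrib_left distrib_right)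
    have "(b + p) * b \<noteq> 0" using abp by (simp add: distrib_right idem)
    then have "b + p \<noteq> 0" by auto
    then show "E 0 0 (b + p) \<noteq> 0" by (metis ent_E ent_zero)
    fix e assume e: "e \<in> R.hm (E 0 0 (b + p)) (E 0 0 (b + p))" "e * e = e"
    define z where "z = ent e 0 0"
    have z: "e = E 0 0 z" "z \<in> Gam" "(b + p) * z = z" "z * (b + p) = z" using hmE'[OF e(1)] by (simp_all add: z_def)
    have zz: "z * z = z" using e(2) by (simp add: z(1))
    \<comment> \<open>With b w = 0, commutation with m gives w m = m w = 0, so \<open>w\<close> is
      an idempotent below \<open>p\<close> that annihilates m.\<close>
    have key: "w = 0" if w: "w \<in> Gam" "(b + p) * w = w" "w * (b + p) = w" "w * w = w" "b * w = 0" for w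
    proof (rule min_idem1)
      show "w \<in> S" "w * w = w" using GamD(1) w by auto
      show "p * w = w" using w(2,5) by (simp add: distrib_right)
      have "w * b = 0" using GamD(2)[OF w(1)] w(5) by simp
      then show "w * p = w" using w(3) by (simp add: distrib_left)
      have "m * w = m * (b * w)" by (simp add: idem)
      then show "w * m = 0" using GamD(6)[OF w(1)] w(5) by simp
    qed
    have "b * z * (b * z) = b * z" using GamD(2)[OF z(2)] zz abp(5) by (metis mult.assoc)
    moreover have "b * z * b = b * z" using GamD(2)[OF z(2)] abp(5) by (metis mult.assoc)
    moreover have "b * z \<in> S" using r.Smult[OF abp(2) GamD(1)[OF z(2)]] .
    ultimately have "idp (E 0 0 (b * z))" "E 0 0 b * E 0 0 (b * z) = E 0 0 (b * z)" "E 0 0 (b * z) * E 0 0 b = E 0 0 (b * z)"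
      using GamD(1)[OF z(2)] abp by (auto simp: idp_def idem mult.assoc)
    then have "E 0 0 (b * z) = 0 \<or> E 0 0 (b * z) = E 0 0 b" using loc_idem[OF Gloc[of True], of "E 0 0 (b * z)"] by simp
    then have "b * z = 0 \<or> b * z = b" by (metis E_inject E_zero)
    then show "e = 0 \<or> e = E 0 0 (b + p)"
    proof
      assume "b * z = 0" then show ?thesis using key[OF z(2-4) zz] by (simp add: z(1))
    next
      assume bz: "b * z = b"
      have "b + p - z = 0"
      proof (rule key)
        show "b + p - z \<in> Gam" using rcat.Sdiff[OF rcat_Gam bG z(2)] .
        show "b * (b + p - z) = 0" using bz by (simp add: algebra_simps idem)
        have bb: "(b + p) * (b + p) = b + p" by (simp add: algebra_simps idem)
        show "(b + p) * (b + p - z) = b + p - z" "(b + p - z) * (b + p) = b + p - z" "(b + p - z) * (b + p - z) = b + p - z"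
          using z(3,4) zz bb by (simp_all only: left_diff_distrib right_diff_distrib) simp
      qed
      then show ?thesis by (simp add: z(1))
    qed
  qed
  show ?thesis
  proof
    show "R.loc (E 0 0 (if c then a else b + p))" for c using locA locB by simp
    have "x = 0" if x: "x \<in> R.hm (E 0 0 (b + p)) (E 0 0 a)" for x
    proof -
      define z where "z = ent x 0 0"
      have z: "x = E 0 0 z" "z \<in> Gam" "a * z = z" "z * (b + p) = z" using hmE'[OF x] by (simp_all add: z_def)
      have "z * b = a * (b * z)" using z(3) GamD(2)[OF z(2)] by (metis mult.assoc)
      then have "z * b = 0" by (simp add: idem)
      moreover have "z * p = 0" using GamD(5)[OF z(2)] z(3) by (metis mult.assoc)
      ultimately show ?thesis using z(1,4) by (simp add: distrib_left)
    qed
    then show "R.hm (E 0 0 (if False then a else b + p)) (E 0 0 (if True then a else b + p)) = {0}" by auto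
  qed (use fitR in blast)
qed

sublocale R: tri "sc Gam" "\<lambda>c. E 0 0 (if c then a else b + p)" by (rule tri_R)

text \<open>Maps between the objects \<open>f\<^sub>1\<^sup>n\<close> and \<open>f\<^sub>2\<^sup>n\<close> of the rotated algebra, where \<open>f\<^sub>1 = b + p\<close>, \<open>f\<^sub>2 = a\<close>.\<close>

definition F :: "nat \<Rightarrow> 'r fmat" where "F n = dg n b + dg n p"

lemma F_dg: "F n = dg n (b + p)" by (simp add: F_def dg_add)

lemma dgo: "dg n b * dg k p = 0" "dg n p * dg k b = 0" "dg n a * dg k p = 0" "dg n p * dg k a = 0" "dg n a * dg k b = 0" "dg n b * dg k a = 0"
  "dg n a * dg n a = dg n a" "dg n b * dg n b = dg n b" "dg n p * dg n p = dg n p" "dg n p * dg n m = dg n m" "dg n m * dg n b = dg n m"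
  "dg n b * dg k m = 0" "dg n m * dg k p = 0" "dg n a * dg k m = 0" "dg n m * dg k a = 0"
  by (simp_all add: dg_mult2 idem)

lemma dgi [simp]: "idp (dg n a)" "idp (dg n b)" "idp (dg n p)" using abp by (simp_all add: dg_idp)
lemma mhm: "dg n m \<in> hm (dg n b) (dg n p)" using m by (auto simp: hm_def dgo)

text \<open>All entries commute with \<open>b\<close>, so the matrix splits into a part
  \<open>x\<close> in degree -1 and a part \<open>y\<close> in degree 0; commutation with
  \<open>m\<close> turns into the commuting square.\<close>

lemma R_FF: "X \<in> R.hm (F n) (F k) \<longleftrightarrow> (\<exists>x\<in>hm (dg n b) (dg k b). \<exists>y\<in>hm (dg n p) (dg k p). X = x + y \<and> y * dg n m = dg k m * x)"
proof
  assume X: "X \<in> R.hm (F n) (F k)"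
  have eX: "ent X i j \<in> Gam" for i j using scD[OF R.hmS[OF X]] .
  have XS: "X \<in> sc S" using GamD(1)[OF eX] by (simp add: sc_iff)
  have XL: "(dg k b + dg k p) * X = X" and XR: "X * (dg n b + dg n p) = X" using R.hmL[OF X] R.hmR[OF X] by (simp_all add: F_def)
  have z: "ent X i j = 0" if "\<not> (i < k \<and> j < n)" for i j
    using that arg_cong[OF XL, of "\<lambda>Z. ent Z i j"] arg_cong[OF XR, of "\<lambda>Z. ent Z i j"]
    by (auto simp: distrib_left distrib_right split: if_splits)
  have 1: "dg k b * X = X * dg n b" using GamD(2)[OF eX] z by (auto simp: fmat_eq_iff)
  have 2: "X * dg n m = dg k m * X" using GamD(6)[OF eX] z by (auto simp: fmat_eq_iff)
  have "X * dg n b + dg k p * X = X * dg n b + X * dg n p"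
    using XL XR unfolding distrib_left distrib_right 1 by (rule trans[OF _ sym])
  then have 3: "dg k p * X = X * dg n p" by (rule add_left_imp_eq)
  show "\<exists>x\<in>hm (dg n b) (dg k b). \<exists>y\<in>hm (dg n p) (dg k p). X = x + y \<and> y * dg n m = dg k m * x"
  proof (intro bexI conjI)
    show "X = dg k b * X + dg k p * X" using XL by (simp add: distrib_right)
    show "dg k b * X \<in> hm (dg n b) (dg k b)"
    proof (rule hmI)
      show "dg k b * X \<in> sc S" using XS abp by auto
      show "dg k b * (dg k b * X) = dg k b * X" by (simp add: asr[OF dgo(8)])
      show "dg k b * X * dg n b = dg k b * X" by (simp add: 1 mult.assoc abp)
    qed
    show "dg k p * X \<in> hm (dg n p) (dg k p)"
    proof (rule hmI)
      show "dg k p * X \<in> sc S" using XS abp by auto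
      show "dg k p * (dg k p * X) = dg k p * X" by (simp add: asr[OF dgo(9)])
      show "dg k p * X * dg n p = dg k p * X" by (simp add: 3 mult.assoc abp)
    qed
    show "dg k p * X * dg n m = dg k m * (dg k b * X)"
      by (simp add: mult.assoc 2 asr[OF dgo(10)] asr[OF dgo(11)])
  qed
next
  assume "\<exists>x\<in>hm (dg n b) (dg k b). \<exists>y\<in>hm (dg n p) (dg k p). X = x + y \<and> y * dg n m = dg k m * x"
  then obtain x y where x: "x \<in> hm (dg n b) (dg k b)" and y: "y \<in> hm (dg n p) (dg k p)" and X: "X = x + y" and c: "y * dg n m = dg k m * x" by blast
  have xo: "dg j p * x = 0" "x * dg j p = 0" "dg j a * x = 0" "x * dg j a = 0" "x * dg n m = 0" for j
    using hmL[OF x] hmR[OF x] dgo by (metis mult.assoc mult_zero_left mult_zero_right)+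
  have yo: "dg j b * y = 0" "y * dg j b = 0" "dg j a * y = 0" "y * dg j a = 0" "dg k m * y = 0" for j
    using hmL[OF y] hmR[OF y] dgo by (metis mult.assoc mult_zero_left mult_zero_right)+
  have ex: "ent x i j = (if i < k \<and> j < n then b * ent x i j else 0)" "ent x i j = (if i < k \<and> j < n then ent x i j * b else 0)" for i j
    using arg_cong[OF hmL[OF x], of "\<lambda>Z. ent Z i j"] arg_cong[OF hmR[OF x], of "\<lambda>Z. ent Z i j"] by (auto split: if_splits)
  have ey: "ent y i j = (if i < k \<and> j < n then p * ent y i j else 0)" "ent y i j = (if i < k \<and> j < n then ent y i j * p else 0)" for i j
    using arg_cong[OF hmL[OF y], of "\<lambda>Z. ent Z i j"] arg_cong[OF hmR[OF y], of "\<lambda>Z. ent Z i j"] by (auto split: if_splits)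
  have G: "ent X i j \<in> Gam" for i j
  proof (cases "i < k \<and> j < n")
    case False
    then have "ent x i j = 0" "ent y i j = 0" using ex(1)[of i j] ey(1)[of i j] by presburger+
    then have "ent X i j = 0" by (simp add: X)
    then show ?thesis using rcat.S0[OF rcat_Gam] by simp
  next
    case True
    define u v where "u = ent x i j" and "v = ent y i j"
    have u: "b * u = u" "u * b = u" using ex[of i j] True by (simp_all add: u_def)
    have v: "p * v = v" "v * p = v" using ey[of i j] True by (simp_all add: v_def)
    have uz: "p * u = 0" "u * p = 0" "a * u = 0" "u * a = 0" "u * m = 0" using u orth am by (metis mult.assoc mult_zero_left mult_zero_right)+
    have vz: "b * v = 0" "v * b = 0" "a * v = 0" "v * a = 0" "m * v = 0" using v orth am by (metis mult.assoc mult_zero_left mult_zero_right)+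
    have vm: "v * m = m * u" using arg_cong[OF c, of "\<lambda>Z. ent Z i j"] True by (simp add: u_def v_def)
    have "u \<in> S" "v \<in> S" using scD hmS[OF x] hmS[OF y] by (auto simp: u_def v_def)
    then have "u + v \<in> Gam" by (intro GamI) (auto simp: distrib_left distrib_right u v uz vz vm)
    then show ?thesis by (simp add: X u_def v_def)
  qed
  show "X \<in> R.hm (F n) (F k)"
  proof (rule R.hmI)
    show "X \<in> sc Gam" using G by (simp add: sc_iff)
    show "F k * X = X" "X * F n = X"
      by (simp_all add: X F_def distrib_left distrib_right hmL[OF x] hmL[OF y] hmR[OF x] hmR[OF y] xo yo)
  qed
qed

text \<open>The source (0 -> P_1)^n is zero in degree -1, so the chain map condition is empty and
  every map P_1^n -> P_1^(k l) occurs.\<close>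

lemma R_AF: "R.hm (dg n a) (F k) = hm (dg n a) (dg k p)"
proof (intro equalityI subsetI)
  fix X assume X: "X \<in> R.hm (dg n a) (F k)"
  have eX: "ent X i j \<in> Gam" for i j using scD[OF R.hmS[OF X]] .
  have XS: "X \<in> sc S" using GamD(1)[OF eX] by (simp add: sc_iff)
  have XL: "dg k b * X + dg k p * X = X" and XR: "X * dg n a = X" using R.hmL[OF X] R.hmR[OF X] by (simp_all add: F_def distrib_right)
  have "b * ent X i j = 0" for i j
  proof -
    have "ent X i j = ent X i j * a \<or> ent X i j = 0" using arg_cong[OF XR, of "\<lambda>Z. ent Z i j"] by (auto split: if_splits)
    then have "ent X i j * b = 0" using orth by (metis mult.assoc mult_zero_left mult_zero_right)
    then show ?thesis using GamD(2)[OF eX] by simp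
  qed
  then have "dg k b * X = 0" by (auto simp: fmat_eq_iff)
  then show "X \<in> hm (dg n a) (dg k p)" using XL XR XS by (auto simp: hm_def)
next
  fix X assume X: "X \<in> hm (dg n a) (dg k p)"
  have G: "ent X i j \<in> Gam" for i j
  proof (cases "i < k \<and> j < n")
    case False
    then have "ent X i j = 0" using arg_cong[OF hmL[OF X], of "\<lambda>Z. ent Z i j"] arg_cong[OF hmR[OF X], of "\<lambda>Z. ent Z i j"] by (auto split: if_splits)
    then show ?thesis using rcat.S0[OF rcat_Gam] by simp
  next
    case True
    define u where "u = ent X i j"
    have u: "p * u = u" "u * a = u" "u \<in> S"
      using arg_cong[OF hmL[OF X], of "\<lambda>Z. ent Z i j"] arg_cong[OF hmR[OF X], of "\<lambda>Z. ent Z i j"] True scD[OF hmS[OF X]] by (auto simp: u_def)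
    have uz: "b * u = 0" "u * b = 0" "a * u = 0" "u * p = 0" "u * m = 0" "m * u = 0" using u(1,2) orth am by (metis mult.assoc mult_zero_left mult_zero_right)+
    then have "u \<in> Gam" using u by (intro GamI) (auto simp: distrib_left distrib_right u uz)
    then show ?thesis by (simp add: u_def)
  qed
  have "dg k b * X = 0" using hmL[OF X] dgo(1) by (metis mult.assoc mult_zero_left)
  then show "X \<in> R.hm (dg n a) (F k)"
    using G hmL[OF X] hmR[OF X] by (intro R.hmI) (auto simp: sc_iff F_def distrib_right)
qed

lemma R_AA: "R.hm (dg n a) (dg k a) = hm (dg n a) (dg k a)"
proof (intro equalityI subsetI)
  fix X assume X: "X \<in> R.hm (dg n a) (dg k a)"
  then show "X \<in> hm (dg n a) (dg k a)" using GamD(1) scD[OF R.hmS[OF X]] R.hmL[OF X] R.hmR[OF X] by (auto simp: hm_def sc_iff)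
next
  fix X assume X: "X \<in> hm (dg n a) (dg k a)"
  have G: "ent X i j \<in> Gam" for i j
  proof (cases "i < k \<and> j < n")
    case False
    then have "ent X i j = 0" using arg_cong[OF hmL[OF X], of "\<lambda>Z. ent Z i j"] arg_cong[OF hmR[OF X], of "\<lambda>Z. ent Z i j"] by (auto split: if_splits)
    then show ?thesis using rcat.S0[OF rcat_Gam] by simp
  next
    case True
    define u where "u = ent X i j"
    have u: "a * u = u" "u * a = u" "u \<in> S"
      using arg_cong[OF hmL[OF X], of "\<lambda>Z. ent Z i j"] arg_cong[OF hmR[OF X], of "\<lambda>Z. ent Z i j"] True scD[OF hmS[OF X]] by (auto simp: u_def)
    have uz: "b * u = 0" "u * b = 0" "p * u = 0" "u * p = 0" "u * m = 0" "m * u = 0" using u(1,2) orth am by (metis mult.assoc mult_zero_left mult_zero_right)+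
    then have "u \<in> Gam" using u by (intro GamI) (auto simp: distrib_left distrib_right u uz)
    then show ?thesis by (simp add: u_def)
  qed
  then show "X \<in> R.hm (dg n a) (dg k a)"
    using hmL[OF X] hmR[OF X] by (intro R.hmI) (auto simp: sc_iff)
qed

end

section \<open>Powers of the approximation, and the correspondence of complexes\<close>

context rot begin

lemma RF_id [simp]: "R.idp (F n)"
proof -
  have "F n \<in> R.hm (F n) (F n)"
    unfolding R_FF by (rule bexI[of _ "dg n b"], rule bexI[of _ "dg n p"]) (auto simp: F_def dgo idem)
  then show ?thesis by (simp add: R.hm_id)
qed

lemma R_fr: "R.fr (dg n a) (replicate_mset n True)" "R.fr (F n) (replicate_mset n False)"
proof -
  have G: "a \<in> Gam" "b + p \<in> Gam" "(b + p) * (b + p) = b + p"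
  proof -
    have "R.idp (E 0 0 a)" "R.idp (E 0 0 (b + p))" using R.Gidp[of True] R.Gidp[of False] by auto
    then show "a \<in> Gam" "b + p \<in> Gam" "(b + p) * (b + p) = b + p"
      by (auto simp: R.idp_def sc_iff split: if_splits)
  qed
  have i: "R.iso (E 0 0 x) (E n n x)" if "x \<in> Gam" "x * x = x" for x n
    by (rule R.isoI[of "E n 0 x" _ _ "E 0 n x"]) (use that rcat.S0[OF rcat_Gam] in \<open>auto simp: R.hm_def sc_iff\<close>)
  have "R.fr (dg n (if c then a else b + p)) (replicate_mset n c)" for c
  proof (induction n)
    case 0 then show ?case using R.fr0 by simp
  next
    case (Suc n)
    let ?x = "if c then a else b + p"
    have "R.fr (dg n ?x + E n n ?x) (add_mset c (replicate_mset n c))"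
      by (rule R.frS[OF Suc]) (use abp G i in \<open>auto simp: fmat_eq_iff\<close>)
    then show ?case by (simp add: dg_Suc)
  qed
  from this[of True] this[of False]
  show "R.fr (dg n a) (replicate_mset n True)" "R.fr (F n) (replicate_mset n False)" by (simp_all add: F_dg)
qed

lemma dg_nz: "n \<noteq> 0 \<Longrightarrow> x \<noteq> 0 \<Longrightarrow> dg n x \<noteq> 0"
  by (auto simp: fmat_eq_iff)

lemma F_nz: "n \<noteq> 0 \<Longrightarrow> F n \<noteq> 0"
proof
  assume n: "n \<noteq> 0" "F n = 0"
  have "dg n b * F n = dg n b" by (simp add: F_def distrib_left dgo idem)
  then show False using n dg_nz[of n b] abp by simp
qed

text \<open>\<open>approx1\<close> applied to each matrix entry, after \<open>q\<close> has been
  identified with a power of P_1.\<close>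

lemma approx: assumes f: "f \<in> hm (dg k b) q" and q: "pure False q"
  shows "\<exists>z\<in>hm (dg k p) q. f = z * dg k m"
proof -
  obtain n where n: "fr q (replicate_mset n False)" using q by (auto simp: pure_def)
  obtain x y where xy: "x \<in> hm q (dg n a)" "y \<in> hm (dg n a) q" "y * x = q" "x * y = dg n a"
    using fr_iso_eq[OF n fr_dg(1)] by (rule isoE)
  define g where "g = x * f"
  have g: "g \<in> hm (dg k b) (dg n a)" using xy f by (auto simp: g_def)
  have ge: "ent g i j = (if i < n \<and> j < k then a * ent g i j else 0)" "ent g i j = (if i < n \<and> j < k then ent g i j * b else 0)" for i j
    using arg_cong[OF hmL[OF g], of "\<lambda>Z. ent Z i j"] arg_cong[OF hmR[OF g], of "\<lambda>Z. ent Z i j"] by (auto split: if_splits)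
  have "\<exists>z\<in>S. a * z = z \<and> z * p = z \<and> ent g i j = z * m" if "i < n" "j < k" for i j
    using ge[of i j] that scD[OF hmS[OF g]] by (intro approx1) simp_all
  then obtain z where z: "\<And>i j. i < n \<Longrightarrow> j < k \<Longrightarrow> z i j \<in> S \<and> a * z i j = z i j \<and> z i j * p = z i j \<and> ent g i j = z i j * m"
    by metis
  define Z where "Z = Fmat (\<lambda>i j. if i < n \<and> j < k then z i j else 0)"
  have eZ: "ent Z i j = (if i < n \<and> j < k then z i j else 0)" for i j
    unfolding Z_def by (subst ent_Fmat[of "n + k"]) auto
  have Z: "Z \<in> hm (dg k p) (dg n a)"
    using z by (auto simp: hm_def sc_iff eZ fmat_eq_iff)
  have "g = Z * dg k m"
  proof (rule fmat_eqI)
    fix i j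
    have "ent g i j = 0" if "\<not> (i < n \<and> j < k)" using ge(1)[of i j] that by simp
    then show "ent g i j = ent (Z * dg k m) i j" using z[of i j] by (cases "i < n"; cases "j < k") (simp_all add: eZ)
  qed
  moreover have "f = y * g" using f xy by (simp add: g_def mult.assoc[symmetric] hmL)
  ultimately have "f = (y * Z) * dg k m" by (simp add: mult.assoc)
  then show ?thesis using xy Z by blast
qed

text \<open>Each product of an entry of \<open>z\<close> with an entry of \<open>c\<close> is
  radical, since otherwise some multiple of it would be the identity, contrary to
  \<open>min1\<close>; and radical endomorphisms of the local object P_1 are closed under
  sums.\<close>

lemma minim: assumes z: "z \<in> hm (dg k p) (E 0 0 a)" "z * dg k m = 0" and c: "c \<in> hm (E 0 0 a) (dg k p)"
  shows "z * c \<in> rad (E 0 0 a) (E 0 0 a)"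
proof -
  have Gl: "loc (E 0 0 a)" using Gloc[of False] by simp
  have z0: "ent z i j = 0" if "\<not> (i = 0 \<and> j < k)" for i j
    using that arg_cong[OF hmL[OF z(1)], of "\<lambda>Z. ent Z i j"] arg_cong[OF hmR[OF z(1)], of "\<lambda>Z. ent Z i j"] by (auto split: if_splits)
  have c0: "ent c i j = 0" if "\<not> (i < k \<and> j = 0)" for i j
    using that arg_cong[OF hmL[OF c], of "\<lambda>Z. ent Z i j"] arg_cong[OF hmR[OF c], of "\<lambda>Z. ent Z i j"] by (auto split: if_splits)
  have zj: "ent z 0 j \<in> S \<and> a * ent z 0 j = ent z 0 j \<and> ent z 0 j * p = ent z 0 j \<and> ent z 0 j * m = 0" if "j < k" for j
    using that arg_cong[OF hmL[OF z(1)], of "\<lambda>Z. ent Z 0 j"] arg_cong[OF hmR[OF z(1)], of "\<lambda>Z. ent Z 0 j"]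
      arg_cong[OF z(2), of "\<lambda>Z. ent Z 0 j"] scD[OF hmS[OF z(1)]] by auto
  have cj: "ent c j 0 \<in> S \<and> p * ent c j 0 = ent c j 0 \<and> ent c j 0 * a = ent c j 0" if "j < k" for j
    using that arg_cong[OF hmL[OF c], of "\<lambda>Z. ent Z j 0"] arg_cong[OF hmR[OF c], of "\<lambda>Z. ent Z j 0"] scD[OF hmS[OF c]] by auto
  have one: "E 0 0 (ent z 0 j * ent c j 0) \<in> rad (E 0 0 a) (E 0 0 a)" if j: "j < k" for j
  proof -
    let ?u = "ent z 0 j" and ?v = "ent c j 0"
    have "w = 0" if w: "w \<in> hm (E 0 0 a) (E 0 0 a)" "w * E 0 0 (?u * ?v) * w = w" for w
    proof (rule ccontr)
      assume nz: "w \<noteq> 0"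
      define w' where "w' = ent w 0 0"
      have ww: "w = E 0 0 w'" using hm_E[OF w(1)] by (simp add: w'_def)
      have w': "w' \<in> S" "a * w' = w'" "w' * a = w'" "w' * (?u * ?v) * w' = w'" using w unfolding ww hm_E_iff by (simp_all add: mult.assoc)
      let ?e = "w' * (?u * ?v)"
      have "idp (E 0 0 ?e)" "E 0 0 a * E 0 0 ?e = E 0 0 ?e" "E 0 0 ?e * E 0 0 a = E 0 0 ?e"
      proof -
        have "?e \<in> S" using w' zj[OF j] cj[OF j] by auto
        moreover have "?e * ?e = ?e" using w'(4) by (metis mult.assoc)
        ultimately show "idp (E 0 0 ?e)" by (simp add: idp_def)
        show "E 0 0 a * E 0 0 ?e = E 0 0 ?e" using w'(2) by (simp add: mult.assoc[symmetric])
        show "E 0 0 ?e * E 0 0 a = E 0 0 ?e" using cj[OF j] by (simp add: mult.assoc)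
      qed
      from loc_idem[OF Gl this] have "?e = 0 \<or> ?e = a" by (metis E_inject E_zero)
      moreover have "?e \<noteq> 0" using w'(4) nz ww by auto
      ultimately have "w' * ?u * ?v = a" by (simp add: mult.assoc)
      moreover have "w' * ?u * ?v \<noteq> a"
        using zj[OF j] cj[OF j] w' by (intro min1) (auto simp: mult.assoc asr[OF w'(2)])
      ultimately show False by blast
    qed
    moreover have "E 0 0 (?u * ?v) \<in> hm (E 0 0 a) (E 0 0 a)"
      unfolding hm_E_iff using zj[OF j] cj[OF j] by (auto simp: mult.assoc) (metis mult.assoc)
    ultimately show ?thesis by (auto simp: rad_def)
  qed
  have "(\<Sum>j<i. E 0 0 (ent z 0 j * ent c j 0)) \<in> rad (E 0 0 a) (E 0 0 a)" if "i \<le> k" for i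
    using that
  proof (induction i)
    case (Suc i)
    then show ?case using rad_add[OF Gl _ one, of "\<Sum>j<i. E 0 0 (ent z 0 j * ent c j 0)" i] by simp
  qed simp
  moreover have "z * c = (\<Sum>j<k. E 0 0 (ent z 0 j * ent c j 0))"
  proof -
    have zb: "bnd z (Suc k)" using z0 by (auto simp: bnd_def)
    have "ent (z * c) s t = (\<Sum>j<k. ent z s j * ent c j t)" for s t
      unfolding ent_times[OF zb] using c0 by simp
    moreover have "(\<Sum>j<k. ent z s j * ent c j t) = (\<Sum>j<k. if s = 0 \<and> t = 0 then ent z 0 j * ent c j 0 else 0)" for s t
      using z0[of s] c0[of _ t] by (cases "s = 0"; cases "t = 0") simp_all
    ultimately show ?thesis by (auto simp: fmat_eq_iff ent_sum)
  qed
  ultimately show ?thesis by simp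
qed

lemma G_not_rad: "E 0 0 a \<notin> rad (E 0 0 a) (E 0 0 a)"
  using radD[of "E 0 0 a" "E 0 0 a" "E 0 0 a" "E 0 0 a"] Gidp[of False] Gnz[of False] by (auto simp: idp_def hm_id)

text \<open>A nonzero \<open>y\<close> contains a copy of P_1. Its projection r satisfies r m^k = 0,
  so by \<open>minim\<close> the identity of P_1 would be radical.\<close>

lemma min_idem: assumes "y \<in> hm (dg k p) (dg k p)" "y * y = y" "y * dg k m = 0" shows "y = 0"
proof (rule ccontr)
  assume n: "y \<noteq> 0"
  have "idp y" using assms by (auto simp: idp_def dest: hmS)
  then have "pure False y" using pure_sub[OF pure_dg(3)] assms hmL hmR by blast
  then obtain c r where cr: "c \<in> hm (E 0 0 a) y" "r \<in> hm y (E 0 0 a)" "r * c = E 0 0 a" using n by (rule pure_has)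
  have yP: "y \<in> hm y (dg k p)" "y \<in> hm (dg k p) y" using assms by (auto simp: hm_def)
  have 1: "c \<in> hm (E 0 0 a) (dg k p)" using hm_mult[OF yP(1) cr(1)] hmL[OF cr(1)] by simp
  have 2: "r \<in> hm (dg k p) (E 0 0 a)" using hm_mult[OF cr(2) yP(2)] hmR[OF cr(2)] by simp
  have "r * dg k m = r * (y * dg k m)" using hmR2[OF cr(2)] by simp
  then have "r * dg k m = 0" using assms(3) by simp
  then show False using minim[OF 2 _ 1] cr(3) G_not_rad by simp
qed

text \<open>The correspondence: a split monomorphism \<open>D\<close> from \<open>f\<^sub>2\<^sup>n\<close> to \<open>f\<^sub>1\<^sup>k\<close> is matched with
  the composite of \<open>m\<^sup>k\<close> with the projection onto the cokernel of \<open>D\<close>.\<close>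

definition ptn :: "nat \<Rightarrow> nat \<Rightarrow> 'r fmat \<Rightarrow> 'r fmat \<Rightarrow> bool" where
  "ptn n k D w \<longleftrightarrow> D \<in> hm (dg n a) (dg k p) \<and> w \<in> hm (dg k p) (dg n a) \<and> w * D = dg n a"

definition cL :: "nat \<Rightarrow> 'r fmat \<Rightarrow> 'r fmat \<Rightarrow> 'r fmat \<times> 'r fmat \<times> 'r fmat" where
  "cL k D w = (dg k b, dg k p - D * w, (dg k p - D * w) * dg k m)"

definition cR :: "nat \<Rightarrow> nat \<Rightarrow> 'r fmat \<Rightarrow> 'r fmat \<times> 'r fmat \<times> 'r fmat" where
  "cR n k D = (dg n a, F k, D)"

lemma ptn_props: assumes "ptn n k D w"
  shows "D \<in> hm (dg n a) (dg k p)" "w \<in> hm (dg k p) (dg n a)" "w * D = dg n a"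
    "(dg k p - D * w) * D = 0" "w * (dg k p - D * w) = 0" "idp (dg k p - D * w)"
    "dg k p * (dg k p - D * w) = dg k p - D * w" "(dg k p - D * w) * dg k p = dg k p - D * w"
    "(dg k p - D * w) * dg k m \<in> hm (dg k b) (dg k p - D * w)"
proof -
  show 1: "D \<in> hm (dg n a) (dg k p)" "w \<in> hm (dg k p) (dg n a)" "w * D = dg n a" using assms by (auto simp: ptn_def)
  show 2: "(dg k p - D * w) * D = 0" "w * (dg k p - D * w) = 0"
    by (simp_all add: algebra_simps hmE[OF 1(1)] hmE[OF 1(2)] 1(3) asr[OF 1(3)])
  show 3: "dg k p * (dg k p - D * w) = dg k p - D * w" "(dg k p - D * w) * dg k p = dg k p - D * w"
    by (simp_all add: algebra_simps hmE[OF 1(1)] hmE[OF 1(2)] dgo idem)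
  have S: "dg k p - D * w \<in> sc S" "D \<in> sc S" "w \<in> sc S"
    using hmS[OF 1(1)] hmS[OF 1(2)] dg_S[OF abp(3)] by auto
  have "(dg k p - D * w) * (dg k p - D * w) = (dg k p - D * w) * dg k p - ((dg k p - D * w) * D) * w"
    by (simp only: right_diff_distrib mult.assoc)
  then show "idp (dg k p - D * w)" using S 2 3 by (simp add: idp_def)
  then show "(dg k p - D * w) * dg k m \<in> hm (dg k b) (dg k p - D * w)"
    using S m by (auto simp: hm_def mult.assoc dgo idp_def) (metis mult.assoc)
qed

lemma ptn_pm: assumes "ptn n k D w" shows "pm (cL k D w)" "R.pm (cR n k D)"
proof -
  note P = ptn_props[OF assms]
  have "pure False (dg k p - D * w)" using pure_sub[OF pure_dg(3) P(6-8)] .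
  then show "pm (cL k D w)" using P(9) pure_dg by (simp add: pm_def cL_def)
  show "R.pm (cR n k D)" using R_fr P(1) by (auto simp: R.pm_def cR_def R.pure_def R_AF)
qed

text \<open>The idempotent \<open>D * w\<close> is isomorphic to P_1^n, so its complement in P_1^(k
  l), the cokernel of D, is P_1^(k l - n).\<close>

lemma ptn_gv: assumes "ptn n k D w"
  shows "gv (cL k D w) = (real k * real l - real n, - real k)" "R.gv (cR n k D) = (real k, - real n)"
    and "n \<le> k * l"
proof -
  note P = ptn_props[OF assms]
  have Dw: "idp (D * w)" "dg k p * (D * w) = D * w" "D * w * dg k p = D * w"
    using hmS[OF P(1)] hmS[OF P(2)] by (auto simp: idp_def mult.assoc P(3) asr[OF P(3)] hmE[OF P(1)] hmE[OF P(2)])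
  obtain M K where MK: "fr (D * w) M" "fr (dg k p - D * w) K" "replicate_mset (k * l) False = M + K"
    using fr_split[OF fr_dgp Dw] by blast
  have "local.iso (dg n a) (D * w)"
    by (rule isoI[of D _ _ w])
      (use hmS[OF P(1)] hmS[OF P(2)] in \<open>auto simp: hm_def mult.assoc P(3) asr[OF P(3)] hmE[OF P(1)] hmE[OF P(2)]\<close>)
  then have "M = replicate_mset n False" using fr_unique[OF MK(1)] fr_iso[OF fr_dg(1)] by blast
  then have s: "k * l = n + size K" using arg_cong[OF MK(3), of size] by simp
  have cK: "count K False = size K" "count K True = 0"
  proof -
    have "count K True \<le> count (replicate_mset (k * l) False) True" unfolding MK(3) by simp
    then show "count K True = 0" by simp
    then have "set_mset K \<subseteq> {False}" using not_in_iff by (metis (full_types) insertI1 subsetI)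
    then have "K = replicate_mset (size K) False" by (rule set_mset_subset_singletonD)
    from arg_cong[OF this, of "\<lambda>M. count M False"] show "count K False = size K" by simp
  qed
  have n1: "nm (dg k b) = replicate_mset k True" "nm (dg k p - D * w) = K"
    using nm_eq[OF fr_dg(2)] nm_eq[OF MK(2)] by auto
  show "n \<le> k * l" using s by simp
  have "real k * real l = real n + real (size K)" using s by (metis of_nat_add of_nat_mult)
  then show "gv (cL k D w) = (real k * real l - real n, - real k)" by (simp add: gv_def cL_def n1 cK)
  show "R.gv (cR n k D) = (real k, - real n)" by (simp add: R.gv_def cR_def R.nm_eq[OF R_fr(1)] R.nm_eq[OF R_fr(2)])
qed

text \<open>Maps P_2^k -> q' lift along m^k to maps P_1^(k l) -> q' by \<open>approx\<close>, and
  restricting these along D gives maps f_2^n -> f_1^k'. In the other direction the retraction w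
  plays the part of D. The work is to correct lifts by maps that annihilate m.\<close>

lemma ptn_hom1: assumes 1: "ptn n k D w" and 2: "ptn n' k' D' w'"
  shows "hom1 (cL k D w) (cL k' D' w') \<longleftrightarrow> R.hom1 (cR n k D) (cR n' k' D')"
proof -
  note P = ptn_props[OF 1] and Q = ptn_props[OF 2]
  define q q' where "q = dg k p - D * w" and "q' = dg k' p - D' * w'"
  note P = P[folded q_def] and Q = Q[folded q'_def]
  have pq: "dg k p = q + D * w" "dg k' p = q' + D' * w'" by (simp_all add: q_def q'_def)
  have pu: "pure False q'" using pure_sub[OF pure_dg(3) Q(6-8)] .
  have qP: "q' \<in> hm (dg k' p) q'" "q' \<in> hm q' (dg k' p)" "q \<in> hm (dg k p) q" "q \<in> hm q (dg k p)"
    using P(6-8) Q(6-8) by (auto simp: hm_def idp_def)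
  show ?thesis unfolding cL_def cR_def q_def[symmetric] q'_def[symmetric]
  proof
    assume L: "hom1 (dg k b, q, q * dg k m) (dg k' b, q', q' * dg k' m)"
    have "\<exists>h\<in>R.hm (F k) (F k'). \<exists>h'\<in>R.hm (dg n a) (dg n' a). f = h * D + D' * h'" if "f \<in> R.hm (dg n a) (F k')" for f
    proof -
      have f: "f \<in> hm (dg n a) (dg k' p)" using that by (simp add: R_AF)
      \<comment> \<open>The map \<open>f\<close> is extended along D by the retraction
        \<open>w\<close>, restricted to P_2^k by m, and pushed to the cokernel: this is the test map
        over \<Lambda>.\<close>
      have "q' * f * w * dg k m \<in> hm (dg k b) q'" using f P(2) qP(1) mhm by (auto intro!: hm_mult)
      then obtain g x where g: "g \<in> hm q q'" "x \<in> hm (dg k b) (dg k' b)" "q' * f * w * dg k m = g * (q * dg k m) + q' * dg k' m * x"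
        using L unfolding hom1_def prod.case by blast
      have "dg k' m * x \<in> hm (dg k b) (dg k' p)" using mhm g by auto
      then obtain y where y: "y \<in> hm (dg k p) (dg k' p)" "dg k' m * x = y * dg k m" using approx pure_dg(3) by blast
      \<comment> \<open>The failure of the factorization before restricting to P_2^k. It annihilates
        m, so (x, y + z) is still a chain map and can absorb it.\<close>
      define z where "z = q' * f * w - g * q - q' * y"
      have zm: "z * dg k m = 0" using g(3) y(2) by (simp add: z_def algebra_simps)
      have zh: "z \<in> hm (dg k p) (dg k' p)" 
      proof -
        have q': "q' \<in> hm (dg k' p) (dg k' p)" using hm_mult[OF qP(2) qP(1)] Q(6) by (simp add: idp_def)
        have "g * q \<in> hm (dg k p) (dg k' p)" using hm_mult[OF hm_mult[OF qP(2) g(1)] qP(3)] hmL[OF g(1)] by simp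
        then show ?thesis unfolding z_def
          using hm_mult[OF q' y(1)] hm_mult[OF hm_mult[OF q' f] P(2)] by (intro hm_diff)
      qed
      have 3: "x + (y + z) \<in> R.hm (F k) (F k')"
        unfolding R_FF using g(2) y zh zm by (intro bexI[of _ x] bexI[of _ "y + z"]) (auto simp: distrib_right)
      have xD: "x * D = 0" using hmR[OF g(2)] hmL[OF P(1)] dgo(1)[of k k] by (metis mult.assoc mult_zero_left mult_zero_right)
      have hD: "(x + (y + z)) * D = y * D + q' * f - q' * (y * D)"
        using P(3,4) hmR[OF f] by (simp add: z_def algebra_simps xD)
      \<comment> \<open>What is left vanishes in the cokernel of D', so it factors through D' by way
        of w'.\<close>
      have "f - (x + (y + z)) * D = (dg k' p - q') * (f - y * D)"
        unfolding hD using hmL[OF f] hmL2[OF y(1)] by (simp add: algebra_simps)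
      also have "\<dots> = D' * (w' * (f - y * D))" unfolding pq by (simp add: mult.assoc)
      finally have "f = (x + (y + z)) * D + D' * (w' * (f - y * D))" by (simp add: algebra_simps)
      moreover have "w' * (f - y * D) \<in> R.hm (dg n a) (dg n' a)"
        unfolding R_AA using Q(2) f y(1) P(1) by (intro hm_mult[of w'] hm_diff) auto
      ultimately show ?thesis using 3 by blast
    qed
    then show "R.hom1 (dg n a, F k, D) (dg n' a, F k', D')" unfolding R.hom1_def prod.case by blast
  next
    assume Rh: "R.hom1 (dg n a, F k, D) (dg n' a, F k', D')"
    have "\<exists>h\<in>hm q q'. \<exists>h'\<in>hm (dg k b) (dg k' b). f = h * (q * dg k m) + q' * dg k' m * h'" if f: "f \<in> hm (dg k b) q'" for f
    proof -
      obtain z where z: "z \<in> hm (dg k p) q'" "f = z * dg k m" using approx[OF f pu] by blast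
      have zP: "z \<in> hm (dg k p) (dg k' p)" using hm_mult[OF qP(2) z(1)] hmL[OF z(1)] by simp
      then have "z * D \<in> R.hm (dg n a) (F k')" unfolding R_AF using P(1) by auto
      then obtain X h' where X: "X \<in> R.hm (F k) (F k')" "h' \<in> hm (dg n a) (dg n' a)" "z * D = X * D + D' * h'"
        using Rh unfolding R.hom1_def prod.case R_AA by blast
      obtain x y where xy: "x \<in> hm (dg k b) (dg k' b)" "y \<in> hm (dg k p) (dg k' p)" "X = x + y" "y * dg k m = dg k' m * x"
        using X(1) unfolding R_FF by blast
      have xD: "x * D = 0" using hmR[OF xy(1)] hmL[OF P(1)] dgo(1)[of k k] by (metis mult.assoc mult_zero_left mult_zero_right)
      have "q' * (z * D) = q' * (y * D) + (q' * D') * h'" unfolding X(3) xy(3) by (simp add: distrib_left distrib_right xD mult.assoc)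
      \<comment> \<open>Since q' D' = 0, the term through D' disappears; hence z - q' y vanishes on
        the image of D and factors through its cokernel q.\<close>
      then have zD: "z * D = q' * y * D" using Q(4) hmL2[OF z(1)] by (simp add: mult.assoc)
      define g where "g = (z - q' * y) * q"
      have gh: "g \<in> hm q q'" unfolding g_def by (rule hm_mult[OF hm_diff[OF z(1) hm_mult[OF qP(1) xy(2)]] qP(4)])
      have "(z - q' * y) * dg k p = g + (z - q' * y) * D * w" unfolding pq g_def by (simp add: distrib_left mult.assoc)
      also have "(z - q' * y) * D = 0" using zD by (simp add: left_diff_distrib)
      finally have "z = q' * y + g" using hmR[OF z(1)] hmR[OF xy(2)] by (simp add: algebra_simps)
      then have "f = q' * (y * dg k m) + g * dg k m" unfolding z(2) by (simp add: distrib_right mult.assoc)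
      also have "\<dots> = g * (q * dg k m) + q' * dg k' m * x" using hmR2[OF gh] xy(4) by (simp add: mult.assoc add.commute)
      finally show ?thesis using gh xy(1) by blast
    qed
    then show "hom1 (dg k b, q, q * dg k m) (dg k' b, q', q' * dg k' m)" unfolding hom1_def prod.case by blast
  qed
qed

text \<open>Idempotent endomorphisms are matched. From right to left, (x, y) induces a map on the
  cokernel of D; from left to right, a map of the cokernel lifts to P_1^(k l), and a Fitting
  idempotent makes the lift idempotent. Minimality of m ensures that trivial pairs match trivial
  pairs.\<close>

lemma ptn_lc: assumes 1: "ptn n k D w" shows "lc (cL k D w) \<longleftrightarrow> R.lc (cR n k D)"
proof -
  note P = ptn_props[OF 1]
  define q where "q = dg k p - D * w"
  note P = P[folded q_def]
  have pq: "dg k p = q + D * w" by (simp add: q_def)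
  have qP: "q \<in> hm (dg k p) q" "q \<in> hm q (dg k p)" and qq: "q * q = q" using P(6-8) by (auto simp: hm_def idp_def)
  have k0: "q = 0" "dg n a = 0" "dg k b = 0" "F k = 0" if "k = 0" using that P(1) P(3)[symmetric] by (auto simp: q_def F_def)
  have nzL: "(dg k b \<noteq> 0 \<or> q \<noteq> 0) \<longleftrightarrow> k \<noteq> 0" using k0 dg_nz[of k b] abp by (cases "k = 0") simp_all
  have nzR: "(dg n a \<noteq> 0 \<or> F k \<noteq> 0) \<longleftrightarrow> k \<noteq> 0" using k0 F_nz[of k] by (cases "k = 0") simp_all
  show ?thesis unfolding cL_def cR_def q_def[symmetric]
  proof
    assume L: "lc (dg k b, q, q * dg k m)"
    have kn: "k \<noteq> 0" using L nzL unfolding lc_def prod.case by blast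
    have "(h' = 0 \<and> X = 0) \<or> (h' = dg n a \<and> X = F k)"
      if t: "h' \<in> R.hm (dg n a) (dg n a)" "X \<in> R.hm (F k) (F k)" and h: "h' * h' = h'" "X * X = X" "X * D = D * h'" for h' X
    proof -
      have h': "h' \<in> hm (dg n a) (dg n a)" using t(1) by (simp add: R_AA)
      obtain x y where xy: "x \<in> hm (dg k b) (dg k b)" "y \<in> hm (dg k p) (dg k p)" "X = x + y" "y * dg k m = dg k m * x"
        using t(2) unfolding R_FF by blast
      have o: "x * y = 0" "y * x = 0" "x * D = 0" "dg k b * y = 0" "dg k b * x = x"
        using hmL[OF xy(1)] hmR[OF xy(1)] hmL[OF xy(2)] hmR[OF xy(2)] hmL[OF P(1)] dgo(1)[of k k] dgo(2)[of k k]
        by (metis mult.assoc mult_zero_left mult_zero_right)+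
      have XX: "x * x + y * y = x + y" using h(2) o unfolding xy(3) by (simp add: algebra_simps)
      have "dg k b * (x * x + y * y) = x * x" "dg k b * (x + y) = x"
        using o by (simp_all add: distrib_left asr[OF o(4)] asr[OF o(5)])
      then have xx: "x * x = x" using XX by simp
      then have yy: "y * y = y" using XX by simp
      have yD: "y * D = D * h'" using h(3) o(3) unfolding xy(3) by (simp add: distrib_right)
      \<comment> \<open>\<open>y\<close> preserves the image of D and \<open>q\<close> annihilates
        it. Thus \<open>q * y\<close> descends to the cokernel, which is the equation
        \<open>qyq\<close>.\<close>
      have qyD: "q * y * D = 0" using yD P(4) by (simp add: mult.assoc) (simp add: mult.assoc[symmetric])
      have "q * y * dg k p = q * y * q + q * y * D * w" unfolding pq by (simp add: distrib_left mult.assoc)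
      also have "\<dots> = q * y * q" unfolding qyD by simp
      finally have e: "q * y * dg k p = q * y * q" .
      have "q * y * dg k p = q * y" by (simp add: mult.assoc hmR[OF xy(2)])
      then have qyq: "q * y * q = q * y" using e by simp
      have g: "q * y \<in> hm q q" using hm_mult[OF hm_mult[OF qP(1) xy(2)] qP(2)] qyq by simp
      have gg: "q * y * (q * y) = q * y"
      proof -
        have "q * y * (q * y) = q * y * q * y" by (simp add: mult.assoc)
        also have "\<dots> = q * (y * y)" unfolding qyq by (simp add: mult.assoc)
        finally show ?thesis by (simp add: yy)
      qed
      have "q * y * (q * dg k m) = q * y * q * dg k m" by (simp add: mult.assoc)
      also have "\<dots> = q * dg k m * x" unfolding qyq by (simp add: mult.assoc xy(4))
      finally have c: "q * y * (q * dg k m) = q * dg k m * x" .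
      have "(x = 0 \<and> q * y = 0) \<or> (x = dg k b \<and> q * y = q)"
        using L xy(1) g xx gg c unfolding lc_def prod.case by blast
      then show ?thesis
      proof
        assume "x = 0 \<and> q * y = 0"
        \<comment> \<open>From x = 0 follows y m = 0, and minimality of m excludes a nonzero
          idempotent of this kind.\<close>
        then have "y = 0" using min_idem[OF xy(2) yy] xy(4) by simp
        then have "D * h' = 0" using yD by simp
        then have "h' = 0" using hmL[OF h'] P(3) by (metis mult.assoc mult_zero_right)
        then show ?thesis using xy(3) \<open>y = 0\<close> \<open>x = 0 \<and> q * y = 0\<close> by simp
      next
        assume x: "x = dg k b \<and> q * y = q"
        have "dg k p - y = 0"
        proof (rule min_idem)
          show "dg k p - y \<in> hm (dg k p) (dg k p)" using xy(2) dgi by (intro hm_diff idp_hm) auto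
          show "(dg k p - y) * (dg k p - y) = dg k p - y" using hmL[OF xy(2)] hmR[OF xy(2)] yy by (simp add: algebra_simps dgo idem)
          show "(dg k p - y) * dg k m = 0" using xy(4) x by (simp add: algebra_simps dgo idem)
        qed
        then have y: "y = dg k p" by simp
        then have "D = D * h'" using yD hmL[OF P(1)] by simp
        then have "h' = dg n a" using hmL[OF h'] P(3) by (metis mult.assoc)
        then show ?thesis using xy(3) x y by (simp add: F_def)
      qed
    qed
    then show "R.lc (dg n a, F k, D)" using kn nzR unfolding R.lc_def prod.case by blast
  next
    assume Rl: "R.lc (dg n a, F k, D)"
    have kn: "k \<noteq> 0" using Rl nzR unfolding R.lc_def prod.case by blast
    have "(x = 0 \<and> g = 0) \<or> (x = dg k b \<and> g = q)"
      if x: "x \<in> hm (dg k b) (dg k b)" "g \<in> hm q q" "x * x = x" "g * g = g" "g * (q * dg k m) = q * dg k m * x" for x g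
    proof -
      have "dg k m * x \<in> hm (dg k b) (dg k p)" using mhm x by auto
      then obtain y0 where y0: "y0 \<in> hm (dg k p) (dg k p)" "dg k m * x = y0 * dg k m" using approx pure_dg(3) by blast
      \<comment> \<open>The lift \<open>y0\<close> of x need not induce \<open>g\<close> on the
        cokernel. The correction term annihilates m^k, so y still lifts x, and it makes q y =
        g.\<close>
      define y where "y = y0 + (g * q - q * y0)"
      have gq: "g * q = g" "q * g = g" using x(2) by (auto simp: hm_def)
      have gP: "g \<in> hm (dg k p) (dg k p)" using hm_mult[OF hm_mult[OF qP(2) x(2)] qP(1)] gq by simp
      have yh: "y \<in> hm (dg k p) (dg k p)" unfolding y_def gq using y0(1) gP hm_mult[OF hm_mult[OF qP(2) qP(1)] y0(1)] qq by auto
      have ym: "y * dg k m = dg k m * x"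
        using x(5) y0(2) by (simp add: y_def algebra_simps)
      have qy: "q * y = g" by (simp add: y_def gq algebra_simps asr[OF qq])
      \<comment> \<open>\<open>y\<close> need not be idempotent although it induces the idempotents
        x and g. Its Fitting idempotent e induces the same two maps, because all powers of
        \<open>y\<close> do.\<close>
      obtain N Y where Y: "Y \<in> sc S" "y * Y = Y * y" "pw y N * pw y N * Y = pw y N" using fit[OF hmS[OF yh]] by blast
      have pc: "pw y j * Y = Y * pw y j" for j by (induction j) (simp_all add: Y mult.assoc, metis Y(2) mult.assoc)
      have ph: "pw y j \<in> hm (dg k p) (dg k p)" for j by (induction j) (use yh in auto)
      define e where "e = pw y N * Y"
      have e2: "e = Y * pw y N" by (simp add: e_def pc)
      have eh: "e \<in> hm (dg k p) (dg k p)"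
      proof (rule hmI)
        show "e \<in> sc S" using hmS[OF ph] Y(1) by (auto simp: e_def)
        show "dg k p * e = e" by (simp add: e_def hmL2[OF ph])
        show "e * dg k p = e" by (simp add: e2 mult.assoc hmR[OF ph])
      qed
      have ee: "e * e = e"
      proof -
        have "e * e = Y * (pw y N * pw y N * Y)" by (simp add: e_def e2[unfolded e_def] mult.assoc)
        then show ?thesis by (simp add: Y(3) e2)
      qed
      have pm: "pw y j * dg k m = dg k m * x" for j
        by (induction j) (simp_all add: ym mult.assoc, simp add: asr[OF ym] x(3) mult.assoc)
      have em: "e * dg k m = dg k m * x"
      proof -
        have "pw y N * dg k m = pw y N * pw y N * Y * dg k m" using Y(3) by simp
        also have "\<dots> = Y * (pw y N * (pw y N * dg k m))" by (simp add: mult.assoc pc) (simp add: mult.assoc[symmetric] pc)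
        also have "\<dots> = Y * (pw y N * dg k m)" by (simp add: pm asr[OF pm] x(3) mult.assoc)
        also have "\<dots> = e * dg k m" by (simp add: e2 mult.assoc)
        finally show ?thesis by (simp add: pm)
      qed
      have gy: "g * y = g" using qy gq(1) x(4) by (metis mult.assoc)
      have gp: "g * pw y j = g" for j by (induction j) (simp_all add: gy mult.assoc[symmetric])
      have gY: "g * Y = g"
      proof -
        have "g * (pw y N * pw y N * Y) = g * Y" by (simp add: mult.assoc[symmetric] gp)
        then show ?thesis using Y(3) gp by simp
      qed
      have qp: "q * pw y j = g" for j
        by (induction j) (simp_all add: qy mult.assoc[symmetric], simp add: gp)
      have qe: "q * e = g" by (simp add: e_def mult.assoc[symmetric] qp gY)
      have o: "x * D = 0" "x * e = 0" "e * x = 0" "dg k b * e = 0"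
        using hmL[OF x(1)] hmR[OF x(1)] hmL[OF eh] hmR[OF eh] hmL[OF P(1)] dgo(1)[of k k] dgo(2)[of k k]
        by (metis mult.assoc mult_zero_left mult_zero_right)+
      have X: "x + e \<in> R.hm (F k) (F k)" unfolding R_FF using x(1) eh em by blast
      have gD: "g * D = 0" using gq(1) P(4) by (metis mult.assoc mult_zero_right)
      have "D * (w * e * D) = (dg k p - q) * (e * D)" by (simp add: pq mult.assoc)
      also have "\<dots> = e * D" using hmL2[OF eh, of D] gD by (simp add: left_diff_distrib mult.assoc[symmetric] qe)
      finally have De: "D * (w * e * D) = e * D" .
      have h': "w * e * D \<in> R.hm (dg n a) (dg n a)" unfolding R_AA using P(1,2) eh by auto
      have hh: "w * e * D * (w * e * D) = w * e * D"
      proof -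
        have "w * e * D * (w * e * D) = w * e * (D * (w * e * D))" by (simp add: mult.assoc)
        also have "\<dots> = w * (e * e) * D" unfolding De by (simp add: mult.assoc)
        finally show ?thesis by (simp add: ee)
      qed
      have XX: "(x + e) * (x + e) = x + e" by (simp add: algebra_simps o x(3) ee)
      have XD: "(x + e) * D = D * (w * e * D)" unfolding De by (simp add: distrib_right o)
      have "(w * e * D = 0 \<and> x + e = 0) \<or> (w * e * D = dg n a \<and> x + e = F k)"
        using Rl h' X hh XX XD unfolding R.lc_def prod.case by blast
      then show ?thesis
      proof
        assume "w * e * D = 0 \<and> x + e = 0"
        then have 0: "x + e = 0" by simp
        have "dg k b * (x + e) = x" by (simp add: distrib_left o hmL[OF x(1)])
        then have x0: "x = 0" using 0 by simp
        then have "e = 0" using 0 by simp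
        then show ?thesis using x0 qe by simp
      next
        assume "w * e * D = dg n a \<and> x + e = F k"
        then have 0: "x + e = F k" by simp
        have "dg k b * (x + e) = x" "dg k b * F k = dg k b" by (simp_all add: distrib_left o hmL[OF x(1)] F_def dgo idem)
        then have x0: "x = dg k b" using 0 by simp
        then have "e = dg k p" using 0 by (simp add: F_def)
        then show ?thesis using x0 qe P(8) by simp
      qed
    qed
    then show "lc (dg k b, q, q * dg k m)" using kn nzL unfolding lc_def prod.case by blast
  qed
qed

end

lemma subset_two: "A \<subseteq> {a, b} \<Longrightarrow> a \<in> A \<Longrightarrow> A = {a} \<or> A = {a, b}"
  by (cases "b \<in> A") blast+

section \<open>Normal forms, the two objects without partner, and the comparison of the
  cones\<close>

context rot begin

text \<open>The differential factors as y m^k by \<open>approx\<close>. Rigidity makes y a split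
  monomorphism or a split epimorphism, and in the first case indecomposability makes it an
  isomorphism. Its kernel, a power of P_1, supplies D.\<close>

lemma exL: assumes X: "pm X" "lc X" "hom1 X X" "fst X \<noteq> 0"
  obtains n k D w where "ptn n k D w" "siso X (cL k D w)" "k \<noteq> 0"
proof -
  obtain p0 q0 d0 where X0: "X = (p0, q0, d0)" by (cases X)
  have P0: "pure True p0" "pure False q0" and cx0: "cx (p0, q0, d0)" using X(1) pm_cx[OF X(1)] by (auto simp: pm_def X0)
  obtain k where k: "fr p0 (replicate_mset k True)" using P0 by (auto simp: pure_def)
  have k0: "k \<noteq> 0"
  proof
    assume "k = 0" then show False using k fr_empty[of p0] X(4) X0 by simp
  qed
  have qi: "idp q0" using pure_idp P0 by blast
  have qq: "q0 * q0 = q0" using qi by (simp add: idp_def)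
  obtain d1 where d1: "cx (dg k b, q0, d1)" "siso (p0, q0, d0) (dg k b, q0, d1)"
    using siso_mk[OF cx0 fr_iso_eq[OF k fr_dg(2)] iso_refl[OF qi]] by blast
  have l1: "lc (dg k b, q0, d1)" using siso_lc[OF d1(2)] X(2) X0 by simp
  have h1: "hom1 (dg k b, q0, d1) (dg k b, q0, d1)"
    using hom1_siso[OF d1(2) d1(2) d1(1) d1(1) cx0] X(3) X0 by simp
  have d1h: "d1 \<in> hm (dg k b) q0" using d1(1) by (simp add: cx_def)
  obtain y where y: "y \<in> hm (dg k p) q0" "d1 = y * dg k m" using approx[OF d1h P0(2)] by blast
  obtain v where v: "v \<in> hm q0 (dg k p)" "v * y * v = v" "y - y * v * y \<in> rad (dg k p) q0"
    using split_rad[OF fr_dgp qi y(1)] .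
  have v2: "v * (y * v) = v" using v(2) by (simp add: mult.assoc)
  \<comment> \<open>\<open>v\<close> inverts the largest split part of y; on the complement K in the
    source and c in the target, y is radical.\<close>
  define K c where "K = dg k p - v * y" and "c = q0 - y * v"
  have yK: "y * K = y - y * v * y" "c * y = y - y * v * y"
    using hmR[OF y(1)] hmL[OF y(1)] by (simp_all add: K_def c_def algebra_simps)
  have KK: "K * K = K" "c * c = c" "dg k p * K = K" "K * dg k p = K" "q0 * c = c" "c * q0 = c"
    unfolding K_def c_def
    by (simp_all add: algebra_simps hmE[OF v(1)] hmE[OF y(1)] v2 asr[OF v2, unfolded mult.assoc] qq dgo idem)
  have KS: "K \<in> sc S" "c \<in> sc S" using hmS[OF v(1)] hmS[OF y(1)] idpS[OF qi] dg_S[OF abp(3)] by (auto simp: K_def c_def)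
  have Kp: "pure False K" using pure_sub[OF pure_dg(3)] KK KS by (auto simp: idp_def)
  have cp: "pure False c" using pure_sub[OF P0(2)] KK KS by (auto simp: idp_def)
  have Kh: "K \<in> hm K (dg k p)" "K \<in> hm (dg k p) K" "c \<in> hm c q0" "c \<in> hm q0 c" using KK KS by (auto simp: hm_def)
  have Gl: "loc (E 0 0 a)" using Gloc[of False] by simp
  have "K = 0 \<or> c = 0"
  proof (rule ccontr)
    assume "\<not> ?thesis"
    then have nz: "K \<noteq> 0" "c \<noteq> 0" by auto
    obtain k1 r1 where k1: "k1 \<in> hm (E 0 0 a) K" "r1 \<in> hm K (E 0 0 a)" "r1 * k1 = E 0 0 a" using pure_has[OF Kp nz(1)] .
    obtain s r where s: "s \<in> hm (E 0 0 a) c" "r \<in> hm c (E 0 0 a)" "r * s = E 0 0 a" using pure_has[OF cp nz(2)] .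
    have k1': "k1 \<in> hm (E 0 0 a) (dg k p)" using hm_mult[OF Kh(1) k1(1)] hmL[OF k1(1)] by simp
    have r1': "r1 \<in> hm (dg k p) (E 0 0 a)" using hm_mult[OF k1(2) Kh(2)] hmR[OF k1(2)] by simp
    have s': "s \<in> hm (E 0 0 a) q0" using hm_mult[OF Kh(3) s(1)] hmL[OF s(1)] by simp
    have r': "r \<in> hm q0 (E 0 0 a)" using hm_mult[OF s(2) Kh(4)] hmR[OF s(2)] by simp
    \<comment> \<open>Test map from a copy of P_1 in K to one in c, restricted along m^k. Rigidity
      would write the identity of P_1 as a sum of three radical maps: one annihilates m, so that
      \<open>minim\<close> applies, the other two pass through y on K or into c.\<close>
    have "s * r1 * dg k m \<in> hm (dg k b) q0" using s' r1' mhm by auto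
    then obtain h h' where h: "h \<in> hm q0 q0" "h' \<in> hm (dg k b) (dg k b)" "s * r1 * dg k m = h * d1 + d1 * h'"
      using h1 unfolding hom1_def prod.case by blast
    have "dg k m * h' \<in> hm (dg k b) (dg k p)" using mhm h(2) by auto
    then obtain h2 where h2: "h2 \<in> hm (dg k p) (dg k p)" "dg k m * h' = h2 * dg k m" using approx pure_dg(3) by blast
    define z where "z = r * (s * r1 - h * y - y * h2)"
    have zh: "z \<in> hm (dg k p) (E 0 0 a)" unfolding z_def
      by (rule hm_mult[OF r'], rule hm_diff[OF hm_diff[OF hm_mult[OF s' r1'] hm_mult[OF h(1) y(1)]] hm_mult[OF y(1) h2(1)]])
    have "(s * r1 - h * y - y * h2) * dg k m = 0" using h(3) h2(2) by (simp add: y(2) algebra_simps)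
    then have "z * dg k m = 0" by (simp add: z_def mult.assoc)
    then have R1: "z * k1 \<in> rad (E 0 0 a) (E 0 0 a)" using minim[OF zh _ k1'] by blast
    have "r * h * (y - y * v * y) * k1 \<in> rad (E 0 0 a) (E 0 0 a)" using rad_mult[OF v(3) hm_mult[OF r' h(1)] k1'] .
    moreover have "r * h * (y - y * v * y) * k1 = r * h * y * k1" unfolding yK(1)[symmetric] using hmL[OF k1(1)] by (simp add: mult.assoc)
    ultimately have R2: "r * h * y * k1 \<in> rad (E 0 0 a) (E 0 0 a)" by simp
    have "r * (y - y * v * y) * (h2 * k1) \<in> rad (E 0 0 a) (E 0 0 a)" using rad_mult[OF v(3) r' hm_mult[OF h2(1) k1']] .
    moreover have "r * (y - y * v * y) * (h2 * k1) = r * y * h2 * k1" unfolding yK(2)[symmetric] using hmR2[OF s(2)] by (simp add: mult.assoc)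
    ultimately have R3: "r * y * h2 * k1 \<in> rad (E 0 0 a) (E 0 0 a)" by simp
    have "r * s * (r1 * k1) = E 0 0 a" using s(3) k1(3) abp by simp
    then have "z * k1 + r * h * y * k1 + r * y * h2 * k1 = E 0 0 a" by (simp add: z_def algebra_simps)
    then show False using rad_add[OF Gl rad_add[OF Gl R1 R2] R3] G_not_rad by simp
  qed
  \<comment> \<open>With K = 0 the pair of the identity of P_2^k and \<open>y * v\<close> is an
    idempotent chain endomorphism that splits off (0 -> c); as k is nonzero it must be the
    identity.\<close>
  moreover have "c = 0" if K0: "K = 0"
  proof -
    have vy: "v * y = dg k p" using K0 by (simp add: K_def)
    have "y * v * d1 = d1 * dg k b" using hmR[OF d1h] vy by (simp add: y(2) mult.assoc asr[OF vy] dgo idem)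
    moreover have "y * v \<in> hm q0 q0" "y * v * (y * v) = y * v" using y(1) v by (auto simp: mult.assoc)
    ultimately have "(dg k b = 0 \<and> y * v = 0) \<or> (dg k b = dg k b \<and> y * v = q0)"
      using lc_sub[OF l1, of "dg k b" "y * v"] qi d1h dgi idp_hm[OF dgi(2)] dgo(8) by blast
    then show ?thesis using dg_nz[OF k0 abp(8)] by (simp add: c_def)
  qed
  ultimately have c0: "c = 0" by blast
  then have yv: "y * v = q0" by (simp add: c_def)
  obtain n where n: "fr K (replicate_mset n False)" using Kp by (auto simp: pure_def)
  obtain x1 y1 where xy: "x1 \<in> hm (dg n a) K" "y1 \<in> hm K (dg n a)" "y1 * x1 = dg n a" "x1 * y1 = K"
    using fr_iso_eq[OF fr_dg(1) n] by (rule isoE)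
  have x1: "x1 \<in> hm (dg n a) (dg k p)" using hm_mult[OF Kh(1) xy(1)] hmL[OF xy(1)] by simp
  have y1: "y1 \<in> hm (dg k p) (dg n a)" using hm_mult[OF xy(2) Kh(2)] hmR[OF xy(2)] by simp
  have pt: "ptn n k x1 y1" using x1 y1 xy(3) by (simp add: ptn_def)
  have vy: "dg k p - x1 * y1 = v * y" by (simp add: xy(4) K_def)
  have vyh: "v * y * v = v" "y * (v * y) = y" using v(2) yv hmL[OF y(1)] by (simp_all add: mult.assoc[symmetric])
  have "siso (dg k b, q0, d1) (cL k x1 y1)" unfolding cL_def vy
  proof (rule sisoI[of "dg k b" _ _ y _ _ "dg k b" v])
    show "dg k b \<in> hm (dg k b) (dg k b)" "dg k b \<in> hm (dg k b) (dg k b)" using dgi by auto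
    show "y \<in> hm (v * y) q0" "v \<in> hm q0 (v * y)" using y(1) v(1) vyh by (auto simp: hm_def mult.assoc)
    show "y * (v * y * dg k m) = d1 * dg k b" using hmR[OF d1h] vyh(2) by (simp add: mult.assoc[symmetric]) (simp add: mult.assoc vyh(2) y(2))
    show "v * d1 = v * y * dg k m * dg k b" by (simp add: y(2) mult.assoc dgo idem)
    show "dg k b = dg k b * dg k b" "dg k b = dg k b * dg k b" "q0 = y * v" using dgo yv by (simp_all add: idem)
  qed simp
  then have "siso X (cL k x1 y1)"
    using kiso_siso_trans[OF siso_kiso[OF d1(2)] _ cx0 d1(1)] gd_kiso_siso pm_gd X(1) ptn_pm(1)[OF pt] X0 by metis
  then show ?thesis using that pt k0 by blast
qed

text \<open>The counterpart of \<open>exL\<close>: rigidity makes D a split monomorphism or a split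
  epimorphism, and in the second case indecomposability makes it an isomorphism. Its retraction is
  the required w.\<close>

lemma exR: assumes Y: "R.pm Y" "R.lc Y" "R.hom1 Y Y" "fst (snd Y) \<noteq> 0"
  obtains n k D w where "ptn n k D w" "R.siso Y (cR n k D)" "k \<noteq> 0"
proof -
  obtain p0 q0 d0 where Y0: "Y = (p0, q0, d0)" by (cases Y)
  have P0: "R.pure True p0" "R.pure False q0" and cx0: "R.cx (p0, q0, d0)" using Y(1) R.pm_cx[OF Y(1)] by (auto simp: R.pm_def Y0)
  obtain n where n: "R.fr p0 (replicate_mset n True)" using P0 by (auto simp: R.pure_def)
  obtain k where k: "R.fr q0 (replicate_mset k False)" using P0 by (auto simp: R.pure_def)
  have k0: "k \<noteq> 0"
  proof
    assume "k = 0" then show False using k R.fr_empty[of q0] Y(4) Y0 by simp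
  qed
  obtain D where D1: "R.cx (dg n a, F k, D)" "R.siso (p0, q0, d0) (dg n a, F k, D)"
    using R.siso_mk[OF cx0 R.fr_iso_eq[OF n R_fr(1)] R.fr_iso_eq[OF k R_fr(2)]] by blast
  have l1: "R.lc (dg n a, F k, D)" using R.siso_lc[OF D1(2)] Y(2) Y0 by simp
  have h1: "R.hom1 (dg n a, F k, D) (dg n a, F k, D)"
    using R.hom1_siso[OF D1(2) D1(2) D1(1) D1(1) cx0] Y(3) Y0 by simp
  have Dh: "D \<in> hm (dg n a) (dg k p)" using D1(1) by (simp add: R.cx_def R_AF)
  obtain w where w: "w \<in> hm (dg k p) (dg n a)" "w * D * w = w" "D - D * w * D \<in> rad (dg n a) (dg k p)"
    using split_rad[OF fr_dg(1) dgi(3) Dh] .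
  have w2: "w * (D * w) = w" using w(2) by (simp add: mult.assoc)
  define K c where "K = dg n a - w * D" and "c = dg k p - D * w"
  have yK: "D * K = D - D * w * D" "c * D = D - D * w * D"
    using hmR[OF Dh] hmL[OF Dh] by (simp_all add: K_def c_def algebra_simps)
  have KK: "K * K = K" "c * c = c" "dg n a * K = K" "K * dg n a = K" "dg k p * c = c" "c * dg k p = c"
    unfolding K_def c_def
    by (simp_all add: algebra_simps hmE[OF w(1)] hmE[OF Dh] w2 asr[OF w2, unfolded mult.assoc] dgo idem)
  have KS: "K \<in> sc S" "c \<in> sc S" using hmS[OF w(1)] hmS[OF Dh] dg_S[OF abp(3)] dg_S[OF abp(1)] by (auto simp: K_def c_def)
  have Kp: "pure False K" using pure_sub[OF pure_dg(1)] KK KS by (auto simp: idp_def)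
  have cp: "pure False c" using pure_sub[OF pure_dg(3)] KK KS by (auto simp: idp_def)
  have Kh: "K \<in> hm K (dg n a)" "K \<in> hm (dg n a) K" "c \<in> hm c (dg k p)" "c \<in> hm (dg k p) c" using KK KS by (auto simp: hm_def)
  have Gl: "loc (E 0 0 a)" using Gloc[of False] by simp
  have "K = 0 \<or> c = 0"
  proof (rule ccontr)
    assume "\<not> ?thesis"
    then have nz: "K \<noteq> 0" "c \<noteq> 0" by auto
    obtain k1 r1 where k1: "k1 \<in> hm (E 0 0 a) K" "r1 \<in> hm K (E 0 0 a)" "r1 * k1 = E 0 0 a" using pure_has[OF Kp nz(1)] .
    obtain s r where s: "s \<in> hm (E 0 0 a) c" "r \<in> hm c (E 0 0 a)" "r * s = E 0 0 a" using pure_has[OF cp nz(2)] .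
    have k1': "k1 \<in> hm (E 0 0 a) (dg n a)" using hm_mult[OF Kh(1) k1(1)] hmL[OF k1(1)] by simp
    have r1': "r1 \<in> hm (dg n a) (E 0 0 a)" using hm_mult[OF k1(2) Kh(2)] hmR[OF k1(2)] by simp
    have s': "s \<in> hm (E 0 0 a) (dg k p)" using hm_mult[OF Kh(3) s(1)] hmL[OF s(1)] by simp
    have r': "r \<in> hm (dg k p) (E 0 0 a)" using hm_mult[OF s(2) Kh(4)] hmR[OF s(2)] by simp
    have "s * r1 \<in> R.hm (dg n a) (F k)" using s' r1' by (auto simp: R_AF)
    then obtain X h' where X: "X \<in> R.hm (F k) (F k)" "h' \<in> hm (dg n a) (dg n a)" "s * r1 = X * D + D * h'"
      using h1 unfolding R.hom1_def prod.case R_AA by blast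
    obtain x y where xy: "x \<in> hm (dg k b) (dg k b)" "y \<in> hm (dg k p) (dg k p)" "X = x + y"
      using X(1) unfolding R_FF by blast
    have xD: "x * D = 0" using hmR[OF xy(1)] hmL[OF Dh] dgo(1)[of k k] by (metis mult.assoc mult_zero_left mult_zero_right)
    have e: "s * r1 = y * D + D * h'" using X(3) xD by (simp add: xy(3) distrib_right)
    have "r * y * (D - D * w * D) * k1 \<in> rad (E 0 0 a) (E 0 0 a)" using rad_mult[OF w(3) hm_mult[OF r' xy(2)] k1'] .
    moreover have "r * y * (D - D * w * D) * k1 = r * y * D * k1" unfolding yK(1)[symmetric] using hmL[OF k1(1)] by (simp add: mult.assoc)
    ultimately have R2: "r * y * D * k1 \<in> rad (E 0 0 a) (E 0 0 a)" by simp
    have "r * (D - D * w * D) * (h' * k1) \<in> rad (E 0 0 a) (E 0 0 a)" using rad_mult[OF w(3) r' hm_mult[OF X(2) k1']] .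
    moreover have "r * (D - D * w * D) * (h' * k1) = r * D * h' * k1" unfolding yK(2)[symmetric] using hmR2[OF s(2)] by (simp add: mult.assoc)
    ultimately have R3: "r * D * h' * k1 \<in> rad (E 0 0 a) (E 0 0 a)" by simp
    have "r * (s * r1) * k1 = r * s * (r1 * k1)" by (simp add: mult.assoc)
    then have "r * (s * r1) * k1 = E 0 0 a" using s(3) k1(3) abp by simp
    then have "r * y * D * k1 + r * D * h' * k1 = E 0 0 a" unfolding e by (simp add: algebra_simps)
    then show False using rad_add[OF Gl R2 R3] G_not_rad by simp
  qed
  \<comment> \<open>With c = 0 the pair of \<open>w * D\<close> and the identity of f_1^k splits off
    (K -> 0); as k is nonzero it must be the identity.\<close>
  moreover have "K = 0" if c0: "c = 0"
  proof -
    have Dw: "D * w = dg k p" using c0 by (simp add: c_def)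
    have "dg k b * D = 0" using asr[OF dgo(1)[of k k], of D] hmL[OF Dh] by simp
    then have FD: "F k * D = D" by (simp add: F_def distrib_right hmL[OF Dh])
    have "F k * D = D * (w * D)" using FD Dw hmL[OF Dh] by (simp add: mult.assoc[symmetric])
    moreover have "w * D \<in> R.hm (dg n a) (dg n a)" "w * D * (w * D) = w * D" using w Dh by (auto simp: R_AA mult.assoc asr[OF w2, unfolded mult.assoc])
    ultimately have "(w * D = 0 \<and> F k = 0) \<or> (w * D = dg n a \<and> F k = F k)"
      using l1 R.idp_hm[OF RF_id[of k]] R.idpM[OF RF_id[of k]] unfolding R.lc_def prod.case by blast
    then show ?thesis using F_nz[OF k0] by (simp add: K_def)
  qed
  ultimately have "K = 0" by blast
  then have "ptn n k D w" using Dh w by (simp add: ptn_def K_def)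
  then show ?thesis using that D1(2) k0 Y0 unfolding cR_def by blast
qed

text \<open>Compatibility with (0 -> P_1) makes every map P_2^k -> P_1 factor through the cokernel
  of D. For n > 0 take the coordinate projection r w: it agrees on m^k with a map that annihilates
  D, against minimality. So D is empty, and m^k is indecomposable only for k = 1.\<close>

lemma compat_L: assumes "ptn n k D w" "k \<noteq> 0" "lc (cL k D w)" "hom1 (cL k D w) (0, E 0 0 a, 0)"
  shows "n = 0" "k = 1"
proof -
  note P = ptn_props[OF assms(1)]
  show n0: "n = 0"
  proof (rule ccontr)
    assume "n \<noteq> 0"
    then have "dg n a \<noteq> 0" using dg_nz abp by blast
    then obtain c r where c: "c \<in> hm (E 0 0 a) (dg n a)" "r \<in> hm (dg n a) (E 0 0 a)" "r * c = E 0 0 a"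
      using pure_has[OF pure_dg(1)] by blast
    have rw: "r * w \<in> hm (dg k p) (E 0 0 a)" using c P by auto
    then have "r * w * dg k m \<in> hm (dg k b) (E 0 0 a)" using mhm by auto
    then obtain h where h: "h \<in> hm (dg k p - D * w) (E 0 0 a)" "r * w * dg k m = h * ((dg k p - D * w) * dg k m)"
      using assms(4) unfolding hom1_def cL_def prod.case by auto
    have hP: "h \<in> hm (dg k p) (E 0 0 a)"
      using h(1) P(8) hmR[OF h(1)] unfolding hm_def by auto (metis mult.assoc)
    have "(r * w - h) * dg k m = 0" using h(2) hmR2[OF h(1), of "dg k m"] by (simp add: left_diff_distrib)
    then have "(r * w - h) * (D * c) \<in> rad (E 0 0 a) (E 0 0 a)" using minim[OF hm_diff[OF rw hP]] hm_mult[OF P(1) c(1)] by blast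
    moreover have "h * D = 0" using hmR[OF h(1)] P(4) by (metis mult.assoc mult_zero_right)
    moreover have "r * (w * (D * c)) = r * c" using P(3) hmL[OF c(1)] by (simp add: mult.assoc[symmetric])
    ultimately have "r * c \<in> rad (E 0 0 a) (E 0 0 a)" by (simp add: left_diff_distrib mult.assoc[symmetric])
    then show False using c(3) G_not_rad by simp
  qed
  then have D0: "D = 0" using P(1) by simp
  show "k = 1"
  proof -
    have l: "lc (dg k b, dg k p, dg k p * dg k m)" using assms(3) by (simp add: cL_def D0)
    have e: "E 0 0 b \<in> hm (dg k b) (dg k b)" "E 0 0 p \<in> hm (dg k p) (dg k p)" "E 0 0 b * E 0 0 b = E 0 0 b" "E 0 0 p * E 0 0 p = E 0 0 p"
      using assms(2) abp by (auto simp: hm_def fmat_eq_iff)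
    have "E 0 0 p * (dg k p * dg k m) = dg k p * dg k m * E 0 0 b"
      using assms(2) m by (auto simp: fmat_eq_iff idem)
    then have "(E 0 0 b = 0 \<and> E 0 0 p = 0) \<or> (E 0 0 b = dg k b \<and> E 0 0 p = dg k p)"
      using l e unfolding lc_def prod.case by blast
    moreover have "E 0 0 b \<noteq> 0" using Gnz[of True] by simp
    ultimately have "E 0 0 b = dg k b" by blast
    from arg_cong[OF this, of "\<lambda>X. ent X 1 1"] have "\<not> 1 < k" using abp by auto
    then show ?thesis using assms(2) by simp
  qed
qed

text \<open>Compatibility with (f_2 -> 0) makes every map P_1 -> P_1^(k l) factor through D, so the
  cokernel is zero and D is an isomorphism. The partner over \<Lambda> is then (P_2^k -> 0),
  indecomposable only for k = 1.\<close>

lemma compat_R: assumes "ptn n k D w" "k \<noteq> 0" "lc (cL k D w)" "R.hom1 (E 0 0 a, 0, 0) (cR n k D)"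
  shows "n = l" "k = 1"
proof -
  note P = ptn_props[OF assms(1)]
  have Ea: "E 0 0 a = dg 1 a" by (simp add: dg_Suc)
  have "dg k p - D * w = 0"
  proof (rule ccontr)
    assume "dg k p - D * w \<noteq> 0"
    then obtain c r where c: "c \<in> hm (E 0 0 a) (dg k p - D * w)" "r \<in> hm (dg k p - D * w) (E 0 0 a)" "r * c = E 0 0 a"
      using pure_has[OF pure_sub[OF pure_dg(3) P(6-8)]] by blast
    have "c \<in> hm (E 0 0 a) (dg k p)" using c(1) P(7) hmL[OF c(1)] unfolding hm_def by auto (metis mult.assoc)
    then have "c \<in> R.hm (dg 1 a) (F k)" by (simp add: R_AF Ea)
    then obtain h' where h: "h' \<in> R.hm (dg 1 a) (dg n a)" "c = D * h'"
      using assms(4) unfolding R.hom1_def cR_def prod.case Ea by auto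
    have "c = (dg k p - D * w) * D * h'" using hmL[OF c(1)] h(2) by (simp add: mult.assoc)
    then have "c = 0" using P(4) by simp
    then show False using c(3) Gnz[of False] by simp
  qed
  note q0 = this
  have "lc (dg k b, 0, 0)" using assms(3) by (simp add: cL_def q0)
  moreover have "cx (dg k b, 0, 0)" using fr_dg(2) fr0 by (auto simp: cx_def)
  ultimately obtain c where c: "local.iso (E 0 0 (if c then b else a)) (dg k b)" using lc_q0 by blast
  have "nm (dg k b) = {#c#}" using nm_iso[of c "dg k b"] c by simp
  then have "replicate_mset k True = {#c#}" using nm_eq[OF fr_dg(2)] by simp
  from arg_cong[OF this, of size] show k1: "k = 1" by simp
  have "nm (dg k p - D * w) = {#}" by (simp add: q0)
  then have "fst (gv (cL k D w)) = 0" by (simp add: gv_def cL_def nm_eq[OF fr_dg(2)])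
  then show "n = l" using ptn_gv(1)[OF assms(1)] k1 by simp
qed

text \<open>The complex m itself, matched with (0 -> f_1); it realizes the only partner that
  \<open>compat_L\<close> allows.\<close>

lemma ptn_T2: "ptn 0 1 0 0" "lc (cL 1 0 0)" "hom1 (cL 1 0 0) (cL 1 0 0)"
proof -
  show p: "ptn 0 1 0 0" by (simp add: ptn_def)
  have F1: "F (Suc 0) = E 0 0 (b + p)" by (simp add: F_dg dg_Suc)
  have "R.lc (cR 0 1 0)" using R.lc_G(1)[of False] by (simp add: cR_def F1)
  then show "lc (cL 1 0 0)" using ptn_lc[OF p] by simp
  have "R.hom1 (cR 0 1 0) (cR 0 1 0)" unfolding R.hom1_def cR_def by (auto intro!: exI[of _ 0])
  then show "hom1 (cL 1 0 0) (cL 1 0 0)" using ptn_hom1[OF p p] by simp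
qed

text \<open>The complex (P_2 -> 0), matched with an isomorphism P_1^l -> p read as f_2^l -> f_1; it
  realizes the only partner that \<open>compat_R\<close> allows.\<close>

lemma ptn_U: obtains D w where "ptn l 1 D w" "lc (cL 1 D w)" "hom1 (cL 1 D w) (cL 1 D w)" "D * w = dg 1 p"
proof -
  have "fr (dg 1 p) (replicate_mset l False)" using fr_dgp[of 1] by simp
  from fr_iso_eq[OF fr_dg(1) this] obtain D w where D: "D \<in> hm (dg l a) (dg 1 p)" "w \<in> hm (dg 1 p) (dg l a)" "w * D = dg l a" "D * w = dg 1 p"
    by (rule isoE)
  have p: "ptn l 1 D w" using D by (simp add: ptn_def)
  have b1: "dg (Suc 0) b = E 0 0 b" by (simp add: dg_Suc)
  have c: "cL 1 D w = (E 0 0 b, 0, 0)" by (simp add: cL_def D b1)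
  have "lc (cL 1 D w)" unfolding c using lc_G(2)[of True] by simp
  moreover have "hom1 (cL 1 D w) (cL 1 D w)" unfolding c hom1_def by (auto intro!: exI[of _ 0])
  ultimately show ?thesis using that p D(4) by blast
qed

text \<open>Families that avoid (0 -> P_1); \<open>R1\<close> likewise avoids (f_2 -> 0). These are
  the families on which the correspondence is defined.\<close>

definition L1 :: "('r fmat \<times> 'r fmat \<times> 'r fmat) set set" where
  "L1 = {F \<in> pmf. \<forall>X\<in>F. fst X \<noteq> 0}"

definition R1 :: "('r fmat \<times> 'r fmat \<times> 'r fmat) set set" where
  "R1 = {F \<in> R.pmf. \<forall>Y\<in>F. fst (snd Y) \<noteq> 0}"

text \<open>The half-plane condition that \<open>rho_eq\<close> asks for: in the normal form the
  second coordinate is -k, with k nonzero.\<close>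

lemma L1_snd: assumes "F' \<in> L1" "v \<in> gv ` F'" shows "snd v < 0"
proof -
  obtain X where X: "X \<in> F'" "v = gv X" using assms by blast
  then have "pm X" "lc X" "hom1 X X" "fst X \<noteq> 0" using assms(1) by (auto simp: L1_def pmf_def)
  then obtain n k D w where p: "ptn n k D w" "siso X (cL k D w)" "k \<noteq> 0" by (rule exL)
  have "gv X = gv (cL k D w)" using siso_gv(1)[OF p(2) pm_cx[OF \<open>pm X\<close>]] by simp
  then show ?thesis using ptn_gv(1)[OF p(1)] p(3) X(2) by simp
qed

text \<open>Only sets of g-vectors are compared, so a normal form may be chosen for each member
  separately; \<open>ptn_lc\<close> and \<open>ptn_hom1\<close> carry indecomposability and
  compatibility across.\<close>

lemma images: "(\<lambda>F'. R.gv ` F') ` R1 = (\<lambda>F'. (\<lambda>(x, y). (- y, x + real l * y)) ` gv ` F') ` L1" (is "?A = ?B")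
proof (intro equalityI subsetI)
  fix V assume "V \<in> ?B"
  then obtain F' where V: "V = (\<lambda>(x, y). (- y, x + real l * y)) ` gv ` F'" and F: "F' \<in> L1" by blast
  have fin: "finite F'" using F by (auto simp: L1_def pmf_def)
  have "\<exists>t. ptn (fst t) (fst (snd t)) (fst (snd (snd t))) (snd (snd (snd t))) \<and>
      siso X (cL (fst (snd t)) (fst (snd (snd t))) (snd (snd (snd t)))) \<and> fst (snd t) \<noteq> 0" if "X \<in> F'" for X
  proof -
    have "pm X" "lc X" "hom1 X X" "fst X \<noteq> 0" using F that by (auto simp: L1_def pmf_def)
    then obtain n k D w where "ptn n k D w" "siso X (cL k D w)" "k \<noteq> 0" by (rule exL)
    then show ?thesis by (intro exI[of _ "(n, k, D, w)"]) simp
  qed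
  then obtain t where t: "\<And>X. X \<in> F' \<Longrightarrow> ptn (fst (t X)) (fst (snd (t X))) (fst (snd (snd (t X)))) (snd (snd (snd (t X)))) \<and>
      siso X (cL (fst (snd (t X))) (fst (snd (snd (t X)))) (snd (snd (snd (t X))))) \<and> fst (snd (t X)) \<noteq> 0"
    by metis
  define n k D w where "n = (\<lambda>X. fst (t X))" and "k = (\<lambda>X. fst (snd (t X)))" and "D = (\<lambda>X. fst (snd (snd (t X))))" and "w = (\<lambda>X. snd (snd (snd (t X))))"
  define Y where "Y = (\<lambda>X. cR (n X) (k X) (D X))"
  have Y: "Y X = cR (n X) (k X) (D X) \<and> ptn (n X) (k X) (D X) (w X) \<and> siso X (cL (k X) (D X) (w X)) \<and> k X \<noteq> 0" if "X \<in> F'" for X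
    using t[OF that] by (simp add: Y_def n_def k_def D_def w_def)
  have pmX: "pm X" "lc X" "cx X" if "X \<in> F'" for X using F that pm_cx by (auto simp: L1_def pmf_def)
  have h: "hom1 X X'" if "X \<in> F'" "X' \<in> F'" for X X' using F that by (auto simp: L1_def pmf_def)
  have "Y ` F' \<in> R1" unfolding R1_def R.pmf_def mem_Collect_eq
  proof (intro conjI ballI)
    show "finite (Y ` F')" using fin by simp
    fix y assume "y \<in> Y ` F'"
    then obtain X where X: "X \<in> F'" "y = Y X" by blast
    note YX = Y[OF X(1)]
    have p: "ptn (n X) (k X) (D X) (w X)" using YX by blast
    have y: "y = cR (n X) (k X) (D X)" using YX X(2) by blast
    show "R.pm y" unfolding y by (rule ptn_pm(2)[OF p])
    have "lc (cL (k X) (D X) (w X))" using siso_lc pmX(2)[OF X(1)] YX by blast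
    then show "R.lc y" using ptn_lc[OF p] unfolding y by blast
    show "fst (snd y) \<noteq> 0" unfolding y cR_def using F_nz YX by simp
    fix y' assume "y' \<in> Y ` F'"
    then obtain X' where X': "X' \<in> F'" "y' = Y X'" by blast
    note YX' = Y[OF X'(1)]
    have p': "ptn (n X') (k X') (D X') (w X')" using YX' by blast
    have y': "y' = cR (n X') (k X') (D X')" using YX' X'(2) by blast
    have "hom1 (cL (k X) (D X) (w X)) (cL (k X') (D X') (w X'))"
      using hom1_siso[OF _ _ pm_cx[OF ptn_pm(1)[OF p]] pm_cx[OF ptn_pm(1)[OF p']] pmX(3)[OF X'(1)] h[OF X(1) X'(1)]] YX YX' by blast
    then show "R.hom1 y y'" using ptn_hom1[OF p p'] unfolding y y' by blast
  qed
  moreover have "V = R.gv ` (Y ` F')"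
  proof -
    have "(\<lambda>(x, y). (- y, x + real l * y)) (gv X) = R.gv (Y X)" if X: "X \<in> F'" for X
    proof -
      note YX = Y[OF X]
      have p: "ptn (n X) (k X) (D X) (w X)" using YX by blast
      have "gv X = gv (cL (k X) (D X) (w X))" using siso_gv(1) YX pmX(3)[OF X] by metis
      then show ?thesis using ptn_gv(1,2)[OF p] YX by (simp add: algebra_simps)
    qed
    then show ?thesis unfolding V image_image by (intro image_cong refl)
  qed
  ultimately show "V \<in> ?A" by blast
next
  fix V assume "V \<in> ?A"
  then obtain F' where V: "V = R.gv ` F'" and F: "F' \<in> R1" by blast
  have fin: "finite F'" using F by (auto simp: R1_def R.pmf_def)
  have "\<exists>t. ptn (fst t) (fst (snd t)) (fst (snd (snd t))) (snd (snd (snd t))) \<and>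
      R.siso Y (cR (fst t) (fst (snd t)) (fst (snd (snd t)))) \<and> fst (snd t) \<noteq> 0" if "Y \<in> F'" for Y
  proof -
    have "R.pm Y" "R.lc Y" "R.hom1 Y Y" "fst (snd Y) \<noteq> 0" using F that by (auto simp: R1_def R.pmf_def)
    then obtain n k D w where "ptn n k D w" "R.siso Y (cR n k D)" "k \<noteq> 0" by (rule exR)
    then show ?thesis by (intro exI[of _ "(n, k, D, w)"]) simp
  qed
  then obtain t where t: "\<And>Y. Y \<in> F' \<Longrightarrow> ptn (fst (t Y)) (fst (snd (t Y))) (fst (snd (snd (t Y)))) (snd (snd (snd (t Y)))) \<and>
      R.siso Y (cR (fst (t Y)) (fst (snd (t Y))) (fst (snd (snd (t Y))))) \<and> fst (snd (t Y)) \<noteq> 0"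
    by metis
  define n k D w where "n = (\<lambda>Y. fst (t Y))" and "k = (\<lambda>Y. fst (snd (t Y)))" and "D = (\<lambda>Y. fst (snd (snd (t Y))))" and "w = (\<lambda>Y. snd (snd (snd (t Y))))"
  define X where "X = (\<lambda>Y. cL (k Y) (D Y) (w Y))"
  have X: "X Y = cL (k Y) (D Y) (w Y) \<and> ptn (n Y) (k Y) (D Y) (w Y) \<and> R.siso Y (cR (n Y) (k Y) (D Y)) \<and> k Y \<noteq> 0" if "Y \<in> F'" for Y
    using t[OF that] by (simp add: X_def n_def k_def D_def w_def)
  have pmY: "R.pm Y" "R.lc Y" "R.cx Y" if "Y \<in> F'" for Y using F that R.pm_cx by (auto simp: R1_def R.pmf_def)
  have h: "R.hom1 Y Y'" if "Y \<in> F'" "Y' \<in> F'" for Y Y' using F that by (auto simp: R1_def R.pmf_def)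
  have "X ` F' \<in> L1" unfolding L1_def pmf_def mem_Collect_eq
  proof (intro conjI ballI)
    show "finite (X ` F')" using fin by simp
    fix y assume "y \<in> X ` F'"
    then obtain Y where Y: "Y \<in> F'" "y = X Y" by blast
    note XY = X[OF Y(1)]
    have p: "ptn (n Y) (k Y) (D Y) (w Y)" using XY by blast
    have y: "y = cL (k Y) (D Y) (w Y)" using XY Y(2) by blast
    show "pm y" unfolding y by (rule ptn_pm(1)[OF p])
    have "R.lc (cR (n Y) (k Y) (D Y))" using R.siso_lc pmY(2)[OF Y(1)] XY by blast
    then show "lc y" using ptn_lc[OF p] unfolding y by blast
    show "fst y \<noteq> 0" unfolding y cL_def using dg_nz[of "k Y" b] abp(8) XY by simp
    fix y' assume "y' \<in> X ` F'"
    then obtain Y' where Y': "Y' \<in> F'" "y' = X Y'" by blast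
    note XY' = X[OF Y'(1)]
    have p': "ptn (n Y') (k Y') (D Y') (w Y')" using XY' by blast
    have y': "y' = cL (k Y') (D Y') (w Y')" using XY' Y'(2) by blast
    have "R.hom1 (cR (n Y) (k Y) (D Y)) (cR (n Y') (k Y') (D Y'))"
      using R.hom1_siso[OF _ _ R.pm_cx[OF ptn_pm(2)[OF p]] R.pm_cx[OF ptn_pm(2)[OF p']] pmY(3)[OF Y'(1)] h[OF Y(1) Y'(1)]] XY XY' by blast
    then show "hom1 y y'" using ptn_hom1[OF p p'] unfolding y y' by blast
  qed
  moreover have "V = (\<lambda>(x, y). (- y, x + real l * y)) ` gv ` (X ` F')"
  proof -
    have "(\<lambda>(x, y). (- y, x + real l * y)) (gv (X Y)) = R.gv Y" if Y: "Y \<in> F'" for Y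
    proof -
      note XY = X[OF Y]
      have p: "ptn (n Y) (k Y) (D Y) (w Y)" using XY by blast
      have "R.gv Y = R.gv (cR (n Y) (k Y) (D Y))" using R.siso_gv(1) XY pmY(3)[OF Y] by metis
      then show ?thesis using ptn_gv(1,2)[OF p] XY by (simp add: algebra_simps)
    qed
    then show ?thesis unfolding V image_image by (intro image_cong refl) simp
  qed
  ultimately show "V \<in> ?B" by blast
qed

text \<open>Families containing (0 -> P_1) contribute nothing but its ray and the cone it spans with
  m. This is where the rank l of the approximation becomes the number in the rotation.\<close>

lemma cones_L: "{cone_gen (gv ` F') | F'. F' \<in> pmf} = (\<lambda>F'. cone_gen (gv ` F')) ` L1 \<union> {cone_gen {(1,0)}, cone_gen {(1,0), (real l, -1)}}" (is "?A = ?B")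
proof (intro equalityI subsetI)
  fix C assume "C \<in> ?A"
  then obtain F' where C: "C = cone_gen (gv ` F')" and F: "F' \<in> pmf" by blast
  show "C \<in> ?B"
  proof (cases "F' \<in> L1")
    case False
    then obtain Z where Z: "Z \<in> F'" "fst Z = 0" using F by (auto simp: L1_def)
    have F2: "pm X" "lc X" "hom1 X X'" "cx X" if "X \<in> F'" "X' \<in> F'" for X X' using F that pm_cx by (auto simp: pmf_def)
    have one: "gv X = (1, 0) \<and> (\<exists>q d. X = (0, q, d) \<and> local.iso (E 0 0 a) q)" if X: "X \<in> F'" "fst X = 0" for X
    proof -
      obtain q d where q: "X = (0, q, d)" using X(2) by (cases X) auto
      obtain c where c: "local.iso (E 0 0 (if c then b else a)) q" using lc_p0 F2(2,4) X(1) q by blast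
      have "pure False q" using F2(1)[OF X(1) X(1)] q by (simp add: pm_def)
      then have "\<not> c" using nm_iso[of c q] c nm_pure[of False q] by (cases c) auto
      then show ?thesis using q c nm_iso[of c q] by (auto simp: gv_def)
    qed
    obtain qz dz where qz: "Z = (0, qz, dz)" "local.iso (E 0 0 a) qz" using one[OF Z] by blast
    have cxZ: "cx Z" and dz0: "dz = 0" using F2[OF Z(1) Z(1)] qz by (auto simp: cx_def)
    have cxG': "cx (0, E 0 0 a, 0)" using cx_G(1)[of False] by simp
    have sZ: "siso Z (0, E 0 0 a, 0)"
    proof -
      obtain u v where "u \<in> hm (E 0 0 a) qz" "v \<in> hm qz (E 0 0 a)" "v * u = E 0 0 a" "u * v = qz" using qz(2) by (rule isoE)
      then show ?thesis unfolding qz(1) dz0 by (intro sisoI[of 0 _ _ u _ _ 0 v]) auto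
    qed
    have all: "gv X \<in> {(1, 0), (real l, -1)}" if X: "X \<in> F'" for X
    proof (cases "fst X = 0")
      case True then show ?thesis using one X by blast
    next
      case False
      obtain n k D w where p: "ptn n k D w" "siso X (cL k D w)" "k \<noteq> 0" using exL[OF F2(1-3)[OF X X] False] .
      have "hom1 (cL k D w) (0, E 0 0 a, 0)"
        using hom1_siso[OF p(2) sZ pm_cx[OF ptn_pm(1)[OF p(1)]] cxG' cxZ F2(3)[OF X Z(1)]] .
      then have "n = 0" "k = 1" using compat_L[OF p(1,3) siso_lc[OF p(2) F2(2)[OF X X]]] by auto
      then show ?thesis using siso_gv(1)[OF p(2) F2(4)[OF X X]] ptn_gv(1)[OF p(1)] by simp
    qed
    have "(1, 0) \<in> gv ` F'" using one[OF Z] Z(1) by (metis imageI)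
    moreover have "gv ` F' \<subseteq> {(1, 0), (real l, -1)}" using all by blast
    ultimately have "gv ` F' = {(1, 0)} \<or> gv ` F' = {(1, 0), (real l, -1)}" by (intro subset_two)
    then show ?thesis using C by auto
  qed (use C in blast)
next
  fix C assume C: "C \<in> ?B"
  have Z: "pm (0, E 0 0 a, 0)" "lc (0, E 0 0 a, 0)" "gv (0, E 0 0 a, 0) = (1, 0)"
    using pure_G[of False] lc_G(1)[of False] nm_iso[of False] iso_refl[OF Gidp[of False]] by (auto simp: pm_def gv_def)
  have Zh: "hom1 (0, E 0 0 a, 0) Y" for Y unfolding hom1_def using hm_0 by (cases Y; simp; blast)
  note T = ptn_T2
  have TZ: "hom1 (cL 1 0 0) (0, E 0 0 a, 0)"
  proof -
    have "\<exists>h\<in>hm (dg 1 p) (E 0 0 a). f = h * (dg 1 p * dg 1 m)" if "f \<in> hm (dg 1 b) (E 0 0 a)" for f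
      using approx[OF that] pure_G[of False] m by simp
    then show ?thesis unfolding hom1_def cL_def by auto
  qed
  have gT: "gv (cL 1 0 0) = (real l, -1)" using ptn_gv(1)[OF T(1)] by simp
  have m: "{(0, E 0 0 a, 0)} \<in> pmf" "{(0, E 0 0 a, 0), cL 1 0 0} \<in> pmf"
    using Z Zh T TZ ptn_pm(1)[OF T(1)] by (auto simp: pmf_def simp del: dg_mult)
  have g: "gv ` {(0, E 0 0 a, 0)} = {(1,0)}" "gv ` {(0, E 0 0 a, 0), cL 1 0 0} = {(1,0), (real l, -1)}" using Z gT by auto
  have "cone_gen (gv ` {(0, E 0 0 a, 0)}) \<in> ?A" "cone_gen (gv ` {(0, E 0 0 a, 0), cL 1 0 0}) \<in> ?A" using m by blast+
  then have "cone_gen {(1,0)} \<in> ?A" "cone_gen {(1,0), (real l, -1)} \<in> ?A" unfolding g by blast+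
  moreover have "(\<lambda>F'. cone_gen (gv ` F')) ` L1 \<subseteq> ?A" unfolding L1_def by blast
  ultimately show "C \<in> ?A" using C by blast
qed

text \<open>The same on the rotated side: (f_2 -> 0) contributes its ray and the cone with f_2^l ->
  f_1, whose g-vector is (1, -l).\<close>

lemma cones_R: "{cone_gen (R.gv ` F') | F'. F' \<in> R.pmf} = (\<lambda>F'. cone_gen (R.gv ` F')) ` R1 \<union> {cone_gen {(0,-1)}, cone_gen {(0,-1), (1, - real l)}}" (is "?A = ?B")
proof (intro equalityI subsetI)
  fix C assume "C \<in> ?A"
  then obtain F' where C: "C = cone_gen (R.gv ` F')" and F: "F' \<in> R.pmf" by blast
  show "C \<in> ?B"
  proof (cases "F' \<in> R1")
    case False
    then obtain Z where Z: "Z \<in> F'" "fst (snd Z) = 0" using F by (auto simp: R1_def)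
    have F2: "R.pm X" "R.lc X" "R.hom1 X X'" "R.cx X" if "X \<in> F'" "X' \<in> F'" for X X' using F that R.pm_cx by (auto simp: R.pmf_def)
    have one: "R.gv X = (0, -1) \<and> (\<exists>q d. X = (q, 0, d) \<and> R.iso (E 0 0 a) q)" if X: "X \<in> F'" "fst (snd X) = 0" for X
    proof -
      obtain q d where q: "X = (q, 0, d)" using X(2) by (cases X) auto
      obtain c where c: "R.iso (E 0 0 (if c then a else b + p)) q" using R.lc_q0 F2(2,4) X(1) q by blast
      have "R.pure True q" using F2(1)[OF X(1) X(1)] q by (simp add: R.pm_def)
      then have "c" using R.nm_iso[of c q] c R.nm_pure[of True q] by (cases c) auto
      then show ?thesis using q c R.nm_iso[of c q] by (auto simp: R.gv_def)
    qed
    obtain qz dz where qz: "Z = (qz, 0, dz)" "R.iso (E 0 0 a) qz" using one[OF Z] by blast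
    have cxZ: "R.cx Z" and dz0: "dz = 0" using F2[OF Z(1) Z(1)] qz by (auto simp: R.cx_def)
    have cxG': "R.cx (E 0 0 a, 0, 0)" using R.cx_G(2)[of True] by simp
    have sZ: "R.siso Z (E 0 0 a, 0, 0)"
    proof -
      obtain u v where "u \<in> R.hm (E 0 0 a) qz" "v \<in> R.hm qz (E 0 0 a)" "v * u = E 0 0 a" "u * v = qz" using qz(2) by (rule R.isoE)
      then show ?thesis unfolding qz(1) dz0 by (intro R.sisoI[of u _ _ 0 _ _ v 0]) auto
    qed
    have all: "R.gv X \<in> {(0, -1), (1, - real l)}" if X: "X \<in> F'" for X
    proof (cases "fst (snd X) = 0")
      case True then show ?thesis using one X by blast
    next
      case False
      obtain n k D w where p: "ptn n k D w" "R.siso X (cR n k D)" "k \<noteq> 0" using exR[OF F2(1-3)[OF X X] False] .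
      have cR: "R.cx (cR n k D)" using R.pm_cx[OF ptn_pm(2)[OF p(1)]] .
      have "R.hom1 (E 0 0 a, 0, 0) (cR n k D)"
        using R.hom1_siso[OF sZ p(2) cxG' cR F2(4)[OF X X] F2(3)[OF Z(1) X]] .
      moreover have "lc (cL k D w)" using ptn_lc[OF p(1)] R.siso_lc[OF p(2) F2(2)[OF X X]] by blast
      ultimately have "n = l" "k = 1" using compat_R[OF p(1,3)] by auto
      then show ?thesis using R.siso_gv(1)[OF p(2) F2(4)[OF X X]] ptn_gv(2)[OF p(1)] by simp
    qed
    have "(0, -1) \<in> R.gv ` F'" using one[OF Z] Z(1) by (metis imageI)
    moreover have "R.gv ` F' \<subseteq> {(0, -1), (1, - real l)}" using all by blast
    ultimately have "R.gv ` F' = {(0, -1)} \<or> R.gv ` F' = {(0, -1), (1, - real l)}" by (intro subset_two)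
    then show ?thesis using C by auto
  qed (use C in blast)
next
  fix C assume C: "C \<in> ?B"
  have Ea: "E 0 0 a = dg 1 a" by (simp add: dg_Suc)
  have Z: "R.pm (E 0 0 a, 0, 0)" "R.lc (E 0 0 a, 0, 0)" "R.gv (E 0 0 a, 0, 0) = (0, -1)"
    using R.pure_G[of True] R.lc_G(2)[of True] R.nm_iso[of True] R.iso_refl[OF R.Gidp[of True]] by (auto simp: R.pm_def R.gv_def)
  have Zh: "R.hom1 Y (E 0 0 a, 0, 0)" for Y unfolding R.hom1_def using R.hm_0 by (cases Y; simp; blast)
  obtain D w where U: "ptn l 1 D w" "lc (cL 1 D w)" "hom1 (cL 1 D w) (cL 1 D w)" "D * w = dg 1 p" by (rule ptn_U)
  have UR: "R.lc (cR l 1 D)" "R.hom1 (cR l 1 D) (cR l 1 D)" using U ptn_lc[OF U(1)] ptn_hom1[OF U(1) U(1)] by auto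
  have ZU: "R.hom1 (E 0 0 a, 0, 0) (cR l 1 D)"
  proof -
    have "\<exists>h\<in>R.hm (dg 1 a) (dg l a). f = D * h" if "f \<in> R.hm (dg 1 a) (F 1)" for f
    proof (rule bexI[of _ "w * f"])
      have f: "f \<in> hm (dg 1 a) (dg 1 p)" using that by (simp add: R_AF)
      show "f = D * (w * f)" using hmL[OF f] U(4) by (simp add: mult.assoc[symmetric])
      show "w * f \<in> R.hm (dg 1 a) (dg l a)" using f ptn_props(2)[OF U(1)] by (auto simp: R_AA)
    qed
    then show ?thesis unfolding R.hom1_def cR_def Ea using R.hm_0 by auto
  qed
  have gT: "R.gv (cR l 1 D) = (1, - real l)" using ptn_gv(2)[OF U(1)] by simp
  have m: "{(E 0 0 a, 0, 0)} \<in> R.pmf" "{(E 0 0 a, 0, 0), cR l 1 D} \<in> R.pmf"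
    using Z Zh UR ZU ptn_pm(2)[OF U(1)] by (auto simp: R.pmf_def)
  have g: "R.gv ` {(E 0 0 a, 0, 0)} = {(0,-1)}" "R.gv ` {(E 0 0 a, 0, 0), cR l 1 D} = {(0,-1), (1, - real l)}" using Z gT by auto
  have "cone_gen (R.gv ` {(E 0 0 a, 0, 0)}) \<in> ?A" "cone_gen (R.gv ` {(E 0 0 a, 0, 0), cR l 1 D}) \<in> ?A" using m by blast+
  then have "cone_gen {(0,-1)} \<in> ?A" "cone_gen {(0,-1), (1, - real l)} \<in> ?A" unfolding g by blast+
  moreover have "(\<lambda>F'. cone_gen (R.gv ` F')) ` R1 \<subseteq> ?A" unfolding R1_def by blast
  ultimately show "C \<in> ?A" using C by blast
qed

end

section \<open>Cones in the plane\<close>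

lemma cone_gen_empty: "cone_gen {} = {(0, 0)}"
  by (auto simp: cone_gen_def)

lemma mem_cone1: "x \<in> cone_gen {u} \<longleftrightarrow> (\<exists>\<alpha>\<ge>0. x = (\<alpha> * fst u, \<alpha> * snd u))"
  unfolding cone_gen_def by (auto intro: exI[of _ "\<lambda>_. _"])

lemma mem_cone2: "x \<in> cone_gen {u, v} \<longleftrightarrow> (\<exists>\<alpha>\<ge>0. \<exists>\<beta>\<ge>0. x = (\<alpha> * fst u + \<beta> * fst v, \<alpha> * snd u + \<beta> * snd v))"
proof (cases "u = v")
  case True
  have "x \<in> cone_gen {u} \<longleftrightarrow> (\<exists>\<alpha>\<ge>0. \<exists>\<beta>\<ge>0. x = (\<alpha> * fst u + \<beta> * fst u, \<alpha> * snd u + \<beta> * snd u))"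
    unfolding mem_cone1
  proof
    assume "\<exists>\<alpha>\<ge>0. x = (\<alpha> * fst u, \<alpha> * snd u)"
    then obtain \<alpha> where "\<alpha> \<ge> 0" "x = (\<alpha> * fst u, \<alpha> * snd u)" by blast
    then show "\<exists>\<alpha>\<ge>0. \<exists>\<beta>\<ge>0. x = (\<alpha> * fst u + \<beta> * fst u, \<alpha> * snd u + \<beta> * snd u)"
      by (intro exI[of _ \<alpha>] conjI exI[of _ 0]) auto
  next
    assume "\<exists>\<alpha>\<ge>0. \<exists>\<beta>\<ge>0. x = (\<alpha> * fst u + \<beta> * fst u, \<alpha> * snd u + \<beta> * snd u)"
    then obtain \<alpha> \<beta> where "\<alpha> \<ge> 0" "\<beta> \<ge> 0" "x = (\<alpha> * fst u + \<beta> * fst u, \<alpha> * snd u + \<beta> * snd u)" by blast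
    then show "\<exists>\<alpha>\<ge>0. x = (\<alpha> * fst u, \<alpha> * snd u)"
      by (intro exI[of _ "\<alpha> + \<beta>"]) (auto simp: distrib_right)
  qed
  then show ?thesis using True by simp
next
  case False
  show ?thesis
  proof
    assume "x \<in> cone_gen {u, v}"
    then obtain c where c: "\<forall>w\<in>{u, v}. c w \<ge> 0" "x = ((\<Sum>w\<in>{u, v}. c w * fst w), (\<Sum>w\<in>{u, v}. c w * snd w))"
      unfolding cone_gen_def by blast
    then show "\<exists>\<alpha>\<ge>0. \<exists>\<beta>\<ge>0. x = (\<alpha> * fst u + \<beta> * fst v, \<alpha> * snd u + \<beta> * snd v)"
      using False by (intro exI[of _ "c u"] conjI exI[of _ "c v"]) auto
  next
    assume "\<exists>\<alpha>\<ge>0. \<exists>\<beta>\<ge>0. x = (\<alpha> * fst u + \<beta> * fst v, \<alpha> * snd u + \<beta> * snd v)"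
    then obtain \<alpha> \<beta> where "\<alpha> \<ge> 0" "\<beta> \<ge> 0" "x = (\<alpha> * fst u + \<beta> * fst v, \<alpha> * snd u + \<beta> * snd v)" by blast
    then show "x \<in> cone_gen {u, v}" unfolding cone_gen_def mem_Collect_eq
      using False by (intro exI[of _ "\<lambda>w. if w = u then \<alpha> else \<beta>"]) auto
  qed
qed

lemma cone_gen_base: assumes "finite V" "v \<in> V" "\<alpha> \<ge> 0" shows "(\<alpha> * fst v, \<alpha> * snd v) \<in> cone_gen V"
  unfolding cone_gen_def mem_Collect_eq
proof (intro exI[of _ "\<lambda>w. if w = v then \<alpha> else 0"] conjI)
  show "(\<alpha> * fst v, \<alpha> * snd v) = ((\<Sum>w\<in>V. (if w = v then \<alpha> else 0) * fst w), (\<Sum>w\<in>V. (if w = v then \<alpha> else 0) * snd w))"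
    using assms by (simp add: if_distrib[of "\<lambda>c. c * _"] sum.delta cong: if_cong)
qed (use assms in auto)

lemma cone_gen_add: assumes "x \<in> cone_gen V" "y \<in> cone_gen V" shows "(fst x + fst y, snd x + snd y) \<in> cone_gen V"
proof -
  obtain c d where c: "\<forall>v\<in>V. c v \<ge> 0" "x = ((\<Sum>v\<in>V. c v * fst v), (\<Sum>v\<in>V. c v * snd v))"
    "\<forall>v\<in>V. d v \<ge> 0" "y = ((\<Sum>v\<in>V. d v * fst v), (\<Sum>v\<in>V. d v * snd v))"
    using assms unfolding cone_gen_def by blast
  then show ?thesis unfolding cone_gen_def mem_Collect_eq
    by (intro exI[of _ "\<lambda>v. c v + d v"]) (auto simp: distrib_right sum.distrib)
qed

lemma cone_gen_scale: assumes "x \<in> cone_gen V" "\<alpha> \<ge> 0" shows "(\<alpha> * fst x, \<alpha> * snd x) \<in> cone_gen V"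
proof -
  obtain c where c: "\<forall>v\<in>V. c v \<ge> 0" "x = ((\<Sum>v\<in>V. c v * fst v), (\<Sum>v\<in>V. c v * snd v))"
    using assms unfolding cone_gen_def by blast
  then show ?thesis unfolding cone_gen_def mem_Collect_eq using assms
    by (intro exI[of _ "\<lambda>v. \<alpha> * c v"]) (auto simp: sum_distrib_left mult.assoc)
qed

lemma cone_gen_0: "(0, 0) \<in> cone_gen V"
  unfolding cone_gen_def by (auto intro: exI[of _ "\<lambda>_. 0"])

lemma cone_gen_sub: assumes V: "finite V" and W: "V \<subseteq> cone_gen W" shows "cone_gen V \<subseteq> cone_gen W"
proof
  fix x assume "x \<in> cone_gen V"
  then obtain c where c: "\<forall>v\<in>V. c v \<ge> 0" "x = ((\<Sum>v\<in>V. c v * fst v), (\<Sum>v\<in>V. c v * snd v))"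
    unfolding cone_gen_def by blast
  have "((\<Sum>v\<in>U. c v * fst v), (\<Sum>v\<in>U. c v * snd v)) \<in> cone_gen W" if "U \<subseteq> V" for U
    using finite_subset[OF that V] that
  proof (induction U rule: finite_induct)
    case empty then show ?case by (simp add: cone_gen_0)
  next
    case (insert v U)
    then have "(c v * fst v, c v * snd v) \<in> cone_gen W" using W c(1) by (intro cone_gen_scale) auto
    from cone_gen_add[OF this insert(3)] insert show ?case by simp
  qed
  then show "x \<in> cone_gen W" using c(2) by blast
qed

lemma cone_gen_eqI: "finite V \<Longrightarrow> finite W \<Longrightarrow> V \<subseteq> cone_gen W \<Longrightarrow> W \<subseteq> cone_gen V \<Longrightarrow> cone_gen V = cone_gen W"
  using cone_gen_sub by blast

lemma cone_gen_halfplane: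
  assumes V: "finite V" "\<And>v. v \<in> V \<Longrightarrow> snd v < 0" "x \<in> cone_gen V"
  shows "snd x \<le> 0" "snd x = 0 \<Longrightarrow> x = (0, 0)"
proof -
  obtain c where c: "\<forall>v\<in>V. c v \<ge> 0" "x = ((\<Sum>v\<in>V. c v * fst v), (\<Sum>v\<in>V. c v * snd v))"
    using V(3) unfolding cone_gen_def by blast
  have n: "c v * snd v \<le> 0" if "v \<in> V" for v using c(1) V(2)[OF that] that by (simp add: mult_nonneg_nonpos)
  show "snd x \<le> 0" using c(2) n by (simp add: sum_nonpos)
  assume "snd x = 0"
  then have "\<forall>v\<in>V. c v * snd v = 0"
    using c(2) n sum_nonneg_eq_0_iff[OF V(1), of "\<lambda>v. - (c v * snd v)"] by (simp add: sum_negf)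
  then have "\<forall>v\<in>V. c v = 0" using V(2) by (metis mult_eq_0_iff order_less_irrefl)
  then show "x = (0, 0)" using c(2) by simp
qed

text \<open>In the open lower half-plane directions are ordered by the ratio x / y, and the extreme
  ratios give the generators. Hence each cone is the origin, a ray or of dimension 2, and is seen by
  \<open>rays_of\<close> and \<open>cones2_of\<close>.\<close>

lemma cone_gen_halfplane_cases:
  assumes V: "finite V" "\<And>v. v \<in> V \<Longrightarrow> snd v < 0"
  obtains "V = {}" | u where "snd u < 0" "cone_gen V = cone_gen {u}"
  | u v where "fst u * snd v - snd u * fst v \<noteq> 0" "cone_gen V = cone_gen {u, v}"
proof (cases "V = {}")
  case False
  define s where "s v = fst v / snd v" for v :: "real \<times> real"
  have fs: "finite (s ` V)" "s ` V \<noteq> {}" using V False by auto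
  obtain u where u: "u \<in> V" "s u = Min (s ` V)" using Min_in[OF fs] by force
  obtain v where v: "v \<in> V" "s v = Max (s ` V)" using Max_in[OF fs] by force
  have le: "s u \<le> s w" "s w \<le> s v" if "w \<in> V" for w using that u v V by (simp_all add: s_def[symmetric])
  have sf: "fst w = s w * snd w" if "w \<in> V" for w using V(2)[OF that] by (simp add: s_def)
  show ?thesis
  proof (cases "s u = s v")
    case True
    have "w \<in> cone_gen {u}" if w: "w \<in> V" for w
    proof -
      have "s w = s u" using le[OF w] True by simp
      then show ?thesis unfolding mem_cone1 using sf[OF w] sf[OF u(1)] V(2)[OF w] V(2)[OF u(1)]
        by (intro exI[of _ "snd w / snd u"]) (auto simp: divide_nonpos_neg prod_eq_iff)
    qed
    then have "cone_gen V = cone_gen {u}"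
      using V u(1) cone_gen_base[OF V(1) u(1), of 1] by (intro cone_gen_eqI) auto
    then show ?thesis using that(2) V(2) u(1) by blast
  next
    case False
    then have lt: "s u < s v" using le[OF u(1)] by simp
    have su: "snd u < 0" "snd v < 0" using V(2) u v by auto
    have "w \<in> cone_gen {u, v}" if w: "w \<in> V" for w
    proof -
      have sw: "snd w < 0" using V(2) w by auto
      \<comment> \<open>The ratio of \<open>w\<close> is a convex combination of the extreme ratios;
        the coefficients are rescaled by the second coordinates.\<close>
      define \<alpha> where "\<alpha> = (s v - s w) * snd w / ((s v - s u) * snd u)"
      define \<beta> where "\<beta> = (s w - s u) * snd w / ((s v - s u) * snd v)"
      have "\<alpha> \<ge> 0" "\<beta> \<ge> 0" unfolding \<alpha>_def \<beta>_def using le[OF w] lt su sw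
        by (auto intro!: divide_nonpos_neg mult_nonneg_nonpos mult_pos_neg)
      moreover have a: "\<alpha> * snd u = (s v - s w) * snd w / (s v - s u)" "\<beta> * snd v = (s w - s u) * snd w / (s v - s u)"
        using su lt by (simp_all add: \<alpha>_def \<beta>_def)
      have "\<alpha> * snd u + \<beta> * snd v = snd w"
        unfolding a add_divide_distrib[symmetric] using lt by (simp add: field_simps)
      moreover have "\<alpha> * fst u + \<beta> * fst v = fst w"
      proof -
        have "\<alpha> * fst u + \<beta> * fst v = s u * (\<alpha> * snd u) + s v * (\<beta> * snd v)" using sf[OF u(1)] sf[OF v(1)] by simp
        also have "\<dots> = (s u * ((s v - s w) * snd w) + s v * ((s w - s u) * snd w)) / (s v - s u)"
          unfolding a by (simp add: add_divide_distrib)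
        also have "s u * ((s v - s w) * snd w) + s v * ((s w - s u) * snd w) = (s v - s u) * (s w * snd w)"
          by (simp add: algebra_simps)
        finally show ?thesis using lt sf[OF w] by simp
      qed
      ultimately show ?thesis unfolding mem_cone2 by (intro exI[of _ \<alpha>] exI[of _ \<beta>] conjI) (auto simp: prod_eq_iff)
    qed
    then have "cone_gen V = cone_gen {u, v}"
      using V u(1) v(1) cone_gen_base[OF V(1) u(1), of 1] cone_gen_base[OF V(1) v(1), of 1] by (intro cone_gen_eqI) auto
    moreover have "fst u * snd v - snd u * fst v \<noteq> 0"
    proof -
      have "fst u * snd v - snd u * fst v = (s u - s v) * (snd u * snd v)"
        using sf[OF u(1)] sf[OF v(1)] by (simp add: algebra_simps)
      then show ?thesis using lt su by simp
    qed
    ultimately show ?thesis using that(3) by blast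
  qed
qed (use that in blast)

definition rmap :: "real \<Rightarrow> real \<times> real \<Rightarrow> real \<times> real" where
  "rmap l = (\<lambda>(x, y). (- y, x + l * y))"

lemma rmap_cone: assumes "finite V" shows "rmap l ` cone_gen V = cone_gen (rmap l ` V)"
proof -
  have inj: "inj_on (rmap l) V" by (auto simp: inj_on_def rmap_def)
  have e: "rmap l ((\<Sum>v\<in>V. c v * fst v), (\<Sum>v\<in>V. c v * snd v)) = ((\<Sum>v\<in>V. c v * fst (rmap l v)), (\<Sum>v\<in>V. c v * snd (rmap l v)))" for c
    by (auto simp: rmap_def case_prod_beta sum_negf[symmetric] sum_distrib_left sum.distrib[symmetric] algebra_simps)
  show ?thesis
  proof (intro equalityI subsetI)
    fix x assume "x \<in> rmap l ` cone_gen V"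
    then obtain c where c: "\<forall>v\<in>V. c v \<ge> 0" "x = rmap l ((\<Sum>v\<in>V. c v * fst v), (\<Sum>v\<in>V. c v * snd v))"
      unfolding cone_gen_def by blast
    show "x \<in> cone_gen (rmap l ` V)" unfolding cone_gen_def mem_Collect_eq
      by (rule exI[of _ "\<lambda>w. c (inv_into V (rmap l) w)"])
        (use c(1) in \<open>auto simp: c(2) e sum.reindex[OF inj] inv_into_f_f[OF inj] intro!: sum.cong\<close>)
  next
    fix x assume "x \<in> cone_gen (rmap l ` V)"
    then obtain c where c: "\<forall>v\<in>rmap l ` V. c v \<ge> 0" "x = ((\<Sum>v\<in>rmap l ` V. c v * fst v), (\<Sum>v\<in>rmap l ` V. c v * snd v))"
      unfolding cone_gen_def by blast
    have "x = rmap l ((\<Sum>v\<in>V. c (rmap l v) * fst v), (\<Sum>v\<in>V. c (rmap l v) * snd v))"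
      unfolding e using c(2) by (simp add: sum.reindex[OF inj])
    moreover have "((\<Sum>v\<in>V. c (rmap l v) * fst v), (\<Sum>v\<in>V. c (rmap l v) * snd v)) \<in> cone_gen V"
      unfolding cone_gen_def using c(1) by (auto intro!: exI[of _ "\<lambda>v. c (rmap l v)"])
    ultimately show "x \<in> rmap l ` cone_gen V" by blast
  qed
qed

lemma ray_ne_cone2: assumes "fst u * snd v - snd u * fst v \<noteq> 0" shows "cone_gen {u, v} \<noteq> cone_gen {w}"
proof
  assume e: "cone_gen {u, v} = cone_gen {w}"
  have "u \<in> cone_gen {u, v}" "v \<in> cone_gen {u, v}"
    using cone_gen_base[of "{u, v}" u 1] cone_gen_base[of "{u, v}" v 1] by auto
  then obtain \<alpha> \<beta> where "u = (\<alpha> * fst w, \<alpha> * snd w)" "v = (\<beta> * fst w, \<beta> * snd w)" unfolding e mem_cone1 by blast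
  then show False using assms by (simp add: algebra_simps)
qed

text \<open>The cones that the rotation discards are exactly those containing (0, 1). The remaining
  ones, with the three new cones, are mapped generator by generator.\<close>

theorem rho_eq:
  fixes l :: real and VL :: "(real \<times> real) set set"
  assumes l: "l \<ge> 0" and VL: "\<And>V. V \<in> VL \<Longrightarrow> finite V" "\<And>V v. V \<in> VL \<Longrightarrow> v \<in> V \<Longrightarrow> snd v < 0" "{} \<in> VL"
    and Sg: "\<Sigma> = cone_gen ` VL \<union> {cone_gen {(1,0)}, cone_gen {(1,0), (l,-1)}} \<union> {cone_gen {(0,1)}, cone_gen {(0,1),(1,0)},
      cone_gen {(0,1),(-1,0)}, cone_gen {(-1,0)}, cone_gen {(-1,0),(0,-1)}}"
  shows "rho \<Sigma> = cone_gen ` (`) (rmap l) ` VL \<union> {cone_gen {(0,-1)}, cone_gen {(0,-1), (1,-l)}} \<union> {cone_gen {(0,1)}, cone_gen {(0,1),(1,0)},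
      cone_gen {(0,1),(-1,0)}, cone_gen {(-1,0)}, cone_gen {(-1,0),(0,-1)}}"
proof -
  have VLh: "snd x \<le> 0" "snd x = 0 \<Longrightarrow> x = (0, 0)" if "V \<in> VL" "x \<in> cone_gen V" for V x
    using cone_gen_halfplane[OF VL(1)[OF that(1)] VL(2)[OF that(1)] that(2)] by blast+
  have rl: "rot_l \<Sigma> = l" unfolding rot_l_def
  proof (rule the_equality)
    show "l \<ge> 0 \<and> cone_gen {(1,0), (l,-1)} \<in> \<Sigma>" using l Sg by simp
    fix l' :: real assume l': "l' \<ge> 0 \<and> cone_gen {(1,0), (l',-1)} \<in> \<Sigma>"
    let ?C = "cone_gen {(1,0), (l',-1)} :: (real \<times> real) set"
    have m: "(1, 0) \<in> ?C" "(l', -1) \<in> ?C"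
      using cone_gen_base[of "{(1,0), (l',-1)}" "(1,0)" 1] cone_gen_base[of "{(1,0), (l',-1)}" "(l',-1)" 1] by auto
    \<comment> \<open>Every cone of \<Sigma> other than \<open>cone_gen {(1,0), (l,-1)}\<close>
      misses one of the points (1, 0) and (l', -1).\<close>
    have 1: "?C \<notin> cone_gen ` VL" using m(1) VLh by fastforce
    have 2: "?C \<noteq> cone_gen {(1,0)}" "?C \<noteq> cone_gen {(0,1)}" "?C \<noteq> cone_gen {(-1,0)}" using m by (auto simp: mem_cone1)
    have 3: "?C \<noteq> cone_gen {(0,1),(1,0)}" "?C \<noteq> cone_gen {(0,1),(-1,0)}"
    proof -
      have "(l', -1) \<notin> cone_gen {(0,1),(1,0)}" "(l', -1) \<notin> cone_gen {(0,1),(-1,0)}" by (auto simp: mem_cone2)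
      then show "?C \<noteq> cone_gen {(0,1),(1,0)}" "?C \<noteq> cone_gen {(0,1),(-1,0)}" using m(2) by blast+
    qed
    have 4: "?C \<noteq> cone_gen {(-1,0),(0,-1)}"
    proof -
      have "(1, 0) \<notin> cone_gen {(-1,0),(0,-1)}" by (auto simp: mem_cone2)
      then show ?thesis using m(1) by blast
    qed
    have C: "?C = cone_gen {(1,0), (l,-1)}" using l' 1 2 3 4 unfolding Sg by blast
    have "(l', -1) \<in> cone_gen {(1,0), (l,-1)}" using m(2) C by simp
    then have "l' \<ge> l" by (auto simp: mem_cone2)
    moreover have "(l, -1) \<in> cone_gen {(1,0), (l,-1)}" using cone_gen_base[of "{(1,0), (l,-1)}" "(l,-1)" 1] by auto
    then have "(l, -1) \<in> ?C" using C by simp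
    then have "l \<ge> l'" by (auto simp: mem_cone2)
    ultimately show "l' = l" by simp
  qed
  let ?KEEP = "{cone_gen {(1,0)}, cone_gen {(1,0), (l,-1)}, cone_gen {(-1,0)}, cone_gen {(-1,0),(0,-1)}} :: (real \<times> real) set set"
  \<comment> \<open>The point (0, 1) separates the cones that stay from those removed, also when two
    descriptions might denote the same set.\<close>
  have keep: "(0, 1) \<notin> C" if "C \<in> cone_gen ` VL \<union> ?KEEP" for C
  proof -
    have "(0, 1) \<notin> cone_gen V" if "V \<in> VL" for V using VLh(1)[OF that, of "(0, 1)"] by auto
    moreover have "(0, 1) \<notin> cone_gen {(1,0)}" "(0, 1) \<notin> cone_gen {(1,0), (l,-1)}" "(0, 1) \<notin> cone_gen {(-1,0)}" "(0, 1) \<notin> cone_gen {(-1,0),(0,-1)}"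
      by (auto simp: mem_cone1 mem_cone2)
    ultimately show ?thesis using that by blast
  qed
  have rem: "(0, 1) \<in> cone_gen {(0,1)}" "(0, 1) \<in> cone_gen {(0,1),(1,0)}" "(0, 1) \<in> cone_gen {(0,1),(-1,0)}"
    using cone_gen_base[of "{(0,1)}" "(0,1)" 1] cone_gen_base[of "{(0,1),(1,0)}" "(0,1)" 1] cone_gen_base[of "{(0,1),(-1,0)}" "(0,1)" 1] by auto
  have sw: "cone_gen {(1,0),(0,1)} = cone_gen {(0,1),(1,0)}" "cone_gen {(-1,0),(0,1)} = cone_gen {(0,1),(-1,0)}"
    by (simp_all add: insert_commute)
  let ?R = "rays_of \<Sigma> - {cone_gen {(0,1)}}"
  let ?T = "cones2_of \<Sigma> - {cone_gen {(1,0),(0,1)}, cone_gen {(-1,0),(0,1)}}"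
  have RT: "{{(0,0)}} \<union> ?R \<union> ?T = cone_gen ` VL \<union> ?KEEP"
  proof (intro equalityI subsetI)
    fix C assume C: "C \<in> {{(0,0)}} \<union> ?R \<union> ?T"
    show "C \<in> cone_gen ` VL \<union> ?KEEP"
    proof (cases "C = {(0,0)}")
      case True then show ?thesis using VL(3) cone_gen_empty by blast
    next
      case False
      then have CS: "C \<in> \<Sigma>" using C by (auto simp: rays_of_def cones2_of_def)
      have "C \<noteq> cone_gen {(0,1)}"
      proof
        assume e: "C = cone_gen {(0,1)}"
        then have "C \<in> cones2_of \<Sigma>" using C False by auto
        then obtain u v where "fst u * snd v - snd u * fst v \<noteq> 0" "C = cone_gen {u, v}" unfolding cones2_of_def by blast
        then show False using ray_ne_cone2 e by blast
      qed
      moreover have "C \<noteq> cone_gen {(0,1),(1,0)}" "C \<noteq> cone_gen {(0,1),(-1,0)}"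
      proof -
        have "C \<in> rays_of \<Sigma> \<or> C \<notin> {cone_gen {(0,1),(1,0)}, cone_gen {(0,1),(-1,0)}}" using C False unfolding sw by blast
        then show "C \<noteq> cone_gen {(0,1),(1,0)}" "C \<noteq> cone_gen {(0,1),(-1,0)}"
          using ray_ne_cone2[of "(0,1)" "(1,0)"] ray_ne_cone2[of "(0,1)" "(-1,0)"] by (auto simp: rays_of_def)
      qed
      ultimately show ?thesis using CS unfolding Sg by blast
    qed
  next
    fix C assume C: "C \<in> cone_gen ` VL \<union> ?KEEP"
    have CS: "C \<in> \<Sigma>" using C unfolding Sg by blast
    have ne: "C \<noteq> cone_gen {(0,1)}" "C \<noteq> cone_gen {(1,0),(0,1)}" "C \<noteq> cone_gen {(-1,0),(0,1)}"
      using keep[OF C] rem unfolding sw by blast+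
    have "C = {(0,0)} \<or> C \<in> rays_of \<Sigma> \<or> C \<in> cones2_of \<Sigma>"
      using C
    proof
      assume "C \<in> cone_gen ` VL"
      then obtain V where V: "V \<in> VL" "C = cone_gen V" by blast
      have fV: "finite V" "\<And>v. v \<in> V \<Longrightarrow> snd v < 0" using VL V(1) by auto
      show ?thesis
      proof (rule cone_gen_halfplane_cases[OF fV])
        assume "V = {}" then show ?thesis using V cone_gen_empty by simp
      next
        fix u assume u: "snd u < 0" "cone_gen V = cone_gen {u}"
        then have "u \<noteq> (0, 0)" by auto
        then show ?thesis using u V CS unfolding rays_of_def by blast
      next
        fix u v assume "fst u * snd v - snd u * fst v \<noteq> 0" "cone_gen V = cone_gen {u, v}"
        then show ?thesis using V CS unfolding cones2_of_def by blast
      qed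
    next
      assume "C \<in> ?KEEP"
      then consider "C = cone_gen {(1,0)}" | "C = cone_gen {(1,0), (l,-1)}" | "C = cone_gen {(-1,0)}" | "C = cone_gen {(-1,0),(0,-1)}" by blast
      then show ?thesis
      proof cases
        case 1
        have "(1, 0) \<noteq> (0::real, 0::real)" by simp
        then show ?thesis using CS 1 unfolding rays_of_def by blast
      next
        case 2
        have "fst (1, 0) * snd (l, -1) - snd (1, 0) * fst (l, -1) \<noteq> (0::real)" by simp
        then show ?thesis using CS 2 unfolding cones2_of_def by blast
      next
        case 3
        have "(-1, 0) \<noteq> (0::real, 0::real)" by simp
        then show ?thesis using CS 3 unfolding rays_of_def by blast
      next
        case 4
        have "fst (-1, 0) * snd (0, -1) - snd (-1, 0) * fst (0, -1) \<noteq> (0::real)" by simp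
        then show ?thesis using CS 4 unfolding cones2_of_def by blast
      qed
    qed
    then show "C \<in> {{(0,0)}} \<union> ?R \<union> ?T" using ne by blast
  qed
  have "rho \<Sigma> = (`) (rmap l) ` (({{(0,0)}} \<union> ?R \<union> ?T) \<union> {cone_gen {(-l,1)}, cone_gen {(-1,0),(-l,1)}, cone_gen {(-l,1),(1,0)}})"
    unfolding rho_def Let_def rl rmap_def[symmetric] by (rule image_cong) auto
  also have "\<dots> = (\<lambda>V. rmap l ` cone_gen V) ` VL \<union> {rmap l ` cone_gen {(1,0)}, rmap l ` cone_gen {(1,0), (l,-1)}, rmap l ` cone_gen {(-1,0)},
      rmap l ` cone_gen {(-1,0),(0,-1)}, rmap l ` cone_gen {(-l,1)}, rmap l ` cone_gen {(-1,0),(-l,1)}, rmap l ` cone_gen {(-l,1),(1,0)}}"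
    unfolding RT by (auto simp: image_Un image_image)
  also have "(\<lambda>V. rmap l ` cone_gen V) ` VL = cone_gen ` (`) (rmap l) ` VL"
    unfolding image_image[of cone_gen] by (intro image_cong refl rmap_cone VL(1))
  finally show ?thesis
    by (simp add: rmap_cone) (auto simp: rmap_def insert_commute)
qed

section \<open>Algebras embedded in a locally finite-dimensional ring\<close>

text \<open>Instantiated three times: for \<Lambda> in its regular matrices, for \<Lambda> at
  position (0, 0) of matrices over these, and for \<Gamma> in \<open>Gam\<close>.\<close>

locale alg = kalg scl for scl :: "'k::field \<Rightarrow> 'r::ring \<Rightarrow> 'r" +
  fixes A :: "('k, 'a) module" and \<phi> :: "'a \<Rightarrow> 'r" and S :: "'r set" and e1 e2 :: 'a
  assumes ringA: "ring A"
    and inj: "inj_on \<phi> (carrier A)"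
    and \<phi>_add: "x \<in> carrier A \<Longrightarrow> y \<in> carrier A \<Longrightarrow> \<phi> (x \<oplus>\<^bsub>A\<^esub> y) = \<phi> x + \<phi> y"
    and \<phi>_mult: "x \<in> carrier A \<Longrightarrow> y \<in> carrier A \<Longrightarrow> \<phi> (x \<otimes>\<^bsub>A\<^esub> y) = \<phi> x * \<phi> y"
    and smult_closed: "x \<in> carrier A \<Longrightarrow> c \<odot>\<^bsub>A\<^esub> x \<in> carrier A"
    and \<phi>_smult: "x \<in> carrier A \<Longrightarrow> \<phi> (c \<odot>\<^bsub>A\<^esub> x) = scl c (\<phi> x)"
    and rcS: "rcat S" and subS: "subspace S"
    and corner: "\<phi> ` carrier A = {x \<in> S. \<phi> \<one>\<^bsub>A\<^esub> * x = x \<and> x * \<phi> \<one>\<^bsub>A\<^esub> = x}"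
    and poi: "complete_poi2 A e1 e2"
    and triA: "\<forall>x\<in>carrier A. e2 \<otimes>\<^bsub>A\<^esub> x \<otimes>\<^bsub>A\<^esub> e1 = \<zero>\<^bsub>A\<^esub>"
begin

interpretation A: ring A by (rule ringA)
interpretation s: rcat S by (rule rcS)

abbreviation "u \<equiv> \<phi> \<one>\<^bsub>A\<^esub>"
definition g :: "bool \<Rightarrow> 'r" where "g b = \<phi> (lab e1 e2 b)"

lemma prim: "primitive_idem A (lab e1 e2 b)" using poi by (auto simp: complete_poi2_def lab_def)
lemma LA [simp]: "lab e1 e2 b \<in> carrier A" using prim[of b] by (auto simp: primitive_idem_def idem_def)
lemma \<phi>_zero: "\<phi> \<zero>\<^bsub>A\<^esub> = 0" using \<phi>_add[of "\<zero>\<^bsub>A\<^esub>" "\<zero>\<^bsub>A\<^esub>"] by simp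
lemma \<phi>S [simp]: "x \<in> carrier A \<Longrightarrow> \<phi> x \<in> S" using corner by blast
lemma \<phi>_eq: "x \<in> carrier A \<Longrightarrow> y \<in> carrier A \<Longrightarrow> \<phi> x = \<phi> y \<longleftrightarrow> x = y" using inj by (rule inj_on_eq_iff)
lemma \<phi>_eq0: "x \<in> carrier A \<Longrightarrow> \<phi> x = 0 \<longleftrightarrow> x = \<zero>\<^bsub>A\<^esub>" using \<phi>_eq[of x "\<zero>\<^bsub>A\<^esub>"] by (simp add: \<phi>_zero)
lemma \<phi>_uminus: "x \<in> carrier A \<Longrightarrow> \<phi> (\<ominus>\<^bsub>A\<^esub> x) = - \<phi> x"
proof -
  assume x: "x \<in> carrier A"
  have "\<phi> (\<ominus>\<^bsub>A\<^esub> x) + \<phi> x = 0" using \<phi>_add[of "\<ominus>\<^bsub>A\<^esub> x" x] x by (simp add: A.l_neg \<phi>_zero)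
  then show ?thesis by (simp add: eq_neg_iff_add_eq_0)
qed

lemma ux: "x \<in> carrier A \<Longrightarrow> u * \<phi> x = \<phi> x" "x \<in> carrier A \<Longrightarrow> \<phi> x * u = \<phi> x"
  using corner by blast+

lemma gg [simp]: "g b * g b = g b"
  using prim[of b] \<phi>_mult[of "lab e1 e2 b" "lab e1 e2 b"] by (simp add: g_def primitive_idem_def idem_def)
lemma gS [simp]: "g b \<in> S" by (simp add: g_def)
lemma g_orth: "b \<noteq> c \<Longrightarrow> g b * g c = 0"
  using poi \<phi>_mult[OF LA LA, of b c] by (cases b; cases c) (auto simp: lab_def g_def complete_poi2_def \<phi>_zero)
lemma g_sum: "u = g False + g True"
proof -
  have "e1 \<oplus>\<^bsub>A\<^esub> e2 = \<one>\<^bsub>A\<^esub>" using poi by (simp add: complete_poi2_def)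
  then show ?thesis using \<phi>_add[OF LA LA, of False True] by (simp add: g_def lab_def)
qed
lemma g_nz [simp]: "g b \<noteq> 0" using prim[of b] \<phi>_eq0[OF LA, of b] by (simp add: g_def primitive_idem_def)
lemma ug [simp]: "u * g b = g b" "g b * u = g b" using ux[OF LA] by (simp_all add: g_def)

lemma in_img: assumes "x \<in> S" "g b * x = x" "x * g c = x" obtains x' where "x' \<in> carrier A" "x = \<phi> x'"
proof -
  have "u * x = x" "x * u = x" using assms ug by (metis mult.assoc)+
  then show ?thesis using corner assms(1) that by blast
qed

lemma tri0: assumes "x \<in> S" shows "g True * x * g False = 0"
proof -
  have "g True * (g True * x * g False) = g True * x * g False" "g True * x * g False * g False = g True * x * g False"
    by (simp_all add: mult.assoc[symmetric]) (simp add: mult.assoc)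
  moreover have "g True * x * g False \<in> S" using assms by (auto intro!: s.Smult)
  ultimately obtain y where y: "y \<in> carrier A" "g True * x * g False = \<phi> y" using in_img by metis
  have c: "e1 \<in> carrier A" "e2 \<in> carrier A" using LA[of False] LA[of True] by (simp_all add: lab_def)
  have "\<phi> (e2 \<otimes>\<^bsub>A\<^esub> y \<otimes>\<^bsub>A\<^esub> e1) = g True * \<phi> y * g False" using c y by (simp add: \<phi>_mult g_def lab_def)
  also have "\<dots> = g True * x * g False" unfolding y(2)[symmetric] by (simp add: mult.assoc[symmetric]) (simp add: mult.assoc)
  finally show ?thesis using triA y(1) \<phi>_zero by simp
qed

lemma prim_idem: assumes "z \<in> S" "g b * z = z" "z * g b = z" "z * z = z" shows "z = 0 \<or> z = g b"
proof -
  obtain x where x: "x \<in> carrier A" "z = \<phi> x" using in_img assms(1-3) by blast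
  let ?e = "lab e1 e2 b"
  let ?y = "?e \<oplus>\<^bsub>A\<^esub> \<ominus>\<^bsub>A\<^esub> x"
  have y: "?y \<in> carrier A" "\<phi> ?y = g b - z" using x by (simp_all add: \<phi>_add \<phi>_uminus g_def)
  have "idem A x" using x assms(4) \<phi>_eq[of "x \<otimes>\<^bsub>A\<^esub> x" x] by (simp add: idem_def \<phi>_mult)
  moreover have "\<phi> (?y \<otimes>\<^bsub>A\<^esub> ?y) = \<phi> ?y" unfolding \<phi>_mult[OF y(1) y(1)] y(2) using assms by (simp add: algebra_simps)
  then have "idem A ?y" using y(1) \<phi>_eq[of "?y \<otimes>\<^bsub>A\<^esub> ?y" ?y] by (simp add: idem_def)
  moreover have "\<phi> (x \<otimes>\<^bsub>A\<^esub> ?y) = 0" "\<phi> (?y \<otimes>\<^bsub>A\<^esub> x) = 0"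
    unfolding \<phi>_mult[OF x(1) y(1)] \<phi>_mult[OF y(1) x(1)] y(2) x(2)[symmetric] using assms by (simp_all add: algebra_simps)
  then have "x \<otimes>\<^bsub>A\<^esub> ?y = \<zero>\<^bsub>A\<^esub>" "?y \<otimes>\<^bsub>A\<^esub> x = \<zero>\<^bsub>A\<^esub>" using x(1) y(1) \<phi>_eq0 by auto
  moreover have "\<phi> (x \<oplus>\<^bsub>A\<^esub> ?y) = \<phi> ?e" using x y by (simp add: \<phi>_add g_def)
  then have "x \<oplus>\<^bsub>A\<^esub> ?y = ?e" using x(1) y(1) \<phi>_eq by simp
  ultimately have "x = \<zero>\<^bsub>A\<^esub> \<or> ?y = \<zero>\<^bsub>A\<^esub>" using prim[of b] unfolding primitive_idem_def by blast
  then show ?thesis using x y \<phi>_zero by auto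
qed

lemma alg_rep: "rep A e1 e2 \<phi> S"
proof -
  interpret R: rcat "sc S" by (rule rcat_sc[OF rcS])
  interpret k: kalg mscl by (rule kalg_fmat)
  have fitR: "\<exists>N Y. Y \<in> sc S \<and> x * Y = Y * x \<and> pw x N * pw x N * Y = pw x N" if "x \<in> sc S" for x
    using k.fitting[OF sub_sc[OF subS] _ that] by blast
  have hmE': "x = E 0 0 (ent x 0 0) \<and> ent x 0 0 \<in> S \<and> v * ent x 0 0 = ent x 0 0 \<and> ent x 0 0 * w = ent x 0 0"
    if x: "x \<in> R.hm (E 0 0 w) (E 0 0 v)" for x w v
  proof -
    have "ent x i j = 0" if "i \<noteq> 0" for i j using arg_cong[OF R.hmL[OF x], of "\<lambda>Z. ent Z i j"] that by simp
    moreover have "ent x i j = 0" if "j \<noteq> 0" for i j using arg_cong[OF R.hmR[OF x], of "\<lambda>Z. ent Z i j"] that by simp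
    moreover have "v * ent x 0 0 = ent x 0 0" "ent x 0 0 * w = ent x 0 0"
      using arg_cong[OF R.hmL[OF x], of "\<lambda>Z. ent Z 0 0"] arg_cong[OF R.hmR[OF x], of "\<lambda>Z. ent Z 0 0"] by simp_all
    ultimately show ?thesis using scD[OF R.hmS[OF x]] by (auto simp: fmat_eq_iff)
  qed
  have "tri (sc S) (\<lambda>b. E 0 0 (\<phi> (lab e1 e2 b)))" unfolding g_def[symmetric]
  proof
    fix b
    show "R.loc (E 0 0 (g b))"
    proof (rule R.loc_of_prim[OF fitR])
      show "R.idp (E 0 0 (g b))" by (auto simp: R.idp_def sc_iff)
      show "E 0 0 (g b) \<noteq> 0" using g_nz[of b] by (metis ent_E ent_zero)
      fix e assume e: "e \<in> R.hm (E 0 0 (g b)) (E 0 0 (g b))" "e * e = e"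
      define z where "z = ent e 0 0"
      have z: "e = E 0 0 z" "z \<in> S" "g b * z = z" "z * g b = z" using hmE'[OF e(1)] by (simp_all add: z_def)
      then have "z * z = z" using e(2) by simp
      then show "e = 0 \<or> e = E 0 0 (g b)" using prim_idem[OF z(2-4)] z(1) by auto
    qed
  next
    have "x = 0" if x: "x \<in> R.hm (E 0 0 (g False)) (E 0 0 (g True))" for x
    proof -
      define z where "z = ent x 0 0"
      have z: "x = E 0 0 z" "z \<in> S" "g True * z = z" "z * g False = z" using hmE'[OF x] by (simp_all add: z_def)
      then have "z = 0" using tri0[of z] by simp
      then show ?thesis using z(1) by simp
    qed
    then show "R.hm (E 0 0 (g False)) (E 0 0 (g True)) = {0}" by auto
  qed (use fitR in blast)
  then interpret T: tri "sc S" "\<lambda>b. E 0 0 (\<phi> (lab e1 e2 b))" .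
  have c: "e1 \<in> carrier A" "e2 \<in> carrier A" using LA[of False] LA[of True] by (simp_all add: lab_def)
  show ?thesis
    by unfold_locales (use rcS ringA c poi inj \<phi>_add \<phi>_mult corner in \<open>simp_all add: complete_poi2_def\<close>)
qed

section \<open>Jacobson radical and residue fields of a triangular algebra\<close>

definition cor :: "bool \<Rightarrow> 'r set" where "cor b = {x \<in> S. g b * x = x \<and> x * g b = x}"
text \<open>The non-units of the local corner, that is, its maximal ideal; \<open>res\<close> says
  that both residue fields equal k.\<close>

definition J :: "bool \<Rightarrow> 'r set" where "J b = {x \<in> cor b. \<not> (\<exists>w\<in>cor b. w * x = g b \<and> x * w = g b)}"
definition res :: bool where "res \<longleftrightarrow> (\<forall>b. \<forall>x\<in>cor b. \<exists>c. x - scl c (g b) \<in> J b)"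

lemma cor_hm: "cor b = s.hm (g b) (g b)" by (auto simp: cor_def s.hm_def)

lemma cor_loc: "s.loc (g b)"
proof (rule s.loc_of_prim)
  show "\<exists>N Y. Y \<in> S \<and> x * Y = Y * x \<and> pw x N * pw x N * Y = pw x N" if "x \<in> S" for x
    using fitting[OF subS s.Smult that] by blast
  show "s.idp (g b)" by (simp add: s.idp_def)
  fix e assume "e \<in> s.hm (g b) (g b)" "e * e = e"
  then show "e = 0 \<or> e = g b" using prim_idem by (auto simp: s.hm_def)
qed simp

lemma cor_closed: "x \<in> cor b \<Longrightarrow> y \<in> cor b \<Longrightarrow> x * y \<in> cor b" "x \<in> cor b \<Longrightarrow> y \<in> cor b \<Longrightarrow> x + y \<in> cor b"
  "x \<in> cor b \<Longrightarrow> y \<in> cor b \<Longrightarrow> x - y \<in> cor b" "g b \<in> cor b" "0 \<in> cor b"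
  unfolding cor_hm by (auto simp: s.hm_id s.idp_def)
lemma cor_scl: "x \<in> cor b \<Longrightarrow> scl c x \<in> cor b"
  using subS by (auto simp: cor_def scl_multL scl_multR subspace_def)
lemma corL: "x \<in> cor b \<Longrightarrow> g b * x = x" and corR: "x \<in> cor b \<Longrightarrow> x * g b = x" by (auto simp: cor_def)

lemma J_cor: "x \<in> J b \<Longrightarrow> x \<in> cor b" by (simp add: J_def)

text \<open>The product in the other order is a nonzero idempotent of a corner with no others but
  its unit, so one-sided inverses are two-sided.\<close>

lemma left_inv: assumes "x \<in> cor b" "w \<in> cor b" "w * x = g b" shows "x \<notin> J b"
proof -
  have "x * w \<in> cor b" "x * w * (x * w) = x * w"
    using cor_closed(1)[OF assms(1,2)] assms by (simp_all add: mult.assoc asr[OF assms(3)] corL)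
  then have "x * w = 0 \<or> x * w = g b" using prim_idem[of "x * w" b] by (auto simp: cor_def)
  moreover have "x * w \<noteq> 0"
  proof
    assume "x * w = 0"
    then have "w * (x * w) * x = 0" by simp
    then have "g b = 0" by (simp add: mult.assoc[symmetric] assms(3)) (simp add: mult.assoc assms(3))
    then show False by simp
  qed
  ultimately show ?thesis using assms by (auto simp: J_def)
qed

lemma right_inv: assumes "x \<in> cor b" "w \<in> cor b" "x * w = g b" shows "x \<notin> J b"
proof -
  have "w * x \<in> cor b" "w * x * (w * x) = w * x"
    using cor_closed(1)[OF assms(2,1)] assms by (simp_all add: mult.assoc asr[OF assms(3)] corL)
  then have "w * x = 0 \<or> w * x = g b" using prim_idem[of "w * x" b] by (auto simp: cor_def)
  moreover have "w * x \<noteq> 0"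
  proof
    assume "w * x = 0"
    then have "x * (w * x) * w = 0" by simp
    then have "g b = 0" by (simp add: mult.assoc[symmetric] assms(3)) (simp add: mult.assoc assms(3))
    then show False by simp
  qed
  ultimately show ?thesis using assms by (auto simp: J_def)
qed

lemma J_multR: assumes "x \<in> J b" "y \<in> cor b" shows "x * y \<in> J b"
proof (rule ccontr)
  assume n: "x * y \<notin> J b"
  have "x * y \<in> cor b" using assms J_cor cor_closed(1) by blast
  then obtain w where w: "w \<in> cor b" "x * y * w = g b" using n by (auto simp: J_def)
  then have "x * (y * w) = g b" by (simp add: mult.assoc)
  then show False using right_inv[OF J_cor[OF assms(1)] cor_closed(1)[OF assms(2) w(1)]] assms(1) by blast
qed

lemma J_multL: assumes "x \<in> J b" "y \<in> cor b" shows "y * x \<in> J b"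
proof (rule ccontr)
  assume n: "y * x \<notin> J b"
  have "y * x \<in> cor b" using assms J_cor cor_closed(1) by blast
  then obtain w where w: "w \<in> cor b" "w * (y * x) = g b" using n by (auto simp: J_def)
  then have "w * y * x = g b" by (simp add: mult.assoc)
  then show False using left_inv[OF J_cor[OF assms(1)] cor_closed(1)[OF w(1) assms(2)]] assms(1) by blast
qed

lemma J_add: assumes "x \<in> J b" "y \<in> J b" shows "x + y \<in> J b"
proof (rule ccontr)
  assume n: "x + y \<notin> J b"
  have "x + y \<in> cor b" using assms J_cor cor_closed(2) by blast
  then obtain w where w: "w \<in> cor b" "w * (x + y) = g b" using n by (auto simp: J_def)
  have "w * x \<in> J b" "w * y \<in> J b" using J_multL assms w(1) by auto
  moreover have "w * x + w * y = g b" using w(2) by (simp add: distrib_left)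
  ultimately show False using cor_loc[of b] J_cor unfolding s.loc_def cor_hm[symmetric] J_def by blast
qed

lemma J_scl: "x \<in> J b \<Longrightarrow> scl c x \<in> J b"
  using J_multL[of x b "scl c (g b)"] cor_scl[OF cor_closed(4)] by (simp add: scl_multL corL[OF J_cor])
lemma J_uminus: "x \<in> J b \<Longrightarrow> - x \<in> J b" using J_scl[of x b "-1"] by simp
lemma J_0: "0 \<in> J b" using cor_closed(5) by (auto simp: J_def)
lemma g_notJ: "g b \<notin> J b" using left_inv[OF cor_closed(4) cor_closed(4)] by simp
lemma J_compl: assumes "x \<in> J b" obtains w where "w \<in> cor b" "w * (g b - x) = g b" "(g b - x) * w = g b"
proof -
  have "x + (g b - x) = g b" by simp
  then show ?thesis using cor_loc[of b] J_cor[OF assms] assms cor_closed(3)[OF cor_closed(4) J_cor[OF assms]] that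
    unfolding s.loc_def cor_hm[symmetric] J_def by blast
qed
lemma J_unique: assumes "x - scl c (g b) \<in> J b" "x - scl d (g b) \<in> J b" shows "c = d"
proof (rule ccontr)
  assume n: "c \<noteq> d"
  have "(x - scl d (g b)) + - (x - scl c (g b)) \<in> J b" using assms J_add J_uminus by blast
  then have "scl (c - d) (g b) \<in> J b" by (simp add: scale_left_diff_distrib)
  from J_scl[OF this, of "1 / (c - d)"] have "g b \<in> J b" using n by simp
  then show False using g_notJ by blast
qed

lemma comp_cor: "x \<in> S \<Longrightarrow> g b * x * g b \<in> cor b"
proof -
  assume "x \<in> S"
  then have "g b * x * g b \<in> S" by (auto intro!: s.Smult)
  then show ?thesis by (simp add: cor_def mult.assoc asr[OF gg])
qed

text \<open>The cross term passes through the other idempotent in both directions, and one of these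
  directions is zero by triangularity.\<close>

lemma comp_mult: assumes "x \<in> carrier A" "y \<in> carrier A"
  shows "g b * \<phi> (x \<otimes>\<^bsub>A\<^esub> y) * g b = (g b * \<phi> x * g b) * (g b * \<phi> y * g b)"
proof -
  have "\<phi> x * \<phi> y = \<phi> x * u * \<phi> y" using ux assms by simp
  then have 1: "g b * \<phi> (x \<otimes>\<^bsub>A\<^esub> y) * g b = g b * \<phi> x * (g b * \<phi> y * g b) + g b * \<phi> x * g (\<not> b) * (g (\<not> b) * \<phi> y * g b)"
    unfolding \<phi>_mult[OF assms] by (cases b) (simp_all add: g_sum algebra_simps asr[OF gg])
  have "g b * \<phi> x * g (\<not> b) = 0 \<or> g (\<not> b) * \<phi> y * g b = 0"
    using tri0[of "\<phi> x"] tri0[of "\<phi> y"] assms by (cases b) simp_all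
  then have "g b * \<phi> (x \<otimes>\<^bsub>A\<^esub> y) * g b = g b * \<phi> x * (g b * \<phi> y * g b)" using 1 by auto
  then show ?thesis by (simp add: mult.assoc asr[OF gg])
qed

text \<open>The preimage of the maximal ideal of one corner under compression; these are the two
  maximal ideals whose intersection is the radical.\<close>

definition I :: "bool \<Rightarrow> 'a set" where "I b = {x \<in> carrier A. g b * \<phi> x * g b \<in> J b}"

lemma I_right: "right_ideal A (I b)"
  unfolding right_ideal_def
proof (intro conjI ballI)
  show "I b \<subseteq> carrier A" by (auto simp: I_def)
  show "\<zero>\<^bsub>A\<^esub> \<in> I b" by (simp add: I_def \<phi>_zero J_0)
  fix x assume x: "x \<in> I b"
  show "\<ominus>\<^bsub>A\<^esub> x \<in> I b" using x J_uminus by (simp add: I_def \<phi>_uminus)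
  show "x \<oplus>\<^bsub>A\<^esub> y \<in> I b" if "y \<in> I b" for y using x that J_add by (simp add: I_def \<phi>_add distrib_left distrib_right)
  show "x \<otimes>\<^bsub>A\<^esub> y \<in> I b" if "y \<in> carrier A" for y using x that J_multR comp_cor by (simp add: I_def comp_mult)
qed

lemma I_max: "max_right_ideal A (I b)"
  unfolding max_right_ideal_def
proof (intro conjI allI impI)
  show "right_ideal A (I b)" by (rule I_right)
  have one: "g b * u * g b = g b" by simp
  then have "\<one>\<^bsub>A\<^esub> \<notin> I b" using g_notJ[of b] by (simp add: I_def)
  then show "I b \<noteq> carrier A" by auto
  fix I' assume I': "right_ideal A I' \<and> I b \<subseteq> I' \<and> I' \<noteq> carrier A"
  show "I' = I b"
  proof (rule ccontr)
    assume "I' \<noteq> I b"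
    then obtain x where x: "x \<in> I'" "x \<notin> I b" using I' by blast
    have xA: "x \<in> carrier A" using x I' by (auto simp: right_ideal_def)
    have "g b * \<phi> x * g b \<in> cor b" using xA comp_cor by simp
    then obtain w where w: "w \<in> cor b" "g b * \<phi> x * g b * w = g b" using x(2) xA by (auto simp: I_def J_def)
    obtain w' where w': "w' \<in> carrier A" "w = \<phi> w'" using in_img[of w b b] w(1) by (auto simp: cor_def)
    let ?c = "lab e1 e2 (\<not> b)"
    \<comment> \<open>The part of x w' outside row b. Compression at b kills it, so it lies in
      \<open>I b\<close>, and subtracting it leaves the idempotent e_b in I'.\<close>
    let ?y = "?c \<otimes>\<^bsub>A\<^esub> (x \<otimes>\<^bsub>A\<^esub> w')"
    have yA: "?y \<in> carrier A" using xA w' by simp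
    have "\<phi> ?y = g (\<not> b) * (\<phi> x * w)" using xA w' by (simp add: \<phi>_mult g_def)
    moreover have gbc: "g b * g (\<not> b) = 0" by (rule g_orth) simp
    ultimately have yI: "?y \<in> I b" using yA J_0 by (simp add: I_def mult.assoc asr[OF gbc])
    have "u * (\<phi> x * w) = g b * (\<phi> x * w) + g (\<not> b) * (\<phi> x * w)" by (cases b) (simp_all add: g_sum distrib_right)
    moreover have "u * (\<phi> x * w) = \<phi> x * w" using ux(1)[OF xA] by (simp add: mult.assoc[symmetric])
    moreover have "g b * (\<phi> x * w) = g b" using w(2) corL[OF w(1)] by (simp add: mult.assoc)
    ultimately have "\<phi> x * w = g b + \<phi> ?y" using xA w' by (simp add: \<phi>_mult g_def)
    then have "\<phi> (x \<otimes>\<^bsub>A\<^esub> w' \<oplus>\<^bsub>A\<^esub> \<ominus>\<^bsub>A\<^esub> ?y) = \<phi> (lab e1 e2 b)"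
    proof -
      assume a: "\<phi> x * w = g b + \<phi> ?y"
      have "\<phi> (x \<otimes>\<^bsub>A\<^esub> w' \<oplus>\<^bsub>A\<^esub> \<ominus>\<^bsub>A\<^esub> ?y) = \<phi> x * w - \<phi> ?y"
        using xA w' yA by (simp add: \<phi>_add \<phi>_uminus \<phi>_mult)
      then show ?thesis unfolding a by (simp add: g_def)
    qed
    then have eq: "x \<otimes>\<^bsub>A\<^esub> w' \<oplus>\<^bsub>A\<^esub> \<ominus>\<^bsub>A\<^esub> ?y = lab e1 e2 b" using \<phi>_eq xA w' yA by simp
    have "?y \<in> I'" using yI I' by blast
    then have "lab e1 e2 b \<in> I'" using I' x(1) w'(1) unfolding right_ideal_def eq[symmetric] by blast
    moreover have "?c \<in> I'"
    proof -
      have "?c \<in> I b" using gbc J_0 by (simp add: I_def g_def[symmetric])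
      then show ?thesis using I' by blast
    qed
    ultimately have "lab e1 e2 b \<oplus>\<^bsub>A\<^esub> ?c \<in> I'" using I' by (auto simp: right_ideal_def)
    moreover have "lab e1 e2 b \<oplus>\<^bsub>A\<^esub> ?c = \<one>\<^bsub>A\<^esub>"
      using poi LA[of True] LA[of False] by (cases b) (auto simp: complete_poi2_def lab_def A.a_comm)
    ultimately have 1: "\<one>\<^bsub>A\<^esub> \<in> I'" by simp
    have "z \<in> I'" if z: "z \<in> carrier A" for z
    proof -
      have "\<one>\<^bsub>A\<^esub> \<otimes>\<^bsub>A\<^esub> z \<in> I'" using I' 1 z unfolding right_ideal_def by blast
      then show ?thesis using z by simp
    qed
    then show False using I' by (auto simp: right_ideal_def)
  qed
qed

text \<open>One inclusion is maximality of both \<open>I b\<close>. Conversely, let M be maximal.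
  Either x already lies in M, or 1 = m + x a with m in M; then m = 1 - x a is triangular with units
  on the diagonal, hence right invertible, and 1 lies in M.\<close>

lemma jac: "jacobson A = I False \<inter> I True"
proof (intro equalityI subsetI)
  fix x assume "x \<in> jacobson A" then show "x \<in> I False \<inter> I True" using I_max by (auto simp: jacobson_def)
next
  fix x assume x: "x \<in> I False \<inter> I True"
  have xA: "x \<in> carrier A" using x by (simp add: I_def)
  have "x \<in> M" if M: "max_right_ideal A M" for M
  proof -
    have Mr: "right_ideal A M" "M \<noteq> carrier A" using M by (auto simp: max_right_ideal_def)
    have MA: "m \<in> carrier A" if "m \<in> M" for m using that Mr by (auto simp: right_ideal_def)
    define M' where "M' = {m \<oplus>\<^bsub>A\<^esub> x \<otimes>\<^bsub>A\<^esub> a | m a. m \<in> M \<and> a \<in> carrier A}"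
    have M'I: "m \<oplus>\<^bsub>A\<^esub> x \<otimes>\<^bsub>A\<^esub> a \<in> M'" if "m \<in> M" "a \<in> carrier A" for m a using that unfolding M'_def by blast
    have zM: "\<zero>\<^bsub>A\<^esub> \<in> M" using Mr by (simp add: right_ideal_def)
    have r: "right_ideal A M'" unfolding right_ideal_def
    proof (intro conjI ballI)
      show "M' \<subseteq> carrier A" using MA xA by (auto simp: M'_def)
      show "\<zero>\<^bsub>A\<^esub> \<in> M'" using M'I[OF zM A.zero_closed] xA by simp
      fix y assume "y \<in> M'"
      then obtain m a where y: "m \<in> M" "a \<in> carrier A" "y = m \<oplus>\<^bsub>A\<^esub> x \<otimes>\<^bsub>A\<^esub> a" unfolding M'_def by blast
      note cl = MA[OF y(1)] y(2) xA
      have "\<ominus>\<^bsub>A\<^esub> y = \<ominus>\<^bsub>A\<^esub> m \<oplus>\<^bsub>A\<^esub> x \<otimes>\<^bsub>A\<^esub> (\<ominus>\<^bsub>A\<^esub> a)" using cl by (subst \<phi>_eq[symmetric]) (simp_all add: y(3) \<phi>_add \<phi>_mult \<phi>_uminus)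
      then show "\<ominus>\<^bsub>A\<^esub> y \<in> M'" using M'I[of "\<ominus>\<^bsub>A\<^esub> m" "\<ominus>\<^bsub>A\<^esub> a"] Mr y by (auto simp: right_ideal_def)
      show "y \<otimes>\<^bsub>A\<^esub> b \<in> M'" if b: "b \<in> carrier A" for b
      proof -
        have "y \<otimes>\<^bsub>A\<^esub> b = m \<otimes>\<^bsub>A\<^esub> b \<oplus>\<^bsub>A\<^esub> x \<otimes>\<^bsub>A\<^esub> (a \<otimes>\<^bsub>A\<^esub> b)" using cl b by (subst \<phi>_eq[symmetric]) (simp_all add: y(3) \<phi>_add \<phi>_mult distrib_right mult.assoc)
        then show ?thesis using M'I[of "m \<otimes>\<^bsub>A\<^esub> b" "a \<otimes>\<^bsub>A\<^esub> b"] Mr y b by (auto simp: right_ideal_def)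
      qed
      fix y' assume "y' \<in> M'"
      then obtain m' a' where y': "m' \<in> M" "a' \<in> carrier A" "y' = m' \<oplus>\<^bsub>A\<^esub> x \<otimes>\<^bsub>A\<^esub> a'" unfolding M'_def by blast
      note cl' = MA[OF y'(1)] y'(2)
      have "y \<oplus>\<^bsub>A\<^esub> y' = (m \<oplus>\<^bsub>A\<^esub> m') \<oplus>\<^bsub>A\<^esub> x \<otimes>\<^bsub>A\<^esub> (a \<oplus>\<^bsub>A\<^esub> a')" using cl cl' by (subst \<phi>_eq[symmetric]) (simp_all add: y(3) y'(3) \<phi>_add \<phi>_mult distrib_left algebra_simps)
      then show "y \<oplus>\<^bsub>A\<^esub> y' \<in> M'" using M'I[of "m \<oplus>\<^bsub>A\<^esub> m'" "a \<oplus>\<^bsub>A\<^esub> a'"] Mr y y' by (auto simp: right_ideal_def)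
    qed
    have sub: "M \<subseteq> M'"
    proof
      fix m assume "m \<in> M"
      then show "m \<in> M'" using M'I[of m "\<zero>\<^bsub>A\<^esub>"] MA xA by simp
    qed
    have xM': "x \<in> M'" using M'I[OF zM A.one_closed] xA by simp
    show "x \<in> M"
    proof (cases "M' = carrier A")
      case False
      then have "M' = M" using M r sub unfolding max_right_ideal_def by blast
      then show ?thesis using xM' by simp
    next
      case True
      then have "\<one>\<^bsub>A\<^esub> \<in> M'" by simp
      then obtain m a where ma: "m \<in> M" "a \<in> carrier A" "\<one>\<^bsub>A\<^esub> = m \<oplus>\<^bsub>A\<^esub> x \<otimes>\<^bsub>A\<^esub> a" unfolding M'_def by blast
      define z where "z = \<phi> (x \<otimes>\<^bsub>A\<^esub> a)"
      have zS: "z \<in> S" using xA ma by (simp add: z_def)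
      have mz: "\<phi> m = u - z" using arg_cong[OF ma(3), of \<phi>] MA[OF ma(1)] ma(2) xA by (simp add: \<phi>_add z_def)
      have "x \<otimes>\<^bsub>A\<^esub> a \<in> I False" "x \<otimes>\<^bsub>A\<^esub> a \<in> I True" using x ma(2) I_right by (auto simp: right_ideal_def)
      then have j: "g False * z * g False \<in> J False" "g True * z * g True \<in> J True" by (simp_all add: I_def z_def)
      define j1 j2 n where "j1 = g False * z * g False" and "j2 = g True * z * g True" and "n = g False * z * g True"
      obtain w1 where w1: "w1 \<in> cor False" "(g False - j1) * w1 = g False" using J_compl[OF j(1)] j1_def by metis
      obtain w2 where w2: "w2 \<in> cor True" "(g True - j2) * w2 = g True" using J_compl[OF j(2)] j2_def by metis
      have uz: "u * z = z" "z * u = z" using ux xA ma(2) by (simp_all add: z_def)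
      have "z = u * z * u" using uz by simp
      also have "\<dots> = j1 + j2 + n + g True * z * g False" by (simp add: g_sum j1_def j2_def n_def algebra_simps)
      finally have zz: "z = j1 + j2 + n" using tri0[OF zS] by simp
      have FT: "g False * g True = 0" "g True * g False = 0" by (simp_all add: g_orth)
      have o: "g False * w2 = 0" "g True * w1 = 0" "j1 * w2 = 0" "j2 * w1 = 0" "n * w1 = 0"
        using corL[OF w1(1)] corL[OF w2(1)] FT unfolding j1_def j2_def n_def
        by (metis mult.assoc mult_zero_left mult_zero_right)+
      have nn: "g False * n = n" by (simp add: n_def mult.assoc asr[OF gg])
      \<comment> \<open>Inverse of the triangular 2 by 2 matrix with diagonal entries 1 - j1 and 1 -
        j2 and off-diagonal entry -n.\<close>
      define v where "v = w1 + w2 + w1 * n * w2"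
      have "(u - z) * v = (g False - j1) * w1 + (g True - j2) * w2 + ((g False - j1) * w1) * n * w2 - n * w2"
        unfolding v_def zz g_sum by (simp add: algebra_simps o o[THEN asr])
      also have "\<dots> = u" unfolding w1(2) w2(2) nn by (simp add: g_sum)
      finally have uv: "(u - z) * v = u" .
      have "v \<in> S" using w1(1) w2(1) zS unfolding v_def n_def by (auto simp: cor_def intro!: s.Smult s.Sadd)
      moreover have "u * v = v" "v * u = v"
      proof -
        have uw: "u * w1 = w1" "u * w2 = w2" "w1 * u = w1" "w2 * u = w2"
          using corL[OF w1(1)] corL[OF w2(1)] corR[OF w1(1)] corR[OF w2(1)] ug by (metis mult.assoc)+
        then show "u * v = v" "v * u = v" by (simp_all add: v_def distrib_left distrib_right mult.assoc uw asr[OF uw(1)])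
      qed
      ultimately obtain v' where v': "v' \<in> carrier A" "v = \<phi> v'" using corner by blast
      have "\<phi> (m \<otimes>\<^bsub>A\<^esub> v') = u" using MA[OF ma(1)] v' uv mz by (simp add: \<phi>_mult)
      then have "m \<otimes>\<^bsub>A\<^esub> v' = \<one>\<^bsub>A\<^esub>" using \<phi>_eq MA[OF ma(1)] v'(1) by simp
      then have 1: "\<one>\<^bsub>A\<^esub> \<in> M" using Mr ma(1) v'(1) unfolding right_ideal_def by metis
      have "\<one>\<^bsub>A\<^esub> \<otimes>\<^bsub>A\<^esub> x \<in> M" using Mr(1) 1 xA unfolding right_ideal_def by blast
      then show ?thesis using xA by simp
    qed
  qed
  then show "x \<in> jacobson A" using xA by (auto simp: jacobson_def)
qed

text \<open>e_b is not in the radical, so some coordinate of the map to k^n is 1 on it. Subtracting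
  the value of x at this coordinate leaves an element of its kernel, which cannot be a unit of the
  corner.\<close>

lemma elementary_res: assumes "elementary A" shows res
proof -
  obtain n and \<psi> :: "'a \<Rightarrow> nat \<Rightarrow> 'k" where
    h: "\<forall>x\<in>carrier A. \<forall>y\<in>carrier A. \<psi> (x \<oplus>\<^bsub>A\<^esub> y) = (\<lambda>i. \<psi> x i + \<psi> y i) \<and> \<psi> (x \<otimes>\<^bsub>A\<^esub> y) = (\<lambda>i. \<psi> x i * \<psi> y i)"
      "\<forall>c. \<forall>x\<in>carrier A. \<psi> (c \<odot>\<^bsub>A\<^esub> x) = (\<lambda>i. c * \<psi> x i)" "{x\<in>carrier A. \<psi> x = (\<lambda>i. 0)} = jacobson A"
    using assms unfolding elementary_def by blast
  show res unfolding res_def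
  proof (intro allI ballI)
    fix b x assume x: "x \<in> cor b"
    let ?e = "lab e1 e2 b"
    obtain x' where x': "x' \<in> carrier A" "x = \<phi> x'" using in_img[of x b b] x by (auto simp: cor_def)
    have "?e \<notin> I b" using g_notJ[of b] by (simp add: I_def g_def[symmetric])
    then have "?e \<notin> jacobson A" using jac by (cases b) auto
    then have "\<psi> ?e \<noteq> (\<lambda>i. 0)" using h(3) LA[of b] by blast
    then obtain j where j: "\<psi> ?e j \<noteq> 0" by (auto simp: fun_eq_iff)
    have "?e \<otimes>\<^bsub>A\<^esub> ?e = ?e" using prim[of b] by (simp add: primitive_idem_def idem_def)
    then have "\<psi> ?e j * \<psi> ?e j = \<psi> ?e j" using h(1) LA[of b] by metis
    then have e1: "\<psi> ?e j = 1" using j by simp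
    let ?c = "\<psi> x' j"
    let ?y = "x' \<oplus>\<^bsub>A\<^esub> (- ?c) \<odot>\<^bsub>A\<^esub> ?e"
    have y: "?y \<in> carrier A" "\<phi> ?y = x - scl ?c (g b)" using x' by (simp_all add: \<phi>_add \<phi>_smult smult_closed g_def)
    have y0: "\<psi> ?y j = 0" using h(1,2) x'(1) LA[of b] smult_closed[OF LA[of b]] e1 by simp
    have "x - scl ?c (g b) \<in> cor b" using x cor_closed(3) cor_scl[OF cor_closed(4)] by blast
    moreover have False if w: "w \<in> cor b" "\<phi> ?y * w = g b" for w
    proof -
      obtain w' where w': "w' \<in> carrier A" "w = \<phi> w'" using in_img[of w b b] w(1) by (auto simp: cor_def)
      have "\<phi> (?y \<otimes>\<^bsub>A\<^esub> w') = \<phi> ?e" using w(2) w' y(1) \<phi>_mult[of ?y w'] by (simp add: g_def)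
      then have "?y \<otimes>\<^bsub>A\<^esub> w' = ?e" using \<phi>_eq y(1) w'(1) by simp
      then have "\<psi> ?e j = \<psi> ?y j * \<psi> w' j" using h(1) y(1) w'(1) by metis
      then show False using y0 e1 by simp
    qed
    ultimately show "\<exists>c. x - scl c (g b) \<in> J b" using y(2) unfolding J_def by (intro exI[of _ ?c]) auto
  qed
qed

text \<open>The residues at the two corners form an algebra map onto k^2: it is multiplicative by
  \<open>comp_mult\<close>, and its kernel is the radical by \<open>jac\<close>.\<close>

lemma res_elementary: assumes res shows "elementary A"
proof -
  define \<chi> where "\<chi> b x = (SOME c. x - scl c (g b) \<in> J b)" for b x
  have \<chi>: "x - scl (\<chi> b x) (g b) \<in> J b" if "x \<in> cor b" for b x
    using assms that unfolding res_def \<chi>_def by (metis someI)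
  have \<chi>I: "\<chi> b x = c" if "x - scl c (g b) \<in> J b" "x \<in> cor b" for b x c
    using J_unique[OF \<chi>[OF that(2)] that(1)] .
  have \<chi>_add: "\<chi> b (x + y) = \<chi> b x + \<chi> b y" if x: "x \<in> cor b" "y \<in> cor b" for b x y
  proof (rule \<chi>I)
    show "x + y \<in> cor b" using x cor_closed by blast
    have "x + y - scl (\<chi> b x + \<chi> b y) (g b) = (x - scl (\<chi> b x) (g b)) + (y - scl (\<chi> b y) (g b))"
      by (simp add: scale_left_distrib)
    then show "x + y - scl (\<chi> b x + \<chi> b y) (g b) \<in> J b" using J_add \<chi> x by metis
  qed
  have \<chi>_mult: "\<chi> b (x * y) = \<chi> b x * \<chi> b y" if x: "x \<in> cor b" "y \<in> cor b" for b x y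
  proof (rule \<chi>I)
    show "x * y \<in> cor b" using x cor_closed by blast
    have "x * y - scl (\<chi> b x * \<chi> b y) (g b) = (x - scl (\<chi> b x) (g b)) * y + scl (\<chi> b x) (y - scl (\<chi> b y) (g b))"
      using corL[OF x(2)] by (simp add: algebra_simps scl_multL scale_right_diff_distrib)
    then show "x * y - scl (\<chi> b x * \<chi> b y) (g b) \<in> J b" using J_add J_multR[OF \<chi>[OF x(1)] x(2)] J_scl[OF \<chi>[OF x(2)]] by metis
  qed
  have \<chi>_scl: "\<chi> b (scl c x) = c * \<chi> b x" if x: "x \<in> cor b" for b c x
  proof (rule \<chi>I)
    show "scl c x \<in> cor b" using x cor_scl by blast
    have "scl c x - scl (c * \<chi> b x) (g b) = scl c (x - scl (\<chi> b x) (g b))" by (simp add: scale_right_diff_distrib)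
    then show "scl c x - scl (c * \<chi> b x) (g b) \<in> J b" using J_scl \<chi> x by metis
  qed
  have \<chi>_g: "\<chi> b (scl c (g b)) = c" for b c by (rule \<chi>I) (auto simp: J_0 cor_scl cor_closed)
  have \<chi>_0: "\<chi> b x = 0 \<longleftrightarrow> x \<in> J b" if "x \<in> cor b" for b x
    using \<chi>[OF that] \<chi>I[of x 0 b] that by auto
  define \<psi> where "\<psi> x = (\<lambda>i::nat. if i = 0 then \<chi> False (g False * \<phi> x * g False) else if i = 1 then \<chi> True (g True * \<phi> x * g True) else 0)" for x
  have one: "g b * u * g b = scl 1 (g b)" for b by simp
  show ?thesis unfolding elementary_def
  proof (intro exI[of _ "2::nat"] exI[of _ \<psi>] conjI ballI allI)
    show "\<psi> ` carrier A = kpow 2"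
    proof (intro equalityI subsetI)
      fix f assume "f \<in> \<psi> ` carrier A" then show "f \<in> kpow 2" by (auto simp: kpow_def \<psi>_def)
    next
      fix f :: "nat \<Rightarrow> 'k" assume f: "f \<in> kpow 2"
      let ?x = "f 0 \<odot>\<^bsub>A\<^esub> lab e1 e2 False \<oplus>\<^bsub>A\<^esub> f 1 \<odot>\<^bsub>A\<^esub> lab e1 e2 True"
      have x: "?x \<in> carrier A" "\<phi> ?x = scl (f 0) (g False) + scl (f 1) (g True)"
        by (simp_all add: smult_closed \<phi>_add \<phi>_smult g_def)
      have FT: "g False * g True = 0" "g True * g False = 0" by (simp_all add: g_orth)
      have "g False * \<phi> ?x * g False = scl (f 0) (g False)" "g True * \<phi> ?x * g True = scl (f 1) (g True)"
        unfolding x(2) by (simp_all add: distrib_left distrib_right scl_multL scl_multR FT)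
      then have "\<psi> ?x = f" using f \<chi>_g by (auto simp: \<psi>_def kpow_def fun_eq_iff)
      then show "f \<in> \<psi> ` carrier A" using x(1) by (metis imageI)
    qed
    show "\<psi> \<one>\<^bsub>A\<^esub> = (\<lambda>i. if i < 2 then 1 else 0)"
      unfolding \<psi>_def one \<chi>_g by (auto simp: fun_eq_iff)
    fix x y assume xy: "x \<in> carrier A" "y \<in> carrier A"
    have c: "g b * \<phi> x * g b \<in> cor b" "g b * \<phi> y * g b \<in> cor b" for b using xy comp_cor by auto
    show "\<psi> (x \<oplus>\<^bsub>A\<^esub> y) = (\<lambda>i. \<psi> x i + \<psi> y i)"
      using \<chi>_add[OF c] xy by (auto simp: \<psi>_def \<phi>_add fun_eq_iff distrib_left distrib_right)
    show "\<psi> (x \<otimes>\<^bsub>A\<^esub> y) = (\<lambda>i. \<psi> x i * \<psi> y i)"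
      using \<chi>_mult[OF c] xy by (auto simp: \<psi>_def comp_mult fun_eq_iff)
  next
    fix c x assume x: "x \<in> carrier A"
    have cc: "g b * \<phi> x * g b \<in> cor b" for b using x comp_cor by auto
    show "\<psi> (c \<odot>\<^bsub>A\<^esub> x) = (\<lambda>i. c * \<psi> x i)"
      using \<chi>_scl[OF cc] x by (auto simp: \<psi>_def \<phi>_smult fun_eq_iff scl_multL scl_multR)
  next
    show "{x \<in> carrier A. \<psi> x = (\<lambda>i. 0)} = jacobson A"
    proof -
      have "\<psi> x = (\<lambda>i. 0) \<longleftrightarrow> x \<in> I False \<inter> I True" if x: "x \<in> carrier A" for x
      proof -
        have cc: "g b * \<phi> x * g b \<in> cor b" for b using x comp_cor by auto
        have "\<psi> x = (\<lambda>i. 0) \<longleftrightarrow> \<chi> False (g False * \<phi> x * g False) = 0 \<and> \<chi> True (g True * \<phi> x * g True) = 0"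
          by (auto simp: \<psi>_def fun_eq_iff split: if_splits)
        then show ?thesis using \<chi>_0[OF cc] x by (simp add: I_def)
      qed
      then show ?thesis using jac by (auto simp: I_def)
    qed
  qed
qed

end

section \<open>The rotated fan\<close>

context rot begin

theorem rot_fan: "R.gfs = rho gfs"
proof -
  have L: "gfs = cone_gen ` (\<lambda>F'. gv ` F') ` L1 \<union> {cone_gen {(1,0)}, cone_gen {(1,0), (real l,-1)}} \<union> {cone_gen {(0,1)}, cone_gen {(0,1),(1,0)},
      cone_gen {(0,1),(-1,0)}, cone_gen {(-1,0)}, cone_gen {(-1,0),(0,-1)}}"
    unfolding gfs_eq cones_L image_image ..
  have rm: "(`) (rmap (real l)) ` (\<lambda>F'. gv ` F') ` L1 = (\<lambda>F'. R.gv ` F') ` R1"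
    unfolding images image_image rmap_def ..
  have "{} \<in> (\<lambda>F'. gv ` F') ` L1" by (rule image_eqI[of _ _ "{}"]) (auto simp: L1_def pmf_def)
  then have "rho gfs = cone_gen ` (\<lambda>F'. R.gv ` F') ` R1 \<union> {cone_gen {(0,-1)}, cone_gen {(0,-1), (1, - real l)}} \<union> {cone_gen {(0,1)}, cone_gen {(0,1),(1,0)},
      cone_gen {(0,1),(-1,0)}, cone_gen {(-1,0)}, cone_gen {(-1,0),(0,-1)}}"
    unfolding rm[symmetric]
  proof (intro rho_eq L)
    fix V assume "V \<in> (\<lambda>F'. gv ` F') ` L1"
    then show "finite V" by (auto simp: L1_def pmf_def)
    fix v assume "v \<in> V"
    then show "snd v < 0" using L1_snd \<open>V \<in> (\<lambda>F'. gv ` F') ` L1\<close> by blast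
  qed auto
  also have "\<dots> = R.gfs" unfolding R.gfs_eq cones_R image_image ..
  finally show ?thesis ..
qed

lemma Gam_facts: "a \<in> Gam" "b + p \<in> Gam" "(b + p) * (b + p) = b + p" "a * (b + p) = 0" "(b + p) * a = 0" "b + p \<noteq> 0"
proof -
  have "R.idp (E 0 0 a)" "R.idp (E 0 0 (b + p))" "E 0 0 (b + p) \<noteq> 0" using R.Gidp[of True] R.Gidp[of False] R.Gnz[of False] by auto
  then show "a \<in> Gam" "b + p \<in> Gam" "(b + p) * (b + p) = b + p" "b + p \<noteq> 0"
    by (auto simp: R.idp_def sc_iff split: if_splits)
  show "a * (b + p) = 0" "(b + p) * a = 0" using orth by (simp_all add: distrib_left distrib_right)
qed

lemma Gam_unit: "x \<in> Gam \<Longrightarrow> (b + p + a) * x = x" "x \<in> Gam \<Longrightarrow> x * (b + p + a) = x"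
  using GamD(3,4) by (simp_all add: algebra_simps)

end

text \<open>The theorem asks for an algebra on the type \<open>nat \<Rightarrow> 'k\<close>, so the subalgebra \<open>T\<close> with unit \<open>v\<close> is
  transported along an injection \<open>fl\<close>.\<close>

definition mk_alg :: "('k \<Rightarrow> 'r \<Rightarrow> 'r) \<Rightarrow> 'r::ring set \<Rightarrow> 'r \<Rightarrow> ('r \<Rightarrow> 'c) \<Rightarrow> ('k, 'c) module" where
  "mk_alg scl T v fl = \<lparr>carrier = fl ` T, monoid.mult = (\<lambda>x y. fl (inv_into UNIV fl x * inv_into UNIV fl y)), one = fl v,
     zero = fl 0, add = (\<lambda>x y. fl (inv_into UNIV fl x + inv_into UNIV fl y)), smult = (\<lambda>c x. fl (scl c (inv_into UNIV fl x)))\<rparr>"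

lemma (in kalg) mk_alg_fd:
  fixes fl :: "'r \<Rightarrow> 'c"
  assumes inj: "inj fl" and T: "rcat T" "subspace T" and v: "v \<in> T" "\<And>x. x \<in> T \<Longrightarrow> v * x = x" "\<And>x. x \<in> T \<Longrightarrow> x * v = x"
  shows "ring (mk_alg scl T v fl)" "fd_algebra (mk_alg scl T v fl)"
proof -
  interpret T: rcat T by fact
  let ?M = "mk_alg scl T v fl"
  note [simp] = mk_alg_def inv_f_f[OF inj]
  have Tneg: "- x \<in> T" if "x \<in> T" for x using T.Sdiff[OF T.S0 that] by simp
  have Tscl: "scl c x \<in> T" if "x \<in> T" for x c using T(2) that by (simp add: subspace_def)
  show R: "ring ?M"
  proof (rule ringI)
    show "abelian_group ?M"
    proof (rule abelian_groupI)
      fix x assume "x \<in> carrier ?M"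
      then obtain x' where "x' \<in> T" "x = fl x'" by auto
      then show "\<exists>y\<in>carrier ?M. y \<oplus>\<^bsub>?M\<^esub> x = \<zero>\<^bsub>?M\<^esub>" using Tneg by (intro bexI[of _ "fl (- x')"]) auto
    qed (auto simp: add_ac)
    show "monoid ?M" by (rule monoidI) (auto simp: v mult.assoc)
  qed (auto simp: distrib_left distrib_right)
  interpret M: ring ?M by (rule R)
  \<comment> \<open>As \<open>v\<close> is the unit of \<open>T\<close>, the whole of
    \<open>T\<close> lies in the finite-dimensional corner at \<open>v\<close>.\<close>
  obtain B where B: "finite B" "\<And>z. v * z * v \<in> span B" using locally_fin[of v v] by blast
  have TB: "T \<subseteq> span B"
  proof
    fix x assume "x \<in> T"
    then have "v * x * v = x" using v by simp
    then show "x \<in> span B" using B(2) by metis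
  qed
  obtain C where C: "C \<subseteq> T" "independent C" "T \<subseteq> span C" using maximal_independent_subset by blast
  have fC: "finite C" using independent_span_bound[OF B(1) C(2)] C(1) TB by blast
  have fs: "finsum ?M (\<lambda>b. f b \<odot>\<^bsub>?M\<^esub> b) (fl ` D) = fl (\<Sum>c\<in>D. scl (f (fl c)) c)" if "finite D" "D \<subseteq> T" for f D
    using that
  proof (induction D rule: finite_induct)
    case empty
    have "finsum ?M (\<lambda>b. f b \<odot>\<^bsub>?M\<^esub> b) {} = \<zero>\<^bsub>?M\<^esub>" by (rule M.finsum_empty)
    then show ?case by simp
  next
    case (insert c D)
    have nin: "fl c \<notin> fl ` D" using insert inj by (auto dest: injD)
    have "finsum ?M (\<lambda>b. f b \<odot>\<^bsub>?M\<^esub> b) (insert (fl c) (fl ` D)) = (f (fl c) \<odot>\<^bsub>?M\<^esub> fl c) \<oplus>\<^bsub>?M\<^esub> finsum ?M (\<lambda>b. f b \<odot>\<^bsub>?M\<^esub> b) (fl ` D)"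
      by (rule M.finsum_insert) (use insert nin Tscl in auto)
    then show ?case using insert by simp
  qed
  have "\<exists>f. x = finsum ?M (\<lambda>b. f b \<odot>\<^bsub>?M\<^esub> b) (fl ` C)" if x: "x \<in> carrier ?M" for x
  proof -
    obtain x' where x': "x' \<in> T" "x = fl x'" using x by auto
    then have "x' \<in> span C" using C by blast
    then obtain h where h: "x' = (\<Sum>c\<in>C. scl (h c) c)" using span_finite[OF fC] by auto
    have "x = finsum ?M (\<lambda>b. h (inv_into UNIV fl b) \<odot>\<^bsub>?M\<^esub> b) (fl ` C)" unfolding fs[OF fC C(1)] using h x' by simp
    then show ?thesis by (rule exI[of _ "\<lambda>b. h (inv_into UNIV fl b)"])
  qed
  moreover have "finite (fl ` C)" "fl ` C \<subseteq> carrier ?M" using fC C by auto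
  ultimately have sp: "\<exists>B. finite B \<and> B \<subseteq> carrier ?M \<and> (\<forall>x\<in>carrier ?M. \<exists>f. x = finsum ?M (\<lambda>b. f b \<odot>\<^bsub>?M\<^esub> b) B)" by blast
  show "fd_algebra ?M" unfolding fd_algebra_def
    using R sp by (intro conjI) (auto simp: Tscl scale_right_distrib scale_left_distrib scl_multL scl_multR)
qed

section \<open>Primitivity, rank, fan and residue fields of the transported algebra\<close>

context rot begin

context
  fixes fl :: "'r \<Rightarrow> 'c" and M :: "('k, 'c) module"
  assumes inj: "inj fl" and M: "M = mk_alg scl Gam (b + p + a) fl"
begin

lemma M_fd: "ring M" "fd_algebra M"
proof -
  have "b + p + a \<in> Gam" using rcat.Sadd[OF rcat_Gam Gam_facts(2,1)] .
  from mk_alg_fd[OF inj rcat_Gam sub_Gam this Gam_unit] show "ring M" "fd_algebra M" by (simp_all add: M)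
qed

lemma M_simps: "carrier M = fl ` Gam" "fl x \<otimes>\<^bsub>M\<^esub> fl y = fl (x * y)" "fl x \<oplus>\<^bsub>M\<^esub> fl y = fl (x + y)"
  "\<one>\<^bsub>M\<^esub> = fl (b + p + a)" "\<zero>\<^bsub>M\<^esub> = fl 0" "c \<odot>\<^bsub>M\<^esub> fl x = fl (scl c x)" "fl x = fl y \<longleftrightarrow> x = y"
  using inj by (simp_all add: M mk_alg_def inj_eq)

lemma M_prim: assumes "z \<in> Gam" "R.loc (E 0 0 z)" shows "primitive_idem M (fl z)"
  unfolding primitive_idem_def
proof (intro conjI allI impI)
  have z: "z * z = z" "z \<noteq> 0" using assms(2) by (auto simp: R.loc_def R.idp_def split: if_splits)
  show "idem M (fl z)" "fl z \<noteq> \<zero>\<^bsub>M\<^esub>" using z assms(1) by (auto simp: idem_def M_simps)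
  fix f h assume a: "idem M f \<and> idem M h \<and> f \<otimes>\<^bsub>M\<^esub> h = \<zero>\<^bsub>M\<^esub> \<and> h \<otimes>\<^bsub>M\<^esub> f = \<zero>\<^bsub>M\<^esub> \<and> f \<oplus>\<^bsub>M\<^esub> h = fl z"
  then obtain x y where x: "x \<in> Gam" "f = fl x" "y \<in> Gam" "h = fl y" by (auto simp: idem_def M_simps)
  have e: "x * x = x" "y * y = y" "x * y = 0" "y * x = 0" "x + y = z" using a x by (auto simp: idem_def M_simps)
  have "z * x = x" "x * z = x" unfolding e(5)[symmetric] using e(1-4) by (simp_all add: distrib_left distrib_right)
  then have "E 0 0 x = 0 \<or> E 0 0 x = E 0 0 z"
    using x e rcat.S0[OF rcat_Gam] by (intro R.loc_idem[OF assms(2)]) (auto simp: R.idp_def sc_iff)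
  then have "x = 0 \<or> x = z" by (metis E_inject E_zero)
  then show "f = \<zero>\<^bsub>M\<^esub> \<or> h = \<zero>\<^bsub>M\<^esub>" using e(5) x by (auto simp: M_simps)
qed

lemma M_poi: "complete_poi2 M (fl (b + p)) (fl a)"
  using M_prim[OF Gam_facts(2)] M_prim[OF Gam_facts(1)] R.Gloc[of False] R.Gloc[of True] Gam_facts(4,5)
  by (simp add: complete_poi2_def M_simps)

lemma M_tri: "\<forall>x\<in>carrier M. fl a \<otimes>\<^bsub>M\<^esub> x \<otimes>\<^bsub>M\<^esub> fl (b + p) = \<zero>\<^bsub>M\<^esub>"
proof
  fix x assume "x \<in> carrier M"
  then obtain y where y: "y \<in> Gam" "x = fl y" by (auto simp: M_simps)
  have "a * y * b = a * b * y" using GamD(2)[OF y(1)] by (simp add: mult.assoc)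
  then have "a * y * (b + p) = 0" using GamD(5)[OF y(1)] orth by (simp add: distrib_left mult.assoc)
  then show "fl a \<otimes>\<^bsub>M\<^esub> x \<otimes>\<^bsub>M\<^esub> fl (b + p) = \<zero>\<^bsub>M\<^esub>" by (simp add: y M_simps)
qed

lemma M_rank2: "rank2 M (fl (b + p)) (fl a)"
  unfolding rank2_def
proof (intro notI, elim exE conjE)
  fix X N assume X: "is_mor M (fl (b + p)) (fl a) [False] [True] X" and N: "is_mor M (fl (b + p)) (fl a) [True] [False] N"
    and e: "mcomp M 1 N X = mid M (fl (b + p)) (fl a) [False]"
  interpret M: ring M by (rule M_fd)
  have "X 0 0 \<in> carrier M \<and> X 0 0 = lab (fl (b + p)) (fl a) True \<otimes>\<^bsub>M\<^esub> X 0 0 \<otimes>\<^bsub>M\<^esub> lab (fl (b + p)) (fl a) False"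
    using spec[OF spec[OF X[unfolded is_mor_def], of 0], of 0] by simp
  then have x0: "X 0 0 = \<zero>\<^bsub>M\<^esub>" using M_tri by (auto simp: lab_def)
  have n0: "N 0 0 \<in> carrier M" using spec[OF spec[OF N[unfolded is_mor_def], of 0], of 0] by simp
  have "mcomp M 1 N X 0 0 = \<zero>\<^bsub>M\<^esub>"
    unfolding mcomp_def using n0 x0 by (simp add: lessThan_Suc M.finsum_insert)
  then have "fl (b + p) = \<zero>\<^bsub>M\<^esub>" unfolding e by (simp add: mid_def lab_def)
  then show False using Gam_facts(6) by (simp add: M_simps)
qed

lemma M_alg: "alg scl M (inv_into UNIV fl) Gam (fl (b + p)) (fl a)"
proof (intro alg.intro alg_axioms.intro)
  have i: "inv_into UNIV fl (fl x) = x" for x using inj by simp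
  show "kalg scl" by unfold_locales
  show "ring M" "rcat Gam" "subspace Gam" "complete_poi2 M (fl (b + p)) (fl a)"
    using M_fd rcat_Gam sub_Gam M_poi by auto
  show "\<forall>x\<in>carrier M. fl a \<otimes>\<^bsub>M\<^esub> x \<otimes>\<^bsub>M\<^esub> fl (b + p) = \<zero>\<^bsub>M\<^esub>" by (rule M_tri)
  show "inj_on (inv_into UNIV fl) (carrier M)" by (auto simp: inj_on_def M_simps i)
  show "inv_into UNIV fl (x \<oplus>\<^bsub>M\<^esub> y) = inv_into UNIV fl x + inv_into UNIV fl y" "inv_into UNIV fl (x \<otimes>\<^bsub>M\<^esub> y) = inv_into UNIV fl x * inv_into UNIV fl y"
    if "x \<in> carrier M" "y \<in> carrier M" for x y using that by (auto simp: M_simps i)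
  show "c \<odot>\<^bsub>M\<^esub> x \<in> carrier M" "inv_into UNIV fl (c \<odot>\<^bsub>M\<^esub> x) = scl c (inv_into UNIV fl x)" if "x \<in> carrier M" for c x
    using that sub_Gam by (auto simp: M_simps i subspace_def)
  show "inv_into UNIV fl ` carrier M = {x \<in> Gam. inv_into UNIV fl \<one>\<^bsub>M\<^esub> * x = x \<and> x * inv_into UNIV fl \<one>\<^bsub>M\<^esub> = x}"
    using Gam_unit by (auto simp: M_simps i image_image)
qed

lemma M_gfan: "gfan M (fl (b + p)) (fl a) = rho gfs"
proof -
  interpret m: alg scl M "inv_into UNIV fl" Gam "fl (b + p)" "fl a" by (rule M_alg)
  have i: "inv_into UNIV fl (fl x) = x" for x using inj by simp
  have G: "(\<lambda>c. E 0 0 (inv_into UNIV fl (lab (fl (b + p)) (fl a) c))) = (\<lambda>c. E 0 0 (if c then a else b + p))"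
    by (auto simp: lab_def i fun_eq_iff)
  have "gfan M (fl (b + p)) (fl a) = R.gfs"
    using rep.gfan_eq[OF m.alg_rep] unfolding G .
  then show ?thesis using rot_fan by simp
qed

text \<open>The corner of \<Gamma> at f_2 is that of \<Lambda> at P_1. For f_1 the degree -1 part
  maps the corner to that of P_2 and sends units to units, so a residue found there serves for
  f_1.\<close>

lemma M_elementary:
  assumes A: "\<And>x. x \<in> S \<Longrightarrow> a * x = x \<Longrightarrow> x * a = x \<Longrightarrow> \<exists>c. \<not> (\<exists>w\<in>S. a * w = w \<and> w * a = w \<and> w * (x - scl c a) = a \<and> (x - scl c a) * w = a)"
    and B: "\<And>x. x \<in> S \<Longrightarrow> b * x = x \<Longrightarrow> x * b = x \<Longrightarrow> \<exists>c. \<not> (\<exists>w\<in>S. b * w = w \<and> w * b = w \<and> w * (x - scl c b) = b \<and> (x - scl c b) * w = b)"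
  shows "elementary M"
proof -
  interpret m: alg scl M "inv_into UNIV fl" Gam "fl (b + p)" "fl a" by (rule M_alg)
  have i: "inv_into UNIV fl (fl x) = x" for x using inj by simp
  have g: "m.g c = (if c then a else b + p)" for c by (auto simp: m.g_def lab_def i)
  have "m.res" unfolding m.res_def
  proof (intro allI ballI)
    fix c x assume x: "x \<in> m.cor c"
    show "\<exists>k. x - scl k (m.g c) \<in> m.J c"
    proof (cases c)
      case True
      then have xa: "x \<in> Gam" "a * x = x" "x * a = x" using x by (auto simp: m.cor_def g)
      then obtain k where k: "\<not> (\<exists>w\<in>S. a * w = w \<and> w * a = w \<and> w * (x - scl k a) = a \<and> (x - scl k a) * w = a)"
        using A GamD(1) by blast
      have "x - scl k a \<in> m.cor c" using m.cor_closed(3)[OF x m.cor_scl[OF m.cor_closed(4)], of k] True by (simp add: g)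
      moreover have "\<not> (\<exists>w\<in>m.cor c. w * (x - scl k a) = a \<and> (x - scl k a) * w = a)"
        using k GamD(1) True by (auto simp: m.cor_def g)
      ultimately show ?thesis using True unfolding m.J_def by (intro exI[of _ k]) (simp add: g)
    next
      case False
      then have xf: "x \<in> Gam" "(b + p) * x = x" "x * (b + p) = x" using x by (auto simp: m.cor_def g)
      have bx: "b * x = x * b" using GamD(2)[OF xf(1)] by simp
      \<comment> \<open>Restriction of the chain endomorphism x to degree -1.\<close>
      have "b * x \<in> S" using GamD(1)[OF xf(1)] abp by auto
      moreover have "b * (b * x) = b * x" using asr[OF abp(5), of x] .
      moreover have "b * x * b = b * x" using bx abp(5) by (simp add: mult.assoc)
      ultimately obtain k where k: "\<not> (\<exists>w\<in>S. b * w = w \<and> w * b = w \<and> w * (b * x - scl k b) = b \<and> (b * x - scl k b) * w = b)"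
        using B by blast
      have "x - scl k (b + p) \<in> m.cor c" using m.cor_closed(3)[OF x m.cor_scl[OF m.cor_closed(4)], of k] False by (simp add: g)
      moreover have False if w: "w \<in> m.cor c" "w * (x - scl k (b + p)) = b + p" "(x - scl k (b + p)) * w = b + p" for w
      proof -
        have wG: "w \<in> Gam" using w(1) by (simp add: m.cor_def)
        have bw: "b * w = w * b" using GamD(2)[OF wG] by simp
        have bb: "b * (b + p) = b" "(b + p) * b = b" by (simp_all add: distrib_left distrib_right idem)
        have 1: "b * (x - scl k (b + p)) = b * x - scl k b" by (simp add: right_diff_distrib scl_multR bb)
        have 2: "(x - scl k (b + p)) * b = b * x - scl k b" by (simp add: left_diff_distrib scl_multL bb bx)
        have "b * w * (b * x - scl k b) = b * w * b * (x - scl k (b + p))" unfolding 1[symmetric] by (simp add: mult.assoc)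
        also have "\<dots> = b * (w * (x - scl k (b + p)))" unfolding bw by (simp add: mult.assoc abp(5)) (simp add: mult.assoc[symmetric] bw)
        also have "\<dots> = b" unfolding w(2) by (rule bb)
        finally have e1: "b * w * (b * x - scl k b) = b" .
        have "(b * x - scl k b) * (b * w) = (x - scl k (b + p)) * (b * (b * w))" unfolding 2[symmetric] by (simp add: mult.assoc)
        also have "\<dots> = ((x - scl k (b + p)) * w) * b" using asr[OF abp(5), of w] bw by (simp add: mult.assoc)
        also have "\<dots> = b" unfolding w(3) by (rule bb)
        finally have e2: "(b * x - scl k b) * (b * w) = b" .
        have "b * w \<in> S" using GamD(1)[OF wG] abp by auto
        moreover have "b * (b * w) = b * w" "b * w * b = b * w" using asr[OF abp(5), of w] bw abp(5) by (simp_all add: mult.assoc)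
        ultimately show False using k e1 e2 by blast
      qed
      ultimately show ?thesis using False unfolding m.J_def by (intro exI[of _ k]) (auto simp: g)
    qed
  qed
  then show ?thesis by (rule m.res_elementary)
qed

end

end

section \<open>The regular representation\<close>

locale fdalg =
  fixes A :: "('k::field, 'a) module"
  assumes fd: "fd_algebra A"
begin

lemma ringA: "ring A" using fd by (simp add: fd_algebra_def)
interpretation A: ring A by (rule ringA)

lemma smult: "x \<in> carrier A \<Longrightarrow> c \<odot>\<^bsub>A\<^esub> x \<in> carrier A"
  "x \<in> carrier A \<Longrightarrow> y \<in> carrier A \<Longrightarrow> c \<odot>\<^bsub>A\<^esub> (x \<oplus>\<^bsub>A\<^esub> y) = c \<odot>\<^bsub>A\<^esub> x \<oplus>\<^bsub>A\<^esub> c \<odot>\<^bsub>A\<^esub> y"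
  "x \<in> carrier A \<Longrightarrow> (c + d) \<odot>\<^bsub>A\<^esub> x = c \<odot>\<^bsub>A\<^esub> x \<oplus>\<^bsub>A\<^esub> d \<odot>\<^bsub>A\<^esub> x"
  "x \<in> carrier A \<Longrightarrow> (c * d) \<odot>\<^bsub>A\<^esub> x = c \<odot>\<^bsub>A\<^esub> (d \<odot>\<^bsub>A\<^esub> x)"
  "x \<in> carrier A \<Longrightarrow> 1 \<odot>\<^bsub>A\<^esub> x = x"
  "x \<in> carrier A \<Longrightarrow> y \<in> carrier A \<Longrightarrow> (c \<odot>\<^bsub>A\<^esub> x) \<otimes>\<^bsub>A\<^esub> y = c \<odot>\<^bsub>A\<^esub> (x \<otimes>\<^bsub>A\<^esub> y)"
  "x \<in> carrier A \<Longrightarrow> y \<in> carrier A \<Longrightarrow> x \<otimes>\<^bsub>A\<^esub> (c \<odot>\<^bsub>A\<^esub> y) = c \<odot>\<^bsub>A\<^esub> (x \<otimes>\<^bsub>A\<^esub> y)"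
proof -
  note * = fd[unfolded fd_algebra_def]
  show "x \<in> carrier A \<Longrightarrow> c \<odot>\<^bsub>A\<^esub> x \<in> carrier A" using * by blast
  show "x \<in> carrier A \<Longrightarrow> y \<in> carrier A \<Longrightarrow> c \<odot>\<^bsub>A\<^esub> (x \<oplus>\<^bsub>A\<^esub> y) = c \<odot>\<^bsub>A\<^esub> x \<oplus>\<^bsub>A\<^esub> c \<odot>\<^bsub>A\<^esub> y" using * by blast
  show "x \<in> carrier A \<Longrightarrow> (c + d) \<odot>\<^bsub>A\<^esub> x = c \<odot>\<^bsub>A\<^esub> x \<oplus>\<^bsub>A\<^esub> d \<odot>\<^bsub>A\<^esub> x" using * by blast
  show "x \<in> carrier A \<Longrightarrow> (c * d) \<odot>\<^bsub>A\<^esub> x = c \<odot>\<^bsub>A\<^esub> (d \<odot>\<^bsub>A\<^esub> x)" using * by blast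
  show "x \<in> carrier A \<Longrightarrow> 1 \<odot>\<^bsub>A\<^esub> x = x" using * by blast
  show "x \<in> carrier A \<Longrightarrow> y \<in> carrier A \<Longrightarrow> (c \<odot>\<^bsub>A\<^esub> x) \<otimes>\<^bsub>A\<^esub> y = c \<odot>\<^bsub>A\<^esub> (x \<otimes>\<^bsub>A\<^esub> y)" by (rule sym) (use * in blast)
  show "x \<in> carrier A \<Longrightarrow> y \<in> carrier A \<Longrightarrow> x \<otimes>\<^bsub>A\<^esub> (c \<odot>\<^bsub>A\<^esub> y) = c \<odot>\<^bsub>A\<^esub> (x \<otimes>\<^bsub>A\<^esub> y)" by (rule sym) (use * in blast)
qed

lemma smult0: "x \<in> carrier A \<Longrightarrow> 0 \<odot>\<^bsub>A\<^esub> x = \<zero>\<^bsub>A\<^esub>" "c \<odot>\<^bsub>A\<^esub> \<zero>\<^bsub>A\<^esub> = \<zero>\<^bsub>A\<^esub>"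
proof -
  assume x: "x \<in> carrier A"
  have "0 \<odot>\<^bsub>A\<^esub> x = 0 \<odot>\<^bsub>A\<^esub> x \<oplus>\<^bsub>A\<^esub> 0 \<odot>\<^bsub>A\<^esub> x" using smult(3)[OF x, of 0 0] by simp
  then show "0 \<odot>\<^bsub>A\<^esub> x = \<zero>\<^bsub>A\<^esub>" using smult(1)[OF x] by (metis A.add.l_cancel_one')
next
  have "c \<odot>\<^bsub>A\<^esub> \<zero>\<^bsub>A\<^esub> = c \<odot>\<^bsub>A\<^esub> \<zero>\<^bsub>A\<^esub> \<oplus>\<^bsub>A\<^esub> c \<odot>\<^bsub>A\<^esub> \<zero>\<^bsub>A\<^esub>" using smult(2)[of "\<zero>\<^bsub>A\<^esub>" "\<zero>\<^bsub>A\<^esub>" c] by simp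
  then show "c \<odot>\<^bsub>A\<^esub> \<zero>\<^bsub>A\<^esub> = \<zero>\<^bsub>A\<^esub>" using smult(1)[OF A.zero_closed] by (metis A.add.l_cancel_one')
qed

definition lin :: "'a set \<Rightarrow> ('a \<Rightarrow> 'k) \<Rightarrow> 'a" where
  "lin B c = finsum A (\<lambda>b. c b \<odot>\<^bsub>A\<^esub> b) B"

lemma lin_empty: "lin {} c = \<zero>\<^bsub>A\<^esub>" by (simp add: lin_def)

lemma lin_insert: "finite B \<Longrightarrow> b \<notin> B \<Longrightarrow> insert b B \<subseteq> carrier A \<Longrightarrow> lin (insert b B) c = c b \<odot>\<^bsub>A\<^esub> b \<oplus>\<^bsub>A\<^esub> lin B c"
  unfolding lin_def by (rule A.finsum_insert) (auto intro: smult)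

lemma lin_closed: "B \<subseteq> carrier A \<Longrightarrow> lin B c \<in> carrier A"
  unfolding lin_def by (rule A.finsum_closed) (auto intro: smult)

lemma lin_add: assumes "finite B" "B \<subseteq> carrier A" shows "lin B (\<lambda>b. c b + d b) = lin B c \<oplus>\<^bsub>A\<^esub> lin B d"
  using assms
proof (induction B rule: finite_induct)
  case (insert b B)
  then have cl: "lin B c \<in> carrier A" "lin B d \<in> carrier A" "c b \<odot>\<^bsub>A\<^esub> b \<in> carrier A" "d b \<odot>\<^bsub>A\<^esub> b \<in> carrier A"
    by (auto intro: smult lin_closed)
  show ?case using insert cl by (simp add: lin_insert smult(3) A.a_ac)
qed (simp add: lin_empty)

lemma lin_scale: assumes "finite B" "B \<subseteq> carrier A" shows "lin B (\<lambda>b. k * c b) = k \<odot>\<^bsub>A\<^esub> lin B c"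
  using assms
proof (induction B rule: finite_induct)
  case (insert b B)
  then have cl: "lin B c \<in> carrier A" "c b \<odot>\<^bsub>A\<^esub> b \<in> carrier A"
    by (auto intro: smult lin_closed)
  show ?case using insert cl by (simp add: lin_insert smult(2,4))
qed (simp add: lin_empty smult0)

text \<open>A spanning set of least cardinality: two different coefficient functions with the same
  value give a relation that can be solved for one element, which could then be omitted.\<close>

lemma basis: "\<exists>B. finite B \<and> B \<subseteq> carrier A \<and> (\<forall>x\<in>carrier A. \<exists>c. x = lin B c)
    \<and> (\<forall>c d. lin B c = lin B d \<longrightarrow> (\<forall>b\<in>B. c b = d b))"
proof -
  let ?P = "\<lambda>B. finite B \<and> B \<subseteq> carrier A \<and> (\<forall>x\<in>carrier A. \<exists>c. x = lin B c)"
  have "\<exists>B. ?P B" using fd unfolding fd_algebra_def lin_def by blast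
  then obtain B0 where "?P B0" by blast
  then have "\<exists>B. ?P B \<and> (\<forall>B'. ?P B' \<longrightarrow> card B \<le> card B')" by (rule ex_has_least_nat[of ?P B0 card])
  then obtain B where B: "?P B" "\<And>B'. ?P B' \<Longrightarrow> card B \<le> card B'" by (elim exE conjE) simp
  have P: "finite B" "B \<subseteq> carrier A" "\<forall>x\<in>carrier A. \<exists>c. x = lin B c" using B(1) by auto
  have eq: "c b = d b" if cd: "lin B c = lin B d" "b \<in> B" for c d b
  proof (rule ccontr)
    assume n: "c b \<noteq> d b"
    define h where "h = (\<lambda>x. c x + - 1 * d x)"
    have hb: "h b \<noteq> 0" using n by (simp add: h_def)
    let ?B = "B - {b}"
    have fB: "finite ?B" "?B \<subseteq> carrier A" "b \<in> carrier A" "b \<notin> ?B" "insert b ?B = B" using B(1) cd(2) by auto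
    have "lin B h = lin B c \<oplus>\<^bsub>A\<^esub> - 1 \<odot>\<^bsub>A\<^esub> lin B d"
      unfolding h_def using B(1) lin_add[of B c "\<lambda>x. - 1 * d x"] lin_scale[of B "- 1" d] by simp
    also have "\<dots> = lin B (\<lambda>b. c b + - 1 * c b)"
      using B(1) lin_add[of B c "\<lambda>x. - 1 * c x"] lin_scale[of B "- 1" c] cd(1) by simp
    also have "\<dots> = lin B (\<lambda>b. 0 * c b)" by simp
    also have "\<dots> = \<zero>\<^bsub>A\<^esub>" using B(1) lin_scale[of B 0 c] smult0(1)[OF lin_closed] by auto
    finally have h0: "lin B h = \<zero>\<^bsub>A\<^esub>" .
    have sp: "\<exists>e. x = lin ?B e" if x: "x \<in> carrier A" for x
    proof -
      obtain f where f: "x = lin B f" using B(1) x by blast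
      define e where "e = (\<lambda>y. f y + - (f b / h b) * h y)"
      have "lin B e = lin B f \<oplus>\<^bsub>A\<^esub> (- (f b / h b)) \<odot>\<^bsub>A\<^esub> lin B h"
        unfolding e_def using B(1) lin_add[of B f "\<lambda>y. - (f b / h b) * h y"] lin_scale[of B "- (f b / h b)" h] by simp
      then have "lin B e = x" using f x by (simp add: h0 smult0)
      moreover have "lin B e = e b \<odot>\<^bsub>A\<^esub> b \<oplus>\<^bsub>A\<^esub> lin ?B e" using lin_insert[of ?B b e] fB B(1) by simp
      moreover have "e b = 0" using hb by (simp add: e_def)
      ultimately have "x = lin ?B e" using smult0(1)[OF fB(3)] lin_closed[OF fB(2)] by simp
      then show ?thesis by blast
    qed
    have "\<forall>x\<in>carrier A. \<exists>c. x = lin ?B c" by (intro ballI sp)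
    then have "card B \<le> card ?B" by (intro B(2) conjI fB)
    then show False using B(1) cd(2) card_Diff1_less[of B b] by auto
  qed
  have "\<forall>c d. lin B c = lin B d \<longrightarrow> (\<forall>b\<in>B. c b = d b)" by (intro allI impI ballI) (rule eq)
  with P show ?thesis by (intro exI[of _ B] conjI)
qed

text \<open>Matrices of left multiplication on a basis. The last clause keeps a finite spanning set
  of the image, from which the left approximation is built.\<close>

theorem regular_rep:
  "\<exists>\<phi> :: 'a \<Rightarrow> 'k fmat. inj_on \<phi> (carrier A) \<and>
    (\<forall>x\<in>carrier A. \<forall>y\<in>carrier A. \<phi> (x \<oplus>\<^bsub>A\<^esub> y) = \<phi> x + \<phi> y) \<and>
    (\<forall>x\<in>carrier A. \<forall>y\<in>carrier A. \<phi> (x \<otimes>\<^bsub>A\<^esub> y) = \<phi> x * \<phi> y) \<and>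
    (\<forall>x\<in>carrier A. \<forall>c. \<phi> (c \<odot>\<^bsub>A\<^esub> x) = kalg.mscl (*) c (\<phi> x)) \<and>
    (\<exists>B. finite B \<and> B \<subseteq> carrier A \<and> (\<forall>x\<in>carrier A. \<exists>f. \<phi> x = (\<Sum>b\<in>B. kalg.mscl (*) (f b) (\<phi> b))))"
proof -
  interpret k: kalg "(*) :: 'k \<Rightarrow> 'k \<Rightarrow> 'k" by (rule kalg_field)
  obtain B where B0: "finite B" "B \<subseteq> carrier A" "\<forall>x\<in>carrier A. \<exists>c. x = lin B c"
    "\<forall>c d. lin B c = lin B d \<longrightarrow> (\<forall>b\<in>B. c b = d b)" using basis by (elim exE conjE) (rule that)
  note B = B0(1,2) B0(3)[rule_format] B0(4)[rule_format]
  define co where "co x = (SOME c. x = lin B c)" for x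
  have co: "lin B (co x) = x" if "x \<in> carrier A" for x
    using someI_ex[OF B(3)[OF that]] by (simp add: co_def)
  have coI: "co x b = c b" if "x = lin B c" "b \<in> B" for x c b
    using B(4)[of "co x" c b] co[of x] lin_closed[OF B(2)] that by simp
  have co_add: "co (x \<oplus>\<^bsub>A\<^esub> y) b = co x b + co y b" if "x \<in> carrier A" "y \<in> carrier A" "b \<in> B" for x y b
    by (rule coI[where c = "\<lambda>b. co x b + co y b"]) (use that co lin_add[OF B(1,2)] in simp_all)
  have co_scale: "co (c \<odot>\<^bsub>A\<^esub> x) b = c * co x b" if "x \<in> carrier A" "b \<in> B" for c x b
    by (rule coI[where c = "\<lambda>b. c * co x b"]) (use that co lin_scale[OF B(1,2)] in simp_all)
  have co_0: "co \<zero>\<^bsub>A\<^esub> b = 0" if "b \<in> B" for b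
    using co_scale[OF A.zero_closed that, of 0] by (simp add: smult0)
  have co_lin: "co (x \<otimes>\<^bsub>A\<^esub> lin D c) b = (\<Sum>d\<in>D. c d * co (x \<otimes>\<^bsub>A\<^esub> d) b)" if "x \<in> carrier A" "b \<in> B" "finite D" "D \<subseteq> carrier A" for x b c D
    using that(3,4)
  proof (induction D rule: finite_induct)
    case empty then show ?case using that(1,2) by (simp add: lin_empty co_0)
  next
    case (insert d D)
    then have cl: "lin D c \<in> carrier A" "d \<in> carrier A" "c d \<odot>\<^bsub>A\<^esub> d \<in> carrier A" by (auto intro: smult lin_closed)
    show ?case using insert cl that(1,2) A.m_closed[OF that(1) cl(2)]
      by (simp add: lin_insert A.r_distr co_add smult(1,7) co_scale)
  qed
  obtain e n where e: "bij_betw e {..<n::nat} B" using ex_bij_betw_nat_finite[OF B(1)] by (auto simp: atLeast0LessThan)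
  have eB: "e i \<in> B" "e i \<in> carrier A" if "i < n" for i using e that B(2) by (auto simp: bij_betw_def)
  define \<phi> where "\<phi> x = Fmat (\<lambda>i j. if i < n \<and> j < n then co (x \<otimes>\<^bsub>A\<^esub> e j) (e i) else 0)" for x
  have ent: "ent (\<phi> x) i j = (if i < n \<and> j < n then co (x \<otimes>\<^bsub>A\<^esub> e j) (e i) else 0)" for x i j
    unfolding \<phi>_def by (subst ent_Fmat[of n]) auto
  have bnd: "bnd (\<phi> x) n" for x by (auto simp: bnd_def ent)
  have add: "\<phi> (x \<oplus>\<^bsub>A\<^esub> y) = \<phi> x + \<phi> y" if "x \<in> carrier A" "y \<in> carrier A" for x y
    by (rule fmat_eqI) (use that eB in \<open>simp add: ent A.l_distr co_add\<close>)
  have scale: "\<phi> (c \<odot>\<^bsub>A\<^esub> x) = k.mscl c (\<phi> x)" if "x \<in> carrier A" for c x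
    by (rule fmat_eqI) (use that eB in \<open>simp add: ent smult(6) co_scale\<close>)
  have mult: "\<phi> (x \<otimes>\<^bsub>A\<^esub> y) = \<phi> x * \<phi> y" if x: "x \<in> carrier A" "y \<in> carrier A" for x y
  proof (rule fmat_eqI)
    fix i j
    show "ent (\<phi> (x \<otimes>\<^bsub>A\<^esub> y)) i j = ent (\<phi> x * \<phi> y) i j"
    proof (cases "i < n \<and> j < n")
      case True
      let ?c = "co (y \<otimes>\<^bsub>A\<^esub> e j)"
      have "x \<otimes>\<^bsub>A\<^esub> y \<otimes>\<^bsub>A\<^esub> e j = x \<otimes>\<^bsub>A\<^esub> lin B ?c" using co x True eB by (simp add: A.m_assoc)
      then have "co (x \<otimes>\<^bsub>A\<^esub> y \<otimes>\<^bsub>A\<^esub> e j) (e i) = (\<Sum>d\<in>B. ?c d * co (x \<otimes>\<^bsub>A\<^esub> d) (e i))"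
        using co_lin[OF x(1) eB(1) B(1,2)] True by simp
      also have "\<dots> = (\<Sum>k<n. ?c (e k) * co (x \<otimes>\<^bsub>A\<^esub> e k) (e i))"
        by (rule sum.reindex_bij_betw[OF e, symmetric])
      also have "\<dots> = ent (\<phi> x * \<phi> y) i j"
        unfolding ent_times[OF bnd] using True by (intro sum.cong) (auto simp: ent mult.commute)
      finally show ?thesis using True by (simp add: ent)
    next
      case False
      then show ?thesis unfolding ent_times[OF bnd] by (auto simp: ent)
    qed
  qed
  \<comment> \<open>Equal matrices mean equal left multiplications on the basis, hence everywhere;
    evaluating at 1 gives equality.\<close>
  have injp: "inj_on \<phi> (carrier A)"
  proof (rule inj_onI)
    fix x y assume x: "x \<in> carrier A" "y \<in> carrier A" "\<phi> x = \<phi> y"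
    have B1: "x \<otimes>\<^bsub>A\<^esub> d = y \<otimes>\<^bsub>A\<^esub> d" if d: "d \<in> B" for d
    proof -
      obtain j where j: "j < n" "d = e j" using e d by (auto simp: bij_betw_def)
      have "co (x \<otimes>\<^bsub>A\<^esub> d) b = co (y \<otimes>\<^bsub>A\<^esub> d) b" if b: "b \<in> B" for b
      proof -
        obtain i where "i < n" "b = e i" using e b by (auto simp: bij_betw_def)
        then show ?thesis using arg_cong[OF x(3), of "\<lambda>X. ent X i j"] j by (simp add: ent)
      qed
      then have "lin B (co (x \<otimes>\<^bsub>A\<^esub> d)) = lin B (co (y \<otimes>\<^bsub>A\<^esub> d))"
        unfolding lin_def using B(2) by (intro A.finsum_cong') (auto intro: smult)
      then have "lin B (co (x \<otimes>\<^bsub>A\<^esub> d)) = lin B (co (y \<otimes>\<^bsub>A\<^esub> d))" by simp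
      moreover have "x \<otimes>\<^bsub>A\<^esub> d \<in> carrier A" "y \<otimes>\<^bsub>A\<^esub> d \<in> carrier A" using x d B(2) by auto
      ultimately show ?thesis by (simp add: co)
    qed
    have "x \<otimes>\<^bsub>A\<^esub> lin D c = y \<otimes>\<^bsub>A\<^esub> lin D c" if "finite D" "D \<subseteq> B" for c D
      using that
    proof (induction D rule: finite_induct)
      case empty then show ?case using x by (simp add: lin_empty)
    next
      case (insert d D)
      then have cl: "lin D c \<in> carrier A" "d \<in> carrier A" "c d \<odot>\<^bsub>A\<^esub> d \<in> carrier A" "insert d D \<subseteq> carrier A"
        using B(2) by (auto intro: smult lin_closed)
      show ?case using insert cl x(1,2) B1 by (simp add: lin_insert A.r_distr smult(7))
    qed
    from this[OF B(1) subset_refl, of "co \<one>\<^bsub>A\<^esub>"] show "x = y" using co x by simp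
  qed
  have sp: "\<exists>f. \<phi> x = (\<Sum>b\<in>B. k.mscl (f b) (\<phi> b))" if x: "x \<in> carrier A" for x
  proof -
    have "\<phi> (lin D c) = (\<Sum>b\<in>D. k.mscl (c b) (\<phi> b))" if "finite D" "D \<subseteq> carrier A" for D c
      using that
    proof (induction D rule: finite_induct)
      case empty
      have "\<phi> \<zero>\<^bsub>A\<^esub> + \<phi> \<zero>\<^bsub>A\<^esub> = \<phi> \<zero>\<^bsub>A\<^esub>" using add[OF A.zero_closed A.zero_closed] by simp
      then show ?case by (simp add: lin_empty)
    next
      case (insert d D)
      then have cl: "lin D c \<in> carrier A" "d \<in> carrier A" "c d \<odot>\<^bsub>A\<^esub> d \<in> carrier A" by (auto intro: smult lin_closed)
      show ?case using insert cl by (simp add: lin_insert add scale)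
    qed
    from this[OF B(1,2), of "co x"] show ?thesis using co[OF x] by auto
  qed
  show ?thesis
    by (intro exI[of _ \<phi>] exI[of _ B] conjI ballI allI injp add mult scale B(1,2) sp)
qed

end

definition flat :: "'k::ring fmat fmat \<Rightarrow> nat \<Rightarrow> 'k" where
  "flat X = (\<lambda>n. ent (ent X (fst (prod_decode (fst (prod_decode n)))) (snd (prod_decode (fst (prod_decode n)))))
     (fst (prod_decode (snd (prod_decode n)))) (snd (prod_decode (snd (prod_decode n)))))"

lemma inj_flat: "inj (flat :: 'k::field fmat fmat \<Rightarrow> _)"
proof (rule injI)
  fix X Y :: "'k fmat fmat" assume e: "flat X = flat Y"
  have "ent (ent X i j) k l = ent (ent Y i j) k l" for i j k l
    using fun_cong[OF e, of "prod_encode (prod_encode (i, j), prod_encode (k, l))"] by (simp add: flat_def)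
  then show "X = Y" by (simp add: fmat_eq_iff)
qed

section \<open>The theorem\<close>

theorem theorem4p6:
  fixes \<Lambda> :: "('k::field, 'a) module" and e1 e2 :: 'a
  assumes "fd_algebra \<Lambda>"
    and "complete_poi2 \<Lambda> e1 e2"
    and "rank2 \<Lambda> e1 e2"
    and "\<forall>x\<in>carrier \<Lambda>. e2 \<otimes>\<^bsub>\<Lambda>\<^esub> x \<otimes>\<^bsub>\<Lambda>\<^esub> e1 = \<zero>\<^bsub>\<Lambda>\<^esub>"
  shows "\<exists>(\<Gamma> :: ('k, nat \<Rightarrow> 'k) module) f1 f2.
           fd_algebra \<Gamma> \<and> complete_poi2 \<Gamma> f1 f2 \<and> rank2 \<Gamma> f1 f2 \<and>
           gfan \<Gamma> f1 f2 = rho (gfan \<Lambda> e1 e2) \<and>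
           (elementary \<Lambda> \<longrightarrow> elementary \<Gamma>)"
proof -
  interpret A: fdalg \<Lambda> by unfold_locales (rule assms)
  interpret \<Lambda>: ring \<Lambda> by (rule A.ringA)
  interpret k0: kalg "(*) :: 'k \<Rightarrow> 'k \<Rightarrow> 'k" by (rule kalg_field)
  interpret k1: kalg k0.mscl by (rule k0.kalg_fmat)
  interpret k2: kalg k1.mscl by (rule k1.kalg_fmat)
  obtain \<phi> :: "'a \<Rightarrow> 'k fmat" where \<phi>0: "inj_on \<phi> (carrier \<Lambda>)"
    "\<forall>x\<in>carrier \<Lambda>. \<forall>y\<in>carrier \<Lambda>. \<phi> (x \<oplus>\<^bsub>\<Lambda>\<^esub> y) = \<phi> x + \<phi> y"
    "\<forall>x\<in>carrier \<Lambda>. \<forall>y\<in>carrier \<Lambda>. \<phi> (x \<otimes>\<^bsub>\<Lambda>\<^esub> y) = \<phi> x * \<phi> y"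
    "\<forall>x\<in>carrier \<Lambda>. \<forall>c. \<phi> (c \<odot>\<^bsub>\<Lambda>\<^esub> x) = k0.mscl c (\<phi> x)"
    "\<exists>B. finite B \<and> B \<subseteq> carrier \<Lambda> \<and> (\<forall>x\<in>carrier \<Lambda>. \<exists>f. \<phi> x = (\<Sum>b\<in>B. k0.mscl (f b) (\<phi> b)))"
    using A.regular_rep by (elim exE[where P = "\<lambda>\<phi>. inj_on \<phi> (carrier \<Lambda>) \<and> Q \<phi>" for Q] conjE) (rule that)
  note \<phi> = \<phi>0(1) \<phi>0(2)[rule_format] \<phi>0(3)[rule_format] \<phi>0(4)[rule_format]
  define T where "T = \<phi> ` carrier \<Lambda>"
  have \<phi>z: "\<phi> \<zero>\<^bsub>\<Lambda>\<^esub> = 0" using \<phi>(2)[of "\<zero>\<^bsub>\<Lambda>\<^esub>" "\<zero>\<^bsub>\<Lambda>\<^esub>"] by simp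
  have \<phi>n: "\<phi> (\<ominus>\<^bsub>\<Lambda>\<^esub> x) = - \<phi> x" if x: "x \<in> carrier \<Lambda>" for x
  proof -
    have "\<phi> (\<ominus>\<^bsub>\<Lambda>\<^esub> x) + \<phi> x = 0" using \<phi>(2)[of "\<ominus>\<^bsub>\<Lambda>\<^esub> x" x] x by (simp add: \<Lambda>.l_neg \<phi>z)
    then show ?thesis by (simp add: eq_neg_iff_add_eq_0)
  qed
  have rT: "rcat T"
  proof
    show "0 \<in> T" using \<phi>z unfolding T_def by (metis \<Lambda>.zero_closed imageI)
    fix x y assume "x \<in> T" "y \<in> T"
    then obtain x' y' where x': "x' \<in> carrier \<Lambda>" "y' \<in> carrier \<Lambda>" "x = \<phi> x'" "y = \<phi> y'" by (auto simp: T_def)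
    have "x + y = \<phi> (x' \<oplus>\<^bsub>\<Lambda>\<^esub> y')" "x - y = \<phi> (x' \<oplus>\<^bsub>\<Lambda>\<^esub> \<ominus>\<^bsub>\<Lambda>\<^esub> y')" "x * y = \<phi> (x' \<otimes>\<^bsub>\<Lambda>\<^esub> y')"
      using x' \<phi> \<phi>n by simp_all
    then show "x + y \<in> T" "x - y \<in> T" "x * y \<in> T" unfolding T_def using x' by auto
  qed
  interpret rT: rcat T by (rule rT)
  have sT: "k1.subspace T" unfolding k1.subspace_def
  proof (intro conjI allI ballI)
    show "0 \<in> T" "\<And>x y. x \<in> T \<Longrightarrow> y \<in> T \<Longrightarrow> x + y \<in> T" by auto
    fix c x assume "x \<in> T"
    then obtain x' where "x' \<in> carrier \<Lambda>" "x = \<phi> x'" by (auto simp: T_def)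
    then show "k0.mscl c x \<in> T" unfolding T_def using \<phi>(4) A.smult(1) by (metis imageI)
  qed
  have u1: "\<phi> \<one>\<^bsub>\<Lambda>\<^esub> * x = x \<and> x * \<phi> \<one>\<^bsub>\<Lambda>\<^esub> = x" if x: "x \<in> T" for x
  proof -
    obtain x' where "x' \<in> carrier \<Lambda>" "x = \<phi> x'" using x by (auto simp: T_def)
    then show ?thesis using \<phi>(3)[of "\<one>\<^bsub>\<Lambda>\<^esub>" x'] \<phi>(3)[of x' "\<one>\<^bsub>\<Lambda>\<^esub>"] by simp
  qed
  have cornerT: "\<phi> ` carrier \<Lambda> = {x \<in> T. \<phi> \<one>\<^bsub>\<Lambda>\<^esub> * x = x \<and> x * \<phi> \<one>\<^bsub>\<Lambda>\<^esub> = x}"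
    using u1 unfolding T_def[symmetric] by blast
  have alg1: "alg k0.mscl \<Lambda> \<phi> T e1 e2"
    by (intro alg.intro alg_axioms.intro k1.kalg_axioms A.ringA \<phi>(1-4) A.smult(1) rT sT cornerT assms(2,4))
  \<comment> \<open>A second layer of matrices: with \<Lambda> at position (0, 0), the other
    positions are free for copies of P_1 orthogonal to the given P_1 and P_2.\<close>
  define \<psi> where "\<psi> x = E 0 0 (\<phi> x)" for x
  define S where "S = sc T"
  have rS: "rcat S" unfolding S_def by (rule rcat_sc[OF rT])
  interpret rS: rcat S by (rule rS)
  have sS: "k2.subspace S" unfolding S_def by (rule k1.sub_sc[OF sT])
  have cornerS: "\<psi> ` carrier \<Lambda> = {x \<in> S. \<psi> \<one>\<^bsub>\<Lambda>\<^esub> * x = x \<and> x * \<psi> \<one>\<^bsub>\<Lambda>\<^esub> = x}"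
  proof (intro equalityI subsetI)
    fix x assume "x \<in> \<psi> ` carrier \<Lambda>"
    then obtain x' where x': "x' \<in> carrier \<Lambda>" "x = E 0 0 (\<phi> x')" by (auto simp: \<psi>_def)
    then have "\<phi> x' \<in> T" by (simp add: T_def)
    then show "x \<in> {x \<in> S. \<psi> \<one>\<^bsub>\<Lambda>\<^esub> * x = x \<and> x * \<psi> \<one>\<^bsub>\<Lambda>\<^esub> = x}"
      using x' u1 by (auto simp: \<psi>_def S_def sc_iff)
  next
    fix x assume x: "x \<in> {x \<in> S. \<psi> \<one>\<^bsub>\<Lambda>\<^esub> * x = x \<and> x * \<psi> \<one>\<^bsub>\<Lambda>\<^esub> = x}"
    then have e: "E 0 0 (\<phi> \<one>\<^bsub>\<Lambda>\<^esub>) * x = x" "x * E 0 0 (\<phi> \<one>\<^bsub>\<Lambda>\<^esub>) = x" by (auto simp: \<psi>_def)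
    have "ent x i j = 0" if "i \<noteq> 0" for i j using arg_cong[OF e(1), of "\<lambda>Z. ent Z i j"] that by simp
    moreover have "ent x i j = 0" if "j \<noteq> 0" for i j using arg_cong[OF e(2), of "\<lambda>Z. ent Z i j"] that by simp
    ultimately have "x = E 0 0 (ent x 0 0)" by (auto simp: fmat_eq_iff)
    moreover have "ent x 0 0 \<in> T" using x by (simp add: S_def sc_iff)
    then obtain x' where "x' \<in> carrier \<Lambda>" "ent x 0 0 = \<phi> x'" by (auto simp: T_def)
    ultimately show "x \<in> \<psi> ` carrier \<Lambda>" by (auto simp: \<psi>_def)
  qed
  have alg2: "alg k1.mscl \<Lambda> \<psi> S e1 e2"
  proof (intro alg.intro alg_axioms.intro k2.kalg_axioms A.ringA A.smult(1) rS sS cornerS assms(2,4))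
    show "inj_on \<psi> (carrier \<Lambda>)" using \<phi>(1) by (auto simp: inj_on_def \<psi>_def)
    show "\<psi> (x \<oplus>\<^bsub>\<Lambda>\<^esub> y) = \<psi> x + \<psi> y" "\<psi> (x \<otimes>\<^bsub>\<Lambda>\<^esub> y) = \<psi> x * \<psi> y" if "x \<in> carrier \<Lambda>" "y \<in> carrier \<Lambda>" for x y
      using that \<phi> by (simp_all add: \<psi>_def E_add)
    show "\<psi> (c \<odot>\<^bsub>\<Lambda>\<^esub> x) = k1.mscl c (\<psi> x)" if "x \<in> carrier \<Lambda>" for c x
      using that \<phi> by (auto simp: \<psi>_def fmat_eq_iff)
  qed
  interpret a1: alg k0.mscl \<Lambda> \<phi> T e1 e2 by (rule alg1)
  interpret a2: alg k1.mscl \<Lambda> \<psi> S e1 e2 by (rule alg2)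
  interpret t1: rep \<Lambda> e1 e2 \<phi> T by (rule a1.alg_rep)
  interpret t2: rep \<Lambda> e1 e2 \<psi> S by (rule a2.alg_rep)
  define a b where "a = E 0 0 (\<phi> e1)" and "b = E 0 0 (\<phi> e2)"
  have G1: "E 0 0 (\<phi> (lab e1 e2 c)) = (if c then b else a)" for c by (simp add: lab_def a_def b_def)
  have G2: "(\<lambda>c. E 0 0 (\<psi> (lab e1 e2 c))) = (\<lambda>c. E 0 0 (if c then b else a))" by (auto simp: lab_def a_def b_def \<psi>_def fun_eq_iff)
  define g1 g2 where "g1 = \<phi> e1" and "g2 = \<phi> e2"
  have eC: "e1 \<in> carrier \<Lambda>" "e2 \<in> carrier \<Lambda>" using a1.LA[of False] a1.LA[of True] by (simp_all add: lab_def)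
  have gg: "g1 * g1 = g1" "g2 * g2 = g2" "g1 * g2 = 0" "g2 * g1 = 0" "g1 \<in> T" "g2 \<in> T"
    using t1.g_idem[of False] t1.g_idem[of True] t1.g_orth[of False True] t1.g_orth[of True False] eC
    by (simp_all add: lab_def g1_def g2_def T_def)
  \<comment> \<open>Generators of \<open>e\<^sub>1\<Lambda>e\<^sub>2\<close> give a left approximation \<open>m0\<close> of the second projective by copies of the first;
    these are placed at positions different from \<open>0\<close>, to be orthogonal to \<open>a\<close>.\<close>
  obtain B where B: "finite B" "B \<subseteq> carrier \<Lambda>" "\<forall>x\<in>carrier \<Lambda>. \<exists>f. \<phi> x = (\<Sum>b\<in>B. k0.mscl (f b) (\<phi> b))" using \<phi>0(5) by (elim exE conjE) (rule that)
  obtain e n where e: "bij_betw e {..<n::nat} B" using ex_bij_betw_nat_finite[OF B(1)] by (auto simp: atLeast0LessThan)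
  have eB: "\<phi> (e i) \<in> T" if "i < n" for i using e that B(2) by (auto simp: bij_betw_def T_def)
  define p0 where "p0 = t1.shd 1 1 (replicate n False)"
  define m0 where "m0 = (\<Sum>i<n. E (Suc i) 0 (g1 * \<phi> (e i) * g2))"
  have p0e: "ent p0 s t = (if s = t \<and> 1 \<le> s \<and> s \<le> n then g1 else 0)" for s t
    by (auto simp: p0_def t1.ent_shd lab_def g1_def)
  have m0e: "ent m0 s t = (if t = 0 \<and> 1 \<le> s \<and> s \<le> n then g1 * \<phi> (e (s - 1)) * g2 else 0)" for s t
  proof -
    have "ent m0 s t = (\<Sum>i<n. if i = s - 1 then (if t = 0 \<and> s \<noteq> 0 then g1 * \<phi> (e (s - 1)) * g2 else 0) else 0)"
      unfolding m0_def ent_sum by (intro sum.cong) auto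
    then show ?thesis by auto
  qed
  have p0f: "t1.fr p0 (replicate_mset n False)"
  proof -
    have i: "t1.iso (t1.dgl (replicate n False)) p0"
      by (rule t1.isoI[of "t1.shd 1 0 (replicate n False)" _ _ "t1.shd 0 1 (replicate n False)"])
        (auto simp: p0_def t1.shd_dgl[symmetric] t1.shd_mult t1.hm_def t1.shd_S)
    show ?thesis using t1.fr_iso[OF t1.fr_dgl i] by simp
  qed
  have m0h: "m0 \<in> t1.hm b p0"
  proof (rule t1.hmI)
    show "m0 \<in> sc T" using gg eB by (auto simp: sc_iff m0e intro!: rT.Smult)
    have bp: "bnd p0 (Suc n)" by (auto simp: bnd_def p0e)
    have "ent (p0 * m0) s t = ent m0 s t" for s t
    proof -
      have "ent (p0 * m0) s t = (\<Sum>i<Suc n. if i = s then ent p0 s s * ent m0 s t else 0)"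
        unfolding ent_times[OF bp] by (intro sum.cong) (auto simp: p0e)
      also have "\<dots> = ent m0 s t" using gg(1) by (auto simp: p0e m0e mult.assoc[symmetric])
      finally show ?thesis .
    qed
    then show "p0 * m0 = m0" by (simp add: fmat_eq_iff)
    show "m0 * b = m0" by (auto simp: fmat_eq_iff[where 'a = "'k fmat"] m0e b_def mult.assoc g2_def[symmetric] gg(2))
  qed
  have appr0: "\<exists>z\<in>t1.hm p0 a. f = z * m0" if f: "f \<in> t1.hm b a" for f
  proof -
    have fL: "a * f = f" and fR: "f * b = f" using t1.hmL[OF f] t1.hmR[OF f] .
    have "ent f i j = 0" if "i \<noteq> 0" for i j using arg_cong[OF fL, of "\<lambda>Z. ent Z i j"] that by (simp add: a_def)
    moreover have "ent f i j = 0" if "j \<noteq> 0" for i j using arg_cong[OF fR, of "\<lambda>Z. ent Z i j"] that by (simp add: b_def)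
    ultimately have f0: "f = E 0 0 (ent f 0 0)" by (auto simp: fmat_eq_iff)
    have fg: "g1 * ent f 0 0 = ent f 0 0" "ent f 0 0 * g2 = ent f 0 0"
      using arg_cong[OF fL, of "\<lambda>Z. ent Z 0 0"] arg_cong[OF fR, of "\<lambda>Z. ent Z 0 0"] by (simp_all add: a_def b_def g1_def g2_def)
    have "ent f 0 0 \<in> T" using t1.hmS[OF f] by (simp add: sc_iff)
    then obtain h where h: "ent f 0 0 = (\<Sum>b\<in>B. k0.mscl (h b) (\<phi> b))" using B(3) by (auto simp: T_def)
    then have h2: "ent f 0 0 = (\<Sum>i<n. k0.mscl (h (e i)) (\<phi> (e i)))"
      using sum.reindex_bij_betw[OF e, of "\<lambda>b. k0.mscl (h b) (\<phi> b)"] by simp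
    \<comment> \<open>The row of coefficients of f with respect to the generators; multiplied with
      the column \<open>m0\<close> it reproduces f.\<close>
    define z where "z = (\<Sum>i<n. E 0 (Suc i) (k0.mscl (h (e i)) g1))"
    have ze: "ent z s t = (if s = 0 \<and> 1 \<le> t \<and> t \<le> n then k0.mscl (h (e (t - 1))) g1 else 0)" for s t
    proof -
      have "ent z s t = (\<Sum>i<n. if i = t - 1 then (if s = 0 \<and> t \<noteq> 0 then k0.mscl (h (e (t - 1))) g1 else 0) else 0)"
        unfolding z_def ent_sum by (intro sum.cong) auto
      then show ?thesis by auto
    qed
    have Tg: "k0.mscl c g1 \<in> T" for c using sT gg(5) by (simp add: k1.subspace_def)
    have zh: "z \<in> t1.hm p0 a"
    proof (rule t1.hmI)
      show "z \<in> sc T" using Tg by (auto simp: sc_iff ze)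
      show "a * z = z" using gg(1) by (auto simp: fmat_eq_iff ze a_def g1_def[symmetric] k1.scl_multR)
      have bp: "bnd p0 (Suc n)" by (auto simp: bnd_def p0e)
      have "ent (z * p0) s t = ent z s t" for s t
      proof -
        have "ent (z * p0) s t = (\<Sum>i<Suc n. if i = t then ent z s t * ent p0 t t else 0)"
          unfolding ent_times'[OF bp] by (intro sum.cong) (auto simp: p0e)
        also have "\<dots> = ent z s t" using gg(1) by (auto simp: p0e ze k1.scl_multL)
        finally show ?thesis .
      qed
      then show "z * p0 = z" by (simp add: fmat_eq_iff)
    qed
    have "z * m0 = (\<Sum>i<n. E 0 0 (k0.mscl (h (e i)) (g1 * \<phi> (e i) * g2)))"
    proof -
      have "z * m0 = (\<Sum>i<n. \<Sum>j<n. E 0 (Suc i) (k0.mscl (h (e i)) g1) * E (Suc j) 0 (g1 * \<phi> (e j) * g2))"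
        unfolding z_def m0_def sum_distrib_left sum_distrib_right by (rule sum.swap)
      also have "\<dots> = (\<Sum>i<n. \<Sum>j<n. if j = i then E 0 0 (k0.mscl (h (e i)) (g1 * \<phi> (e i) * g2)) else 0)"
        by (intro sum.cong refl) (auto simp: k1.scl_multL mult.assoc[symmetric] gg(1))
      finally show ?thesis by simp
    qed
    also have "\<dots> = E 0 0 (\<Sum>i<n. k0.mscl (h (e i)) (g1 * \<phi> (e i) * g2))"
      by (auto simp: fmat_eq_iff[where 'a = "'k fmat"] ent_sum)
    also have "(\<Sum>i<n. k0.mscl (h (e i)) (g1 * \<phi> (e i) * g2)) = g1 * ent f 0 0 * g2"
      unfolding h2 by (simp add: sum_distrib_left sum_distrib_right k1.scl_multL k1.scl_multR)
    also have "\<dots> = ent f 0 0" using fg by simp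
    finally have "z * m0 = f" using f0 by simp
    then show ?thesis using zh by blast
  qed
  have GT: "E 0 0 (\<phi> (lab e1 e2 True)) = b" and GF: "E 0 0 (\<phi> (lab e1 e2 False)) = a" by (simp_all add: G1)
  obtain p l where p: "t1.fr p (replicate_mset l False)" "m0 \<in> t1.hm b p" "p0 * p = p" "p * p0 = p"
    "\<And>f. f \<in> t1.hm b a \<Longrightarrow> \<exists>z\<in>t1.hm p a. f = z * m0"
    "\<And>z k. z \<in> t1.hm p a \<Longrightarrow> z * m0 = 0 \<Longrightarrow> k \<in> t1.hm a p \<Longrightarrow> z * k \<noteq> a"
  proof (rule t1.minimal_approx[of p0 n m0, unfolded GT GF])
    fix p l assume h: "t1.fr p (replicate_mset l False)" "m0 \<in> t1.hm b p" "p0 * p = p" "p * p0 = p"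
      "\<And>f. f \<in> t1.hm b a \<Longrightarrow> \<exists>z\<in>t1.hm p a. f = z * m0"
      "\<And>z k. z \<in> t1.hm p a \<Longrightarrow> z * m0 = 0 \<Longrightarrow> k \<in> t1.hm a p \<Longrightarrow> z * k \<noteq> a"
    show thesis by (rule that) (fact h)+
  qed (rule p0f | rule m0h | (rule appr0, assumption))+
  have ES: "E 0 0 x \<in> sc S" if "x \<in> S" for x using that by (auto simp: sc_iff)
  \<comment> \<open>Lifts the decomposition of p from matrices over \<open>T\<close> to matrices
    over \<open>S\<close>, the level at which the rotation is carried out.\<close>
  have frE: "t2.fr (E 0 0 q) N" if "t1.fr q N" for q N
    using that
  proof (induction rule: t1.fr.induct)
    case fr0 then show ?case using t2.fr0 by simp
  next
    case (frS q N c h)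
    have "t2.iso (E 0 0 (\<psi> (lab e1 e2 c))) (E 0 0 h)"
    proof -
      obtain x y where "x \<in> t1.hm (E 0 0 (\<phi> (lab e1 e2 c))) h" "y \<in> t1.hm h (E 0 0 (\<phi> (lab e1 e2 c)))"
        "y * x = E 0 0 (\<phi> (lab e1 e2 c))" "x * y = h" using frS(2) by (rule t1.isoE)
      then show ?thesis unfolding \<psi>_def
        by (intro t2.isoI[of "E 0 0 x" _ _ "E 0 0 y"] t2.hmI) (simp_all add: rS.hm_def ES S_def[symmetric])
    qed
    from t2.frS[OF frS(5) this] show ?case using frS(3,4) by (simp add: E_add)
  qed
  have o0: "a * p0 = 0" "p0 * a = 0" "b * p0 = 0" "p0 * b = 0"
    by (auto simp: fmat_eq_iff a_def b_def p0e)
  have hmS: "x \<in> t1.hm q q' \<longleftrightarrow> x \<in> S \<and> q' * x = x \<and> x * q = x" for x q q' by (simp add: t1.hm_def S_def)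
  have tri2: "tri (sc S) (\<lambda>c. E 0 0 (if c then b else a))" using t2.tri_axioms unfolding G2 .
  have "rot S a b k1.mscl p m0 l"
  proof (intro rot.intro rot_axioms.intro tri2 k2.kalg_axioms rS sS)
    show "a * b = 0" "b * a = 0" using gg(3,4) by (auto simp: a_def b_def g1_def g2_def)
    show "a * p = 0" "p * a = 0" "b * p = 0" "p * b = 0"
      using o0 p(3,4) by (metis mult.assoc mult_zero_left mult_zero_right)+
    show "tri.fr (sc S) (\<lambda>c. E 0 0 (if c then b else a)) (E 0 0 p) (replicate_mset l False)"
      using frE[OF p(1)] unfolding G2 .
    show "m0 \<in> S" "p * m0 = m0" "m0 * b = m0" using p(2) by (simp_all add: hmS)
    show "\<exists>z\<in>S. a * z = z \<and> z * p = z \<and> f = z * m0" if "f \<in> S" "a * f = f" "f * b = f" for f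
      using p(5)[of f] that by (auto simp: hmS)
    show "z * k \<noteq> a" if "z \<in> S" "a * z = z" "z * p = z" "z * m0 = 0" "k \<in> S" "p * k = k" "k * a = k" for z k
      using p(6)[of z k] that by (simp add: hmS)
  qed
  then interpret r: rot S a b k1.mscl p m0 l .
  define M where "M = mk_alg k1.mscl r.Gam (b + p + a) flat"
  have gf: "gfan \<Lambda> e1 e2 = tri.gfs (sc S) (\<lambda>c. E 0 0 (if c then b else a))" using t2.gfan_eq unfolding G2 .
  have el: "elementary M" if "elementary \<Lambda>"
  proof -
    have res: "a2.res" using a2.elementary_res[OF that] .
    have ga: "a2.g False = a" "a2.g True = b" by (simp_all add: a2.g_def lab_def \<psi>_def a_def b_def)
    show ?thesis
    proof (rule r.M_elementary[OF inj_flat M_def])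
      fix x assume "x \<in> S" "a * x = x" "x * a = x"
      then have x: "x \<in> a2.cor False" by (simp add: a2.cor_def ga)
      then obtain c where c: "x - k1.mscl c a \<in> a2.J False" using res unfolding a2.res_def ga(1)[symmetric] by blast
      then show "\<exists>c. \<not> (\<exists>w\<in>S. a * w = w \<and> w * a = w \<and> w * (x - k1.mscl c a) = a \<and> (x - k1.mscl c a) * w = a)"
        unfolding a2.J_def a2.cor_def ga by blast
    next
      fix x assume "x \<in> S" "b * x = x" "x * b = x"
      then have x: "x \<in> a2.cor True" by (simp add: a2.cor_def ga)
      then obtain c where c: "x - k1.mscl c b \<in> a2.J True" using res unfolding a2.res_def ga(2)[symmetric] by blast
      then show "\<exists>c. \<not> (\<exists>w\<in>S. b * w = w \<and> w * b = w \<and> w * (x - k1.mscl c b) = b \<and> (x - k1.mscl c b) * w = b)"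
        unfolding a2.J_def a2.cor_def ga by blast
    qed
  qed
  have "fd_algebra M" "complete_poi2 M (flat (b + p)) (flat a)" "rank2 M (flat (b + p)) (flat a)"
    "gfan M (flat (b + p)) (flat a) = rho (gfan \<Lambda> e1 e2)"
    using r.M_fd(2)[OF inj_flat M_def] r.M_poi[OF inj_flat M_def] r.M_rank2[OF inj_flat M_def] r.M_gfan[OF inj_flat M_def]
    unfolding gf by blast+
  then show ?thesis using el by blast
qed

end
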